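(* Let $k$ be a field and let $\mathcal{C}=(\mathcal{C},\mathbb{E},\mathfrak{s},\mathbb{E}^{-1})$ be a $k$-linear Hom-finite Krull--Schmidt extriangulated category with a negative first extension. Let $(\Theta,\mathbb{P})$ be a mixed stratifying system in $\mathcal{C}$ and $B:=\mathrm{End}_{\mathcal{C}}(\mathbb{P})$. Let $\Psi:=\mathcal{C}(\mathbb{P},-):\mathcal{C}\to\mathrm{mod}\,B$. Then $(\Psi(\Theta),\Psi(\mathbb{P}))$ is a mixed stratifying system in $\mathrm{mod}\,B$ and the restriction $\Psi:\mathcal{F}(\Theta)\to\mathcal{F}(\Psi(\Theta))$ is an equivalence of categories. Moreover, $B$ is a mixed stratified algebra with respect to $\Psi(\Theta)$.
   Context: All categories are skeletally small; subcategories are full and closed under isomorphisms. Extriangulated categories $(\mathcal{C},\mathbb{E},\mathfrak{s})$ are in the sense of Nakaoka--Palu: $\mathcal{C}$ is additive, $\mathbb{E}:\mathcal{C}^{op}\times\mathcal{C}\to\mathrm{Ab}$ is an additive bifunctor, and $\mathfrak{s}$ assigns to each $\delta\in\mathbb{E}(C,A)$ an equivalence class $[A\to B\to C]$ of complexes, subject to their axioms. If $\mathfrak{s}(\delta)=[A\xrightarrow{f}B\xrightarrow{g}C]$, then $A\xrightarrow{f}B\xrightarrow{g}C\overset{\delta}{\dashrightarrow}$ is an $\mathfrak{s}$-conflation. A negative first extension on $\mathcal{C}$ is an additive bifunctor $\mathbb{E}^{-1}:\mathcal{C}^{op}\times\mathcal{C}\to\mathrm{Ab}$ together with, for each $\delta\in\mathbb{E}(C,A)$,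 natural transformations $\mathbb{E}^{-1}(-,C)\to\mathcal{C}(-,A)$ and $\mathbb{E}^{-1}(A,-)\to\mathcal{C}(C,-)$ such that for every $\mathfrak{s}$-conflation $A\to B\to C\overset{\delta}{\dashrightarrow}$ and every $W$ the sequences $\mathbb{E}^{-1}(W,A)\to\mathbb{E}^{-1}(W,B)\to\mathbb{E}^{-1}(W,C)\to\mathcal{C}(W,A)\to\mathcal{C}(W,B)$ and $\mathbb{E}^{-1}(C,W)\to\mathbb{E}^{-1}(B,W)\to\mathbb{E}^{-1}(A,W)\to\mathcal{C}(C,W)\to\mathcal{C}(B,W)$ are exact. For a finite dimensional algebra $A$, $\mathrm{mod}\,A$ (finitely generated right modules) is regarded as such a category with $\mathbb{E}=\mathrm{Ext}^1_A$, conflations the short exact sequences, and $\mathbb{E}^{-1}=0$. $\mathcal{X}*\mathcal{Y}$ is the subcategory of all $M$ with an $\mathfrak{s}$-conflation $X\to M\to Y\dashrightarrow$, $X\in\mathcal{X}$, $Y\in\mathcal{Y}$; $\mathcal{F}(M):=\bigcup_{l>0}\mathrm{add}\,M*\cdots*\mathrm{add}\,M$ ($l$ factors). An ordered set of objects is identified with the direct sum of its members. A brick is an object whose endomorphism ring is a division ring; a stone is an indecomposable object $M$ with $\mathbb{E}(M,M)=0$. A mixed stratifying system $(\Theta,\mathbb{P})$ consists of an ordered set $\Theta=(\Theta(1),\dots,\Theta(t))$ of objects and an ordered set $\mathbb{P}=(P(1),\dots,P(t))$ of indecomposable objects such that: each $\Theta(i)$ is a brick or a stone; $\mathcal{C}(\Theta(i),\Theta(j))=0$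 for $i>j$; for each $i$ there is an $\mathfrak{s}$-conflation $K(i)\to P(i)\to\Theta(i)\dashrightarrow$ with $K(i)\in\mathcal{F}(\Theta(i)\oplus\cdots\oplus\Theta(t))$ and $\mathbb{E}(P(i),\mathcal{F}(\Theta))=0$; and $\mathbb{E}^{-1}(\Theta,\Theta)=0$. Write $\Psi(\Theta)=(\Psi(\Theta(1)),\dots,\Psi(\Theta(t)))$ and similarly $\Psi(\mathbb{P})$. For a basic finite dimensional algebra $A$ with a complete ordered set $(e_1,\dots,e_n)$ of primitive orthogonal idempotents and $S(i)=\mathrm{top}\,e_iA$: the standard module $\Delta(i)$ is the maximal factor module of $e_iA$ lying in $\mathcal{F}(S(1)\oplus\cdots\oplus S(i))$; the proper standard module $\overline{\Delta}(i)$ is the maximal factor module of $\Delta(i)$ with $\mathrm{rad}\,\overline{\Delta}(i)\in\mathcal{F}(S(1)\oplus\cdots\oplus S(i-1))$. $A$ is a mixed stratified algebra with respect to $\Xi=(\Xi(1),\dots,\Xi(n))$ if $A\in\mathcal{F}(\Xi)$ and $\Xi(i)\in\{\Delta(i),\overline{\Delta}(i)\}$ for each $i$. For $B=\mathrm{End}_{\mathcal{C}}(\mathbb{P})$ the ordered idempotents are $(e_{P(1)},\dots,e_{P(t)})$, where $e_{P(i)}$ is the composition of the projection $\mathbb{P}\to P(i)$ with the inclusion $P(i)\to\mathbb{P}$. *)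

theory Defs
  imports "HOL-Algebra.Module" "HOL-Algebra.AbelCoset"
begin

section \<open>Additive categories\<close>

record ('o, 'm) category =
  Obj :: "'o set"
  Hom :: "'o \<Rightarrow> 'o \<Rightarrow> 'm set"
  ident :: "'o \<Rightarrow> 'm"
  cmp :: "'m \<Rightarrow> 'm \<Rightarrow> 'm"  (infixl "\<bullet>\<index>" 75)  \<comment> \<open>\<open>g \<bullet> f\<close> is \<open>g\<close> after \<open>f\<close>\<close>

text \<open>Distinct hom-sets are disjoint, so a morphism determines its domain and codomain.\<close>

locale category =
  fixes C (structure)
  assumes ident_closed: "X \<in> Obj C \<Longrightarrow> ident C X \<in> Hom C X X"
    and cmp_closed: "\<lbrakk>X \<in> Obj C; Y \<in> Obj C; Z \<in> Obj C; f \<in> Hom C X Y; g \<in> Hom C Y Z\<rbrakk>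
      \<Longrightarrow> g \<bullet> f \<in> Hom C X Z"
    and cmp_assoc: "\<lbrakk>W \<in> Obj C; X \<in> Obj C; Y \<in> Obj C; Z \<in> Obj C;
      f \<in> Hom C W X; g \<in> Hom C X Y; h \<in> Hom C Y Z\<rbrakk> \<Longrightarrow> (h \<bullet> g) \<bullet> f = h \<bullet> (g \<bullet> f)"
    and cmp_ident_right: "\<lbrakk>X \<in> Obj C; Y \<in> Obj C; f \<in> Hom C X Y\<rbrakk> \<Longrightarrow> f \<bullet> ident C X = f"
    and cmp_ident_left: "\<lbrakk>X \<in> Obj C; Y \<in> Obj C; f \<in> Hom C X Y\<rbrakk> \<Longrightarrow> ident C Y \<bullet> f = f"
    and hom_disjoint: "\<lbrakk>X \<in> Obj C; Y \<in> Obj C; X' \<in> Obj C; Y' \<in> Obj C;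
      f \<in> Hom C X Y; f \<in> Hom C X' Y'\<rbrakk> \<Longrightarrow> X = X' \<and> Y = Y'"

definition is_iso :: "('o, 'm, 'z) category_scheme \<Rightarrow> 'o \<Rightarrow> 'o \<Rightarrow> 'm \<Rightarrow> bool" where
  "is_iso C X Y f \<longleftrightarrow> f \<in> Hom C X Y \<and>
     (\<exists>g \<in> Hom C Y X. g \<bullet>\<^bsub>C\<^esub> f = ident C X \<and> f \<bullet>\<^bsub>C\<^esub> g = ident C Y)"

definition isomorphic :: "('o, 'm, 'z) category_scheme \<Rightarrow> 'o \<Rightarrow> 'o \<Rightarrow> bool" where
  "isomorphic C X Y \<longleftrightarrow> (\<exists>f. is_iso C X Y f)"

definition full_sub :: "('o, 'm, 'z) category_scheme \<Rightarrow> 'o set \<Rightarrow> ('o, 'm, 'z) category_scheme" where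
  "full_sub C S = C\<lparr>Obj := S\<rparr>"

text \<open>A functor is given by an object map \<open>Fo\<close> and, for all objects \<open>X\<close>, \<open>Y\<close>, a map
  \<open>Fm X Y\<close> on morphisms from \<open>X\<close> to \<open>Y\<close>.\<close>

definition is_functor ::
  "('o, 'm, 'z) category_scheme \<Rightarrow> ('p, 'n, 'y) category_scheme
     \<Rightarrow> ('o \<Rightarrow> 'p) \<Rightarrow> ('o \<Rightarrow> 'o \<Rightarrow> 'm \<Rightarrow> 'n) \<Rightarrow> bool" where
  "is_functor C D Fo Fm \<longleftrightarrow>
     (\<forall>X \<in> Obj C. Fo X \<in> Obj D) \<and>
     (\<forall>X \<in> Obj C. \<forall>Y \<in> Obj C. \<forall>f \<in> Hom C X Y. Fm X Y f \<in> Hom D (Fo X) (Fo Y)) \<and>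
     (\<forall>X \<in> Obj C. Fm X X (ident C X) = ident D (Fo X)) \<and>
     (\<forall>X \<in> Obj C. \<forall>Y \<in> Obj C. \<forall>Z \<in> Obj C. \<forall>f \<in> Hom C X Y. \<forall>g \<in> Hom C Y Z.
        Fm X Z (g \<bullet>\<^bsub>C\<^esub> f) = Fm Y Z g \<bullet>\<^bsub>D\<^esub> Fm X Y f)"

definition natural_iso ::
  "('o, 'm, 'z) category_scheme \<Rightarrow> ('p, 'n, 'y) category_scheme
     \<Rightarrow> ('o \<Rightarrow> 'p) \<Rightarrow> ('o \<Rightarrow> 'o \<Rightarrow> 'm \<Rightarrow> 'n)
     \<Rightarrow> ('o \<Rightarrow> 'p) \<Rightarrow> ('o \<Rightarrow> 'o \<Rightarrow> 'm \<Rightarrow> 'n) \<Rightarrow> ('o \<Rightarrow> 'n) \<Rightarrow> bool" where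
  "natural_iso C D Fo Fm Go Gm \<eta> \<longleftrightarrow>
     (\<forall>X \<in> Obj C. is_iso D (Fo X) (Go X) (\<eta> X)) \<and>
     (\<forall>X \<in> Obj C. \<forall>Y \<in> Obj C. \<forall>f \<in> Hom C X Y.
        Gm X Y f \<bullet>\<^bsub>D\<^esub> \<eta> X = \<eta> Y \<bullet>\<^bsub>D\<^esub> Fm X Y f)"

definition is_equivalence ::
  "('o, 'm, 'z) category_scheme \<Rightarrow> ('p, 'n, 'y) category_scheme
     \<Rightarrow> ('o \<Rightarrow> 'p) \<Rightarrow> ('o \<Rightarrow> 'o \<Rightarrow> 'm \<Rightarrow> 'n) \<Rightarrow> bool" where
  "is_equivalence C D Fo Fm \<longleftrightarrow> is_functor C D Fo Fm \<and>
     (\<exists>Go Gm \<eta> \<epsilon>. is_functor D C Go Gm \<and>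
        natural_iso C C (\<lambda>X. X) (\<lambda>X Y f. f)
          (\<lambda>X. Go (Fo X)) (\<lambda>X Y f. Gm (Fo X) (Fo Y) (Fm X Y f)) \<eta> \<and>
        natural_iso D D (\<lambda>X. Fo (Go X)) (\<lambda>X Y f. Fm (Go X) (Go Y) (Gm X Y f))
          (\<lambda>X. X) (\<lambda>X Y f. f) \<epsilon>)"

record ('o, 'm) preadd = "('o, 'm) category" +
  zer :: "'o \<Rightarrow> 'o \<Rightarrow> 'm"
  pls :: "'m \<Rightarrow> 'm \<Rightarrow> 'm"  (infixl "\<boxplus>\<index>" 65)

definition hom_group :: "('o, 'm, 'z) preadd_scheme \<Rightarrow> 'o \<Rightarrow> 'o \<Rightarrow> 'm monoid" where
  "hom_group C X Y = \<lparr>carrier = Hom C X Y, mult = pls C, one = zer C X Y\<rparr>"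

definition End_ring :: "('o, 'm, 'z) preadd_scheme \<Rightarrow> 'o \<Rightarrow> 'm ring" where
  "End_ring C X = \<lparr>carrier = Hom C X X, mult = cmp C, one = ident C X,
     zero = zer C X X, add = pls C\<rparr>"

definition is_zero_obj :: "('o, 'm, 'z) preadd_scheme \<Rightarrow> 'o \<Rightarrow> bool" where
  "is_zero_obj C X \<longleftrightarrow> X \<in> Obj C \<and> ident C X = zer C X X"

definition biproduct ::
  "('o, 'm, 'z) preadd_scheme \<Rightarrow> 'o \<Rightarrow> 'o \<Rightarrow> 'o \<Rightarrow> 'm \<Rightarrow> 'm \<Rightarrow> 'm \<Rightarrow> 'm \<Rightarrow> bool" where
  "biproduct C X Y Z i1 i2 p1 p2 \<longleftrightarrow>
     X \<in> Obj C \<and> Y \<in> Obj C \<and> Z \<in> Obj C \<and>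
     i1 \<in> Hom C X Z \<and> i2 \<in> Hom C Y Z \<and> p1 \<in> Hom C Z X \<and> p2 \<in> Hom C Z Y \<and>
     p1 \<bullet>\<^bsub>C\<^esub> i1 = ident C X \<and> p2 \<bullet>\<^bsub>C\<^esub> i2 = ident C Y \<and>
     p1 \<bullet>\<^bsub>C\<^esub> i2 = zer C Y X \<and> p2 \<bullet>\<^bsub>C\<^esub> i1 = zer C X Y \<and>
     (i1 \<bullet>\<^bsub>C\<^esub> p1) \<boxplus>\<^bsub>C\<^esub> (i2 \<bullet>\<^bsub>C\<^esub> p2) = ident C Z"

definition direct_sum ::
  "('o, 'm, 'z) preadd_scheme \<Rightarrow> nat set \<Rightarrow> (nat \<Rightarrow> 'o) \<Rightarrow> 'o
     \<Rightarrow> (nat \<Rightarrow> 'm) \<Rightarrow> (nat \<Rightarrow> 'm) \<Rightarrow> bool" where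
  "direct_sum C I X Z \<iota> \<pi> \<longleftrightarrow> finite I \<and> Z \<in> Obj C \<and>
     (\<forall>i \<in> I. X i \<in> Obj C \<and> \<iota> i \<in> Hom C (X i) Z \<and> \<pi> i \<in> Hom C Z (X i)) \<and>
     (\<forall>i \<in> I. \<forall>j \<in> I. \<pi> j \<bullet>\<^bsub>C\<^esub> \<iota> i = (if i = j then ident C (X i) else zer C (X i) (X j))) \<and>
     finprod (hom_group C Z Z) (\<lambda>i. \<iota> i \<bullet>\<^bsub>C\<^esub> \<pi> i) I = ident C Z"

locale additive_category = category C for C :: "('o, 'm, 'z) preadd_scheme" (structure) +
  assumes hom_comm_group: "\<lbrakk>X \<in> Obj C; Y \<in> Obj C\<rbrakk> \<Longrightarrow> comm_group (hom_group C X Y)"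
    and cmp_pls_left: "\<lbrakk>X \<in> Obj C; Y \<in> Obj C; Z \<in> Obj C;
      f \<in> Hom C X Y; g \<in> Hom C Y Z; g' \<in> Hom C Y Z\<rbrakk>
      \<Longrightarrow> (g \<boxplus> g') \<bullet> f = (g \<bullet> f) \<boxplus> (g' \<bullet> f)"
    and cmp_pls_right: "\<lbrakk>X \<in> Obj C; Y \<in> Obj C; Z \<in> Obj C;
      f \<in> Hom C X Y; f' \<in> Hom C X Y; g \<in> Hom C Y Z\<rbrakk>
      \<Longrightarrow> g \<bullet> (f \<boxplus> f') = (g \<bullet> f) \<boxplus> (g \<bullet> f')"
    and zero_obj_exists: "\<exists>Z. is_zero_obj C Z"
    and biproduct_exists: "\<lbrakk>X \<in> Obj C; Y \<in> Obj C\<rbrakk>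
      \<Longrightarrow> \<exists>Z i1 i2 p1 p2. biproduct C X Y Z i1 i2 p1 p2"

definition indecomposable :: "('o, 'm, 'z) preadd_scheme \<Rightarrow> 'o \<Rightarrow> bool" where
  "indecomposable C X \<longleftrightarrow> X \<in> Obj C \<and> \<not> is_zero_obj C X \<and>
     (\<forall>Y Z i1 i2 p1 p2. biproduct C Y Z X i1 i2 p1 p2 \<longrightarrow> is_zero_obj C Y \<or> is_zero_obj C Z)"

definition division_ring :: "('a, 'z) ring_scheme \<Rightarrow> bool" where
  "division_ring R \<longleftrightarrow> ring R \<and> Units R = carrier R - {\<zero>\<^bsub>R\<^esub>}"

definition local_ring :: "('a, 'z) ring_scheme \<Rightarrow> bool" where
  "local_ring R \<longleftrightarrow> ring R \<and> \<one>\<^bsub>R\<^esub> \<noteq> \<zero>\<^bsub>R\<^esub> \<and>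
     (\<forall>a \<in> carrier R - Units R. \<forall>b \<in> carrier R - Units R. a \<oplus>\<^bsub>R\<^esub> b \<notin> Units R)"

definition brick :: "('o, 'm, 'z) preadd_scheme \<Rightarrow> 'o \<Rightarrow> bool" where
  "brick C X \<longleftrightarrow> X \<in> Obj C \<and> division_ring (End_ring C X)"

definition krull_schmidt :: "('o, 'm, 'z) preadd_scheme \<Rightarrow> bool" where
  "krull_schmidt C \<longleftrightarrow> (\<forall>X \<in> Obj C. \<exists>n Y \<iota> \<pi>. direct_sum C {..<n::nat} Y X \<iota> \<pi> \<and>
     (\<forall>i<n. local_ring (End_ring C (Y i))))"

text \<open>Here the commutative group \<open>G\<close> is written multiplicatively: \<open>\<otimes>\<close> is vector addition.\<close>

definition k_space :: "('k::field \<Rightarrow> 'm \<Rightarrow> 'm) \<Rightarrow> ('m, 'z) monoid_scheme \<Rightarrow> bool" where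
  "k_space sm G \<longleftrightarrow> comm_group G \<and>
     (\<forall>a. \<forall>x \<in> carrier G. sm a x \<in> carrier G) \<and>
     (\<forall>x \<in> carrier G. sm 1 x = x) \<and>
     (\<forall>a b. \<forall>x \<in> carrier G. sm (a * b) x = sm a (sm b x)) \<and>
     (\<forall>a b. \<forall>x \<in> carrier G. sm (a + b) x = sm a x \<otimes>\<^bsub>G\<^esub> sm b x) \<and>
     (\<forall>a. \<forall>x \<in> carrier G. \<forall>y \<in> carrier G. sm a (x \<otimes>\<^bsub>G\<^esub> y) = sm a x \<otimes>\<^bsub>G\<^esub> sm a y)"

definition fin_dim :: "('k::field \<Rightarrow> 'm \<Rightarrow> 'm) \<Rightarrow> ('m, 'z) monoid_scheme \<Rightarrow> bool" where
  "fin_dim sm G \<longleftrightarrow> (\<exists>S. finite S \<and> S \<subseteq> carrier G \<and>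
     (\<forall>x \<in> carrier G. \<exists>c. x = finprod G (\<lambda>s. sm (c s) s) S))"

locale k_linear_category = additive_category C
  for C :: "('o, 'm, 'z) preadd_scheme" (structure) +
  fixes sm :: "'k::field \<Rightarrow> 'm \<Rightarrow> 'm"
  assumes hom_k_space: "\<lbrakk>X \<in> Obj C; Y \<in> Obj C\<rbrakk> \<Longrightarrow> k_space sm (hom_group C X Y)"
    and sm_cmp_left: "\<lbrakk>X \<in> Obj C; Y \<in> Obj C; Z \<in> Obj C; f \<in> Hom C X Y; g \<in> Hom C Y Z\<rbrakk>
      \<Longrightarrow> sm a g \<bullet> f = sm a (g \<bullet> f)"
    and sm_cmp_right: "\<lbrakk>X \<in> Obj C; Y \<in> Obj C; Z \<in> Obj C; f \<in> Hom C X Y; g \<in> Hom C Y Z\<rbrakk>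
      \<Longrightarrow> g \<bullet> sm a f = sm a (g \<bullet> f)"

definition hom_finite :: "('o, 'm, 'z) preadd_scheme \<Rightarrow> ('k::field \<Rightarrow> 'm \<Rightarrow> 'm) \<Rightarrow> bool" where
  "hom_finite C sm \<longleftrightarrow> (\<forall>X \<in> Obj C. \<forall>Y \<in> Obj C. fin_dim sm (hom_group C X Y))"


section \<open>Extriangulated categories with a negative first extension\<close>

text \<open>\<open>G X A\<close> is the value at \<open>(X, A)\<close> of a bifunctor from \<open>C\<^sup>o\<^sup>p \<times> C\<close> to abelian groups, again
  written multiplicatively (so \<open>\<one>\<close> is the zero element);
  \<open>psh X a : G X A \<rightarrow> G X A'\<close> is \<open>a\<^sub>*\<close> and \<open>pll A c : G X A \<rightarrow> G X' A\<close> is \<open>c\<^sup>*\<close>.\<close>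

definition additive_bifunctor ::
  "('o, 'm, 'z) preadd_scheme \<Rightarrow> ('o \<Rightarrow> 'o \<Rightarrow> 'e monoid)
     \<Rightarrow> ('o \<Rightarrow> 'm \<Rightarrow> 'e \<Rightarrow> 'e) \<Rightarrow> ('o \<Rightarrow> 'm \<Rightarrow> 'e \<Rightarrow> 'e) \<Rightarrow> bool" where
  "additive_bifunctor C G psh pll \<longleftrightarrow>
     (\<forall>X \<in> Obj C. \<forall>A \<in> Obj C. comm_group (G X A)) \<and>
     (\<forall>X \<in> Obj C. \<forall>A \<in> Obj C. \<forall>A' \<in> Obj C. \<forall>a \<in> Hom C A A'.
        psh X a \<in> hom (G X A) (G X A')) \<and>
     (\<forall>X \<in> Obj C. \<forall>X' \<in> Obj C. \<forall>A \<in> Obj C. \<forall>c \<in> Hom C X' X.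
        pll A c \<in> hom (G X A) (G X' A)) \<and>
     (\<forall>X \<in> Obj C. \<forall>A \<in> Obj C. \<forall>\<delta> \<in> carrier (G X A).
        psh X (ident C A) \<delta> = \<delta> \<and> pll A (ident C X) \<delta> = \<delta>) \<and>
     (\<forall>X \<in> Obj C. \<forall>A \<in> Obj C. \<forall>A' \<in> Obj C. \<forall>A'' \<in> Obj C.
        \<forall>a \<in> Hom C A A'. \<forall>a' \<in> Hom C A' A''. \<forall>\<delta> \<in> carrier (G X A).
        psh X (a' \<bullet>\<^bsub>C\<^esub> a) \<delta> = psh X a' (psh X a \<delta>)) \<and>
     (\<forall>X \<in> Obj C. \<forall>X' \<in> Obj C. \<forall>X'' \<in> Obj C. \<forall>A \<in> Obj C.
        \<forall>c \<in> Hom C X' X. \<forall>c' \<in> Hom C X'' X'. \<forall>\<delta> \<in> carrier (G X A).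
        pll A (c \<bullet>\<^bsub>C\<^esub> c') \<delta> = pll A c' (pll A c \<delta>)) \<and>
     (\<forall>X \<in> Obj C. \<forall>X' \<in> Obj C. \<forall>A \<in> Obj C. \<forall>A' \<in> Obj C.
        \<forall>a \<in> Hom C A A'. \<forall>c \<in> Hom C X' X. \<forall>\<delta> \<in> carrier (G X A).
        psh X' a (pll A c \<delta>) = pll A' c (psh X a \<delta>)) \<and>
     (\<forall>X \<in> Obj C. \<forall>A \<in> Obj C. \<forall>A' \<in> Obj C. \<forall>a \<in> Hom C A A'. \<forall>a' \<in> Hom C A A'.
        \<forall>\<delta> \<in> carrier (G X A). psh X (a \<boxplus>\<^bsub>C\<^esub> a') \<delta> = psh X a \<delta> \<otimes>\<^bsub>G X A'\<^esub> psh X a' \<delta>) \<and>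
     (\<forall>X \<in> Obj C. \<forall>X' \<in> Obj C. \<forall>A \<in> Obj C. \<forall>c \<in> Hom C X' X. \<forall>c' \<in> Hom C X' X.
        \<forall>\<delta> \<in> carrier (G X A). pll A (c \<boxplus>\<^bsub>C\<^esub> c') \<delta> = pll A c \<delta> \<otimes>\<^bsub>G X' A\<^esub> pll A c' \<delta>)"

text \<open>A sequence \<open>A \<rightarrow> B \<rightarrow> X\<close> with given ends is encoded as the triple of its middle term and its
  two maps; \<open>seq_class\<close> is its class under isomorphisms that are the identity on both ends.\<close>

definition seq_class ::
  "('o, 'm, 'z) category_scheme \<Rightarrow> 'o \<Rightarrow> 'o \<Rightarrow> 'o \<times> 'm \<times> 'm \<Rightarrow> ('o \<times> 'm \<times> 'm) set" where
  "seq_class C A X = (\<lambda>(B, f, g). {(B', f', g').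
     B' \<in> Obj C \<and> f' \<in> Hom C A B' \<and> g' \<in> Hom C B' X \<and>
     (\<exists>b. is_iso C B B' b \<and> b \<bullet>\<^bsub>C\<^esub> f = f' \<and> g' \<bullet>\<^bsub>C\<^esub> b = g)})"

text \<open>\<open>Ext X A\<close> is \<open>E(X, A)\<close>, and \<open>rlz X A \<delta>\<close> is the class \<open>s(\<delta>)\<close>.\<close>

record ('o, 'm, 'e) extri = "('o, 'm) preadd" +
  Ext :: "'o \<Rightarrow> 'o \<Rightarrow> 'e monoid"
  push :: "'o \<Rightarrow> 'm \<Rightarrow> 'e \<Rightarrow> 'e"
  pull :: "'o \<Rightarrow> 'm \<Rightarrow> 'e \<Rightarrow> 'e"
  rlz :: "'o \<Rightarrow> 'o \<Rightarrow> 'e \<Rightarrow> ('o \<times> 'm \<times> 'm) set"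

definition conflation ::
  "('o, 'm, 'e, 'z) extri_scheme \<Rightarrow> 'o \<Rightarrow> 'm \<Rightarrow> 'o \<Rightarrow> 'm \<Rightarrow> 'o \<Rightarrow> 'e \<Rightarrow> bool" where
  "conflation T A f B g X \<delta> \<longleftrightarrow> A \<in> Obj T \<and> X \<in> Obj T \<and>
     \<delta> \<in> carrier (Ext T X A) \<and> (B, f, g) \<in> rlz T X A \<delta>"

locale extriangulated_category = additive_category C
  for C :: "('o, 'm, 'e, 'z) extri_scheme" (structure) +
  assumes ET1: "additive_bifunctor C (Ext C) (push C) (pull C)"
    and ET2_class: "\<lbrakk>A \<in> Obj C; X \<in> Obj C; \<delta> \<in> carrier (Ext C X A)\<rbrakk> \<Longrightarrow>
      \<exists>B f g. B \<in> Obj C \<and> f \<in> Hom C A B \<and> g \<in> Hom C B X \<and> g \<bullet> f = zer C A X \<and>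
        rlz C X A \<delta> = seq_class C A X (B, f, g)"
    and ET2_realization: "\<lbrakk>conflation C A f B g X \<delta>; conflation C A' f' B' g' X' \<delta>';
      a \<in> Hom C A A'; c \<in> Hom C X X'; push C X a \<delta> = pull C A' c \<delta>'\<rbrakk> \<Longrightarrow>
      \<exists>b \<in> Hom C B B'. b \<bullet> f = f' \<bullet> a \<and> g' \<bullet> b = c \<bullet> g"
    and ET2_zero: "biproduct C A X B i1 i2 p1 p2 \<Longrightarrow> conflation C A i1 B p2 X \<one>\<^bsub>Ext C X A\<^esub>"
    and ET2_sum: "\<lbrakk>conflation C A f B g X \<delta>; conflation C A' f' B' g' X' \<delta>';
      biproduct C A A' A2 iA iA' pA pA'; biproduct C B B' B2 iB iB' pB pB';
      biproduct C X X' X2 iX iX' pX pX'\<rbrakk> \<Longrightarrow>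
      conflation C A2 ((iB \<bullet> f \<bullet> pA) \<boxplus> (iB' \<bullet> f' \<bullet> pA')) B2
        ((iX \<bullet> g \<bullet> pB) \<boxplus> (iX' \<bullet> g' \<bullet> pB')) X2
        (push C X2 iA (pull C A pX \<delta>) \<otimes>\<^bsub>Ext C X2 A2\<^esub> push C X2 iA' (pull C A' pX' \<delta>'))"
    and ET3: "\<lbrakk>conflation C A f B g X \<delta>; conflation C A' f' B' g' X' \<delta>';
      a \<in> Hom C A A'; b \<in> Hom C B B'; b \<bullet> f = f' \<bullet> a\<rbrakk> \<Longrightarrow>
      \<exists>c \<in> Hom C X X'. c \<bullet> g = g' \<bullet> b \<and> push C X a \<delta> = pull C A' c \<delta>'"
    and ET3_op: "\<lbrakk>conflation C A f B g X \<delta>; conflation C A' f' B' g' X' \<delta>';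
      b \<in> Hom C B B'; c \<in> Hom C X X'; c \<bullet> g = g' \<bullet> b\<rbrakk> \<Longrightarrow>
      \<exists>a \<in> Hom C A A'. b \<bullet> f = f' \<bullet> a \<and> push C X a \<delta> = pull C A' c \<delta>'"
    and ET4: "\<lbrakk>conflation C A f B f' D \<delta>; conflation C B g X g' F \<delta>'\<rbrakk> \<Longrightarrow>
      \<exists>E \<delta>'' h' d e. E \<in> Obj C \<and> d \<in> Hom C D E \<and> e \<in> Hom C E F \<and>
        conflation C A (g \<bullet> f) X h' E \<delta>'' \<and>
        h' \<bullet> g = d \<bullet> f' \<and> g' = e \<bullet> h' \<and>
        conflation C D d E e F (push C F f' \<delta>') \<and>
        pull C A d \<delta>'' = \<delta> \<and>
        push C E f \<delta>'' = pull C B e \<delta>'"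
    and ET4_op: "\<lbrakk>conflation C D f' A f B \<delta>; conflation C F g' B g X \<delta>'\<rbrakk> \<Longrightarrow>
      \<exists>E \<delta>'' h' d e. E \<in> Obj C \<and> d \<in> Hom C D E \<and> e \<in> Hom C E F \<and>
        conflation C E h' A (g \<bullet> f) X \<delta>'' \<and>
        h' \<bullet> d = f' \<and> f \<bullet> h' = g' \<bullet> e \<and>
        conflation C D d E e F (pull C D g' \<delta>) \<and>
        push C X e \<delta>'' = \<delta>' \<and>
        push C B d \<delta> = pull C E g \<delta>''"

text \<open>\<open>NExt W A\<close> is \<open>E\<^sup>-\<^sup>1(W, A)\<close>. For \<open>\<delta>\<close> in \<open>E(X, A)\<close>, the connecting transformations are
  \<open>ncon X A \<delta> W : E\<^sup>-\<^sup>1(W, X) \<rightarrow> Hom(W, A)\<close> and \<open>nconop X A \<delta> W : E\<^sup>-\<^sup>1(A, W) \<rightarrow> Hom(X, W)\<close>.\<close>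

record ('o, 'm, 'e, 'n) neg_extri = "('o, 'm, 'e) extri" +
  NExt :: "'o \<Rightarrow> 'o \<Rightarrow> 'n monoid"
  npush :: "'o \<Rightarrow> 'm \<Rightarrow> 'n \<Rightarrow> 'n"
  npull :: "'o \<Rightarrow> 'm \<Rightarrow> 'n \<Rightarrow> 'n"
  ncon :: "'o \<Rightarrow> 'o \<Rightarrow> 'e \<Rightarrow> 'o \<Rightarrow> 'n \<Rightarrow> 'm"
  nconop :: "'o \<Rightarrow> 'o \<Rightarrow> 'e \<Rightarrow> 'o \<Rightarrow> 'n \<Rightarrow> 'm"

locale extriangulated_negative = extriangulated_category C
  for C :: "('o, 'm, 'e, 'n, 'z) neg_extri_scheme" (structure) +
  assumes NE1: "additive_bifunctor C (NExt C) (npush C) (npull C)"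
    and ncon_hom: "\<lbrakk>X \<in> Obj C; A \<in> Obj C; W \<in> Obj C; \<delta> \<in> carrier (Ext C X A)\<rbrakk> \<Longrightarrow>
      ncon C X A \<delta> W \<in> hom (NExt C W X) (hom_group C W A)"
    and ncon_natural: "\<lbrakk>X \<in> Obj C; A \<in> Obj C; W \<in> Obj C; W' \<in> Obj C;
      \<delta> \<in> carrier (Ext C X A); w \<in> Hom C W' W; \<nu> \<in> carrier (NExt C W X)\<rbrakk> \<Longrightarrow>
      ncon C X A \<delta> W' (npull C X w \<nu>) = ncon C X A \<delta> W \<nu> \<bullet> w"
    and nconop_hom: "\<lbrakk>X \<in> Obj C; A \<in> Obj C; W \<in> Obj C; \<delta> \<in> carrier (Ext C X A)\<rbrakk> \<Longrightarrow>
      nconop C X A \<delta> W \<in> hom (NExt C A W) (hom_group C X W)"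
    and nconop_natural: "\<lbrakk>X \<in> Obj C; A \<in> Obj C; W \<in> Obj C; W' \<in> Obj C;
      \<delta> \<in> carrier (Ext C X A); w \<in> Hom C W W'; \<nu> \<in> carrier (NExt C A W)\<rbrakk> \<Longrightarrow>
      nconop C X A \<delta> W' (npush C A w \<nu>) = w \<bullet> nconop C X A \<delta> W \<nu>"
    and exact_covariant: "\<lbrakk>conflation C A f B g X \<delta>; W \<in> Obj C\<rbrakk> \<Longrightarrow>
      npush C W f ` carrier (NExt C W A) = kernel (NExt C W B) (NExt C W X) (npush C W g) \<and>
      npush C W g ` carrier (NExt C W B) = kernel (NExt C W X) (hom_group C W A) (ncon C X A \<delta> W) \<and>
      ncon C X A \<delta> W ` carrier (NExt C W X) =
        kernel (hom_group C W A) (hom_group C W B) (\<lambda>u. f \<bullet> u)"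
    and exact_contravariant: "\<lbrakk>conflation C A f B g X \<delta>; W \<in> Obj C\<rbrakk> \<Longrightarrow>
      npull C W g ` carrier (NExt C X W) = kernel (NExt C B W) (NExt C A W) (npull C W f) \<and>
      npull C W f ` carrier (NExt C B W) = kernel (NExt C A W) (hom_group C X W) (nconop C X A \<delta> W) \<and>
      nconop C X A \<delta> W ` carrier (NExt C A W) =
        kernel (hom_group C X W) (hom_group C B W) (\<lambda>u. u \<bullet> g)"


section \<open>Filtered objects and mixed stratifying systems\<close>

text \<open>Subcategories are generated by sets of objects: \<open>addc C S\<close> is \<open>add\<close> of the direct sum of
  the members of \<open>S\<close>, i.e. all direct summands of finite direct sums of members of \<open>S\<close>.\<close>

definition addc :: "('o, 'm, 'z) preadd_scheme \<Rightarrow> 'o set \<Rightarrow> 'o set" where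
  "addc C S = {Z \<in> Obj C. \<exists>n Y M \<iota> \<pi> W i1 i2 p1 p2.
     (\<forall>i<n. Y i \<in> S) \<and> direct_sum C {..<n} Y M \<iota> \<pi> \<and> biproduct C Z W M i1 i2 p1 p2}"

definition star :: "('o, 'm, 'e, 'z) extri_scheme \<Rightarrow> 'o set \<Rightarrow> 'o set \<Rightarrow> 'o set" where
  "star T S S' = {M \<in> Obj T. \<exists>X \<in> S. \<exists>Y \<in> S'. \<exists>f g \<delta>. conflation T X f M g Y \<delta>}"

text \<open>\<open>filt_len T S l\<close> is \<open>add S * \<dots> * add S\<close> with \<open>l + 1\<close> factors.\<close>

primrec filt_len :: "('o, 'm, 'e, 'z) extri_scheme \<Rightarrow> 'o set \<Rightarrow> nat \<Rightarrow> 'o set" where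
  "filt_len T S 0 = addc T S"
| "filt_len T S (Suc l) = star T (addc T S) (filt_len T S l)"

definition filt :: "('o, 'm, 'e, 'z) extri_scheme \<Rightarrow> 'o set \<Rightarrow> 'o set" where
  "filt T S = (\<Union>l. filt_len T S l)"

definition stone :: "('o, 'm, 'e, 'z) extri_scheme \<Rightarrow> 'o \<Rightarrow> bool" where
  "stone T M \<longleftrightarrow> indecomposable T M \<and> carrier (Ext T M M) = {\<one>\<^bsub>Ext T M M\<^esub>}"

definition mixed_stratifying_system ::
  "('o, 'm, 'e, 'n, 'z) neg_extri_scheme \<Rightarrow> nat \<Rightarrow> (nat \<Rightarrow> 'o) \<Rightarrow> (nat \<Rightarrow> 'o) \<Rightarrow> bool" where
  "mixed_stratifying_system T t \<Theta> P \<longleftrightarrow>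
     (\<forall>i \<in> {1..t}. \<Theta> i \<in> Obj T \<and> indecomposable T (P i)) \<and>
     (\<forall>i \<in> {1..t}. brick T (\<Theta> i) \<or> stone T (\<Theta> i)) \<and>
     (\<forall>i \<in> {1..t}. \<forall>j \<in> {1..t}. i > j \<longrightarrow> Hom T (\<Theta> i) (\<Theta> j) = {zer T (\<Theta> i) (\<Theta> j)}) \<and>
     (\<forall>i \<in> {1..t}.
        (\<exists>K \<in> filt T (\<Theta> ` {i..t}). \<exists>f g \<delta>. conflation T K f (P i) g (\<Theta> i) \<delta>) \<and>
        (\<forall>X \<in> filt T (\<Theta> ` {1..t}). carrier (Ext T (P i) X) = {\<one>\<^bsub>Ext T (P i) X\<^esub>})) \<and>
     (\<forall>i \<in> {1..t}. \<forall>j \<in> {1..t}.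
        carrier (NExt T (\<Theta> i) (\<Theta> j)) = {\<one>\<^bsub>NExt T (\<Theta> i) (\<Theta> j)\<^esub>})"


section \<open>Module categories\<close>

text \<open>Right modules over a possibly noncommutative ring use the library's record; \<open>r \<odot>\<^bsub>M\<^esub> x\<close>
  stands for \<open>x \<cdot> r\<close>, and the fields \<open>mult\<close> and \<open>one\<close> of \<open>M\<close> are not used.\<close>

definition right_module :: "('r, 'y) ring_scheme \<Rightarrow> ('r, 'x) module \<Rightarrow> bool" where
  "right_module R M \<longleftrightarrow> ring R \<and> abelian_group M \<and>
     (\<forall>r \<in> carrier R. \<forall>x \<in> carrier M. r \<odot>\<^bsub>M\<^esub> x \<in> carrier M) \<and>
     (\<forall>x \<in> carrier M. \<one>\<^bsub>R\<^esub> \<odot>\<^bsub>M\<^esub> x = x) \<and>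
     (\<forall>r \<in> carrier R. \<forall>s \<in> carrier R. \<forall>x \<in> carrier M.
        (r \<otimes>\<^bsub>R\<^esub> s) \<odot>\<^bsub>M\<^esub> x = s \<odot>\<^bsub>M\<^esub> (r \<odot>\<^bsub>M\<^esub> x)) \<and>
     (\<forall>r \<in> carrier R. \<forall>s \<in> carrier R. \<forall>x \<in> carrier M.
        (r \<oplus>\<^bsub>R\<^esub> s) \<odot>\<^bsub>M\<^esub> x = (r \<odot>\<^bsub>M\<^esub> x) \<oplus>\<^bsub>M\<^esub> (s \<odot>\<^bsub>M\<^esub> x)) \<and>
     (\<forall>r \<in> carrier R. \<forall>x \<in> carrier M. \<forall>y \<in> carrier M.
        r \<odot>\<^bsub>M\<^esub> (x \<oplus>\<^bsub>M\<^esub> y) = (r \<odot>\<^bsub>M\<^esub> x) \<oplus>\<^bsub>M\<^esub> (r \<odot>\<^bsub>M\<^esub> y))"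

definition fin_gen :: "('r, 'y) ring_scheme \<Rightarrow> ('r, 'x) module \<Rightarrow> bool" where
  "fin_gen R M \<longleftrightarrow> (\<exists>S. finite S \<and> S \<subseteq> carrier M \<and>
     (\<forall>x \<in> carrier M. \<exists>c. (\<forall>s \<in> S. c s \<in> carrier R) \<and> x = finsum M (\<lambda>s. c s \<odot>\<^bsub>M\<^esub> s) S))"

definition mod_hom ::
  "('r, 'y) ring_scheme \<Rightarrow> ('r, 'x) module \<Rightarrow> ('r, 'x) module \<Rightarrow> ('x \<Rightarrow> 'x) set" where
  "mod_hom R M N = {f \<in> carrier M \<rightarrow>\<^sub>E carrier N.
     (\<forall>x \<in> carrier M. \<forall>y \<in> carrier M. f (x \<oplus>\<^bsub>M\<^esub> y) = f x \<oplus>\<^bsub>N\<^esub> f y) \<and>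
     (\<forall>r \<in> carrier R. \<forall>x \<in> carrier M. f (r \<odot>\<^bsub>M\<^esub> x) = r \<odot>\<^bsub>N\<^esub> f x)}"

type_synonym ('r, 'x) mod_mor = "('r, 'x) module \<times> ('r, 'x) module \<times> ('x \<Rightarrow> 'x)"

text \<open>The additive category of finitely generated right \<open>R\<close>-modules whose elements have type \<open>'x\<close>.
  This represents every isomorphism class of finitely generated modules as soon as every
  quotient of every \<open>R\<^sup>n\<close> embeds into \<open>'x\<close> as a set. For \<open>R = End P\<close> in a Hom-finite Krull-Schmidt
  category with nonzero \<open>P\<close> and \<open>'x = 'm\<close> the type of morphisms this is automatic: the identities
  of the objects \<open>P\<^sup>n\<close> are pairwise distinct, so \<open>'m\<close> is infinite, and \<open>R\<close> is a subset of \<open>'m\<close>.\<close>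

definition mod_add :: "('r, 'y) ring_scheme \<Rightarrow> (('r, 'x) module, ('r, 'x) mod_mor) preadd" where
  "mod_add R = \<lparr>Obj = {M. right_module R M \<and> fin_gen R M},
     Hom = (\<lambda>M N. {(M', N', f). M' = M \<and> N' = N \<and> f \<in> mod_hom R M N}),
     ident = (\<lambda>M. (M, M, \<lambda>x \<in> carrier M. x)),
     cmp = (\<lambda>(N', L, g) (M, N, f). (M, L, compose (carrier M) g f)),
     zer = (\<lambda>M N. (M, N, \<lambda>x \<in> carrier M. \<zero>\<^bsub>N\<^esub>)),
     pls = (\<lambda>(M, N, f) (M', N', g). (M, N, \<lambda>x \<in> carrier M. f x \<oplus>\<^bsub>N\<^esub> g x))\<rparr>"

abbreviation mor_fun :: "('r, 'x) mod_mor \<Rightarrow> 'x \<Rightarrow> 'x" where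
  "mor_fun f \<equiv> snd (snd f)"

definition short_exact :: "('r, 'y) ring_scheme \<Rightarrow> ('r, 'x) module \<Rightarrow> ('r, 'x) module
    \<Rightarrow> (('r, 'x) module \<times> ('r, 'x) mod_mor \<times> ('r, 'x) mod_mor) set" where
  "short_exact R A X = {(B, f, g). A \<in> Obj (mod_add R) \<and> B \<in> Obj (mod_add R) \<and> X \<in> Obj (mod_add R) \<and>
     f \<in> Hom (mod_add R) A B \<and> g \<in> Hom (mod_add R) B X \<and>
     inj_on (mor_fun f) (carrier A) \<and>
     mor_fun f ` carrier A = a_kernel B X (mor_fun g) \<and>
     mor_fun g ` carrier B = carrier X}"

text \<open>\<open>Ext\<^sup>1\<close> is Yoneda's: an element of \<open>Ext\<^sup>1(X, A)\<close> is an equivalence class of short exact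
  sequences \<open>A \<rightarrow> B \<rightarrow> X\<close>. \<open>yoneda_push\<close> and \<open>yoneda_pull\<close> collect the sequences that receive,
  respectively admit, a morphism from (to) a member of the given class which is the identity on
  one end and the given map on the other; these are the pushout and pullback sequences.\<close>

type_synonym ('r, 'x) mod_ext = "(('r, 'x) module \<times> ('r, 'x) mod_mor \<times> ('r, 'x) mod_mor) set"

definition yoneda_ext ::
  "('r, 'y) ring_scheme \<Rightarrow> ('r, 'x) module \<Rightarrow> ('r, 'x) module \<Rightarrow> ('r, 'x) mod_ext set" where
  "yoneda_ext R X A = seq_class (mod_add R) A X ` short_exact R A X"

definition yoneda_push ::
  "('r, 'y) ring_scheme \<Rightarrow> ('r, 'x) module \<Rightarrow> ('r, 'x) mod_mor
     \<Rightarrow> ('r, 'x) mod_ext \<Rightarrow> ('r, 'x) mod_ext" where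
  "yoneda_push R X a \<xi> = {(B', f', g'). (B', f', g') \<in> short_exact R (fst (snd a)) X \<and>
     (\<exists>(B, f, g) \<in> \<xi>. \<exists>b \<in> Hom (mod_add R) B B'.
        b \<bullet>\<^bsub>mod_add R\<^esub> f = f' \<bullet>\<^bsub>mod_add R\<^esub> a \<and> g' \<bullet>\<^bsub>mod_add R\<^esub> b = g)}"

definition yoneda_pull ::
  "('r, 'y) ring_scheme \<Rightarrow> ('r, 'x) module \<Rightarrow> ('r, 'x) mod_mor
     \<Rightarrow> ('r, 'x) mod_ext \<Rightarrow> ('r, 'x) mod_ext" where
  "yoneda_pull R A c \<xi> = {(B', f', g'). (B', f', g') \<in> short_exact R A (fst c) \<and>
     (\<exists>(B, f, g) \<in> \<xi>. \<exists>b \<in> Hom (mod_add R) B' B.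
        b \<bullet>\<^bsub>mod_add R\<^esub> f' = f \<and> g \<bullet>\<^bsub>mod_add R\<^esub> b = c \<bullet>\<^bsub>mod_add R\<^esub> g')}"

text \<open>The Baer sum is the direct sum of two sequences, pulled back along the diagonal \<open>iX + iX'\<close>
  of \<open>X\<close> and pushed out along the codiagonal \<open>pA + pA'\<close> of \<open>A\<close>.\<close>

definition baer_sum ::
  "('r, 'y) ring_scheme \<Rightarrow> ('r, 'x) module \<Rightarrow> ('r, 'x) module
     \<Rightarrow> ('r, 'x) mod_ext \<Rightarrow> ('r, 'x) mod_ext \<Rightarrow> ('r, 'x) mod_ext" where
  "baer_sum R X A \<xi> \<xi>' = {s. \<exists>(B, f, g) \<in> \<xi>. \<exists>(B', f', g') \<in> \<xi>'.
     \<exists>A2 iA iA' pA pA' B2 iB iB' pB pB' X2 iX iX' pX pX'.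
       biproduct (mod_add R) A A A2 iA iA' pA pA' \<and>
       biproduct (mod_add R) B B' B2 iB iB' pB pB' \<and>
       biproduct (mod_add R) X X X2 iX iX' pX pX' \<and>
       s \<in> yoneda_push R X (pA \<boxplus>\<^bsub>mod_add R\<^esub> pA')
         (yoneda_pull R A2 (iX \<boxplus>\<^bsub>mod_add R\<^esub> iX')
           {(B2,
             (iB \<bullet>\<^bsub>mod_add R\<^esub> f \<bullet>\<^bsub>mod_add R\<^esub> pA) \<boxplus>\<^bsub>mod_add R\<^esub> (iB' \<bullet>\<^bsub>mod_add R\<^esub> f' \<bullet>\<^bsub>mod_add R\<^esub> pA'),
             (iX \<bullet>\<^bsub>mod_add R\<^esub> g \<bullet>\<^bsub>mod_add R\<^esub> pB) \<boxplus>\<^bsub>mod_add R\<^esub> (iX' \<bullet>\<^bsub>mod_add R\<^esub> g' \<bullet>\<^bsub>mod_add R\<^esub> pB'))})}"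

definition split_class ::
  "('r, 'y) ring_scheme \<Rightarrow> ('r, 'x) module \<Rightarrow> ('r, 'x) module \<Rightarrow> ('r, 'x) mod_ext" where
  "split_class R X A = {(B, f, g). \<exists>i p. biproduct (mod_add R) A X B f i p g}"

text \<open>\<open>mod R\<close> with \<open>Ext\<^sup>1\<close>, the short exact sequences as conflations, and \<open>E\<^sup>-\<^sup>1 = 0\<close>.\<close>

definition mod_cat ::
  "('r, 'y) ring_scheme
     \<Rightarrow> (('r, 'x) module, ('r, 'x) mod_mor, ('r, 'x) mod_ext, unit) neg_extri" where
  "mod_cat R = \<lparr>Obj = Obj (mod_add R), Hom = Hom (mod_add R), ident = ident (mod_add R),
     cmp = cmp (mod_add R), zer = zer (mod_add R), pls = pls (mod_add R),
     Ext = (\<lambda>X A. \<lparr>carrier = yoneda_ext R X A, mult = baer_sum R X A, one = split_class R X A\<rparr>),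
     push = yoneda_push R, pull = yoneda_pull R, rlz = (\<lambda>X A \<xi>. \<xi>),
     NExt = (\<lambda>W A. \<lparr>carrier = {()}, mult = (\<lambda>_ _. ()), one = ()\<rparr>),
     npush = (\<lambda>_ _ _. ()), npull = (\<lambda>_ _ _. ()),
     ncon = (\<lambda>X A \<xi> W _. zer (mod_add R) W A), nconop = (\<lambda>X A \<xi> W _. zer (mod_add R) X W)\<rparr>"


section \<open>Mixed stratified algebras\<close>

definition fd_algebra :: "('k::field \<Rightarrow> 'a \<Rightarrow> 'a) \<Rightarrow> 'a ring \<Rightarrow> bool" where
  "fd_algebra sm A \<longleftrightarrow> ring A \<and> k_space sm (add_monoid A) \<and> fin_dim sm (add_monoid A) \<and>
     (\<forall>r. \<forall>a \<in> carrier A. \<forall>b \<in> carrier A.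
        sm r a \<otimes>\<^bsub>A\<^esub> b = sm r (a \<otimes>\<^bsub>A\<^esub> b) \<and> a \<otimes>\<^bsub>A\<^esub> sm r b = sm r (a \<otimes>\<^bsub>A\<^esub> b))"

definition primitive_idempotent :: "'a ring \<Rightarrow> 'a \<Rightarrow> bool" where
  "primitive_idempotent A e \<longleftrightarrow> e \<in> carrier A \<and> e \<otimes>\<^bsub>A\<^esub> e = e \<and> e \<noteq> \<zero>\<^bsub>A\<^esub> \<and>
     (\<forall>f \<in> carrier A. \<forall>g \<in> carrier A. f \<otimes>\<^bsub>A\<^esub> f = f \<and> g \<otimes>\<^bsub>A\<^esub> g = g \<and>
        f \<otimes>\<^bsub>A\<^esub> g = \<zero>\<^bsub>A\<^esub> \<and> g \<otimes>\<^bsub>A\<^esub> f = \<zero>\<^bsub>A\<^esub> \<and> e = f \<oplus>\<^bsub>A\<^esub> g \<longrightarrow> f = \<zero>\<^bsub>A\<^esub> \<or> g = \<zero>\<^bsub>A\<^esub>)"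

definition complete_idempotents :: "'a ring \<Rightarrow> nat \<Rightarrow> (nat \<Rightarrow> 'a) \<Rightarrow> bool" where
  "complete_idempotents A n e \<longleftrightarrow>
     (\<forall>i \<in> {1..n}. primitive_idempotent A (e i)) \<and>
     (\<forall>i \<in> {1..n}. \<forall>j \<in> {1..n}. i \<noteq> j \<longrightarrow> e i \<otimes>\<^bsub>A\<^esub> e j = \<zero>\<^bsub>A\<^esub>) \<and>
     finsum A e {1..n} = \<one>\<^bsub>A\<^esub>"

text \<open>The right module \<open>e A\<close>; in particular \<open>right_ideal A \<one>\<close> is the regular module.\<close>

definition right_ideal :: "'a ring \<Rightarrow> 'a \<Rightarrow> ('a, 'a) module" where
  "right_ideal A e = \<lparr>carrier = (\<lambda>a. e \<otimes>\<^bsub>A\<^esub> a) ` carrier A, mult = undefined, one = undefined,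
     zero = \<zero>\<^bsub>A\<^esub>, add = add A, smult = (\<lambda>a x. x \<otimes>\<^bsub>A\<^esub> a)\<rparr>"

definition basic_algebra :: "'a ring \<Rightarrow> nat \<Rightarrow> (nat \<Rightarrow> 'a) \<Rightarrow> bool" where
  "basic_algebra A n e \<longleftrightarrow> (\<forall>i \<in> {1..n}. \<forall>j \<in> {1..n}. i \<noteq> j \<longrightarrow>
     \<not> isomorphic (mod_add A) (right_ideal A (e i)) (right_ideal A (e j)))"

definition maximal_submodule :: "'a ring \<Rightarrow> 'x set \<Rightarrow> ('a, 'x) module \<Rightarrow> bool" where
  "maximal_submodule A U M \<longleftrightarrow> submodule U A M \<and> U \<noteq> carrier M \<and>
     (\<forall>V. submodule V A M \<and> U \<subseteq> V \<longrightarrow> V = U \<or> V = carrier M)"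

definition rad :: "'a ring \<Rightarrow> ('a, 'x) module \<Rightarrow> ('a, 'x) module" where
  "rad A M = M\<lparr>carrier := carrier M \<inter> \<Inter>{U. maximal_submodule A U M}\<rparr>"

text \<open>Factor modules are represented, up to isomorphism, by surjective homomorphisms.\<close>

definition factor_map ::
  "'a ring \<Rightarrow> ('a, 'x) module \<Rightarrow> ('a, 'x) module \<Rightarrow> ('x \<Rightarrow> 'x) \<Rightarrow> bool" where
  "factor_map A M N p \<longleftrightarrow> M \<in> Obj (mod_add A) \<and> N \<in> Obj (mod_add A) \<and>
     p \<in> mod_hom A M N \<and> p ` carrier M = carrier N"

definition is_top :: "'a ring \<Rightarrow> ('a, 'x) module \<Rightarrow> ('a, 'x) module \<Rightarrow> bool" where
  "is_top A M S \<longleftrightarrow> (\<exists>p. factor_map A M S p \<and> a_kernel M S p = carrier (rad A M))"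

text \<open>\<open>N\<close> is the maximal factor module of \<open>M\<close> among those lying in \<open>Q\<close>.\<close>

definition max_factor ::
  "'a ring \<Rightarrow> ('a, 'x) module \<Rightarrow> ('a, 'x) module set \<Rightarrow> ('a, 'x) module \<Rightarrow> bool" where
  "max_factor A M Q N \<longleftrightarrow> N \<in> Q \<and> (\<exists>p. factor_map A M N p \<and>
     (\<forall>N' \<in> Q. \<forall>q. factor_map A M N' q \<longrightarrow> a_kernel M N p \<subseteq> a_kernel M N' q))"

text \<open>All modules isomorphic to some \<open>S(j) = top (e\<^sub>j A)\<close> with \<open>j \<in> J\<close>.\<close>

definition simples :: "'a ring \<Rightarrow> (nat \<Rightarrow> 'a) \<Rightarrow> nat set \<Rightarrow> ('a, 'a) module set" where
  "simples A e J = {S. \<exists>j \<in> J. is_top A (right_ideal A (e j)) S}"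

definition standard_module :: "'a ring \<Rightarrow> (nat \<Rightarrow> 'a) \<Rightarrow> nat \<Rightarrow> ('a, 'a) module \<Rightarrow> bool" where
  "standard_module A e i D \<longleftrightarrow>
     max_factor A (right_ideal A (e i)) (filt (mod_cat A) (simples A e {1..i})) D"

definition proper_standard_module :: "'a ring \<Rightarrow> (nat \<Rightarrow> 'a) \<Rightarrow> nat \<Rightarrow> ('a, 'a) module \<Rightarrow> bool" where
  "proper_standard_module A e i N \<longleftrightarrow> (\<exists>D. standard_module A e i D \<and>
     max_factor A D {N'. rad A N' \<in> filt (mod_cat A) (simples A e {1..<i})} N)"

definition mixed_stratified_algebra ::
  "('k::field \<Rightarrow> 'a \<Rightarrow> 'a) \<Rightarrow> 'a ring \<Rightarrow> nat \<Rightarrow> (nat \<Rightarrow> 'a) \<Rightarrow> (nat \<Rightarrow> ('a, 'a) module) \<Rightarrow> bool" where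
  "mixed_stratified_algebra sm A n e \<Xi> \<longleftrightarrow>
     fd_algebra sm A \<and> complete_idempotents A n e \<and> basic_algebra A n e \<and>
     right_ideal A \<one>\<^bsub>A\<^esub> \<in> filt (mod_cat A) (\<Xi> ` {1..n}) \<and>
     (\<forall>i \<in> {1..n}. standard_module A e i (\<Xi> i) \<or> proper_standard_module A e i (\<Xi> i))"


section \<open>The functor represented by an object\<close>

definition psi_obj :: "('o, 'm, 'z) preadd_scheme \<Rightarrow> 'o \<Rightarrow> 'o \<Rightarrow> ('m, 'm) module" where
  "psi_obj C P X = \<lparr>carrier = Hom C P X, mult = undefined, one = undefined,
     zero = zer C P X, add = pls C, smult = (\<lambda>b f. f \<bullet>\<^bsub>C\<^esub> b)\<rparr>"

definition psi_mor :: "('o, 'm, 'z) preadd_scheme \<Rightarrow> 'o \<Rightarrow> 'o \<Rightarrow> 'o \<Rightarrow> 'm \<Rightarrow> ('m, 'm) mod_mor" where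
  "psi_mor C P X Y h = (psi_obj C P X, psi_obj C P Y, \<lambda>f \<in> Hom C P X. h \<bullet>\<^bsub>C\<^esub> f)"

end

theory Submission
  imports Defs
begin

text \<open>The vanishing of \<open>E\<^sup>-\<^sup>1\<close> on \<open>\<Theta>\<close> and of \<open>E(P, F(\<Theta>))\<close> makes \<open>\<Psi>\<close> exact on conflations in \<open>F(\<Theta>)\<close>.
  A horseshoe argument presents every \<open>X\<close> in \<open>F(\<Theta>)\<close> by a conflation \<open>K \<rightarrow> P0 \<rightarrow> X\<close> with \<open>P0\<close> in \<open>add P\<close>
  and \<open>K\<close> in \<open>F(\<Theta>)\<close>; since \<open>\<Psi>\<close> is bijective on morphisms out of \<open>add P\<close>, it is full and faithful on
  \<open>F(\<Theta>)\<close>. An extension of \<open>\<Psi> X\<close> by \<open>\<Psi> A\<close> is the pushout of \<open>\<Psi> K \<rightarrow> \<Psi> P0 \<rightarrow> \<Psi> X\<close> along some \<open>\<Psi> K \<rightarrow> \<Psi> A\<close>,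
  which lifts to \<open>K \<rightarrow> A\<close>, so extensions lift and \<open>\<Psi>\<close> is essentially surjective.

  If \<open>\<Theta>(i)\<close> is a brick, every nonzero map from an object of \<open>F(\<Theta>(i), \<dots>, \<Theta>(t))\<close> to \<open>\<Theta>(i)\<close> becomes surjective
  under \<open>\<Psi>\<close>, which makes \<open>\<Psi> \<Theta>(i)\<close> proper standard. If it is a stone, \<open>\<Psi> K(i)\<close> is either generated by its
  parts at \<open>e(j)\<close> with \<open>j > i\<close>, so that \<open>\<Psi> \<Theta>(i)\<close> is standard, or some \<open>K(i) \<rightarrow> \<Theta>(i)\<close> is surjective under \<open>\<Psi>\<close>;
  the latter extends to \<open>P(i)\<close> and would exhibit \<open>e(i)\<close> as a sum of elements of two proper submodules
  of the local module \<open>e(i) B\<close>.\<close>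

section \<open>Preadditive categories and local objects\<close>

text \<open>Two obstacles shape the argument. The other obstacle is \<open>add\<close> in the
  definition of \<open>filt\<close>: it brings in direct summands, which an induction over
  filtrations cannot follow. Because every \<Theta>(i) has a local endomorphism ring, such summands
  are again finite direct sums of the \<Theta>(i), and \<open>filt\<close> may be replaced by the
  set \<open>fl\<close>, whose filtration factors are single \<Theta>(i). Locality of P(i) plays the
  same part for B: it makes each e(i) B local, so that two proper submodules cannot jointly produce
  e(i). Throughout, \<open>thr\<close> records that a morphism is a finite sum of morphisms through
  given objects, and additivity reduces statements about objects of add P to the single object
  P.\<close>

locale preadditive = category C for C :: "('o, 'm, 'z) preadd_scheme" (structure) +
  assumes hom_grp: "\<lbrakk>X \<in> Obj C; Y \<in> Obj C\<rbrakk> \<Longrightarrow> comm_group (hom_group C X Y)"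
    and pls_left: "\<lbrakk>X \<in> Obj C; Y \<in> Obj C; Z \<in> Obj C;
      f \<in> Hom C X Y; g \<in> Hom C Y Z; g' \<in> Hom C Y Z\<rbrakk>
      \<Longrightarrow> (g \<boxplus> g') \<bullet> f = (g \<bullet> f) \<boxplus> (g' \<bullet> f)"
    and pls_right: "\<lbrakk>X \<in> Obj C; Y \<in> Obj C; Z \<in> Obj C;
      f \<in> Hom C X Y; f' \<in> Hom C X Y; g \<in> Hom C Y Z\<rbrakk>
      \<Longrightarrow> g \<bullet> (f \<boxplus> f') = (g \<bullet> f) \<boxplus> (g \<bullet> f')"
begin

section \<open>Typed arrow calculus in a preadditive category\<close>

definition ar :: "'m \<Rightarrow> bool" where
  "ar f \<longleftrightarrow> (\<exists>X \<in> Obj C. \<exists>Y \<in> Obj C. f \<in> Hom C X Y)"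

definition src :: "'m \<Rightarrow> 'o" where
  "src f = (THE X. X \<in> Obj C \<and> (\<exists>Y \<in> Obj C. f \<in> Hom C X Y))"

definition tgt :: "'m \<Rightarrow> 'o" where
  "tgt f = (THE Y. Y \<in> Obj C \<and> (\<exists>X \<in> Obj C. f \<in> Hom C X Y))"

definition mn :: "'m \<Rightarrow> 'm" where
  "mn f = inv\<^bsub>hom_group C (src f) (tgt f)\<^esub> f"

lemma src_eq: "\<lbrakk>X \<in> Obj C; Y \<in> Obj C; f \<in> Hom C X Y\<rbrakk> \<Longrightarrow> src f = X"
  unfolding src_def by (rule the_equality) (use hom_disjoint in blast)+

lemma tgt_eq: "\<lbrakk>X \<in> Obj C; Y \<in> Obj C; f \<in> Hom C X Y\<rbrakk> \<Longrightarrow> tgt f = Y"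
  unfolding tgt_def by (rule the_equality) (use hom_disjoint in blast)+

text \<open>Typing judgements become equations between sources and targets, so that the simplifier
  can discharge the side conditions of the composition laws without being given intermediate
  objects.\<close>

lemma hom_iff [simp]:
  "\<lbrakk>X \<in> Obj C; Y \<in> Obj C\<rbrakk> \<Longrightarrow> f \<in> Hom C X Y \<longleftrightarrow> ar f \<and> src f = X \<and> tgt f = Y"
  using src_eq tgt_eq unfolding ar_def by metis

lemma arD: "ar f \<Longrightarrow> src f \<in> Obj C \<and> tgt f \<in> Obj C \<and> f \<in> Hom C (src f) (tgt f)"
  using src_eq tgt_eq unfolding ar_def by metis

lemma src_obj [simp]: "ar f \<Longrightarrow> src f \<in> Obj C" and tgt_obj [simp]: "ar f \<Longrightarrow> tgt f \<in> Obj C"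
  using arD by auto

lemma arI: "\<lbrakk>X \<in> Obj C; Y \<in> Obj C; f \<in> Hom C X Y\<rbrakk> \<Longrightarrow> ar f \<and> src f = X \<and> tgt f = Y"
  by simp

lemma ident_arr [simp]:
  assumes "X \<in> Obj C"
  shows "ar (ident C X)" "src (ident C X) = X" "tgt (ident C X) = X"
  using arI[OF assms assms ident_closed[OF assms]] by auto

lemma cmp_arr [simp]:
  assumes "ar f" "ar g" "tgt f = src g"
  shows "ar (g \<bullet> f)" "src (g \<bullet> f) = src f" "tgt (g \<bullet> f) = tgt g"
  using arI[OF _ _ cmp_closed[of "src f" "tgt f" "tgt g" f g]] arD[OF assms(1)] arD[OF assms(2)] assms(3)
  by auto

lemma assoc [simp]:
  assumes "ar f" "ar g" "ar h" "tgt f = src g" "tgt g = src h"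
  shows "(h \<bullet> g) \<bullet> f = h \<bullet> (g \<bullet> f)"
  using assms by (intro cmp_assoc[of "src f" "src g" "src h" "tgt h"]) auto

lemma ident_right [simp]: "\<lbrakk>ar f; X = src f\<rbrakk> \<Longrightarrow> f \<bullet> ident C X = f"
  by (auto intro: cmp_ident_right[of _ "tgt f"])

lemma ident_left [simp]: "\<lbrakk>ar f; X = tgt f\<rbrakk> \<Longrightarrow> ident C X \<bullet> f = f"
  by (auto intro: cmp_ident_left[of "src f"])

lemma carrier_hom_group [simp]: "carrier (hom_group C X Y) = Hom C X Y"
  and mult_hom_group [simp]: "mult (hom_group C X Y) = pls C"
  and one_hom_group [simp]: "one (hom_group C X Y) = zer C X Y"
  by (simp_all add: hom_group_def)

lemma pls_arr [simp]:
  assumes "ar f" "ar g" "src f = src g" "tgt f = tgt g"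
  shows "ar (f \<boxplus> g)" "src (f \<boxplus> g) = src g" "tgt (f \<boxplus> g) = tgt g"
proof -
  interpret comm_group "hom_group C (src g) (tgt g)" using assms by (intro hom_grp) auto
  show "ar (f \<boxplus> g)" "src (f \<boxplus> g) = src g" "tgt (f \<boxplus> g) = tgt g"
    using m_closed[of f g] assms by auto
qed

lemma zer_arr [simp]:
  assumes "X \<in> Obj C" "Y \<in> Obj C"
  shows "ar (zer C X Y)" "src (zer C X Y) = X" "tgt (zer C X Y) = Y"
proof -
  interpret comm_group "hom_group C X Y" using assms by (intro hom_grp) auto
  show "ar (zer C X Y)" "src (zer C X Y) = X" "tgt (zer C X Y) = Y"
    using one_closed assms by auto
qed

lemma mn_arr [simp]:
  assumes "ar f"
  shows "ar (mn f)" "src (mn f) = src f" "tgt (mn f) = tgt f"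
proof -
  interpret comm_group "hom_group C (src f) (tgt f)" using assms by (intro hom_grp) auto
  show "ar (mn f)" "src (mn f) = src f" "tgt (mn f) = tgt f"
    using inv_closed[of f] assms unfolding mn_def by auto
qed

lemma pls_ac:
  assumes "ar f" "ar g" "src f = src g" "tgt f = tgt g"
  shows pls_comm: "f \<boxplus> g = g \<boxplus> f"
    and pls_assoc: "\<lbrakk>ar h; src g = src h; tgt g = tgt h\<rbrakk> \<Longrightarrow> (f \<boxplus> g) \<boxplus> h = f \<boxplus> (g \<boxplus> h)"
    and pls_lcomm: "\<lbrakk>ar h; src g = src h; tgt g = tgt h\<rbrakk> \<Longrightarrow> f \<boxplus> (g \<boxplus> h) = g \<boxplus> (f \<boxplus> h)"
proof -
  interpret comm_group "hom_group C (src g) (tgt g)" using assms by (intro hom_grp) auto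
  show "f \<boxplus> g = g \<boxplus> f" using m_comm[of f g] assms by auto
  show "(f \<boxplus> g) \<boxplus> h = f \<boxplus> (g \<boxplus> h)" if "ar h" "src g = src h" "tgt g = tgt h"
    using m_assoc[of f g h] assms that by auto
  show "f \<boxplus> (g \<boxplus> h) = g \<boxplus> (f \<boxplus> h)" if "ar h" "src g = src h" "tgt g = tgt h"
    using m_lcomm[of f g h] assms that by auto
qed

lemma pls_zer [simp]:
  assumes "ar f" "X = src f" "Y = tgt f"
  shows "f \<boxplus> zer C X Y = f" "zer C X Y \<boxplus> f = f"
proof -
  interpret comm_group "hom_group C X Y" using assms by (intro hom_grp) auto
  show "f \<boxplus> zer C X Y = f" using r_one[of f] assms by auto
  show "zer C X Y \<boxplus> f = f" using l_one[of f] assms by auto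
qed

lemma pls_mn [simp]:
  assumes "ar f"
  shows "f \<boxplus> mn f = zer C (src f) (tgt f)" "mn f \<boxplus> f = zer C (src f) (tgt f)"
proof -
  interpret comm_group "hom_group C (src f) (tgt f)" using assms by (intro hom_grp) auto
  show "f \<boxplus> mn f = zer C (src f) (tgt f)" using r_inv[of f] assms unfolding mn_def by auto
  show "mn f \<boxplus> f = zer C (src f) (tgt f)" using l_inv[of f] assms unfolding mn_def by auto
qed

lemma pls_mn_cancel [simp]:
  assumes "ar f" "ar g" "src f = src g" "tgt f = tgt g"
  shows "f \<boxplus> (mn f \<boxplus> g) = g" "mn f \<boxplus> (f \<boxplus> g) = g"
  using assms by (simp_all add: pls_assoc[symmetric] del: pls_mn) (simp_all add: assms)

lemma pls_cancel:
  assumes "ar f" "ar g" "ar h" "src f = src g" "tgt f = tgt g" "src h = src g" "tgt h = tgt g"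
  shows pls_lcancel: "h \<boxplus> f = h \<boxplus> g \<longleftrightarrow> f = g"
    and pls_rcancel: "f \<boxplus> h = g \<boxplus> h \<longleftrightarrow> f = g"
proof -
  show 1: "h \<boxplus> f = h \<boxplus> g \<longleftrightarrow> f = g"
    using pls_mn_cancel(2)[of h f] pls_mn_cancel(2)[of h g] assms by metis
  show "f \<boxplus> h = g \<boxplus> h \<longleftrightarrow> f = g"
    using 1 assms by (simp add: pls_comm[of _ h])
qed

lemma pls_eq_self:
  assumes "ar f" "ar g" "src f = src g" "tgt f = tgt g" "g \<boxplus> f = g \<or> f \<boxplus> g = g"
  shows "f = zer C (src g) (tgt g)"
proof -
  have "g \<boxplus> f = g \<boxplus> zer C (src g) (tgt g)"
    using assms pls_comm[of f g] by auto
  then show ?thesis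
    using pls_lcancel[of f "zer C (src g) (tgt g)" g] assms by simp
qed

lemma distr_left [simp]:
  "\<lbrakk>ar f; ar g; ar h; tgt f = src g; src g = src h; tgt g = tgt h\<rbrakk>
    \<Longrightarrow> (g \<boxplus> h) \<bullet> f = (g \<bullet> f) \<boxplus> (h \<bullet> f)"
  by (rule pls_left[of "src f" "src g" "tgt g"]) auto

lemma distr_right [simp]:
  "\<lbrakk>ar f; ar g; ar h; tgt f = src h; src f = src g; tgt f = tgt g\<rbrakk>
    \<Longrightarrow> h \<bullet> (f \<boxplus> g) = (h \<bullet> f) \<boxplus> (h \<bullet> g)"
  by (rule pls_right[of "src f" "tgt f" "tgt h"]) auto

lemma cmp_zer_right [simp]:
  assumes "ar g" "X \<in> Obj C" "Y = src g"
  shows "g \<bullet> zer C X Y = zer C X (tgt g)"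
proof -
  have "(g \<bullet> zer C X Y) \<boxplus> (g \<bullet> zer C X Y) = g \<bullet> (zer C X Y \<boxplus> zer C X Y)"
    using assms by (subst distr_right) auto
  also have "\<dots> = g \<bullet> zer C X Y" using assms by (subst pls_zer) auto
  finally show ?thesis using pls_eq_self[of "g \<bullet> zer C X Y" "g \<bullet> zer C X Y"] assms by auto
qed

lemma cmp_zer_left [simp]:
  assumes "ar f" "Y \<in> Obj C" "X = tgt f"
  shows "zer C X Y \<bullet> f = zer C (src f) Y"
proof -
  have "(zer C X Y \<bullet> f) \<boxplus> (zer C X Y \<bullet> f) = (zer C X Y \<boxplus> zer C X Y) \<bullet> f"
    using assms by (subst distr_left) auto
  also have "\<dots> = zer C X Y \<bullet> f" using assms by (subst pls_zer) auto
  finally show ?thesis using pls_eq_self[of "zer C X Y \<bullet> f" "zer C X Y \<bullet> f"] assms by auto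
qed

lemma mn_unique:
  assumes "ar f" "ar g" "src f = src g" "tgt f = tgt g" "f \<boxplus> g = zer C (src g) (tgt g)"
  shows "mn f = g"
  using pls_mn_cancel(2)[of f g] assms by auto

lemma mn_cmp_left [simp]:
  assumes "ar f" "ar g" "tgt f = src g"
  shows "mn g \<bullet> f = mn (g \<bullet> f)"
proof (rule mn_unique[symmetric])
  have "(g \<bullet> f) \<boxplus> (mn g \<bullet> f) = (g \<boxplus> mn g) \<bullet> f"
    using assms by (subst distr_left) auto
  then show "(g \<bullet> f) \<boxplus> (mn g \<bullet> f) = zer C (src (mn g \<bullet> f)) (tgt (mn g \<bullet> f))"
    using assms by simp
qed (use assms in auto)

lemma mn_cmp_right [simp]:
  assumes "ar f" "ar g" "tgt f = src g"
  shows "g \<bullet> mn f = mn (g \<bullet> f)"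
proof (rule mn_unique[symmetric])
  have "(g \<bullet> f) \<boxplus> (g \<bullet> mn f) = g \<bullet> (f \<boxplus> mn f)"
    using assms by (subst distr_right) auto
  then show "(g \<bullet> f) \<boxplus> (g \<bullet> mn f) = zer C (src (g \<bullet> mn f)) (tgt (g \<bullet> mn f))"
    using assms by simp
qed (use assms in auto)

lemma mn_mn [simp]: "ar f \<Longrightarrow> mn (mn f) = f"
  by (rule mn_unique) auto

lemma mn_zer [simp]: "\<lbrakk>X \<in> Obj C; Y \<in> Obj C\<rbrakk> \<Longrightarrow> mn (zer C X Y) = zer C X Y"
  by (rule mn_unique) auto

lemma diff_eq_zer:
  assumes "ar f" "ar g" "src f = src g" "tgt f = tgt g" "f \<boxplus> mn g = zer C (src g) (tgt g)"
  shows "f = g"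
  using mn_unique[of f "mn g"] assms mn_mn by (metis mn_arr)

text \<open>Locality of the endomorphism ring in the form in which it is applied: whenever the
  identity is a sum, one summand is invertible. For a nonzero ring this is equivalent to the
  nonunits being closed under addition.\<close>

definition loc :: "'o \<Rightarrow> bool" where
  "loc X \<longleftrightarrow> X \<in> Obj C \<and> ident C X \<noteq> zer C X X \<and>
     (\<forall>u v. u \<in> Hom C X X \<and> v \<in> Hom C X X \<and> u \<boxplus> v = ident C X \<longrightarrow> is_iso C X X u \<or> is_iso C X X v)"

lemma locD:
  "\<lbrakk>loc X; ar u; src u = X; tgt u = X; ar v; src v = X; tgt v = X; u \<boxplus> v = ident C X\<rbrakk>
    \<Longrightarrow> is_iso C X X u \<or> is_iso C X X v"
  unfolding loc_def by simp

lemma is_isoI: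
  "\<lbrakk>f \<in> Hom C X Y; g \<in> Hom C Y X; g \<bullet> f = ident C X; f \<bullet> g = ident C Y\<rbrakk> \<Longrightarrow> is_iso C X Y f"
  unfolding is_iso_def by auto

lemma is_isoE:
  assumes "is_iso C X Y f" "X \<in> Obj C" "Y \<in> Obj C"
  obtains g where "ar f" "src f = X" "tgt f = Y" "ar g" "src g = Y" "tgt g = X"
    "g \<bullet> f = ident C X" "f \<bullet> g = ident C Y" "is_iso C Y X g"
  using assms unfolding is_iso_def by (metis hom_iff)

lemma is_iso_cmp:
  assumes "is_iso C X Y f" "is_iso C Y Z g" "X \<in> Obj C" "Y \<in> Obj C" "Z \<in> Obj C"
  shows "is_iso C X Z (g \<bullet> f)"
proof -
  obtain f' where f: "ar f" "src f = X" "tgt f = Y" "ar f'" "src f' = Y" "tgt f' = X"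
    "f' \<bullet> f = ident C X" "f \<bullet> f' = ident C Y" using is_isoE[OF assms(1,3,4)] by metis
  obtain g' where g: "ar g" "src g = Y" "tgt g = Z" "ar g'" "src g' = Z" "tgt g' = Y"
    "g' \<bullet> g = ident C Y" "g \<bullet> g' = ident C Z" using is_isoE[OF assms(2,4,5)] by metis
  have "g' \<bullet> (g \<bullet> f) = f" "f \<bullet> (f' \<bullet> g') = g'"
    using assoc[of f g g'] assoc[of g' f' f] f g by simp_all
  then show ?thesis
    using f g assms by (intro is_isoI[where g="f' \<bullet> g'"]) auto
qed

lemma isomorphic_sym:
  "\<lbrakk>isomorphic C X Y; X \<in> Obj C; Y \<in> Obj C\<rbrakk> \<Longrightarrow> isomorphic C Y X"
  unfolding isomorphic_def by (metis is_isoE)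

lemma End_ring_simps [simp]:
  "carrier (End_ring C X) = Hom C X X" "mult (End_ring C X) = cmp C" "one (End_ring C X) = ident C X"
  "zero (End_ring C X) = zer C X X" "add (End_ring C X) = pls C"
  by (simp_all add: End_ring_def)

lemma ring_End:
  assumes "X \<in> Obj C"
  shows "ring (End_ring C X)"
proof (rule ringI)
  show "abelian_group (End_ring C X)"
  proof (rule abelian_groupI)
    show "\<exists>y\<in>carrier (End_ring C X). y \<oplus>\<^bsub>End_ring C X\<^esub> x = \<zero>\<^bsub>End_ring C X\<^esub>"
      if "x \<in> carrier (End_ring C X)" for x
      using that assms by (intro bexI[of _ "mn x"]) auto
  qed (use assms in \<open>auto simp: pls_ac\<close>)
  show "monoid (End_ring C X)"
    using assms by (intro monoidI) auto
qed (use assms in auto)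

lemma Units_End:
  assumes "X \<in> Obj C"
  shows "u \<in> Units (End_ring C X) \<longleftrightarrow> is_iso C X X u"
  unfolding Units_def is_iso_def by auto

lemma local_ring_loc:
  assumes "X \<in> Obj C" "local_ring (End_ring C X)"
  shows "loc X"
proof -
  have "ident C X \<in> Units (End_ring C X)"
    using assms Units_End[of X "ident C X"] is_isoI[of "ident C X" X X "ident C X"] by simp
  then show ?thesis
    using assms unfolding loc_def local_ring_def Ball_def Diff_iff Units_End[OF assms(1)]
    by (metis End_ring_simps hom_iff)
qed

text \<open>In a division ring a non-invertible \<open>u\<close> is zero, so
  \<open>u \<boxplus> v = ident C X\<close> leaves \<open>v\<close> equal to the identity.\<close>

lemma brick_loc:
  assumes "brick C X"
  shows "loc X"
proof -
  have X: "X \<in> Obj C" and U: "Units (End_ring C X) = Hom C X X - {zer C X X}"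
    using assms unfolding brick_def division_ring_def by auto
  have id: "is_iso C X X (ident C X)" using X is_isoI[of "ident C X" X X "ident C X"] by simp
  have "is_iso C X X v" if "ar u" "src u = X" "tgt u = X" "ar v" "src v = X" "tgt v = X"
    "u \<boxplus> v = ident C X" "\<not> is_iso C X X u" for u v
  proof -
    have "u = zer C X X" using that U X by (auto simp flip: Units_End)
    then show ?thesis using that id by simp
  qed
  moreover have "ident C X \<noteq> zer C X X"
    using id U X by (auto simp flip: Units_End)
  ultimately show ?thesis using X unfolding loc_def by auto
qed

lemma loc_iso:
  assumes "loc X" "isomorphic C X Y" "Y \<in> Obj C"
  shows "loc Y"
proof -
  have X: "X \<in> Obj C" using assms(1) by (simp add: loc_def)
  obtain f where f: "is_iso C X Y f" using assms(2) by (auto simp: isomorphic_def)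
  obtain g where fg: "ar f" "src f = X" "tgt f = Y" "ar g" "src g = Y" "tgt g = X"
    "g \<bullet> f = ident C X" "f \<bullet> g = ident C Y" and g: "is_iso C Y X g"
    using is_isoE[OF f X assms(3)] by metis
  have "ident C Y \<noteq> zer C Y Y"
  proof
    assume *: "ident C Y = zer C Y Y"
    have "g \<bullet> (ident C Y \<bullet> f) = zer C X X" unfolding * using fg X assms by simp
    then show False using fg X assms by (simp add: loc_def)
  qed
  moreover have "is_iso C Y Y u \<or> is_iso C Y Y v" if uv: "ar u" "src u = Y" "tgt u = Y" "ar v" "src v = Y"
    "tgt v = Y" "u \<boxplus> v = ident C Y" for u v
  proof -
    have conj_iso: "is_iso C Y Y w" if "is_iso C X X (g \<bullet> (w \<bullet> f))" "ar w" "src w = Y" "tgt w = Y" for w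
    proof -
      have "is_iso C Y Y (f \<bullet> ((g \<bullet> (w \<bullet> f)) \<bullet> g))"
        using is_iso_cmp[OF is_iso_cmp[OF g that(1)] f] X assms by simp
      moreover have "f \<bullet> ((g \<bullet> (w \<bullet> f)) \<bullet> g) = (f \<bullet> g) \<bullet> (w \<bullet> (f \<bullet> g))"
        using fg(1-6) that(2-4) by simp
      ultimately show ?thesis using fg that by simp
    qed
    have "(g \<bullet> (u \<bullet> f)) \<boxplus> (g \<bullet> (v \<bullet> f)) = g \<bullet> ((u \<boxplus> v) \<bullet> f)"
      using fg uv(1-6) by simp
    also have "\<dots> = ident C X" using uv fg by simp
    finally have "is_iso C X X (g \<bullet> (u \<bullet> f)) \<or> is_iso C X X (g \<bullet> (v \<bullet> f))"
      using fg uv by (intro locD[OF assms(1)]) auto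
    then show ?thesis using conj_iso uv by blast
  qed
  ultimately show ?thesis using assms(3) unfolding loc_def by auto
qed

text \<open>The index \<open>n\<close> counts the summands; it is the measure of the induction in
  \<open>idempotent_splits\<close>. The statement \<open>thr S X X n (ident C X)\<close> replaces
  membership of X in \<open>add S\<close>: it needs neither a chosen direct sum of members of S nor
  the existence of biproducts.\<close>

inductive thr :: "'o set \<Rightarrow> 'o \<Rightarrow> 'o \<Rightarrow> nat \<Rightarrow> 'm \<Rightarrow> bool" for S X Y where
  thr_zer: "thr S X Y 0 (zer C X Y)"
| thr_pls: "\<lbrakk>thr S X Y n s; Z \<in> S; a \<in> Hom C X Z; b \<in> Hom C Z Y\<rbrakk> \<Longrightarrow> thr S X Y (Suc n) (s \<boxplus> (b \<bullet> a))"

lemma thr_arr: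
  assumes "thr S X Y n s" "S \<subseteq> Obj C" "X \<in> Obj C" "Y \<in> Obj C"
  shows "ar s" "src s = X" "tgt s = Y"
proof -
  have "ar s \<and> src s = X \<and> tgt s = Y"
    using assms(1)
  proof induction
    case (thr_pls n s Z a b)
    then have "Z \<in> Obj C" using assms(2) by auto
    then show ?case using thr_pls assms by auto
  qed (use assms in auto)
  then show "ar s" "src s = X" "tgt s = Y" by auto
qed

lemma thr_cmp:
  assumes "thr S X Y n s" "S \<subseteq> Obj C" "X \<in> Obj C" "Y \<in> Obj C" "X' \<in> Obj C" "Y' \<in> Obj C"
    "f \<in> Hom C X' X" "g \<in> Hom C Y Y'"
  shows "thr S X' Y' n (g \<bullet> (s \<bullet> f))"
  using assms(1)
proof induction
  case thr_zer
  then show ?case using assms thr.thr_zer by simp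
next
  case (thr_pls n s Z a b)
  have Z: "Z \<in> Obj C" using assms thr_pls by auto
  note s = thr_arr[OF thr_pls(1) assms(2-4)]
  have "thr S X' Y' (Suc n) ((g \<bullet> (s \<bullet> f)) \<boxplus> ((g \<bullet> b) \<bullet> (a \<bullet> f)))"
    using thr_pls assms Z by (intro thr.thr_pls) auto
  moreover have "(g \<bullet> (s \<bullet> f)) \<boxplus> ((g \<bullet> b) \<bullet> (a \<bullet> f)) = g \<bullet> ((s \<boxplus> (b \<bullet> a)) \<bullet> f)"
    using thr_pls assms Z s by simp
  ultimately show ?case by simp
qed

lemma thr_add:
  assumes "thr S X Y n s" "thr S X Y m r" "S \<subseteq> Obj C" "X \<in> Obj C" "Y \<in> Obj C"
  shows "\<exists>k. thr S X Y k (s \<boxplus> r)"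
  using assms(2)
proof induction
  case thr_zer
  have "s \<boxplus> zer C X Y = s" using thr_arr[OF assms(1,3-5)] by simp
  then show ?case using assms(1) by metis
next
  case (thr_pls m r Z a b)
  then obtain k where "thr S X Y k (s \<boxplus> r)" by auto
  then have "thr S X Y (Suc k) ((s \<boxplus> r) \<boxplus> (b \<bullet> a))"
    using thr_pls by (intro thr.thr_pls)
  moreover have "(s \<boxplus> r) \<boxplus> (b \<bullet> a) = s \<boxplus> (r \<boxplus> (b \<bullet> a))"
    using thr_arr[OF assms(1,3-5)] thr_arr[OF thr_pls(1) assms(3-5)] thr_pls assms
    by (subst pls_assoc) auto
  ultimately show ?case by metis
qed

lemma thr_one:
  assumes "Z \<in> S" "a \<in> Hom C X Z" "b \<in> Hom C Z Y" "S \<subseteq> Obj C" "X \<in> Obj C" "Y \<in> Obj C"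
  shows "thr S X Y 1 (b \<bullet> a)"
proof -
  have Z: "Z \<in> Obj C" using assms by auto
  have "zer C X Y \<boxplus> (b \<bullet> a) = b \<bullet> a" using assms Z by simp
  then show ?thesis using thr_pls[OF thr_zer assms(1-3)] by simp
qed

lemma direct_sum_thr:
  assumes "direct_sum C I Y M \<iota> \<pi>" "\<forall>i \<in> I. Y i \<in> S" "S \<subseteq> Obj C"
  shows "\<exists>n. thr S M M n (ident C M)"
proof -
  have M: "M \<in> Obj C" and I: "finite I"
    and id: "finprod (hom_group C M M) (\<lambda>i. \<iota> i \<bullet> \<pi> i) I = ident C M"
    using assms unfolding direct_sum_def by auto
  interpret comm_group "hom_group C M M" using M by (intro hom_grp)
  have hom: "\<iota> i \<bullet> \<pi> i \<in> carrier (hom_group C M M)" if "i \<in> I" for i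
    using that assms M unfolding direct_sum_def by (auto simp: subset_eq)
  \<comment> \<open>Partial sums over a subset J are not identities, so the induction runs over the
    \<open>finprod\<close> of the idempotents instead of over direct sums.\<close>
  have "\<exists>n. thr S M M n (finprod (hom_group C M M) (\<lambda>i. \<iota> i \<bullet> \<pi> i) J)" if "J \<subseteq> I" for J
    using finite_subset[OF that I] that
  proof (induction J rule: finite_induct)
    case empty
    then show ?case using thr_zer by auto
  next
    case (insert i J)
    let ?s = "finprod (hom_group C M M) (\<lambda>i. \<iota> i \<bullet> \<pi> i) J"
    have i: "i \<in> I" using insert by auto
    have J: "(\<lambda>i. \<iota> i \<bullet> \<pi> i) \<in> J \<rightarrow> carrier (hom_group C M M)" using hom insert by blast
    obtain n where n: "thr S M M n ?s" using insert by auto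
    have "finprod (hom_group C M M) (\<lambda>i. \<iota> i \<bullet> \<pi> i) (insert i J) = ?s \<boxplus> (\<iota> i \<bullet> \<pi> i)"
      using finprod_insert[OF insert(1,2) J hom[OF i]] m_comm[OF hom[OF i] finprod_closed[OF J]] by simp
    moreover have "thr S M M (Suc n) (?s \<boxplus> (\<iota> i \<bullet> \<pi> i))"
      using n i assms by (intro thr_pls[where Z="Y i"]) (auto simp: direct_sum_def)
    ultimately show ?case by metis
  qed
  then show ?thesis using id by (metis order_refl)
qed

section \<open>Biproducts, zero objects and additive closures\<close>

lemma biproductD:
  assumes "biproduct C X Y Z i1 i2 p1 p2"
  shows "X \<in> Obj C" "Y \<in> Obj C" "Z \<in> Obj C" "ar i1" "src i1 = X" "tgt i1 = Z"
    "ar i2" "src i2 = Y" "tgt i2 = Z" "ar p1" "src p1 = Z" "tgt p1 = X" "ar p2" "src p2 = Z" "tgt p2 = Y"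
    "p1 \<bullet> i1 = ident C X" "p2 \<bullet> i2 = ident C Y" "p1 \<bullet> i2 = zer C Y X" "p2 \<bullet> i1 = zer C X Y"
    "(i1 \<bullet> p1) \<boxplus> (i2 \<bullet> p2) = ident C Z"
  using assms unfolding biproduct_def by auto

text \<open>Composites are normalized with brackets to the right, so an equation
  \<open>p \<bullet> i = r\<close> does not match inside \<open>p \<bullet> (i \<bullet> f)\<close>;
  this is its usable form.\<close>

lemma pre_simp:
  assumes "p \<bullet> i = r" "ar p" "ar i" "ar f" "tgt f = src i" "tgt i = src p"
  shows "p \<bullet> (i \<bullet> f) = r \<bullet> f"
  using assms(1) assoc[of f i p] assms by simp

lemma biproduct_pre:
  assumes "biproduct C X Y Z i1 i2 p1 p2" "ar f"
  shows "tgt f = X \<Longrightarrow> p1 \<bullet> (i1 \<bullet> f) = f" "tgt f = Y \<Longrightarrow> p2 \<bullet> (i2 \<bullet> f) = f"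
    "tgt f = Y \<Longrightarrow> p1 \<bullet> (i2 \<bullet> f) = zer C (src f) X" "tgt f = X \<Longrightarrow> p2 \<bullet> (i1 \<bullet> f) = zer C (src f) Y"
    "tgt f = Z \<Longrightarrow> (i1 \<bullet> (p1 \<bullet> f)) \<boxplus> (i2 \<bullet> (p2 \<bullet> f)) = f"
proof -
  note b = biproductD[OF assms(1)]
  show "tgt f = X \<Longrightarrow> p1 \<bullet> (i1 \<bullet> f) = f" using pre_simp[OF b(16)] b assms by simp
  show "tgt f = Y \<Longrightarrow> p2 \<bullet> (i2 \<bullet> f) = f" using pre_simp[OF b(17)] b assms by simp
  show "tgt f = Y \<Longrightarrow> p1 \<bullet> (i2 \<bullet> f) = zer C (src f) X" using pre_simp[OF b(18)] b assms by simp
  show "tgt f = X \<Longrightarrow> p2 \<bullet> (i1 \<bullet> f) = zer C (src f) Y" using pre_simp[OF b(19)] b assms by simp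
  assume t: "tgt f = Z"
  have "((i1 \<bullet> p1) \<boxplus> (i2 \<bullet> p2)) \<bullet> f = (i1 \<bullet> (p1 \<bullet> f)) \<boxplus> (i2 \<bullet> (p2 \<bullet> f))"
    using b(1-15) assms(2) t by (subst distr_left) auto
  then show "(i1 \<bullet> (p1 \<bullet> f)) \<boxplus> (i2 \<bullet> (p2 \<bullet> f)) = f" using b(20) assms t by simp
qed

lemma biproduct_swap:
  assumes "biproduct C X Y Z i1 i2 p1 p2"
  shows "biproduct C Y X Z i2 i1 p2 p1"
  using biproductD[OF assms] unfolding biproduct_def by (auto simp: pls_comm)

lemma zero_objD:
  assumes "is_zero_obj C Z" "X \<in> Obj C"
  shows "Z \<in> Obj C" "f \<in> Hom C X Z \<Longrightarrow> f = zer C X Z" "f \<in> Hom C Z X \<Longrightarrow> f = zer C Z X"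
proof -
  show Z: "Z \<in> Obj C" using assms by (simp add: is_zero_obj_def)
  have id: "ident C Z = zer C Z Z" using assms by (simp add: is_zero_obj_def)
  show "f = zer C X Z" if "f \<in> Hom C X Z"
  proof -
    have "f = ident C Z \<bullet> f" using that Z assms by simp
    then show ?thesis unfolding id using that Z assms by simp
  qed
  show "f = zer C Z X" if "f \<in> Hom C Z X"
  proof -
    have "f = f \<bullet> ident C Z" using that Z assms by simp
    then show ?thesis unfolding id using that Z assms by simp
  qed
qed

lemma biproduct_zero_right:
  assumes "is_zero_obj C O'" "X \<in> Obj C"
  shows "biproduct C X O' X (ident C X) (zer C O' X) (ident C X) (zer C X O')"
  using assms zero_objD(1)[OF assms] unfolding biproduct_def is_zero_obj_def by simp

lemma biproduct_zero_iso:
  assumes "biproduct C X Y Z i1 i2 p1 p2" "is_zero_obj C Y"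
  shows "is_iso C X Z i1" "is_iso C Z X p1"
proof -
  note b = biproductD[OF assms(1)]
  have "p2 = zer C Z Y" using zero_objD(2)[OF assms(2) b(3)] b by simp
  then have "i1 \<bullet> p1 = ident C Z" using b by simp
  then show "is_iso C X Z i1" "is_iso C Z X p1" using b by (auto intro!: is_isoI)
qed

lemma zero_obj_iso:
  assumes "is_zero_obj C Z" "isomorphic C Z Y" "Y \<in> Obj C"
  shows "is_zero_obj C Y"
proof -
  have Z: "Z \<in> Obj C" using assms(1) by (simp add: is_zero_obj_def)
  obtain f where "is_iso C Z Y f" using assms by (auto simp: isomorphic_def)
  then obtain g where fg: "ar f" "src f = Z" "tgt f = Y" "ar g" "src g = Y" "tgt g = Z" "f \<bullet> g = ident C Y"
    using is_isoE[OF _ Z assms(3)] by metis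
  have "f = zer C Z Y" using zero_objD(3)[OF assms(1,3)] fg assms Z by simp
  then have "ident C Y = zer C Y Y" using fg assms by simp
  then show ?thesis using assms by (simp add: is_zero_obj_def)
qed

lemma zero_obj_addc:
  assumes "is_zero_obj C Z"
  shows "Z \<in> addc C S"
proof -
  have Z: "Z \<in> Obj C" "ident C Z = zer C Z Z" using assms by (auto simp: is_zero_obj_def)
  interpret comm_group "hom_group C Z Z" using Z by (intro hom_grp)
  \<comment> \<open>A zero object is the empty direct sum: the empty \<open>finprod\<close> is the
    zero endomorphism, which here is the identity.\<close>
  have "direct_sum C {..<0} (\<lambda>_. Z) Z (\<lambda>_. ident C Z) (\<lambda>_. ident C Z)"
    using Z unfolding direct_sum_def by simp
  then show ?thesis
    using biproduct_zero_right[OF assms Z(1)] Z(1) unfolding addc_def by blast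
qed

text \<open>The object is a one-term direct sum whose complement is a zero object. The zero object
  is passed in, because the preadditive axioms do not provide one.\<close>

lemma member_addc:
  assumes "is_zero_obj C Z" "X \<in> S" "X \<in> Obj C"
  shows "X \<in> addc C S"
proof -
  interpret comm_group "hom_group C X X" using assms by (intro hom_grp)
  have "finprod (hom_group C X X) (\<lambda>i. ident C X \<bullet> ident C X) {..<Suc 0} = ident C X"
    using assms by (simp add: lessThan_Suc)
  then have "direct_sum C {..<Suc 0} (\<lambda>_. X) X (\<lambda>_. ident C X) (\<lambda>_. ident C X)"
    using assms unfolding direct_sum_def by simp
  then show ?thesis
    unfolding addc_def mem_Collect_eq
    using biproduct_zero_right[OF assms(1,3)] assms(2,3)
    by (intro conjI exI[of _ "Suc 0"] exI[of _ "\<lambda>_. X"] exI[of _ X] exI[of _ "\<lambda>_. ident C X"] exI[of _ Z]) auto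
qed

lemma addc_thr:
  assumes "X \<in> addc C S" "S \<subseteq> Obj C"
  shows "X \<in> Obj C" "\<exists>n. thr S X X n (ident C X)"
proof -
  obtain n Y M \<iota> \<pi> W i1 i2 p1 p2 where "\<forall>i<n. Y i \<in> S" and ds: "direct_sum C {..<n} Y M \<iota> \<pi>"
    and b: "biproduct C X W M i1 i2 p1 p2"
    using assms unfolding addc_def by auto
  then obtain k where k: "thr S M M k (ident C M)" using direct_sum_thr[OF ds _ assms(2)] by auto
  note b' = biproductD[OF b]
  show "X \<in> Obj C" by fact
  have "thr S X X k (p1 \<bullet> (ident C M \<bullet> i1))"
    using b' assms by (intro thr_cmp[OF k]) auto
  then show "\<exists>n. thr S X X n (ident C X)" using b' by auto
qed

inductive_set sums :: "'o set \<Rightarrow> 'o set" for S where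
  sums_zero: "is_zero_obj C Z \<Longrightarrow> Z \<in> sums S"
| sums_add: "\<lbrakk>Y \<in> S; Z \<in> sums S; biproduct C Y Z V i1 i2 p1 p2\<rbrakk> \<Longrightarrow> V \<in> sums S"

lemma sums_obj: "X \<in> sums S \<Longrightarrow> X \<in> Obj C"
  by (induction rule: sums.induct) (auto simp: is_zero_obj_def biproduct_def)

lemma biproduct_iso:
  assumes "biproduct C X Y Z i1 i2 p1 p2" "is_iso C Z Z' f" "Z' \<in> Obj C"
  obtains j1 j2 q1 q2 where "biproduct C X Y Z' j1 j2 q1 q2"
proof -
  note b = biproductD[OF assms(1)]
  obtain g where fg: "ar f" "src f = Z" "tgt f = Z'" "ar g" "src g = Z'" "tgt g = Z"
    "g \<bullet> f = ident C Z" "f \<bullet> g = ident C Z'" using is_isoE[OF assms(2) b(3) assms(3)] by metis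
  have s: "g \<bullet> (f \<bullet> h) = h" if "ar h" "tgt h = Z" for h
    using pre_simp[OF fg(7)] fg that by simp
  have "(f \<bullet> (i1 \<bullet> (p1 \<bullet> g))) \<boxplus> (f \<bullet> (i2 \<bullet> (p2 \<bullet> g))) = f \<bullet> ((i1 \<bullet> (p1 \<bullet> g)) \<boxplus> (i2 \<bullet> (p2 \<bullet> g)))"
    using b(1-15) fg(1-6) by simp
  also have "\<dots> = ident C Z'" using biproduct_pre(5)[OF assms(1), of g] fg by simp
  finally have "biproduct C X Y Z' (f \<bullet> i1) (f \<bullet> i2) (p1 \<bullet> g) (p2 \<bullet> g)"
    using b fg s assms(3) unfolding biproduct_def by simp
  then show thesis by (rule that)
qed

lemma sums_iso:
  assumes "X \<in> sums S" "isomorphic C X Y" "Y \<in> Obj C"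
  shows "Y \<in> sums S"
  using assms(1)
proof cases
  case sums_zero
  then show ?thesis using zero_obj_iso assms sums.sums_zero by blast
next
  case (sums_add Y' Z i1 i2 p1 p2)
  then show ?thesis
    using assms biproduct_iso sums.sums_add unfolding isomorphic_def by metis
qed

definition splits :: "'o set \<Rightarrow> 'm \<Rightarrow> bool" where
  "splits S e \<longleftrightarrow> (\<exists>Z \<in> sums S. \<exists>i p. ar i \<and> src i = Z \<and> tgt i = src e \<and> ar p \<and> src p = src e \<and> tgt p = Z \<and>
     p \<bullet> i = ident C Z \<and> i \<bullet> p = e)"

text \<open>The idempotent \<open>i1 \<bullet> p1\<close> of a decomposition is the identity or
  zero; in the first case the complement is a zero object, in the second the summand itself.\<close>

lemma trivial_idempotents_indecomposable:
  assumes "X \<in> Obj C" "ident C X \<noteq> zer C X X"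
    "\<And>e. \<lbrakk>e \<in> Hom C X X; e \<bullet> e = e\<rbrakk> \<Longrightarrow> e = ident C X \<or> e = zer C X X"
  shows "indecomposable C X"
proof -
  have "is_zero_obj C Y \<or> is_zero_obj C Z" if bi: "biproduct C Y Z X i1 i2 p1 p2" for Y Z i1 i2 p1 p2
  proof -
    note b = biproductD[OF bi]
    have "i1 \<bullet> p1 = ident C X \<or> i1 \<bullet> p1 = zer C X X"
      using b biproduct_pre[OF bi] by (intro assms(3)) auto
    then show ?thesis
    proof
      assume *: "i1 \<bullet> p1 = zer C X X"
      have "p1 \<bullet> ((i1 \<bullet> p1) \<bullet> i1) = ident C Y" using b by simp
      then have "ident C Y = zer C Y Y" unfolding * using b by simp
      then show ?thesis using b by (simp add: is_zero_obj_def)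
    next
      assume *: "i1 \<bullet> p1 = ident C X"
      have "p2 \<bullet> ((i1 \<bullet> p1) \<bullet> i2) = zer C Z Z" using b by simp
      then have "ident C Z = zer C Z Z" unfolding * using b by simp
      then show ?thesis using b by (simp add: is_zero_obj_def)
    qed
  qed
  then show ?thesis using assms unfolding indecomposable_def is_zero_obj_def by blast
qed

text \<open>One of e and 1 - e is invertible, since their sum is the identity. An invertible
  idempotent is the identity, and if 1 - e is invertible, then (1 - e) e = 0 gives e = 0.\<close>

lemma loc_idempotent:
  assumes "loc X" "e \<in> Hom C X X" "e \<bullet> e = e"
  shows "e = ident C X \<or> e = zer C X X"
proof -
  have X: "X \<in> Obj C" using assms by (simp add: loc_def)
  let ?d = "ident C X \<boxplus> mn e"
  have e: "ar e" "src e = X" "tgt e = X" using assms X by auto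
  have "e \<boxplus> ?d = ident C X" using e X pls_lcomm[of e "ident C X" "mn e"] by simp
  then consider "is_iso C X X e" | "is_iso C X X ?d"
    using assms(1) e X unfolding loc_def by (metis hom_iff ident_arr mn_arr pls_arr)
  then show ?thesis
  proof cases
    case 1
    obtain g where g: "ar g" "src g = X" "tgt g = X" "g \<bullet> e = ident C X" using is_isoE[OF 1 X X] by metis
    have "g \<bullet> (e \<bullet> e) = e" using pre_simp[OF g(4), of e] g e X by simp
    then show ?thesis using assms(3) g by simp
  next
    case 2
    obtain g where g: "ar g" "src g = X" "tgt g = X" "g \<bullet> ?d = ident C X" using is_isoE[OF 2 X X] by metis
    have "?d \<bullet> e = zer C X X" using e X assms(3) by simp
    then have "(g \<bullet> ?d) \<bullet> e = zer C X X" using g(1-3) e X by (subst assoc) auto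
    then show ?thesis using g e X by simp
  qed
qed

end

sublocale additive_category \<subseteq> preadditive
  by (intro preadditive.intro preadditive_axioms.intro category_axioms)
    (auto intro: hom_comm_group cmp_pls_left cmp_pls_right)

section \<open>Splitting idempotents and Krull-Schmidt decompositions\<close>

context additive_category
begin

text \<open>The induction drops the last summand \<open>b \<bullet> a\<close> of \<open>e = s + b \<bullet> a\<close>: if \<open>a \<bullet> b\<close> is invertible,
  then its source splits off \<open>e\<close>; otherwise \<open>1 - a \<bullet> b\<close> is invertible, and then so is \<open>s = e - b \<bullet> a\<close>
  in \<open>e End(M) e\<close>, so that \<open>e = s \<bullet> s\<inverse>\<close> is a sum of fewer morphisms.\<close>

lemma idempotent_splits:
  assumes "thr S M M n e" "e \<bullet> e = e" "\<And>Y. Y \<in> S \<Longrightarrow> loc Y" "M \<in> Obj C"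
  shows "splits S e"
  using assms(1,2)
proof (induction n arbitrary: e)
  case 0
  obtain Z where Z: "is_zero_obj C Z" using zero_obj_exists by blast
  then have Z': "Z \<in> Obj C" "ident C Z = zer C Z Z" by (auto simp: is_zero_obj_def)
  from 0 have e: "e = zer C M M" using thr.cases by blast
  show ?case
    unfolding splits_def
    using Z Z' assms(4) by (intro bexI[of _ Z] exI[of _ "zer C Z M"] exI[of _ "zer C M Z"])
      (auto simp: e intro: sums_zero)
next
  case (Suc n)
  have S: "S \<subseteq> Obj C" using assms(3) by (auto simp: loc_def)
  have M: "M \<in> Obj C" by fact
  obtain s0 Y a0 b0 where t0: "thr S M M n s0" "Y \<in> S" "a0 \<in> Hom C M Y" "b0 \<in> Hom C Y M"
    and e0: "e = s0 \<boxplus> (b0 \<bullet> a0)" using Suc.prems(1) by cases auto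
  have Y: "Y \<in> Obj C" and lY: "loc Y" using t0 S assms(3) by auto
  have e: "ar e" "src e = M" "tgt e = M" using thr_arr[OF Suc.prems(1) S M M] by auto
  have ab0: "ar a0" "src a0 = M" "tgt a0 = Y" "ar b0" "src b0 = Y" "tgt b0 = M" using t0 Y M by auto
  have s0: "ar s0" "src s0 = M" "tgt s0 = M" using thr_arr[OF t0(1) S M M] by auto
  \<comment> \<open>Multiplying by \<open>e\<close> keeps the number of summands and moves the
    equation e = s + b a into e End(M) e, where \<open>a \<bullet> e = a\<close> and
    \<open>e \<bullet> b = b\<close> hold.\<close>
  define s a b where "s = e \<bullet> (s0 \<bullet> e)" and "a = a0 \<bullet> e" and "b = e \<bullet> b0"
  have s: "ar s" "src s = M" "tgt s = M" "thr S M M n s"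
    using s0 e thr_cmp[OF t0(1) S M M M M, of e e] M unfolding s_def by auto
  have ab: "ar a" "src a = M" "tgt a = Y" "ar b" "src b = Y" "tgt b = M"
    using ab0 e unfolding a_def b_def by auto
  have ee: "e \<bullet> e = e" by fact
  have ae: "a \<bullet> e = a" and eb: "e \<bullet> b = b" unfolding a_def b_def using ab0 e ee pre_simp[OF ee] by auto
  have "e = e \<bullet> (e \<bullet> e)" using ee by simp
  also have "\<dots> = e \<bullet> ((s0 \<boxplus> (b0 \<bullet> a0)) \<bullet> e)" using e0 by simp
  also have "\<dots> = s \<boxplus> (b \<bullet> a)" using s0 ab0 e unfolding s_def a_def b_def by simp
  finally have es: "e = s \<boxplus> (b \<bullet> a)" .
  define u where "u = a \<bullet> b"
  define v where "v = ident C Y \<boxplus> mn u"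
  have u: "ar u" "src u = Y" "tgt u = Y" using ab unfolding u_def by auto
  have v: "ar v" "src v = Y" "tgt v = Y" using u Y unfolding v_def by auto
  have "u \<boxplus> v = ident C Y" unfolding v_def using u Y pls_mn_cancel(1)[of u] pls_lcomm[of u "ident C Y" "mn u"] by simp
  then have uv: "v \<boxplus> u = ident C Y" using u v by (simp add: pls_comm)
  consider "is_iso C Y Y u" | "is_iso C Y Y v"
    using lY uv u v Y unfolding loc_def by auto
  then show ?case
  proof cases
    case 1
    obtain w where w: "ar w" "src w = Y" "tgt w = Y" "w \<bullet> u = ident C Y" "u \<bullet> w = ident C Y"
      using is_isoE[OF 1 Y Y] by metis
    have abw: "a \<bullet> (b \<bullet> (w \<bullet> h)) = h" if "ar h" "tgt h = Y" for h
    proof -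
      have "a \<bullet> (b \<bullet> (w \<bullet> h)) = (u \<bullet> w) \<bullet> h" using ab w(1-3) that unfolding u_def by simp
      then show ?thesis using w that by simp
    qed
    \<comment> \<open>\<open>e1\<close> is an idempotent below \<open>e\<close> with image Y, where
      \<open>w\<close> inverts \<open>a \<bullet> b\<close>. Its complement \<open>e2\<close>
      annihilates \<open>b\<close>, so the summand through Y disappears from e2 = e2 e e2 and the
      induction hypothesis applies to \<open>e2\<close>.\<close>
    define e1 e2 where "e1 = b \<bullet> (w \<bullet> a)" and "e2 = e \<boxplus> mn e1"
    have e1: "ar e1" "src e1 = M" "tgt e1 = M" using ab w unfolding e1_def by auto
    have e2: "ar e2" "src e2 = M" "tgt e2 = M" using e e1 unfolding e2_def by auto
    have e11: "e1 \<bullet> e1 = e1" unfolding e1_def using ab w abw[of a] by simp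
    have ee1: "e \<bullet> e1 = e1" unfolding e1_def using pre_simp[OF eb] ab w e by simp
    have e1e: "e1 \<bullet> e = e1" unfolding e1_def using ae ab w e by simp
    have e2e2: "e2 \<bullet> e2 = e2" and e2e: "e2 \<bullet> e = e2" and e2e1: "e2 \<bullet> e1 = zer C M M"
      unfolding e2_def using e e1 e11 ee1 e1e ee M by (simp_all add: pls_ac)
    have "w \<bullet> (a \<bullet> b) = ident C Y" using w u_def by simp
    then have e1b: "e1 \<bullet> b = b" unfolding e1_def using ab w by simp
    have e2b: "e2 \<bullet> b = zer C Y M" unfolding e2_def using e e1 ab eb e1b by simp
    have "e2 = e2 \<bullet> (e \<bullet> e2)" using e2e2 pre_simp[OF e2e, of e2] e e2 by simp
    also have "\<dots> = (e2 \<bullet> (s \<bullet> e2)) \<boxplus> ((e2 \<bullet> b) \<bullet> (a \<bullet> e2))"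
      unfolding es using s(1-3) ab e2 by simp
    also have "\<dots> = e2 \<bullet> (s \<bullet> e2)" unfolding e2b using s ab e2 M by simp
    finally have "thr S M M n e2"
      using thr_cmp[OF s(4) S M M M M, of e2 e2] e2 M by simp
    then have "splits S e2" using Suc.IH e2e2 by blast
    then obtain Z i p where Z: "Z \<in> sums S" and ip: "ar i" "src i = Z" "tgt i = M" "ar p" "src p = M" "tgt p = Z"
      "p \<bullet> i = ident C Z" "i \<bullet> p = e2" unfolding splits_def using e2 by auto
    have ZO: "Z \<in> Obj C" using sums_obj[OF Z] .
    obtain V j1 j2 q1 q2 where V: "biproduct C Y Z V j1 j2 q1 q2"
      using biproduct_exists[OF Y ZO] by blast
    note V' = biproductD[OF V]
    have VS: "V \<in> sums S" using sums_add[OF t0(2) Z V] .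
    have "a \<bullet> e1 = a" unfolding e1_def using abw[of a] ab by simp
    then have ae2: "a \<bullet> e2 = zer C M Y" unfolding e2_def using ab e e1 ae by simp
    have "a \<bullet> i = (a \<bullet> e2) \<bullet> i" using ip ab pre_simp[OF ip(7)] by (simp flip: ip(8))
    then have ai: "a \<bullet> i = zer C Z Y" unfolding ae2 using ip Y by simp
    have "p \<bullet> b = p \<bullet> (e2 \<bullet> b)" using ip ab pre_simp[OF ip(7)] by (simp flip: ip(8))
    then have pb: "p \<bullet> b = zer C Y Z" unfolding e2b using ip Y by simp
    \<comment> \<open>\<open>I\<close> and \<open>Q\<close> split \<open>e\<close> through Y
      \<oplus> Z. The factor \<open>w\<close> sits on one side only, so that the Y-component of
      \<open>Q \<bullet> I\<close> is a b w, the identity.\<close>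
    define I where "I = (b \<bullet> (w \<bullet> q1)) \<boxplus> (i \<bullet> q2)"
    define Q where "Q = (j1 \<bullet> a) \<boxplus> (j2 \<bullet> p)"
    have I: "ar I" "src I = V" "tgt I = M" using ab w V' ip unfolding I_def by auto
    have Q: "ar Q" "src Q = M" "tgt Q = V" using ab w V' ip unfolding Q_def by auto
    have "Q \<bullet> I = ident C V"
      unfolding Q_def I_def using ab w V' ip abw[of q1] pre_simp[OF ai, of q2] pre_simp[OF pb, of "w \<bullet> q1"]
        pre_simp[OF ip(7), of q2] ZO Y by simp
    moreover have "I \<bullet> Q = e"
    proof -
      have "I \<bullet> Q = e1 \<boxplus> e2"
        unfolding Q_def I_def using ab(1-6) w(1-3) V' ip biproduct_pre[OF V] ZO Y M
        by (simp add: e1_def flip: ip(8))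
      then show ?thesis unfolding e2_def using e e1 pls_lcomm[of e1 e "mn e1"] by simp
    qed
    ultimately show ?thesis unfolding splits_def using VS I Q e by blast
  next
    case 2
    obtain w where w: "ar w" "src w = Y" "tgt w = Y" "w \<bullet> v = ident C Y" "v \<bullet> w = ident C Y"
      using is_isoE[OF 2 Y Y] by metis
    \<comment> \<open>With \<open>w\<close> inverse to 1 - a b, the expression e + b w a is inverse
      to s = e - b a in e End(M) e; the verification rests on s b = b (1 - a b).\<close>
    define r where "r = e \<boxplus> (b \<bullet> (w \<bullet> a))"
    have r: "ar r" "src r = M" "tgt r = M" using e ab w unfolding r_def by auto
    have "(s \<bullet> e) \<boxplus> (b \<bullet> a) = (s \<boxplus> (b \<bullet> a)) \<bullet> e" using s e ab ae by simp
    also have "\<dots> = s \<boxplus> (b \<bullet> a)" using ee es by simp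
    finally have se: "s \<bullet> e = s" using pls_rcancel[of "s \<bullet> e" s "b \<bullet> a"] s e ab by simp
    have "(s \<bullet> b) \<boxplus> (b \<bullet> u) = (s \<boxplus> (b \<bullet> a)) \<bullet> b" unfolding u_def using s ab by simp
    also have "\<dots> = b \<bullet> (v \<boxplus> u)" using eb es uv ab by simp
    also have "\<dots> = (b \<bullet> v) \<boxplus> (b \<bullet> u)" using ab u v by simp
    finally have sb: "s \<bullet> b = b \<bullet> v" using pls_rcancel[of "s \<bullet> b" "b \<bullet> v" "b \<bullet> u"] s u v ab by simp
    have "s \<bullet> (b \<bullet> (w \<bullet> a)) = b \<bullet> ((v \<bullet> w) \<bullet> a)" using pre_simp[OF sb, of "w \<bullet> a"] s ab v w(1-3) by simp
    then have "s \<bullet> r = e" unfolding r_def using s e ab w se es by simp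
    moreover have "thr S M M n (s \<bullet> r)"
      using thr_cmp[OF s(4) S M M M M, of r "ident C M"] r s M by simp
    ultimately show ?thesis using Suc by simp
  qed
qed

text \<open>The image of the identity is X up to isomorphism, so splitting the identity through
  \<open>sums S\<close> decomposes X.\<close>

lemma ident_thr_sums:
  assumes "thr S X X n (ident C X)" "\<And>Y. Y \<in> S \<Longrightarrow> loc Y" "X \<in> Obj C"
  shows "X \<in> sums S"
proof -
  have "splits S (ident C X)"
    using assms by (intro idempotent_splits) auto
  then obtain Z i p where "Z \<in> sums S" "ar i" "src i = Z" "tgt i = X" "ar p" "src p = X" "tgt p = Z"
    "p \<bullet> i = ident C Z" "i \<bullet> p = ident C X" unfolding splits_def using assms by auto
  then show ?thesis
    using sums_iso sums_obj assms(3) is_isoI[of i Z X p] unfolding isomorphic_def by (metis hom_iff)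
qed

lemma sums_thr:
  assumes "X \<in> sums S" "S \<subseteq> Obj C"
  shows "\<exists>n. thr S X X n (ident C X)"
  using assms(1)
proof induction
  case (sums_zero Z)
  then show ?case using thr_zer[of S Z Z] by (auto simp: is_zero_obj_def)
next
  case (sums_add Y Z V i1 i2 p1 p2)
  note b = biproductD[OF sums_add(3)]
  obtain n where n: "thr S Z Z n (ident C Z)" using sums_add by auto
  have 1: "thr S V V n (i2 \<bullet> (ident C Z \<bullet> p2))" using b assms by (intro thr_cmp[OF n]) auto
  have 2: "thr S V V 1 (i1 \<bullet> p1)" using b assms sums_add by (intro thr_one[of Y]) auto
  have "\<exists>k. thr S V V k ((i1 \<bullet> p1) \<boxplus> (i2 \<bullet> (ident C Z \<bullet> p2)))"
    using thr_add[OF 2 1 assms(2)] b by auto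
  then show ?case using b by simp
qed

text \<open>X is a finite direct sum of objects with local endomorphism rings. Indecomposability
  turns everything after one such summand into a zero object, and locality is transported along the
  resulting isomorphism.\<close>

lemma indecomposable_loc:
  assumes "indecomposable C X" "krull_schmidt C"
  shows "loc X"
proof -
  have X: "X \<in> Obj C" using assms by (simp add: indecomposable_def)
  obtain n Y \<iota> \<pi> where ds: "direct_sum C {..<n::nat} Y X \<iota> \<pi>" and l: "\<forall>i<n. local_ring (End_ring C (Y i))"
    using assms X unfolding krull_schmidt_def by blast
  let ?S = "Y ` {..<n}"
  have Yo: "?S \<subseteq> Obj C" using ds by (auto simp: direct_sum_def)
  have loc: "loc Z" if "Z \<in> ?S" for Z using that l Yo by (auto intro: local_ring_loc)
  obtain k where "thr ?S X X k (ident C X)" using direct_sum_thr[OF ds _ Yo] by auto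
  then have "X \<in> sums ?S" using ident_thr_sums loc X by blast
  then show ?thesis
  proof cases
    case sums_zero
    then show ?thesis using assms by (simp add: indecomposable_def)
  next
    case (sums_add Y Z i1 i2 p1 p2)
    have "loc Y" using loc sums_add by blast
    then have "\<not> is_zero_obj C Y" by (simp add: loc_def is_zero_obj_def)
    then have "is_zero_obj C Z" using assms sums_add unfolding indecomposable_def by blast
    then show ?thesis
      using biproduct_zero_iso(1)[OF sums_add(3)] loc_iso[OF \<open>loc Y\<close> _ X] by (auto simp: isomorphic_def)
  qed
qed

text \<open>This is the step that disposes of direct summands: the identity of a summand is still a
  sum of morphisms through members of S, and splitting it needs only that these members are
  local.\<close>

lemma addc_sums:
  assumes "X \<in> addc C S" "\<And>Y. Y \<in> S \<Longrightarrow> loc Y"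
  shows "X \<in> sums S"
proof -
  have "S \<subseteq> Obj C" using assms by (auto simp: loc_def)
  then show ?thesis using addc_thr[OF assms(1)] ident_thr_sums assms by blast
qed

end

section \<open>Extriangulated categories and filtrations\<close>

context preadditive
begin

lemma biproduct_iso_explicit:
  assumes "biproduct C X Y Z i1 i2 p1 p2" "ar f" "src f = Z" "tgt f = Z'" "ar g" "src g = Z'" "tgt g = Z"
    "g \<bullet> f = ident C Z" "f \<bullet> g = ident C Z'"
  shows "biproduct C X Y Z' (f \<bullet> i1) (f \<bullet> i2) (p1 \<bullet> g) (p2 \<bullet> g)"
proof -
  note b = biproductD[OF assms(1)]
  have Z': "Z' \<in> Obj C" using assms tgt_obj by metis
  have s: "g \<bullet> (f \<bullet> h) = h" if "ar h" "tgt h = Z" for h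
    using pre_simp[OF assms(8)] assms that by simp
  have "(f \<bullet> (i1 \<bullet> (p1 \<bullet> g))) \<boxplus> (f \<bullet> (i2 \<bullet> (p2 \<bullet> g))) = f \<bullet> ((i1 \<bullet> (p1 \<bullet> g)) \<boxplus> (i2 \<bullet> (p2 \<bullet> g)))"
    using b(1-15) assms(2-7) by simp
  also have "\<dots> = ident C Z'" using biproduct_pre(5)[OF assms(1), of g] assms by simp
  finally show ?thesis
    using b assms s Z' unfolding biproduct_def by simp
qed

lemma biproduct_iso_factor:
  assumes "is_iso C X Y f" "is_zero_obj C Z" "X \<in> Obj C" "Y \<in> Obj C"
  shows "\<exists>i p. biproduct C Z Y X (zer C Z X) i p f"
proof -
  obtain g where g: "ar f" "src f = X" "tgt f = Y" "ar g" "src g = Y" "tgt g = X"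
    "g \<bullet> f = ident C X" "f \<bullet> g = ident C Y" using is_isoE[OF assms(1,3,4)] by metis
  have Z: "Z \<in> Obj C" "ident C Z = zer C Z Z" using assms by (auto simp: is_zero_obj_def)
  have "biproduct C Z Y X (zer C Z X) g (zer C X Z) f"
    using g Z assms unfolding biproduct_def by simp
  then show ?thesis by blast
qed

text \<open>Stands for X in add Q. The identity of X being a sum of morphisms through Q is what the
  additive reductions in \<open>thr_faithful\<close>, \<open>thr_full\<close>,
  \<open>thr_projective\<close> and \<open>bif_thr_ident\<close> consume.\<close>

definition thr_ob :: "'o \<Rightarrow> 'o \<Rightarrow> bool" where
  "thr_ob Q X \<longleftrightarrow> Q \<in> Obj C \<and> X \<in> Obj C \<and> (\<exists>n. thr {Q} X X n (ident C X))"

lemma thr_ob_iso: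
  assumes "thr_ob Q X" "isomorphic C X Y" "Y \<in> Obj C"
  shows "thr_ob Q Y"
proof -
  have X: "X \<in> Obj C" "Q \<in> Obj C" using assms by (auto simp: thr_ob_def)
  obtain f where f: "is_iso C X Y f" using assms by (auto simp: isomorphic_def)
  obtain g where g: "ar f" "src f = X" "tgt f = Y" "ar g" "src g = Y" "tgt g = X"
    "g \<bullet> f = ident C X" "f \<bullet> g = ident C Y" using is_isoE[OF f X(1) assms(3)] by metis
  obtain n where "thr {Q} X X n (ident C X)" using assms by (auto simp: thr_ob_def)
  from thr_cmp[OF this _ X(1) X(1) assms(3) assms(3), of g f] g X assms
  show ?thesis by (auto simp: thr_ob_def)
qed

lemma thr_ob_biproduct:
  assumes "thr_ob Q X" "thr_ob Q Y" "biproduct C X Y Z i1 i2 p1 p2"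
  shows "thr_ob Q Z"
proof -
  note b = biproductD[OF assms(3)]
  have Q: "{Q} \<subseteq> Obj C" using assms by (auto simp: thr_ob_def)
  obtain n where n: "thr {Q} X X n (ident C X)" using assms by (auto simp: thr_ob_def)
  obtain m where m: "thr {Q} Y Y m (ident C Y)" using assms by (auto simp: thr_ob_def)
  have 1: "thr {Q} Z Z n (i1 \<bullet> (ident C X \<bullet> p1))" using b by (intro thr_cmp[OF n Q]) auto
  have 2: "thr {Q} Z Z m (i2 \<bullet> (ident C Y \<bullet> p2))" using b by (intro thr_cmp[OF m Q]) auto
  show ?thesis using thr_add[OF 1 2 Q b(3) b(3)] b Q unfolding thr_ob_def by simp
qed

lemma thr_ob_zero: "\<lbrakk>is_zero_obj C Z; Q \<in> Obj C\<rbrakk> \<Longrightarrow> thr_ob Q Z"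
  using thr_zer[of "{Q}" Z Z] unfolding thr_ob_def is_zero_obj_def by auto

lemma thr_ob_retract:
  assumes "f \<in> Hom C X Q" "g \<in> Hom C Q X" "g \<bullet> f = ident C X" "X \<in> Obj C" "Q \<in> Obj C"
  shows "thr_ob Q X"
  using thr_one[of Q "{Q}" f X g X] assms unfolding thr_ob_def by auto

section \<open>Additive bifunctors, treated once for both \<open>Ext\<close> and
  \<open>NExt\<close>\<close>

context
  fixes G :: "'o \<Rightarrow> 'o \<Rightarrow> 'e monoid" and psh pll
  assumes bif: "additive_bifunctor C G psh pll"
begin

lemma bif_group: "\<lbrakk>X \<in> Obj C; A \<in> Obj C\<rbrakk> \<Longrightarrow> comm_group (G X A)"
  using bif[unfolded additive_bifunctor_def, THEN conjunct1] by blast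

lemma bif_one: "\<lbrakk>X \<in> Obj C; A \<in> Obj C\<rbrakk> \<Longrightarrow> \<one>\<^bsub>G X A\<^esub> \<in> carrier (G X A)"
  by (intro monoid.one_closed comm_monoid.axioms(1) comm_group.axioms(1) bif_group)

lemma push_hom: "\<lbrakk>X \<in> Obj C; ar a\<rbrakk> \<Longrightarrow> psh X a \<in> hom (G X (src a)) (G X (tgt a))"
  using bif unfolding additive_bifunctor_def by (simp add: arD)

lemma pull_hom: "\<lbrakk>A \<in> Obj C; ar c\<rbrakk> \<Longrightarrow> pll A c \<in> hom (G (tgt c) A) (G (src c) A)"
  using bif unfolding additive_bifunctor_def by (simp add: arD)

lemma push_closed: "\<lbrakk>X \<in> Obj C; ar a; d \<in> carrier (G X (src a)); A = tgt a\<rbrakk> \<Longrightarrow> psh X a d \<in> carrier (G X A)"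
  using push_hom unfolding hom_def by auto

lemma pull_closed: "\<lbrakk>A \<in> Obj C; ar c; d \<in> carrier (G (tgt c) A); X = src c\<rbrakk> \<Longrightarrow> pll A c d \<in> carrier (G X A)"
  using pull_hom unfolding hom_def by auto

lemma push_one: "\<lbrakk>X \<in> Obj C; ar a; A = src a\<rbrakk> \<Longrightarrow> psh X a \<one>\<^bsub>G X A\<^esub> = \<one>\<^bsub>G X (tgt a)\<^esub>"
  using hom_one[OF push_hom] bif_group unfolding comm_group_def group_def by auto

lemma pull_one: "\<lbrakk>A \<in> Obj C; ar c; X = tgt c\<rbrakk> \<Longrightarrow> pll A c \<one>\<^bsub>G X A\<^esub> = \<one>\<^bsub>G (src c) A\<^esub>"
  using hom_one[OF pull_hom] bif_group unfolding comm_group_def group_def by auto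

lemma push_mult:
  "\<lbrakk>X \<in> Obj C; ar a; A = src a; d \<in> carrier (G X A); e \<in> carrier (G X A)\<rbrakk>
    \<Longrightarrow> psh X a (d \<otimes>\<^bsub>G X A\<^esub> e) = psh X a d \<otimes>\<^bsub>G X (tgt a)\<^esub> psh X a e"
  using push_hom unfolding hom_def by auto

lemma push_ident: "\<lbrakk>X \<in> Obj C; A \<in> Obj C; d \<in> carrier (G X A)\<rbrakk> \<Longrightarrow> psh X (ident C A) d = d"
  using bif[unfolded additive_bifunctor_def, THEN conjunct2, THEN conjunct2, THEN conjunct2, THEN conjunct1] by blast

lemma pull_ident: "\<lbrakk>X \<in> Obj C; A \<in> Obj C; d \<in> carrier (G X A)\<rbrakk> \<Longrightarrow> pll A (ident C X) d = d"
  using bif[unfolded additive_bifunctor_def, THEN conjunct2, THEN conjunct2, THEN conjunct2, THEN conjunct1] by blast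

lemma push_cmp:
  assumes "X \<in> Obj C" "ar a" "ar b" "tgt a = src b" "d \<in> carrier (G X (src a))"
  shows "psh X (b \<bullet> a) d = psh X b (psh X a d)"
proof -
  have *: "\<forall>X \<in> Obj C. \<forall>A \<in> Obj C. \<forall>A' \<in> Obj C. \<forall>A'' \<in> Obj C. \<forall>a \<in> Hom C A A'. \<forall>a' \<in> Hom C A' A''.
    \<forall>d \<in> carrier (G X A). psh X (a' \<bullet> a) d = psh X a' (psh X a d)"
    by (rule bif[unfolded additive_bifunctor_def, THEN conjunct2, THEN conjunct2, THEN conjunct2, THEN conjunct2, THEN conjunct1])
  show ?thesis
    by (rule *[rule_format, of X "src a" "tgt a" "tgt b"]) (use assms in auto)
qed

lemma pull_cmp:
  assumes "A \<in> Obj C" "ar a" "ar b" "tgt a = src b" "d \<in> carrier (G (tgt b) A)"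
  shows "pll A (b \<bullet> a) d = pll A a (pll A b d)"
proof -
  have *: "\<forall>X \<in> Obj C. \<forall>X' \<in> Obj C. \<forall>X'' \<in> Obj C. \<forall>A \<in> Obj C. \<forall>c \<in> Hom C X' X. \<forall>c' \<in> Hom C X'' X'.
    \<forall>d \<in> carrier (G X A). pll A (c \<bullet> c') d = pll A c' (pll A c d)"
    by (rule bif[unfolded additive_bifunctor_def, THEN conjunct2, THEN conjunct2, THEN conjunct2, THEN conjunct2, THEN conjunct2, THEN conjunct1])
  show ?thesis
    by (rule *[rule_format, of "tgt b" "src b" "src a"]) (use assms in auto)
qed

lemma push_pull:
  assumes "ar a" "ar c" "d \<in> carrier (G (tgt c) (src a))" "X = src c" "A = tgt a" "A' = src a" "X' = tgt c"
  shows "psh X a (pll A' c d) = pll A c (psh X' a d)"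
proof -
  have *: "\<forall>X \<in> Obj C. \<forall>X' \<in> Obj C. \<forall>A \<in> Obj C. \<forall>A' \<in> Obj C. \<forall>a \<in> Hom C A A'. \<forall>c \<in> Hom C X' X.
    \<forall>d \<in> carrier (G X A). psh X' a (pll A c d) = pll A' c (psh X a d)"
    by (rule bif[unfolded additive_bifunctor_def, THEN conjunct2, THEN conjunct2, THEN conjunct2, THEN conjunct2, THEN conjunct2, THEN conjunct2, THEN conjunct1])
  show ?thesis unfolding assms(4-7)
    by (rule *[rule_format]) (use assms in auto)
qed

lemma push_pls:
  assumes "X \<in> Obj C" "ar a" "ar b" "src a = src b" "tgt a = tgt b" "d \<in> carrier (G X (src b))"
  shows "psh X (a \<boxplus> b) d = psh X a d \<otimes>\<^bsub>G X (tgt b)\<^esub> psh X b d"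
proof -
  have *: "\<forall>X \<in> Obj C. \<forall>A \<in> Obj C. \<forall>A' \<in> Obj C. \<forall>a \<in> Hom C A A'. \<forall>a' \<in> Hom C A A'. \<forall>d \<in> carrier (G X A).
    psh X (a \<boxplus> a') d = psh X a d \<otimes>\<^bsub>G X A'\<^esub> psh X a' d"
    by (rule bif[unfolded additive_bifunctor_def, THEN conjunct2, THEN conjunct2, THEN conjunct2, THEN conjunct2, THEN conjunct2, THEN conjunct2, THEN conjunct2, THEN conjunct1])
  show ?thesis by (rule *[rule_format, of X "src b"]) (use assms in auto)
qed

lemma pull_pls:
  assumes "A \<in> Obj C" "ar a" "ar b" "src a = src b" "tgt a = tgt b" "d \<in> carrier (G (tgt b) A)"
  shows "pll A (a \<boxplus> b) d = pll A a d \<otimes>\<^bsub>G (src b) A\<^esub> pll A b d"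
proof -
  have *: "\<forall>X \<in> Obj C. \<forall>X' \<in> Obj C. \<forall>A \<in> Obj C. \<forall>c \<in> Hom C X' X. \<forall>c' \<in> Hom C X' X. \<forall>d \<in> carrier (G X A).
    pll A (c \<boxplus> c') d = pll A c d \<otimes>\<^bsub>G X' A\<^esub> pll A c' d"
    by (rule bif[unfolded additive_bifunctor_def, THEN conjunct2, THEN conjunct2, THEN conjunct2, THEN conjunct2, THEN conjunct2, THEN conjunct2, THEN conjunct2, THEN conjunct2])
  show ?thesis by (rule *[rule_format, of "tgt b"]) (use assms in auto)
qed

text \<open>An element with d + d = d is neutral. Since a zero morphism added to itself is
  unchanged, this yields \<open>push_zer\<close> and \<open>pull_zer\<close>.\<close>

lemma bif_idem:
  assumes "X \<in> Obj C" "A \<in> Obj C" "d \<in> carrier (G X A)" "d \<otimes>\<^bsub>G X A\<^esub> d = d"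
  shows "d = \<one>\<^bsub>G X A\<^esub>"
proof -
  interpret comm_group "G X A" using assms by (intro bif_group)
  show ?thesis using assms(3,4) by (metis r_cancel_one)
qed

lemma push_zer:
  assumes "X \<in> Obj C" "A \<in> Obj C" "B \<in> Obj C" "d \<in> carrier (G X A)"
  shows "psh X (zer C A B) d = \<one>\<^bsub>G X B\<^esub>"
proof (rule bif_idem)
  show "psh X (zer C A B) d \<otimes>\<^bsub>G X B\<^esub> psh X (zer C A B) d = psh X (zer C A B) d"
    using push_pls[of X "zer C A B" "zer C A B" d] assms by simp
qed (use assms in \<open>auto intro: push_closed\<close>)

lemma pull_zer:
  assumes "X \<in> Obj C" "A \<in> Obj C" "Y \<in> Obj C" "d \<in> carrier (G X A)"
  shows "pll A (zer C Y X) d = \<one>\<^bsub>G Y A\<^esub>"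
proof (rule bif_idem)
  show "pll A (zer C Y X) d \<otimes>\<^bsub>G Y A\<^esub> pll A (zer C Y X) d = pll A (zer C Y X) d"
    using pull_pls[of A "zer C Y X" "zer C Y X" d] assms by simp
qed (use assms in \<open>auto intro: pull_closed\<close>)

lemma bif_zero_obj:
  assumes "is_zero_obj C Z" "X \<in> Obj C"
  shows "carrier (G X Z) = {\<one>\<^bsub>G X Z\<^esub>}" "carrier (G Z X) = {\<one>\<^bsub>G Z X\<^esub>}"
proof -
  have Z: "Z \<in> Obj C" "ident C Z = zer C Z Z" using assms by (auto simp: is_zero_obj_def)
  have "d = \<one>\<^bsub>G X Z\<^esub>" if "d \<in> carrier (G X Z)" for d
    using push_ident[OF assms(2) Z(1) that] push_zer[OF assms(2) Z(1) Z(1) that] Z by simp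
  then show "carrier (G X Z) = {\<one>\<^bsub>G X Z\<^esub>}" using bif_one[OF assms(2) Z(1)] by blast
  have "d = \<one>\<^bsub>G Z X\<^esub>" if "d \<in> carrier (G Z X)" for d
    using pull_ident[OF Z(1) assms(2) that] pull_zer[OF Z(1) assms(2) Z(1) that] Z by simp
  then show "carrier (G Z X) = {\<one>\<^bsub>G Z X\<^esub>}" using bif_one[OF Z(1) assms(2)] by blast
qed

text \<open>Each summand of \<open>s\<close> pulls \<open>d\<close> back through a group
  \<open>G Z A\<close> that is trivial. With \<open>s\<close> an identity this shows that vanishing
  passes from S to add S.\<close>

lemma bif_thr:
  assumes "thr S X Y n s" "S \<subseteq> Obj C" "X \<in> Obj C" "Y \<in> Obj C" "A \<in> Obj C"
    "\<And>Z. Z \<in> S \<Longrightarrow> carrier (G Z A) = {\<one>\<^bsub>G Z A\<^esub>}" "d \<in> carrier (G Y A)"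
  shows "pll A s d = \<one>\<^bsub>G X A\<^esub>"
  using assms(1)
proof induction
  case thr_zer
  then show ?case using pull_zer assms by simp
next
  case (thr_pls n s Z a b)
  interpret comm_group "G X A" using assms by (intro bif_group)
  have Z: "Z \<in> Obj C" using thr_pls assms by auto
  note s = thr_arr[OF thr_pls(1) assms(2-4)]
  have ab: "ar a" "src a = X" "tgt a = Z" "ar b" "src b = Z" "tgt b = Y" using thr_pls Z assms by auto
  have "pll A (b \<bullet> a) d = pll A a (pll A b d)" using ab assms by (intro pull_cmp) auto
  also have "pll A b d = \<one>\<^bsub>G Z A\<^esub>"
    using pull_closed[of A b d Z] assms(5-7) ab thr_pls by auto
  also have "pll A a \<one>\<^bsub>G Z A\<^esub> = \<one>\<^bsub>G X A\<^esub>" using pull_one[of A a Z] ab assms by simp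
  finally have "pll A (b \<bullet> a) d = \<one>\<^bsub>G X A\<^esub>" .
  then show ?case using pull_pls[of A s "b \<bullet> a" d] s ab thr_pls assms by simp
qed

lemma bif_thr_ident:
  assumes "thr S X X n (ident C X)" "S \<subseteq> Obj C" "X \<in> Obj C" "A \<in> Obj C"
    "\<And>Z. Z \<in> S \<Longrightarrow> carrier (G Z A) = {\<one>\<^bsub>G Z A\<^esub>}"
  shows "carrier (G X A) = {\<one>\<^bsub>G X A\<^esub>}"
  using bif_thr[OF assms(1-3) assms(3,4,5)] pull_ident bif_one assms by (metis equalityI insertCI singletonD subsetI)

end

end

section \<open>Exactness consequences of the axioms of an extriangulated category\<close>

context extriangulated_category
begin

lemmas ext_push_closed = push_closed[OF ET1] and ext_pull_closed = pull_closed[OF ET1]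
  and ext_push_one = push_one[OF ET1] and ext_pull_one = pull_one[OF ET1]
  and ext_push_ident = push_ident[OF ET1] and ext_pull_ident = pull_ident[OF ET1]
  and ext_push_cmp = push_cmp[OF ET1] and ext_pull_cmp = pull_cmp[OF ET1]
  and ext_push_zer = push_zer[OF ET1] and ext_pull_zer = pull_zer[OF ET1]
  and ext_one = bif_one[OF ET1] and ext_push_pull = push_pull[OF ET1]
  and ext_push_mult = push_mult[OF ET1] and ext_group = bif_group[OF ET1]

text \<open>The typing and the vanishing of the composite are known for one representative of the
  class; the isomorphism of middle terms carries them over.\<close>

lemma conflD:
  assumes "conflation C A f B g X d"
  shows "A \<in> Obj C" "X \<in> Obj C" "B \<in> Obj C" "d \<in> carrier (Ext C X A)"
    "ar f" "src f = A" "tgt f = B" "ar g" "src g = B" "tgt g = X" "g \<bullet> f = zer C A X"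
proof -
  have 1: "A \<in> Obj C" "X \<in> Obj C" "d \<in> carrier (Ext C X A)"
    and m: "(B, f, g) \<in> rlz C X A d" using assms by (auto simp: conflation_def)
  show "A \<in> Obj C" "X \<in> Obj C" "d \<in> carrier (Ext C X A)" by (rule 1)+
  obtain B' f' g' where r: "B' \<in> Obj C" "f' \<in> Hom C A B'" "g' \<in> Hom C B' X" "g' \<bullet> f' = zer C A X"
    "rlz C X A d = seq_class C A X (B', f', g')"
    using ET2_class[OF 1] by blast
  then obtain b where B: "B \<in> Obj C" "f \<in> Hom C A B" "g \<in> Hom C B X"
    and b: "is_iso C B' B b" "b \<bullet> f' = f" "g \<bullet> b = g'"
    using m by (auto simp: seq_class_def)
  have b': "ar b" "src b = B'" "tgt b = B" using is_isoE[OF b(1) r(1) B(1)] by metis+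
  show "B \<in> Obj C" by fact
  show fg: "ar f" "src f = A" "tgt f = B" "ar g" "src g = B" "tgt g = X" using B 1 by auto
  have "g \<bullet> (b \<bullet> f') = g' \<bullet> f'" using pre_simp[OF b(3), of f'] b' fg r 1 by simp
  then show "g \<bullet> f = zer C A X" using b r by simp
qed

text \<open>Both sequences are equivalent to the representative supplied by
  \<open>ET2_class\<close>, and the two isomorphisms of middle terms are composed.\<close>

lemma confl_unique:
  assumes "conflation C A f B g X d" "conflation C A f' B' g' X d"
  obtains b b' where "ar b" "src b = B" "tgt b = B'" "ar b'" "src b' = B'" "tgt b' = B"
    "b' \<bullet> b = ident C B" "b \<bullet> b' = ident C B'" "b \<bullet> f = f'" "g' \<bullet> b = g"
proof -
  note c = conflD[OF assms(1)] and c' = conflD[OF assms(2)]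
  obtain B0 f0 g0 where r: "B0 \<in> Obj C" "f0 \<in> Hom C A B0" "g0 \<in> Hom C B0 X"
    "rlz C X A d = seq_class C A X (B0, f0, g0)"
    using ET2_class[OF c(1,2,4)] by blast
  obtain b1 where b1: "is_iso C B0 B b1" "b1 \<bullet> f0 = f" "g \<bullet> b1 = g0"
    using assms(1) r by (auto simp: seq_class_def conflation_def)
  obtain b2 where b2: "is_iso C B0 B' b2" "b2 \<bullet> f0 = f'" "g' \<bullet> b2 = g0"
    using assms(2) r by (auto simp: seq_class_def conflation_def)
  obtain a1 where a1: "ar b1" "src b1 = B0" "tgt b1 = B" "ar a1" "src a1 = B" "tgt a1 = B0"
    "a1 \<bullet> b1 = ident C B0" "b1 \<bullet> a1 = ident C B" using is_isoE[OF b1(1) r(1) c(3)] by metis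
  obtain a2 where a2: "ar b2" "src b2 = B0" "tgt b2 = B'" "ar a2" "src a2 = B'" "tgt a2 = B0"
    "a2 \<bullet> b2 = ident C B0" "b2 \<bullet> a2 = ident C B'" using is_isoE[OF b2(1) r(1) c'(3)] by metis
  have f0: "ar f0" "src f0 = A" "tgt f0 = B0" using r c by auto
  show thesis
  proof (rule that[of "b2 \<bullet> a1" "b1 \<bullet> a2"])
    show "(b1 \<bullet> a2) \<bullet> (b2 \<bullet> a1) = ident C B" using a1 a2 pre_simp[OF a2(7), of a1] by simp
    show "(b2 \<bullet> a1) \<bullet> (b1 \<bullet> a2) = ident C B'" using a1 a2 pre_simp[OF a1(7), of a2] by simp
    show "(b2 \<bullet> a1) \<bullet> f = f'" using a1 a2 b1 b2 f0 pre_simp[OF a1(7), of f0] by (simp flip: b1(2))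
    have "g' \<bullet> (b2 \<bullet> a1) = (g \<bullet> b1) \<bullet> a1" using a1 a2 b1 b2 c' by (simp flip: assoc)
    then show "g' \<bullet> (b2 \<bullet> a1) = g" using a1 c by simp
  qed (use a1 a2 in auto)
qed

lemma confl_exists:
  assumes "A \<in> Obj C" "X \<in> Obj C" "d \<in> carrier (Ext C X A)"
  obtains B f g where "conflation C A f B g X d"
proof -
  obtain B f g where *: "B \<in> Obj C" "f \<in> Hom C A B" "g \<in> Hom C B X"
    "rlz C X A d = seq_class C A X (B, f, g)"
    using ET2_class[OF assms] by blast
  have "is_iso C B B (ident C B)" using * is_isoI[of "ident C B" B B "ident C B"] by simp
  then have "(B, f, g) \<in> seq_class C A X (B, f, g)"
    unfolding seq_class_def using * assms by (auto intro!: exI[of _ "ident C B"])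
  then show thesis using that assms * unfolding conflation_def by auto
qed

lemma confl_iso_mid:
  assumes "conflation C A f B g X d" "is_iso C B B' b" "B' \<in> Obj C"
  shows "\<exists>f' g'. conflation C A f' B' g' X d"
proof -
  note c = conflD[OF assms(1)]
  obtain b' where b: "ar b" "src b = B" "tgt b = B'" "ar b'" "src b' = B'" "tgt b' = B"
    "b' \<bullet> b = ident C B" "b \<bullet> b' = ident C B'" using is_isoE[OF assms(2) c(3) assms(3)] by metis
  obtain B0 f0 g0 where r: "B0 \<in> Obj C" "f0 \<in> Hom C A B0" "g0 \<in> Hom C B0 X"
    "rlz C X A d = seq_class C A X (B0, f0, g0)"
    using ET2_class[OF c(1,2,4)] by blast
  obtain b1 where b1: "is_iso C B0 B b1" "b1 \<bullet> f0 = f" "g \<bullet> b1 = g0"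
    using assms(1) r by (auto simp: seq_class_def conflation_def)
  have a1: "ar b1" "src b1 = B0" "tgt b1 = B"
    using is_isoE[OF b1(1) r(1) c(3)] by metis+
  have f0: "ar f0" "src f0 = A" "tgt f0 = B0" using r c by auto
  have "is_iso C B0 B' (b \<bullet> b1)" using is_iso_cmp b1(1) assms r c by metis
  moreover have "(b \<bullet> b1) \<bullet> f0 = b \<bullet> f" using a1 b f0 by (simp add: b1)
  moreover have "(g \<bullet> b') \<bullet> (b \<bullet> b1) = g0" using a1 b c pre_simp[OF b(7), of b1] by (simp add: b1)
  ultimately have "(B', b \<bullet> f, g \<bullet> b') \<in> rlz C X A d"
    unfolding r seq_class_def using b c assms(3) by auto
  then show ?thesis using c assms unfolding conflation_def by blast
qed

lemma confl_zero_left: "\<lbrakk>is_zero_obj C Z; Y \<in> Obj C\<rbrakk> \<Longrightarrow> conflation C Z (zer C Z Y) Y (ident C Y) Y \<one>\<^bsub>Ext C Y Z\<^esub>"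
  by (rule ET2_zero[OF biproduct_swap[OF biproduct_zero_right]])

lemma confl_zero_right: "\<lbrakk>is_zero_obj C Z; Y \<in> Obj C\<rbrakk> \<Longrightarrow> conflation C Y (ident C Y) Y (zer C Y Z) Z \<one>\<^bsub>Ext C Z Y\<^esub>"
  by (rule ET2_zero[OF biproduct_zero_right])

lemma confl_isom: "\<lbrakk>is_zero_obj C Z; is_iso C X Y f; X \<in> Obj C; Y \<in> Obj C\<rbrakk>
    \<Longrightarrow> conflation C Z (zer C Z X) X f Y \<one>\<^bsub>Ext C Y Z\<^esub>"
  using biproduct_iso_factor ET2_zero by metis

text \<open>Together with the zero morphism out of A, \<open>h\<close> forms a commuting square into
  the split conflation 0 -> Y = Y, and \<open>ET3\<close> supplies the third component.\<close>

lemma weak_cokernel: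
  assumes "conflation C A f B g X d" "ar h" "src h = B" "tgt h = Y" "h \<bullet> f = zer C A Y"
  obtains h' where "ar h'" "src h' = X" "tgt h' = Y" "h = h' \<bullet> g"
proof -
  note c = conflD[OF assms(1)]
  obtain Z where Z: "is_zero_obj C Z" using zero_obj_exists by blast
  have ZO: "Z \<in> Obj C" using Z by (simp add: is_zero_obj_def)
  have Y: "Y \<in> Obj C" using assms tgt_obj by metis
  have "\<exists>h' \<in> Hom C X Y. h' \<bullet> g = ident C Y \<bullet> h \<and>
      push C X (zer C A Z) d = pull C Z h' \<one>\<^bsub>Ext C Y Z\<^esub>"
    by (rule ET3[OF assms(1) confl_zero_left[OF Z Y]]) (use assms(2-5) c Y ZO in simp_all)
  then obtain h' where "h' \<in> Hom C X Y" "h' \<bullet> g = ident C Y \<bullet> h" by blast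
  then show thesis using that[of h'] assms c Y by simp
qed

lemma weak_kernel:
  assumes "conflation C A f B g X d" "ar h" "src h = W" "tgt h = B" "g \<bullet> h = zer C W X"
  obtains h' where "ar h'" "src h' = W" "tgt h' = A" "h = f \<bullet> h'"
proof -
  note c = conflD[OF assms(1)]
  obtain Z where Z: "is_zero_obj C Z" using zero_obj_exists by blast
  have ZO: "Z \<in> Obj C" using Z by (simp add: is_zero_obj_def)
  have W: "W \<in> Obj C" using assms src_obj by metis
  have "\<exists>h' \<in> Hom C W A. h \<bullet> ident C W = f \<bullet> h' \<and>
      push C Z h' \<one>\<^bsub>Ext C Z W\<^esub> = pull C A (zer C Z X) d"
    by (rule ET3_op[OF confl_zero_right[OF Z W] assms(1)]) (use assms(2-5) c W ZO in simp_all)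
  then obtain h' where "h' \<in> Hom C W A" "h \<bullet> ident C W = f \<bullet> h'" by blast
  then show thesis using that[of h'] assms c W by simp
qed

text \<open>A trivial pullback makes the pair (identity of A, \<open>c\<close>) compatible with the
  split class on A and W. Realizing it by a morphism out of A \<oplus> W and restricting to W gives
  the lift.\<close>

lemma lift_deflation:
  assumes "conflation C A f B g X d" "ar c" "src c = W" "tgt c = X" "pull C A c d = \<one>\<^bsub>Ext C W A\<^esub>"
  obtains b where "ar b" "src b = W" "tgt b = B" "g \<bullet> b = c"
proof -
  note cf = conflD[OF assms(1)]
  have W: "W \<in> Obj C" using assms src_obj by metis
  obtain Z i1 i2 p1 p2 where b: "biproduct C A W Z i1 i2 p1 p2" using biproduct_exists cf(1) W by blast
  note b' = biproductD[OF b]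
  have "\<exists>b \<in> Hom C Z B. b \<bullet> i1 = f \<bullet> ident C A \<and> g \<bullet> b = c \<bullet> p2"
    by (rule ET2_realization[OF ET2_zero[OF b] assms(1)])
      (use assms(2-5) cf W ext_push_ident[OF W cf(1) ext_one[OF W cf(1)]] in simp_all)
  then obtain b where "b \<in> Hom C Z B" "g \<bullet> b = c \<bullet> p2" by blast
  then have b2: "ar b" "src b = Z" "tgt b = B" "g \<bullet> b = c \<bullet> p2" using b' cf by auto
  have "g \<bullet> (b \<bullet> i2) = c"
    using pre_simp[OF b2(4), of i2] b2 cf b' assms by simp
  then show thesis using that[of "b \<bullet> i2"] b2 b' by simp
qed

lemma extend_inflation:
  assumes "conflation C A f B g X d" "ar a" "src a = A" "tgt a = W" "push C X a d = \<one>\<^bsub>Ext C X W\<^esub>"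
  obtains b where "ar b" "src b = B" "tgt b = W" "b \<bullet> f = a"
proof -
  note cf = conflD[OF assms(1)]
  have W: "W \<in> Obj C" using assms tgt_obj by metis
  obtain Z i1 i2 p1 p2 where b: "biproduct C W X Z i1 i2 p1 p2" using biproduct_exists cf(2) W by blast
  note b' = biproductD[OF b]
  have "\<exists>b \<in> Hom C B Z. b \<bullet> f = i1 \<bullet> a \<and> p2 \<bullet> b = ident C X \<bullet> g"
    by (rule ET2_realization[OF assms(1) ET2_zero[OF b]])
      (use assms(2-5) cf W ext_pull_ident[OF cf(2) W ext_one[OF cf(2) W]] in simp_all)
  then obtain b where "b \<in> Hom C B Z" "b \<bullet> f = i1 \<bullet> a" by blast
  then have b2: "ar b" "src b = B" "tgt b = Z" "b \<bullet> f = i1 \<bullet> a" using b' cf by auto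
  have "(p1 \<bullet> b) \<bullet> f = a"
    using biproduct_pre(1)[OF b, of a] b2 cf b' assms by simp
  then show thesis using that[of "p1 \<bullet> b"] b2 b' by simp
qed

text \<open>\<open>ET3\<close>, applied to the square into B = B -> 0, exhibits the pushed class as
  pulled back from the trivial class over a zero object.\<close>

lemma push_inflation:
  assumes "conflation C A f B g X d"
  shows "push C X f d = \<one>\<^bsub>Ext C X B\<^esub>"
proof -
  note cf = conflD[OF assms]
  obtain Z where Z: "is_zero_obj C Z" using zero_obj_exists by blast
  have ZO: "Z \<in> Obj C" using Z by (simp add: is_zero_obj_def)
  have "\<exists>c \<in> Hom C X Z. c \<bullet> g = zer C B Z \<bullet> ident C B \<and> push C X f d = pull C B c \<one>\<^bsub>Ext C Z B\<^esub>"
    by (rule ET3[OF assms confl_zero_right[OF Z cf(3)]]) (use cf in simp_all)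
  then obtain c where c: "c \<in> Hom C X Z" "push C X f d = pull C B c \<one>\<^bsub>Ext C Z B\<^esub>" by blast
  then show ?thesis using ext_pull_one[of B c Z] cf ZO by simp
qed

text \<open>Exactness of Hom(A, W) -> E(X, W) -> E(B, W) in the middle: a realization of
  \<open>e\<close> receives a lift of \<open>g\<close>, and \<open>ET3_op\<close> completes this
  lift to a morphism of conflations over the identity of X.\<close>

lemma pull_trivial_push:
  assumes "conflation C A f B g X d" "e \<in> carrier (Ext C X W)" "W \<in> Obj C" "pull C W g e = \<one>\<^bsub>Ext C B W\<^esub>"
  obtains a where "ar a" "src a = A" "tgt a = W" "e = push C X a d"
proof -
  note cf = conflD[OF assms(1)]
  obtain M m n where M: "conflation C W m M n X e" using confl_exists assms cf by metis
  note cM = conflD[OF M]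
  obtain b where b: "ar b" "src b = B" "tgt b = M" "n \<bullet> b = g"
    using lift_deflation[OF M] cf assms by metis
  have "\<exists>a \<in> Hom C A W. b \<bullet> f = m \<bullet> a \<and> push C X a d = pull C W (ident C X) e"
    by (rule ET3_op[OF assms(1) M]) (use b cf cM in simp_all)
  then obtain a where "a \<in> Hom C A W" "push C X a d = pull C W (ident C X) e" by blast
  then show thesis using that[of a] ext_pull_ident[OF cf(2) assms(3,2)] cf assms by simp
qed

lemma retraction_split:
  assumes "conflation C A f B g X d" "ar r" "src r = B" "tgt r = A" "r \<bullet> f = ident C A"
  shows "d = \<one>\<^bsub>Ext C X A\<^esub>"
proof -
  note cf = conflD[OF assms(1)]
  have "d = push C X (r \<bullet> f) d" using ext_push_ident cf assms by simp
  also have "\<dots> = push C X r (push C X f d)" using cf assms by (intro ext_push_cmp) auto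
  also have "\<dots> = \<one>\<^bsub>Ext C X A\<^esub>" using push_inflation[OF assms(1)] ext_push_one[of X r B] cf assms by simp
  finally show ?thesis .
qed

lemma split_biproduct:
  assumes "conflation C A f B g X \<one>\<^bsub>Ext C X A\<^esub>"
  obtains i p where "biproduct C A X B f i p g"
proof -
  note cf = conflD[OF assms]
  obtain Z i1 i2 p1 p2 where b: "biproduct C A X Z i1 i2 p1 p2" using biproduct_exists cf by blast
  note b' = biproductD[OF b]
  obtain h h' where h: "ar h" "src h = Z" "tgt h = B" "ar h'" "src h' = B" "tgt h' = Z"
    "h' \<bullet> h = ident C Z" "h \<bullet> h' = ident C B" "h \<bullet> i1 = f" "g \<bullet> h = p2"
    using confl_unique[OF ET2_zero[OF b] assms] by metis
  have "p2 \<bullet> h' = g" using h cf by (simp flip: h(10))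
  then show thesis using biproduct_iso_explicit[OF b h(1-8)] h that by metis
qed

text \<open>\<open>ET4_op\<close> restricts a realization W -> M -> B of a class to W -> E -> A.
  This splits, and its retraction E -> W extends over E -> M because E(X, W) vanishes. The extension
  is a retraction of W -> M.\<close>

lemma ext_trivial_ext:
  assumes "conflation C A f B g X d" "W \<in> Obj C"
    "carrier (Ext C X W) = {\<one>\<^bsub>Ext C X W\<^esub>}" "carrier (Ext C A W) = {\<one>\<^bsub>Ext C A W\<^esub>}"
  shows "carrier (Ext C B W) = {\<one>\<^bsub>Ext C B W\<^esub>}"
proof -
  note cf = conflD[OF assms(1)]
  have "e = \<one>\<^bsub>Ext C B W\<^esub>" if e: "e \<in> carrier (Ext C B W)" for e
  proof -
    obtain M m n where M: "conflation C W m M n B e" using confl_exists assms cf e by metis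
    note cM = conflD[OF M]
    obtain E d'' h' d' e' where E: "E \<in> Obj C" "d' \<in> Hom C W E"
      and cE: "conflation C E h' M (g \<bullet> n) X d''" and hd: "h' \<bullet> d' = m"
      and cE2: "conflation C W d' E e' A (pull C W f e)"
      using ET4_op[OF M assms(1)] by blast
    note c1 = conflD[OF cE] and c2 = conflD[OF cE2]
    have "pull C W f e = \<one>\<^bsub>Ext C A W\<^esub>" using c2 assms by auto
    then obtain i r where "biproduct C W A E d' i r e'" using split_biproduct cE2 by metis
    then have r: "ar r" "src r = E" "tgt r = W" "r \<bullet> d' = ident C W" by (auto dest: biproductD)
    have "push C X r d'' = \<one>\<^bsub>Ext C X W\<^esub>"
      using ext_push_closed[of X r d'' W] r c1 assms by auto
    then obtain r' where r': "ar r'" "src r' = M" "tgt r' = W" "r' \<bullet> h' = r"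
      using extend_inflation[OF cE r(1-3)] by metis
    have "r' \<bullet> m = ident C W" using pre_simp[OF r'(4), of d'] r' r c1 c2 by (simp flip: hd)
    then show ?thesis using retraction_split[OF M] r' by metis
  qed
  then show ?thesis using ext_one[OF cf(3) assms(2)] by blast
qed

text \<open>\<open>filt\<close> permits factors in \<open>add S\<close>; here each step attaches one
  member of S on the left, starting from a zero object. This form admits induction, and
  \<open>filt_fl\<close> identifies the two sets when the members of S are local.\<close>

inductive_set fl :: "'o set \<Rightarrow> 'o set" for S where
  fl_zero: "is_zero_obj C Z \<Longrightarrow> Z \<in> fl S"
| fl_ext: "\<lbrakk>T \<in> S; Y \<in> fl S; conflation C T f X g Y d\<rbrakk> \<Longrightarrow> X \<in> fl S"

lemma fl_obj: "X \<in> fl S \<Longrightarrow> X \<in> Obj C"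
  by (induction rule: fl.induct) (auto simp: is_zero_obj_def dest: conflD)

lemma fl_mono: "X \<in> fl S \<Longrightarrow> S \<subseteq> S' \<Longrightarrow> X \<in> fl S'"
  by (induction rule: fl.induct) (auto intro: fl.intros)

lemma fl_iso:
  assumes "X \<in> fl S" "isomorphic C X Y" "Y \<in> Obj C"
  shows "Y \<in> fl S"
  using assms(1)
proof cases
  case fl_zero
  then show ?thesis using zero_obj_iso assms fl.fl_zero by blast
next
  case (fl_ext T Z f g d)
  then show ?thesis
    using confl_iso_mid assms fl.fl_ext unfolding isomorphic_def by metis
qed

text \<open>Induction on the filtration of the left end. If A has bottom factor T and quotient A',
  then \<open>ET4\<close> makes M an extension with bottom factor T and quotient E, where E is an
  extension of Y by A' and falls under the induction hypothesis.\<close>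

lemma fl_closed:
  assumes "A \<in> fl S" "conflation C A f M g Y d" "Y \<in> fl S"
  shows "M \<in> fl S"
  using assms
proof (induction arbitrary: f M g d rule: fl.induct)
  case (fl_zero Z)
  note c = conflD[OF fl_zero(2)]
  have "d = \<one>\<^bsub>Ext C Y Z\<^esub>" using bif_zero_obj(1)[OF ET1 fl_zero(1) c(2)] c by auto
  then obtain i p where "biproduct C Z Y M f i p g" using split_biproduct fl_zero by metis
  from biproduct_zero_iso(1)[OF biproduct_swap[OF this] fl_zero(1)]
  show ?case using fl_iso fl_zero c unfolding isomorphic_def by blast
next
  case (fl_ext T A' f' A g' d')
  obtain E d'' h' d2 e where "conflation C T (f \<bullet> f') M h' E d''"
    "conflation C A' d2 E e Y (push C Y g' d)"
    using ET4[OF fl_ext(3) fl_ext(5)] by blast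
  then show ?case using fl_ext fl.fl_ext by metis
qed

lemma fl_member:
  assumes "T \<in> S" "T \<in> Obj C"
  shows "T \<in> fl S"
proof -
  obtain Z where Z: "is_zero_obj C Z" using zero_obj_exists by blast
  show ?thesis using fl_ext[OF assms(1) fl_zero[OF Z] confl_zero_right[OF Z assms(2)]] .
qed

lemma fl_biproduct:
  "\<lbrakk>biproduct C X Y Z i1 i2 p1 p2; X \<in> fl S; Y \<in> fl S\<rbrakk> \<Longrightarrow> Z \<in> fl S"
  using fl_closed ET2_zero by metis

lemma sums_fl: "X \<in> sums S \<Longrightarrow> S \<subseteq> fl S' \<Longrightarrow> X \<in> fl S'"
  by (induction rule: sums.induct) (auto intro: fl_zero fl_biproduct)

lemma fl_filt_len:
  assumes "X \<in> fl S"
  shows "\<exists>l. X \<in> filt_len C S l"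
  using assms
proof induction
  case (fl_zero Z)
  then show ?case using zero_obj_addc[of Z S] by (intro exI[of _ 0]) auto
next
  case (fl_ext T Y f X g d)
  note c = conflD[OF fl_ext(3)]
  obtain Z where Z: "is_zero_obj C Z" using zero_obj_exists by blast
  obtain l where "Y \<in> filt_len C S l" using fl_ext by auto
  moreover have "T \<in> addc C S" using member_addc[OF Z] fl_ext c by auto
  ultimately have "X \<in> filt_len C S (Suc l)"
    unfolding filt_len.simps star_def using fl_ext(3) c(3) by blast
  then show ?case by blast
qed

text \<open>By locality, members of \<open>add S\<close> are finite direct sums of members of S,
  hence lie in \<open>fl S\<close>; the rest is closure under extensions. Conversely, members of S
  and zero objects lie in \<open>add S\<close>.\<close>

lemma filt_fl:
  assumes "\<And>Y. Y \<in> S \<Longrightarrow> loc Y"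
  shows "filt C S = fl S"
proof -
  have "S \<subseteq> fl S" using assms fl_member by (auto simp: loc_def)
  then have add: "X \<in> fl S" if "X \<in> addc C S" for X
    using addc_sums[OF that assms] sums_fl by blast
  have "filt_len C S l \<subseteq> fl S" for l
  proof (induction l)
    case 0
    then show ?case using add by auto
  next
    case (Suc l)
    show ?case
      using fl_closed[OF add] Suc unfolding filt_len.simps star_def by blast
  qed
  moreover have "fl S \<subseteq> (\<Union>l. filt_len C S l)" by (rule subsetI) (simp add: fl_filt_len)
  ultimately show ?thesis unfolding filt_def by blast
qed

lemma ext_trivial_fl:
  assumes "X \<in> fl S" "W \<in> Obj C" "\<And>T. T \<in> S \<Longrightarrow> carrier (Ext C T W) = {\<one>\<^bsub>Ext C T W\<^esub>}"
  shows "carrier (Ext C X W) = {\<one>\<^bsub>Ext C X W\<^esub>}"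
  using assms(1)
proof induction
  case (fl_zero Z)
  then show ?case using bif_zero_obj(2)[OF ET1] assms by blast
next
  case (fl_ext T Y f X g d)
  then show ?case using ext_trivial_ext assms by blast
qed

text \<open>Nakaoka--Palu, Proposition 3.15: the class \<open>i1\<^sub>* d1 + i2\<^sub>* d2\<close> in \<open>E(X, A1 \<oplus> A2)\<close> realizes
  the pullback of the two deflations.\<close>

lemma pullback_half:
  assumes "biproduct C A1 A2 Z i1 i2 p1 p2" "conflation C Z m M n X \<mu>" "push C X p2 \<mu> = d2"
    "conflation C A2 f2 B2 g2 X d2"
  shows "\<exists>E m1 n1 e1. conflation C A1 m1 M n1 E e1 \<and> isomorphic C E B2"
proof -
  obtain E d'' h' d e where E: "conflation C A1 (m \<bullet> i1) M h' E d''" "conflation C A2 d E e X (push C X p2 \<mu>)"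
    using ET4[OF ET2_zero[OF assms(1)] assms(2)] by blast
  obtain b b' where "ar b" "src b = E" "tgt b = B2" "ar b'" "src b' = B2" "tgt b' = E"
    "b' \<bullet> b = ident C E" "b \<bullet> b' = ident C B2"
    using confl_unique[OF E(2)[unfolded assms(3)] assms(4)] by metis
  moreover have "E \<in> Obj C" "B2 \<in> Obj C" using conflD E(2) assms(4) by blast+
  ultimately have "isomorphic C E B2"
    unfolding isomorphic_def by (intro exI[of _ b] is_isoI[where g=b']) auto
  then show ?thesis using E by blast
qed

lemma deflation_pullback:
  assumes "conflation C A1 f1 B1 g1 X d1" "conflation C A2 f2 B2 g2 X d2"
  obtains M E1 E2 m1 n1 e1 m2 n2 e2 where "conflation C A1 m1 M n1 E2 e1" "isomorphic C E2 B2"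
    "conflation C A2 m2 M n2 E1 e2" "isomorphic C E1 B1"
proof -
  note c1 = conflD[OF assms(1)] and c2 = conflD[OF assms(2)]
  obtain Z i1 i2 p1 p2 where b: "biproduct C A1 A2 Z i1 i2 p1 p2" using biproduct_exists c1 c2 by metis
  note b' = biproductD[OF b]
  let ?\<mu> = "push C X i1 d1 \<otimes>\<^bsub>Ext C X Z\<^esub> push C X i2 d2"
  interpret Z: comm_group "Ext C X Z" using ext_group c1 b' by blast
  interpret A: comm_group "Ext C X A1" using ext_group c1 b' by blast
  interpret B: comm_group "Ext C X A2" using ext_group c1 b' by blast
  have k: "push C X i1 d1 \<in> carrier (Ext C X Z)" "push C X i2 d2 \<in> carrier (Ext C X Z)"
    by (rule ext_push_closed; use b' c1 c2 in simp)+
  obtain M m n where M: "conflation C Z m M n X ?\<mu>" using confl_exists[OF b'(3) c1(2) Z.m_closed[OF k]] by metis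
  \<comment> \<open>The cross term vanishes because p2 i1 = 0, and p2 i2 is the identity.\<close>
  have 1: "push C X p2 ?\<mu> = d2"
    using b' c1 c2 k ext_push_mult[of X p2 Z] ext_push_cmp[of X i1 p2 d1, symmetric]
      ext_push_cmp[of X i2 p2 d2, symmetric] ext_push_zer[of X A1 A2 d1] ext_push_ident[of X A2 d2] by simp
  have 2: "push C X p1 ?\<mu> = d1"
    using b' c1 c2 k ext_push_mult[of X p1 Z] ext_push_cmp[of X i1 p1 d1, symmetric]
      ext_push_cmp[of X i2 p1 d2, symmetric] ext_push_zer[of X A2 A1 d2] ext_push_ident[of X A1 d1] by simp
  show thesis
    using pullback_half[OF b M 1 assms(2)] pullback_half[OF biproduct_swap[OF b] M 2 assms(1)] that by metis
qed

definition presented :: "'o set \<Rightarrow> 'o \<Rightarrow> 'o \<Rightarrow> bool" where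
  "presented S Q X \<longleftrightarrow> (\<exists>K f P g d. conflation C K f P g X d \<and> K \<in> fl S \<and> thr_ob Q P)"

text \<open>\<open>ET4_op\<close> makes P -> Y -> X a deflation whose left end is an extension of L
  by K, and filtered objects are closed under extensions.\<close>

lemma presented_compose:
  assumes "conflation C K f P g Y d" "K \<in> fl S" "thr_ob Q P" "conflation C L k Y h X d'" "L \<in> fl S"
  shows "presented S Q X"
proof -
  obtain E d'' h' d2 e where "conflation C E h' P (h \<bullet> g) X d''"
    "conflation C K d2 E e L (pull C K k d)"
    using ET4_op[OF assms(1,4)] by blast
  then show ?thesis using fl_closed assms unfolding presented_def by metis
qed

lemma presented_iso:
  assumes "presented S Q X" "isomorphic C X Y" "Y \<in> Obj C"
  shows "presented S Q Y"
proof -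
  obtain K f P g d where K: "conflation C K f P g X d" "K \<in> fl S" "thr_ob Q P"
    using assms by (auto simp: presented_def)
  obtain Z where Z: "is_zero_obj C Z" using zero_obj_exists by blast
  obtain h where "is_iso C X Y h" using assms by (auto simp: isomorphic_def)
  from presented_compose[OF K confl_isom[OF Z this] fl_zero[OF Z]] show ?thesis using conflD K assms by blast
qed

text \<open>M is the pullback of Y -> X and P2 -> X. It is A \<oplus> P2 up to isomorphism, because
  extensions of objects of add Q by A vanish. Hence P1 \<oplus> P2 deflates onto M with left end K1,
  M deflates onto Y with left end K2, and the two deflations are composed.\<close>

lemma presented_ext:
  assumes "presented S Q A" "presented S Q X" "conflation C A a Y y X d" "A \<in> Obj C"
    "\<And>P. thr_ob Q P \<Longrightarrow> carrier (Ext C P A) = {\<one>\<^bsub>Ext C P A\<^esub>}"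
  shows "presented S Q Y"
proof -
  obtain K1 f1 P1 g1 d1 where 1: "conflation C K1 f1 P1 g1 A d1" "K1 \<in> fl S" "thr_ob Q P1"
    using assms by (auto simp: presented_def)
  obtain K2 f2 P2 g2 d2 where 2: "conflation C K2 f2 P2 g2 X d2" "K2 \<in> fl S" "thr_ob Q P2"
    using assms by (auto simp: presented_def)
  obtain M E1 E2 m1 n1 e1 m2 n2 e2 where M: "conflation C A m1 M n1 E2 e1" "isomorphic C E2 P2"
    "conflation C K2 m2 M n2 E1 e2" "isomorphic C E1 Y"
    using deflation_pullback[OF assms(3) 2(1)] by metis
  note cM = conflD[OF M(1)] and cM' = conflD[OF M(3)] and c1 = conflD[OF 1(1)] and c2 = conflD[OF 2(1)]
    and c3 = conflD[OF assms(3)]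
  have E2: "thr_ob Q E2" using thr_ob_iso[OF 2(3) isomorphic_sym[OF M(2)]] cM c2 by auto
  then have "e1 = \<one>\<^bsub>Ext C E2 A\<^esub>" using assms(5) cM by auto
  then obtain i p where b: "biproduct C A E2 M m1 i p n1" using split_biproduct M(1) by metis
  obtain Z where Z: "is_zero_obj C Z" using zero_obj_exists by blast
  obtain V i1 i2 p1 p2 where V: "biproduct C P1 E2 V i1 i2 p1 p2" using biproduct_exists c1 cM by metis
  \<comment> \<open>The conflation K1 -> P1 -> A is added to 0 -> E2 = E2; the outer ends K1
    \<oplus> 0 and A \<oplus> E2 are represented by K1 and M.\<close>
  obtain h k e where "conflation C K1 h V k M e"
    using ET2_sum[OF 1(1) confl_zero_left[OF Z cM(2)] biproduct_zero_right[OF Z c1(1)] V b] by blast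
  from presented_compose[OF this 1(2) thr_ob_biproduct[OF 1(3) E2 V] M(3) 2(2)]
  show ?thesis using presented_iso M(4) c3 by blast
qed

lemma presented_fl:
  assumes "X \<in> fl S" "S \<subseteq> Obj C" "Q \<in> Obj C" "\<And>T. T \<in> S \<Longrightarrow> presented S Q T"
    "\<And>P T. \<lbrakk>thr_ob Q P; T \<in> S\<rbrakk> \<Longrightarrow> carrier (Ext C P T) = {\<one>\<^bsub>Ext C P T\<^esub>}"
  shows "presented S Q X"
  using assms(1)
proof induction
  case (fl_zero Z)
  then show ?case
    using confl_zero_left[OF fl_zero, of Z] fl.fl_zero thr_ob_zero[OF fl_zero assms(3)]
    unfolding presented_def is_zero_obj_def by blast
next
  case (fl_ext T Y f X g d)
  then show ?case using presented_ext[OF assms(4) fl_ext(4,3)] assms by blast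
qed

end

section \<open>Consequences of vanishing negative extensions\<close>

context extriangulated_negative
begin

lemma next_exact_left:
  assumes "conflation C A f B g X d" "W \<in> Obj C" "carrier (NExt C W A) = {\<one>\<^bsub>NExt C W A\<^esub>}"
    "carrier (NExt C W X) = {\<one>\<^bsub>NExt C W X\<^esub>}"
  shows "carrier (NExt C W B) = {\<one>\<^bsub>NExt C W B\<^esub>}"
proof -
  note c = conflD[OF assms(1)]
  have "\<nu> = \<one>\<^bsub>NExt C W B\<^esub>" if "\<nu> \<in> carrier (NExt C W B)" for \<nu>
  proof -
    have "npush C W g \<nu> = \<one>\<^bsub>NExt C W X\<^esub>"
      using push_closed[OF NE1 assms(2), of g \<nu> X] that c assms by auto
    then have "\<nu> \<in> npush C W f ` carrier (NExt C W A)"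
      using exact_covariant[OF assms(1,2)] that unfolding kernel_def by auto
    then show ?thesis using push_one[OF NE1 assms(2), of f A] c assms by auto
  qed
  then show ?thesis using bif_one[OF NE1 assms(2) c(3)] by blast
qed

lemma next_exact_right:
  assumes "conflation C A f B g X d" "W \<in> Obj C" "carrier (NExt C A W) = {\<one>\<^bsub>NExt C A W\<^esub>}"
    "carrier (NExt C X W) = {\<one>\<^bsub>NExt C X W\<^esub>}"
  shows "carrier (NExt C B W) = {\<one>\<^bsub>NExt C B W\<^esub>}"
proof -
  note c = conflD[OF assms(1)]
  have "\<nu> = \<one>\<^bsub>NExt C B W\<^esub>" if "\<nu> \<in> carrier (NExt C B W)" for \<nu>
  proof -
    have "npull C W f \<nu> = \<one>\<^bsub>NExt C A W\<^esub>"
      using pull_closed[OF NE1 assms(2), of f \<nu> A] that c assms by auto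
    then have "\<nu> \<in> npull C W g ` carrier (NExt C X W)"
      using exact_contravariant[OF assms(1,2)] that unfolding kernel_def by auto
    then show ?thesis using pull_one[OF NE1 assms(2), of g X] c assms by auto
  qed
  then show ?thesis using bif_one[OF NE1 c(3) assms(2)] by blast
qed

text \<open>The two arguments are filtered separately: the second one against members of S, and the
  first one against the fixed object Y.\<close>

lemma next_trivial_fl:
  assumes "X \<in> fl S" "Y \<in> fl S" "\<And>T U. \<lbrakk>T \<in> S; U \<in> S\<rbrakk> \<Longrightarrow> carrier (NExt C T U) = {\<one>\<^bsub>NExt C T U\<^esub>}"
  shows "carrier (NExt C X Y) = {\<one>\<^bsub>NExt C X Y\<^esub>}"
proof -
  have 1: "carrier (NExt C T Y) = {\<one>\<^bsub>NExt C T Y\<^esub>}" if "T \<in> S" "T \<in> Obj C" for T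
    using assms(2)
  proof induction
    case (fl_zero Z)
    then show ?case using bif_zero_obj(1)[OF NE1] that by blast
  next
    case (fl_ext U Y f X g d)
    then show ?case using next_exact_left assms(3) that by blast
  qed
  show ?thesis
    using assms(1)
  proof induction
    case (fl_zero Z)
    then show ?case using bif_zero_obj(2)[OF NE1] fl_obj[OF assms(2)] by blast
  next
    case (fl_ext T X' f X g d)
    then show ?case using next_exact_right 1 fl_obj[OF assms(2)] conflD(1) by metis
  qed
qed

text \<open>By exactness, a morphism from W killed by the inflation comes from the negative
  extension group of W and X, which is trivial.\<close>

lemma inflation_monic:
  assumes "conflation C A f B g X d" "carrier (NExt C W X) = {\<one>\<^bsub>NExt C W X\<^esub>}" "ar h" "src h = W" "tgt h = A"
    "f \<bullet> h = zer C W B"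
  shows "h = zer C W A"
proof -
  note c = conflD[OF assms(1)]
  have W: "W \<in> Obj C" using assms src_obj by metis
  have "h \<in> ncon C X A d W ` carrier (NExt C W X)"
    using exact_covariant[OF assms(1) W] assms c W unfolding kernel_def by auto
  then have "h = ncon C X A d W \<one>\<^bsub>NExt C W X\<^esub>" using assms(2) by auto
  also have "\<dots> = zer C W A"
    using hom_one[OF ncon_hom[OF c(2,1) W c(4)]] bif_group[OF NE1 W c(2)] hom_grp[OF W c(1)]
    unfolding comm_group_def by auto
  finally show ?thesis .
qed

lemma deflation_epic:
  assumes "conflation C A f B g X d" "carrier (NExt C A W) = {\<one>\<^bsub>NExt C A W\<^esub>}" "ar h" "src h = X" "tgt h = W"
    "h \<bullet> g = zer C B W"
  shows "h = zer C X W"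
proof -
  note c = conflD[OF assms(1)]
  have W: "W \<in> Obj C" using assms tgt_obj by metis
  have "h \<in> nconop C X A d W ` carrier (NExt C A W)"
    using exact_contravariant[OF assms(1) W] assms c W unfolding kernel_def by auto
  then have "h = nconop C X A d W \<one>\<^bsub>NExt C A W\<^esub>" using assms(2) by auto
  also have "\<dots> = zer C X W"
    using hom_one[OF nconop_hom[OF c(2,1) W c(4)]] bif_group[OF NE1 c(1) W] hom_grp[OF c(2) W]
    unfolding comm_group_def by auto
  finally show ?thesis .
qed

end

section \<open>Modules of finite length\<close>

locale rmodule = R: ring R + M: abelian_group M
  for R :: "('r, 'y) ring_scheme" (structure) and M :: "('r, 'x) module" (structure) +
  assumes smult_closed [simp]: "\<lbrakk>r \<in> carrier R; x \<in> carrier M\<rbrakk> \<Longrightarrow> r \<odot>\<^bsub>M\<^esub> x \<in> carrier M"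
    and smult_one [simp]: "x \<in> carrier M \<Longrightarrow> \<one> \<odot>\<^bsub>M\<^esub> x = x"
    and smult_assoc: "\<lbrakk>r \<in> carrier R; s \<in> carrier R; x \<in> carrier M\<rbrakk> \<Longrightarrow> (r \<otimes> s) \<odot>\<^bsub>M\<^esub> x = s \<odot>\<^bsub>M\<^esub> (r \<odot>\<^bsub>M\<^esub> x)"
    and smult_l_distr: "\<lbrakk>r \<in> carrier R; s \<in> carrier R; x \<in> carrier M\<rbrakk>
      \<Longrightarrow> (r \<oplus> s) \<odot>\<^bsub>M\<^esub> x = (r \<odot>\<^bsub>M\<^esub> x) \<oplus>\<^bsub>M\<^esub> (s \<odot>\<^bsub>M\<^esub> x)"
    and smult_r_distr: "\<lbrakk>r \<in> carrier R; x \<in> carrier M; y \<in> carrier M\<rbrakk>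
      \<Longrightarrow> r \<odot>\<^bsub>M\<^esub> (x \<oplus>\<^bsub>M\<^esub> y) = (r \<odot>\<^bsub>M\<^esub> x) \<oplus>\<^bsub>M\<^esub> (r \<odot>\<^bsub>M\<^esub> y)"

lemma rmodule_iff: "rmodule R M \<longleftrightarrow> right_module R M"
  unfolding rmodule_def rmodule_axioms_def right_module_def by auto

context rmodule
begin

lemma smult_l_zero [simp]:
  assumes "x \<in> carrier M"
  shows "\<zero> \<odot>\<^bsub>M\<^esub> x = \<zero>\<^bsub>M\<^esub>"
proof -
  have "\<zero> \<odot>\<^bsub>M\<^esub> x \<oplus>\<^bsub>M\<^esub> \<zero> \<odot>\<^bsub>M\<^esub> x = \<zero> \<odot>\<^bsub>M\<^esub> x"
    using smult_l_distr[of \<zero> \<zero> x] assms by simp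
  then show ?thesis using assms by (simp add: M.add.r_cancel_one)
qed

lemma smult_r_zero [simp]:
  assumes "r \<in> carrier R"
  shows "r \<odot>\<^bsub>M\<^esub> \<zero>\<^bsub>M\<^esub> = \<zero>\<^bsub>M\<^esub>"
proof -
  have "r \<odot>\<^bsub>M\<^esub> \<zero>\<^bsub>M\<^esub> \<oplus>\<^bsub>M\<^esub> r \<odot>\<^bsub>M\<^esub> \<zero>\<^bsub>M\<^esub> = r \<odot>\<^bsub>M\<^esub> \<zero>\<^bsub>M\<^esub>"
    using smult_r_distr[of r "\<zero>\<^bsub>M\<^esub>" "\<zero>\<^bsub>M\<^esub>"] assms by simp
  then show ?thesis using assms by (simp add: M.add.r_cancel_one)
qed

lemma smult_minus_one:
  assumes "x \<in> carrier M"
  shows "(\<ominus> \<one>) \<odot>\<^bsub>M\<^esub> x = \<ominus>\<^bsub>M\<^esub> x"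
proof -
  have "(\<ominus> \<one>) \<odot>\<^bsub>M\<^esub> x \<oplus>\<^bsub>M\<^esub> x = \<zero>\<^bsub>M\<^esub>"
    using smult_l_distr[of "\<ominus> \<one>" \<one> x] assms by (simp add: R.l_neg)
  then show ?thesis using assms by (metis M.minus_equality R.add.inv_closed R.one_closed smult_closed)
qed

lemma diff_eq_zero:
  assumes "x \<in> carrier M" "y \<in> carrier M"
  shows "x \<ominus>\<^bsub>M\<^esub> y = \<zero>\<^bsub>M\<^esub> \<longleftrightarrow> x = y"
  using assms by (metis M.add.inv_closed M.minus_equality M.minus_minus M.r_neg a_minus_def)

text \<open>\<open>submodule\<close> also demands closure under negatives, which is the action of
  the scalar -1.\<close>

lemma submoduleI:
  assumes "U \<subseteq> carrier M" "\<zero>\<^bsub>M\<^esub> \<in> U" "\<And>x y. \<lbrakk>x \<in> U; y \<in> U\<rbrakk> \<Longrightarrow> x \<oplus>\<^bsub>M\<^esub> y \<in> U"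
    "\<And>r x. \<lbrakk>r \<in> carrier R; x \<in> U\<rbrakk> \<Longrightarrow> r \<odot>\<^bsub>M\<^esub> x \<in> U"
  shows "submodule U R M"
proof (intro submodule.intro subgroup.intro submodule_axioms.intro)
  show "inv\<^bsub>add_monoid M\<^esub> x \<in> U" if "x \<in> U" for x
    using assms(4)[of "\<ominus> \<one>" x] smult_minus_one[of x] that assms(1) by (auto simp: a_inv_def)
qed (use assms in auto)

end

lemma submoduleD:
  assumes "submodule U R M"
  shows "U \<subseteq> carrier M" "\<zero>\<^bsub>M\<^esub> \<in> U" "\<And>x y. \<lbrakk>x \<in> U; y \<in> U\<rbrakk> \<Longrightarrow> x \<oplus>\<^bsub>M\<^esub> y \<in> U"
    "\<And>r x. \<lbrakk>r \<in> carrier R; x \<in> U\<rbrakk> \<Longrightarrow> r \<odot>\<^bsub>M\<^esub> x \<in> U" "\<And>x. x \<in> U \<Longrightarrow> \<ominus>\<^bsub>M\<^esub> x \<in> U"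
    "\<And>x y. \<lbrakk>x \<in> U; y \<in> U\<rbrakk> \<Longrightarrow> x \<ominus>\<^bsub>M\<^esub> y \<in> U"
proof -
  interpret submodule U R M by fact
  show "U \<subseteq> carrier M" "\<zero>\<^bsub>M\<^esub> \<in> U" "\<And>x y. \<lbrakk>x \<in> U; y \<in> U\<rbrakk> \<Longrightarrow> x \<oplus>\<^bsub>M\<^esub> y \<in> U"
    "\<And>r x. \<lbrakk>r \<in> carrier R; x \<in> U\<rbrakk> \<Longrightarrow> r \<odot>\<^bsub>M\<^esub> x \<in> U" "\<And>x. x \<in> U \<Longrightarrow> \<ominus>\<^bsub>M\<^esub> x \<in> U"
    using subset one_closed m_closed smult_closed m_inv_closed by (auto simp: a_inv_def)
  then show "\<And>x y. \<lbrakk>x \<in> U; y \<in> U\<rbrakk> \<Longrightarrow> x \<ominus>\<^bsub>M\<^esub> y \<in> U" by (simp add: a_minus_def)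
qed

context rmodule
begin

lemma whole_submodule: "submodule (carrier M) R M"
  by (rule submoduleI) auto

lemma zero_submodule: "submodule {\<zero>\<^bsub>M\<^esub>} R M"
  by (rule submoduleI) auto

lemma cyclic_submodule:
  assumes "x \<in> carrier M"
  shows "submodule ((\<lambda>r. r \<odot>\<^bsub>M\<^esub> x) ` carrier R) R M" "x \<in> (\<lambda>r. r \<odot>\<^bsub>M\<^esub> x) ` carrier R"
proof -
  show "submodule ((\<lambda>r. r \<odot>\<^bsub>M\<^esub> x) ` carrier R) R M"
  proof (rule submoduleI)
    show "\<zero>\<^bsub>M\<^esub> \<in> (\<lambda>r. r \<odot>\<^bsub>M\<^esub> x) ` carrier R" using assms by (intro image_eqI[of _ _ \<zero>]) auto
  next
    fix y z assume "y \<in> (\<lambda>r. r \<odot>\<^bsub>M\<^esub> x) ` carrier R" "z \<in> (\<lambda>r. r \<odot>\<^bsub>M\<^esub> x) ` carrier R"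
    then show "y \<oplus>\<^bsub>M\<^esub> z \<in> (\<lambda>r. r \<odot>\<^bsub>M\<^esub> x) ` carrier R"
      using assms by (auto simp flip: smult_l_distr)
  next
    fix r y assume "r \<in> carrier R" "y \<in> (\<lambda>r. r \<odot>\<^bsub>M\<^esub> x) ` carrier R"
    then show "r \<odot>\<^bsub>M\<^esub> y \<in> (\<lambda>r. r \<odot>\<^bsub>M\<^esub> x) ` carrier R"
      using assms by (auto simp flip: smult_assoc)
  qed (use assms in auto)
  show "x \<in> (\<lambda>r. r \<odot>\<^bsub>M\<^esub> x) ` carrier R" using assms by (intro image_eqI[of _ _ \<one>]) auto
qed

lemma sum_submodule:
  assumes "submodule U R M" "submodule V R M"
  shows "submodule {u \<oplus>\<^bsub>M\<^esub> v | u v. u \<in> U \<and> v \<in> V} R M" (is "submodule ?S R M")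
    "U \<subseteq> {u \<oplus>\<^bsub>M\<^esub> v | u v. u \<in> U \<and> v \<in> V}" "V \<subseteq> {u \<oplus>\<^bsub>M\<^esub> v | u v. u \<in> U \<and> v \<in> V}"
proof -
  note U = submoduleD[OF assms(1)] and V = submoduleD[OF assms(2)]
  show "submodule ?S R M"
  proof (rule submoduleI)
    show "?S \<subseteq> carrier M" using U(1) V(1) by auto
    show "\<zero>\<^bsub>M\<^esub> \<in> ?S" using U(2) V(2) by (auto intro!: exI[of _ "\<zero>\<^bsub>M\<^esub>"])
  next
    fix x y assume "x \<in> ?S" "y \<in> ?S"
    then obtain u v u' v' where uv: "x = u \<oplus>\<^bsub>M\<^esub> v" "y = u' \<oplus>\<^bsub>M\<^esub> v'" "u \<in> U" "v \<in> V" "u' \<in> U" "v' \<in> V" by auto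
    moreover have "u \<in> carrier M" "v \<in> carrier M" "u' \<in> carrier M" "v' \<in> carrier M" using uv U(1) V(1) by auto
    ultimately have "x \<oplus>\<^bsub>M\<^esub> y = (u \<oplus>\<^bsub>M\<^esub> u') \<oplus>\<^bsub>M\<^esub> (v \<oplus>\<^bsub>M\<^esub> v')" by (simp add: M.a_ac)
    then show "x \<oplus>\<^bsub>M\<^esub> y \<in> ?S" using uv U(3) V(3) by blast
  next
    fix r x assume r: "r \<in> carrier R" "x \<in> ?S"
    then obtain u v where uv: "x = u \<oplus>\<^bsub>M\<^esub> v" "u \<in> U" "v \<in> V" by auto
    then have "r \<odot>\<^bsub>M\<^esub> x = (r \<odot>\<^bsub>M\<^esub> u) \<oplus>\<^bsub>M\<^esub> (r \<odot>\<^bsub>M\<^esub> v)"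
      using r(1) U(1) V(1) by (simp add: smult_r_distr subset_eq)
    then show "r \<odot>\<^bsub>M\<^esub> x \<in> ?S" using uv U(4) V(4) r by blast
  qed
  show "U \<subseteq> ?S"
  proof
    fix u assume "u \<in> U"
    then show "u \<in> ?S" using V(2) U(1) by (intro CollectI exI[of _ u] exI[of _ "\<zero>\<^bsub>M\<^esub>"]) auto
  qed
  show "V \<subseteq> ?S"
  proof
    fix u assume "u \<in> V"
    then show "u \<in> ?S" using U(2) V(1) by (intro CollectI exI[of _ "\<zero>\<^bsub>M\<^esub>"] exI[of _ u]) auto
  qed
qed

lemma sub_rmodule:
  assumes "submodule U R M"
  shows "rmodule R (M\<lparr>carrier := U\<rparr>)"
proof -
  note U = submoduleD[OF assms]
  have c: "\<And>x. x \<in> U \<Longrightarrow> x \<in> carrier M" using U(1) by auto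
  have "abelian_group (M\<lparr>carrier := U\<rparr>)"
  proof (rule abelian_groupI)
    fix x assume "x \<in> carrier (M\<lparr>carrier := U\<rparr>)"
    then show "\<exists>y \<in> carrier (M\<lparr>carrier := U\<rparr>). y \<oplus>\<^bsub>M\<lparr>carrier := U\<rparr>\<^esub> x = \<zero>\<^bsub>M\<lparr>carrier := U\<rparr>\<^esub>"
      using U(5)[of x] c by (intro bexI[of _ "\<ominus>\<^bsub>M\<^esub> x"]) (auto simp: M.l_neg)
  qed (use U c in \<open>auto simp: M.a_ac\<close>)
  then show ?thesis
    using U(4) c by (intro rmodule.intro rmodule_axioms.intro R.ring_axioms)
      (auto simp: smult_assoc smult_l_distr smult_r_distr)
qed

lemma sub_submodule:
  assumes "submodule U R M"
  shows "submodule V R (M\<lparr>carrier := U\<rparr>) \<longleftrightarrow> submodule V R M \<and> V \<subseteq> U"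
proof -
  interpret U: rmodule R "M\<lparr>carrier := U\<rparr>" by (rule sub_rmodule[OF assms])
  show ?thesis
  proof
    assume "submodule V R (M\<lparr>carrier := U\<rparr>)"
    note V = submoduleD[OF this]
    show "submodule V R M \<and> V \<subseteq> U"
      using V submoduleD(1)[OF assms] by (auto intro!: submoduleI)
  next
    assume "submodule V R M \<and> V \<subseteq> U"
    then show "submodule V R (M\<lparr>carrier := U\<rparr>)"
      using submoduleD[of V R M] by (intro U.submoduleI) auto
  qed
qed

definition span :: "'x set \<Rightarrow> 'x set" where
  "span S = \<Inter>{U. submodule U R M \<and> S \<subseteq> U}"

lemma span_submodule:
  assumes "S \<subseteq> carrier M"
  shows "submodule (span S) R M" "S \<subseteq> span S"
proof -
  have w: "carrier M \<in> {U. submodule U R M \<and> S \<subseteq> U}" using whole_submodule assms by auto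
  show "submodule (span S) R M"
    unfolding span_def by (rule submoduleI) (use w in \<open>auto intro: submoduleD\<close>)
qed (auto simp: span_def)

lemma span_least: "\<lbrakk>submodule U R M; S \<subseteq> U\<rbrakk> \<Longrightarrow> span S \<subseteq> U"
  by (auto simp: span_def)

lemma finsum_submodule:
  assumes "submodule U R M" "finite S" "\<And>s. s \<in> S \<Longrightarrow> f s \<in> U"
  shows "finsum M f S \<in> U"
  using assms(2,3)
proof (induction S rule: finite_induct)
  case empty
  then show ?case using submoduleD[OF assms(1)] by simp
next
  case (insert x F)
  have "f \<in> F \<rightarrow> carrier M" "f x \<in> carrier M" using insert submoduleD(1)[OF assms(1)] by auto
  then show ?case using insert submoduleD(3)[OF assms(1)] by simp
qed

lemma smult_finsum:
  assumes "finite S" "f \<in> S \<rightarrow> carrier M" "r \<in> carrier R"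
  shows "r \<odot>\<^bsub>M\<^esub> finsum M f S = finsum M (\<lambda>s. r \<odot>\<^bsub>M\<^esub> f s) S"
  using assms
proof (induction S rule: finite_induct)
  case (insert x F)
  have "(\<lambda>s. r \<odot>\<^bsub>M\<^esub> f s) \<in> F \<rightarrow> carrier M" using insert by (auto intro!: smult_closed)
  then show ?case using insert by (simp add: smult_r_distr)
qed simp

lemma fin_gen_span: "fin_gen R M \<longleftrightarrow> (\<exists>S. finite S \<and> S \<subseteq> carrier M \<and> span S = carrier M)"
proof
  assume "fin_gen R M"
  then obtain S where S: "finite S" "S \<subseteq> carrier M"
    "\<forall>x \<in> carrier M. \<exists>c. (\<forall>s \<in> S. c s \<in> carrier R) \<and> x = finsum M (\<lambda>s. c s \<odot>\<^bsub>M\<^esub> s) S"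
    unfolding fin_gen_def by auto
  have "carrier M \<subseteq> span S"
  proof
    fix x assume "x \<in> carrier M"
    then obtain c where c: "\<forall>s \<in> S. c s \<in> carrier R" "x = finsum M (\<lambda>s. c s \<odot>\<^bsub>M\<^esub> s) S" using S by blast
    show "x \<in> span S" unfolding c(2)
    proof (rule finsum_submodule[OF span_submodule(1)[OF S(2)] S(1)])
      fix s assume "s \<in> S"
      then show "c s \<odot>\<^bsub>M\<^esub> s \<in> span S"
        using c(1) span_submodule(2)[OF S(2)] by (intro submoduleD(4)[OF span_submodule(1)[OF S(2)]]) auto
    qed
  qed
  moreover have "span S \<subseteq> carrier M" by (rule submoduleD(1)[OF span_submodule(1)[OF S(2)]])
  ultimately show "\<exists>S. finite S \<and> S \<subseteq> carrier M \<and> span S = carrier M"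
    using S by (intro exI[of _ S]) auto
next
  assume "\<exists>S. finite S \<and> S \<subseteq> carrier M \<and> span S = carrier M"
  then obtain S where S: "finite S" "S \<subseteq> carrier M" "span S = carrier M" by auto
  \<comment> \<open>The linear combinations of S form a submodule containing S, so they exhaust the
    span.\<close>
  let ?V = "{x. \<exists>c. (\<forall>s \<in> S. c s \<in> carrier R) \<and> x = finsum M (\<lambda>s. c s \<odot>\<^bsub>M\<^esub> s) S}"
  have cl: "(\<lambda>s. c s \<odot>\<^bsub>M\<^esub> s) \<in> S \<rightarrow> carrier M" if "\<forall>s \<in> S. c s \<in> carrier R" for c
    using that S by (auto intro!: smult_closed)
  have "submodule ?V R M"
  proof (rule submoduleI)
    show "?V \<subseteq> carrier M" using cl by auto
    have "finsum M (\<lambda>s. \<zero> \<odot>\<^bsub>M\<^esub> s) S = \<zero>\<^bsub>M\<^esub>"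
      using S by (intro M.add.finprod_one_eqI) auto
    then show "\<zero>\<^bsub>M\<^esub> \<in> ?V" by (intro CollectI exI[of _ "\<lambda>_. \<zero>"]) auto
  next
    fix x y assume "x \<in> ?V" "y \<in> ?V"
    then obtain c d where cd: "\<forall>s \<in> S. c s \<in> carrier R" "x = finsum M (\<lambda>s. c s \<odot>\<^bsub>M\<^esub> s) S"
      "\<forall>s \<in> S. d s \<in> carrier R" "y = finsum M (\<lambda>s. d s \<odot>\<^bsub>M\<^esub> s) S" by auto
    have "x \<oplus>\<^bsub>M\<^esub> y = finsum M (\<lambda>s. c s \<odot>\<^bsub>M\<^esub> s \<oplus>\<^bsub>M\<^esub> d s \<odot>\<^bsub>M\<^esub> s) S"
      unfolding cd using M.finsum_addf[OF cl cl, of c d] cd by simp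
    also have "\<dots> = finsum M (\<lambda>s. (c s \<oplus> d s) \<odot>\<^bsub>M\<^esub> s) S"
      using cd S by (intro M.finsum_cong') (auto simp: smult_l_distr subset_eq)
    finally show "x \<oplus>\<^bsub>M\<^esub> y \<in> ?V" using cd by (intro CollectI exI[of _ "\<lambda>s. c s \<oplus> d s"]) auto
  next
    fix r x assume r: "r \<in> carrier R" "x \<in> ?V"
    then obtain c where c: "\<forall>s \<in> S. c s \<in> carrier R" "x = finsum M (\<lambda>s. c s \<odot>\<^bsub>M\<^esub> s) S" by auto
    have "r \<odot>\<^bsub>M\<^esub> x = finsum M (\<lambda>s. r \<odot>\<^bsub>M\<^esub> (c s \<odot>\<^bsub>M\<^esub> s)) S"
      unfolding c(2) using smult_finsum[OF S(1) cl] c r by blast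
    also have "\<dots> = finsum M (\<lambda>s. (c s \<otimes> r) \<odot>\<^bsub>M\<^esub> s) S"
      using c S r by (intro M.finsum_cong') (auto simp: smult_assoc subset_eq)
    finally show "r \<odot>\<^bsub>M\<^esub> x \<in> ?V" using c r by (intro CollectI exI[of _ "\<lambda>s. c s \<otimes> r"]) auto
  qed
  moreover have "S \<subseteq> ?V"
  proof
    fix s assume s: "s \<in> S"
    let ?c = "\<lambda>s'. if s' = s then \<one> else \<zero>"
    have "finsum M (\<lambda>s'. ?c s' \<odot>\<^bsub>M\<^esub> s') S = finsum M (\<lambda>s'. if s = s' then s' else \<zero>\<^bsub>M\<^esub>) S"
      using S by (intro M.finsum_cong') auto
    also have "\<dots> = s" using S s by (intro M.add.finprod_singleton) auto
    finally show "s \<in> ?V" by (intro CollectI exI[of _ ?c]) auto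
  qed
  ultimately have "span S \<subseteq> ?V" by (rule span_least)
  then show "fin_gen R M" unfolding fin_gen_def S(3) using S(1,2) by (intro exI[of _ S]) auto
qed

text \<open>A bound on lengths of chains, encoded as a strictly monotone map from submodules to
  natural numbers. It yields both chain conditions at once, restricts to submodules, and passes to
  images by taking preimages, without composition series.\<close>

definition fin_len :: bool where
  "fin_len \<longleftrightarrow> (\<exists>\<mu> :: 'x set \<Rightarrow> nat. \<forall>U V. submodule U R M \<and> submodule V R M \<and> U \<subset> V \<longrightarrow> \<mu> U < \<mu> V)"

text \<open>The measure is bounded by its value on the whole module, so a member of largest measure
  exists, and strict monotonicity makes it maximal.\<close>

lemma fin_len_acc:
  assumes fin_len "U \<in> \<U>" "\<And>V. V \<in> \<U> \<Longrightarrow> submodule V R M"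
  shows "\<exists>V \<in> \<U>. \<forall>W \<in> \<U>. V \<subseteq> W \<longrightarrow> W = V"
proof -
  obtain \<mu> :: "'x set \<Rightarrow> nat" where \<mu>: "\<And>U V. \<lbrakk>submodule U R M; submodule V R M; U \<subset> V\<rbrakk> \<Longrightarrow> \<mu> U < \<mu> V"
    using assms(1) unfolding fin_len_def by blast
  have bd: "\<mu> V \<le> \<mu> (carrier M)" if "V \<in> \<U>" for V
    using \<mu>[OF assms(3)[OF that] whole_submodule] submoduleD(1)[OF assms(3)[OF that]]
    by (cases "V = carrier M") (auto intro: less_imp_le)
  then have "\<exists>V. V \<in> \<U> \<and> (\<forall>W. W \<in> \<U> \<longrightarrow> \<mu> W \<le> \<mu> V)"
    by (intro ex_has_greatest_nat[where P="\<lambda>V. V \<in> \<U>" and k=U and b="Suc (\<mu> (carrier M))"])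
      (simp_all add: less_Suc_eq_le assms(2))
  then obtain V where V: "V \<in> \<U>" "\<And>W. W \<in> \<U> \<Longrightarrow> \<mu> W \<le> \<mu> V" by blast
  show ?thesis
  proof (intro bexI[OF _ V(1)] ballI impI)
    fix W assume W: "W \<in> \<U>" "V \<subseteq> W"
    then show "W = V"
      using \<mu>[OF assms(3)[OF V(1)] assms(3)[OF W(1)]] V(2)[OF W(1)] by auto
  qed
qed

lemma fin_len_dcc:
  assumes fin_len "U \<in> \<U>" "\<And>V. V \<in> \<U> \<Longrightarrow> submodule V R M"
  shows "\<exists>V \<in> \<U>. \<forall>W \<in> \<U>. W \<subseteq> V \<longrightarrow> W = V"
proof -
  obtain \<mu> :: "'x set \<Rightarrow> nat" where \<mu>: "\<And>U V. \<lbrakk>submodule U R M; submodule V R M; U \<subset> V\<rbrakk> \<Longrightarrow> \<mu> U < \<mu> V"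
    using assms(1) unfolding fin_len_def by blast
  have "\<exists>V. V \<in> \<U> \<and> (\<forall>W. W \<in> \<U> \<longrightarrow> \<mu> V \<le> \<mu> W)"
    by (rule ex_has_least_nat[where P="\<lambda>V. V \<in> \<U>", OF assms(2)])
  then obtain V where V: "V \<in> \<U>" "\<And>W. W \<in> \<U> \<Longrightarrow> \<mu> V \<le> \<mu> W" by blast
  show ?thesis
  proof (intro bexI[OF _ V(1)] ballI impI)
    fix W assume W: "W \<in> \<U>" "W \<subseteq> V"
    then show "W = V"
      using \<mu>[OF assms(3)[OF W(1)] assms(3)[OF V(1)]] V(2)[OF W(1)] by auto
  qed
qed

text \<open>A submodule that is maximal among the finitely generated ones contains every element,
  since adjoining one more generator cannot enlarge it.\<close>

lemma fin_len_fin_gen: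
  assumes fin_len
  shows "fin_gen R M"
proof -
  let ?\<U> = "span ` {S. finite S \<and> S \<subseteq> carrier M}"
  have "\<exists>V \<in> ?\<U>. \<forall>W \<in> ?\<U>. V \<subseteq> W \<longrightarrow> W = V"
    by (rule fin_len_acc[OF assms, of "span {}"]) (auto simp: span_submodule)
  then obtain V where V: "V \<in> ?\<U>" "\<forall>W \<in> ?\<U>. V \<subseteq> W \<longrightarrow> W = V" by (elim bexE) (rule that)
  then obtain S where S: "finite S" "S \<subseteq> carrier M" "V = span S" by auto
  have "carrier M \<subseteq> V"
  proof
    fix x assume x: "x \<in> carrier M"
    have "span S \<subseteq> span (insert x S)"
      using span_submodule[of "insert x S"] S x by (intro span_least) auto
    then have "span (insert x S) = V" using bspec[OF V(2), of "span (insert x S)"] S x by blast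
    then show "x \<in> V" using span_submodule(2)[of "insert x S"] S x by auto
  qed
  moreover have "V \<subseteq> carrier M" using submoduleD(1)[OF span_submodule(1)[OF S(2)]] S(3) by simp
  ultimately show ?thesis using S unfolding fin_gen_span by (intro exI[of _ S]) auto
qed

lemma fin_len_sub:
  assumes fin_len "submodule U R M"
  shows "rmodule.fin_len R (M\<lparr>carrier := U\<rparr>)"
proof -
  obtain \<mu> :: "'x set \<Rightarrow> nat" where "\<And>U V. \<lbrakk>submodule U R M; submodule V R M; U \<subset> V\<rbrakk> \<Longrightarrow> \<mu> U < \<mu> V"
    using assms(1) unfolding fin_len_def by blast
  then show ?thesis
    unfolding rmodule.fin_len_def[OF sub_rmodule[OF assms(2)]] sub_submodule[OF assms(2)]
    by (intro exI[of _ \<mu>]) auto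
qed

end

section \<open>Homomorphisms of right modules\<close>

lemma mod_homD:
  assumes "f \<in> mod_hom R M N"
  shows "\<And>x. x \<in> carrier M \<Longrightarrow> f x \<in> carrier N"
    "\<And>x y. \<lbrakk>x \<in> carrier M; y \<in> carrier M\<rbrakk> \<Longrightarrow> f (x \<oplus>\<^bsub>M\<^esub> y) = f x \<oplus>\<^bsub>N\<^esub> f y"
    "\<And>r x. \<lbrakk>r \<in> carrier R; x \<in> carrier M\<rbrakk> \<Longrightarrow> f (r \<odot>\<^bsub>M\<^esub> x) = r \<odot>\<^bsub>N\<^esub> f x"
    "f \<in> extensional (carrier M)"
  using assms unfolding mod_hom_def by (auto simp: PiE_def)

lemma mod_homI:
  "\<lbrakk>\<And>x. x \<in> carrier M \<Longrightarrow> f x \<in> carrier N;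
    \<And>x y. \<lbrakk>x \<in> carrier M; y \<in> carrier M\<rbrakk> \<Longrightarrow> f (x \<oplus>\<^bsub>M\<^esub> y) = f x \<oplus>\<^bsub>N\<^esub> f y;
    \<And>r x. \<lbrakk>r \<in> carrier R; x \<in> carrier M\<rbrakk> \<Longrightarrow> f (r \<odot>\<^bsub>M\<^esub> x) = r \<odot>\<^bsub>N\<^esub> f x;
    f \<in> extensional (carrier M)\<rbrakk> \<Longrightarrow> f \<in> mod_hom R M N"
  unfolding mod_hom_def by (auto simp: PiE_def)

lemma mod_hom_restrictI:
  assumes "rmodule R M" "\<And>x. x \<in> carrier M \<Longrightarrow> f x \<in> carrier N"
    "\<And>x y. \<lbrakk>x \<in> carrier M; y \<in> carrier M\<rbrakk> \<Longrightarrow> f (x \<oplus>\<^bsub>M\<^esub> y) = f x \<oplus>\<^bsub>N\<^esub> f y"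
    "\<And>r x. \<lbrakk>r \<in> carrier R; x \<in> carrier M\<rbrakk> \<Longrightarrow> f (r \<odot>\<^bsub>M\<^esub> x) = r \<odot>\<^bsub>N\<^esub> f x"
  shows "(\<lambda>x \<in> carrier M. f x) \<in> mod_hom R M N"
proof -
  interpret rmodule R M by fact
  show ?thesis by (rule mod_homI) (use assms in auto)
qed

lemma mod_hom_eqI:
  "\<lbrakk>f \<in> mod_hom R M N; g \<in> mod_hom R M N; \<And>x. x \<in> carrier M \<Longrightarrow> f x = g x\<rbrakk> \<Longrightarrow> f = g"
  using mod_homD(4) by (intro extensionalityI[of f "carrier M" g]) auto

locale rmod_hom = M: rmodule R M + N: rmodule R N
  for R :: "('r, 'y) ring_scheme" (structure) and M N :: "('r, 'x) module" +
  fixes f assumes hom: "f \<in> mod_hom R M N"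
begin

lemmas closed [simp] = mod_homD(1)[OF hom] and add = mod_homD(2)[OF hom] and lin = mod_homD(3)[OF hom]

lemma zero [simp]: "f \<zero>\<^bsub>M\<^esub> = \<zero>\<^bsub>N\<^esub>"
  using lin[of \<zero> "\<zero>\<^bsub>M\<^esub>"] by simp

lemma neg: "x \<in> carrier M \<Longrightarrow> f (\<ominus>\<^bsub>M\<^esub> x) = \<ominus>\<^bsub>N\<^esub> f x"
  using lin[of "\<ominus> \<one>" x] by (simp add: M.smult_minus_one N.smult_minus_one)

lemma diff: "\<lbrakk>x \<in> carrier M; y \<in> carrier M\<rbrakk> \<Longrightarrow> f (x \<ominus>\<^bsub>M\<^esub> y) = f x \<ominus>\<^bsub>N\<^esub> f y"
  by (simp add: a_minus_def add neg)

lemma diff_zero: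
  assumes "x \<in> carrier M" "y \<in> carrier M"
  shows "f (x \<ominus>\<^bsub>M\<^esub> y) = \<zero>\<^bsub>N\<^esub> \<longleftrightarrow> f x = f y"
  using assms by (simp add: diff N.diff_eq_zero)

lemma kernel_iff: "x \<in> a_kernel M N f \<longleftrightarrow> x \<in> carrier M \<and> f x = \<zero>\<^bsub>N\<^esub>"
  by (simp add: a_kernel_def')

lemma vimage_submodule:
  assumes "submodule V R N"
  shows "submodule {x \<in> carrier M. f x \<in> V} R M"
  using submoduleD[OF assms] by (intro M.submoduleI) (auto simp: add lin)

lemma image_submodule:
  assumes "submodule U R M"
  shows "submodule (f ` U) R N"
proof -
  note U = submoduleD[OF assms]
  have c: "\<And>x. x \<in> U \<Longrightarrow> x \<in> carrier M" using U(1) by auto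
  show ?thesis
  proof (rule N.submoduleI)
    show "\<zero>\<^bsub>N\<^esub> \<in> f ` U" using U(2) zero by (metis image_eqI)
  next
    fix x y assume "x \<in> f ` U" "y \<in> f ` U"
    then show "x \<oplus>\<^bsub>N\<^esub> y \<in> f ` U" using U(3) c by (auto simp flip: add)
  next
    fix r x assume "r \<in> carrier R" "x \<in> f ` U"
    then show "r \<odot>\<^bsub>N\<^esub> x \<in> f ` U" using U(4) c by (auto simp flip: lin)
  qed (use c in auto)
qed

lemma inj_onI_kernel:
  assumes "\<And>x. x \<in> carrier M \<Longrightarrow> f x = \<zero>\<^bsub>N\<^esub> \<Longrightarrow> x = \<zero>\<^bsub>M\<^esub>"
  shows "inj_on f (carrier M)"
proof (rule inj_onI)
  fix x y assume xy: "x \<in> carrier M" "y \<in> carrier M" "f x = f y"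
  then have "x \<ominus>\<^bsub>M\<^esub> y = \<zero>\<^bsub>M\<^esub>" using assms[of "x \<ominus>\<^bsub>M\<^esub> y"] diff_zero by simp
  then show "x = y" using xy by (simp add: M.diff_eq_zero)
qed

lemma fin_gen_image:
  assumes "f ` carrier M = carrier N" "fin_gen R M"
  shows "fin_gen R N"
proof -
  obtain S where S: "finite S" "S \<subseteq> carrier M" "M.span S = carrier M" using assms(2) M.fin_gen_span by auto
  have fS: "f ` S \<subseteq> carrier N" using S by auto
  have "M.span S \<subseteq> {x \<in> carrier M. f x \<in> N.span (f ` S)}"
    using S N.span_submodule[OF fS] by (intro M.span_least vimage_submodule) auto
  then have "carrier M \<subseteq> {x \<in> carrier M. f x \<in> N.span (f ` S)}" unfolding S(3) .
  then have "carrier N \<subseteq> N.span (f ` S)" unfolding assms(1)[symmetric] by auto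
  then show ?thesis unfolding N.fin_gen_span
    using S fS submoduleD(1)[OF N.span_submodule(1)[OF fS]] by (intro exI[of _ "f ` S"]) auto
qed

lemma fin_len_image:
  assumes "f ` carrier M = carrier N" "M.fin_len"
  shows "N.fin_len"
proof -
  obtain \<mu> :: "'x set \<Rightarrow> nat" where \<mu>: "\<And>U V. \<lbrakk>submodule U R M; submodule V R M; U \<subset> V\<rbrakk> \<Longrightarrow> \<mu> U < \<mu> V"
    using assms(2) unfolding M.fin_len_def by blast
  have "\<mu> {x \<in> carrier M. f x \<in> U} < \<mu> {x \<in> carrier M. f x \<in> V}"
    if UV: "submodule U R N" "submodule V R N" "U \<subset> V" for U V
  proof (rule \<mu>)
    obtain y where "y \<in> V" "y \<notin> U" using psubset_imp_ex_mem[OF UV(3)] by auto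
    then have "y \<in> carrier N" using submoduleD(1)[OF UV(2)] by auto
    then obtain x where "x \<in> carrier M" "f x = y" unfolding assms(1)[symmetric] by blast
    then show "{x \<in> carrier M. f x \<in> U} \<subset> {x \<in> carrier M. f x \<in> V}"
      using UV(3) \<open>y \<in> V\<close> \<open>y \<notin> U\<close> by blast
  qed (use UV vimage_submodule in auto)
  then show ?thesis unfolding N.fin_len_def
    by (intro exI[of _ "\<lambda>U. \<mu> {x \<in> carrier M. f x \<in> U}"]) simp
qed

text \<open>The factorization is \<open>h\<close> evaluated at chosen preimages; the choice does not
  matter because the difference of two preimages is killed by \<open>f\<close>, hence by
  \<open>h\<close>.\<close>

lemma factor_through:
  assumes "f ` carrier M = carrier N" "rmodule R L" "h \<in> mod_hom R M L"
    "\<And>x. \<lbrakk>x \<in> carrier M; f x = \<zero>\<^bsub>N\<^esub>\<rbrakk> \<Longrightarrow> h x = \<zero>\<^bsub>L\<^esub>"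
  obtains h' where "h' \<in> mod_hom R N L" "\<And>x. x \<in> carrier M \<Longrightarrow> h' (f x) = h x"
proof -
  interpret L: rmodule R L by fact
  interpret h: rmod_hom R M L h by unfold_locales fact
  let ?s = "\<lambda>y. SOME x. x \<in> carrier M \<and> f x = y"
  have s: "?s y \<in> carrier M \<and> f (?s y) = y" if "y \<in> carrier N" for y
    by (rule someI_ex) (use that in \<open>auto simp flip: assms(1)\<close>)
  have eq: "h x = h y" if "x \<in> carrier M" "y \<in> carrier M" "f x = f y" for x y
    using assms(4)[of "x \<ominus>\<^bsub>M\<^esub> y"] that diff_zero h.diff_zero by simp
  let ?h = "\<lambda>y \<in> carrier N. h (?s y)"
  have h': "?h (f x) = h x" if "x \<in> carrier M" for x
  proof -
    have "h (?s (f x)) = h x" by (rule eq) (use that s[of "f x"] in simp_all)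
    then show ?thesis using that by simp
  qed
  have "?h \<in> mod_hom R N L"
  proof (rule mod_homI)
    fix x y assume xy: "x \<in> carrier N" "y \<in> carrier N"
    then obtain x' y' where "x' \<in> carrier M" "y' \<in> carrier M" "x = f x'" "y = f y'"
      unfolding assms(1)[symmetric] by blast
    then show "?h (x \<oplus>\<^bsub>N\<^esub> y) = ?h x \<oplus>\<^bsub>L\<^esub> ?h y"
      using h'[of "x' \<oplus>\<^bsub>M\<^esub> y'"] h'[of x'] h'[of y'] by (simp add: add h.add)
  next
    fix r x assume r: "r \<in> carrier R" "x \<in> carrier N"
    then obtain x' where "x' \<in> carrier M" "x = f x'" unfolding assms(1)[symmetric] by blast
    then show "?h (r \<odot>\<^bsub>N\<^esub> x) = r \<odot>\<^bsub>L\<^esub> ?h x"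
      using h'[of "r \<odot>\<^bsub>M\<^esub> x'"] h'[of x'] r by (simp add: lin h.lin)
  qed (use s in auto)
  then show thesis using that h' by blast
qed

end

lemma mod_hom_cmp:
  assumes "rmodule R L" "f \<in> mod_hom R L M" "g \<in> mod_hom R M N"
  shows "compose (carrier L) g f \<in> mod_hom R L N"
proof -
  interpret rmodule R L by fact
  note f = mod_homD[OF assms(2)] and g = mod_homD[OF assms(3)]
  show ?thesis by (rule mod_homI) (auto simp: compose_def f g)
qed

section \<open>Hom groups and quotient modules\<close>

context rmodule
begin

lemma mod_hom_id: "(\<lambda>x \<in> carrier M. x) \<in> mod_hom R M M"
  by (rule mod_hom_restrictI) (auto intro: rmodule_axioms)

lemma mod_hom_zero:
  assumes "rmodule R N"
  shows "(\<lambda>x \<in> carrier N. \<zero>\<^bsub>M\<^esub>) \<in> mod_hom R N M"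
  by (rule mod_hom_restrictI) (use assms in auto)

lemma mod_hom_add:
  assumes "rmodule R N" "f \<in> mod_hom R N M" "g \<in> mod_hom R N M"
  shows "(\<lambda>x \<in> carrier N. f x \<oplus>\<^bsub>M\<^esub> g x) \<in> mod_hom R N M"
proof -
  note f = mod_homD[OF assms(2)] and g = mod_homD[OF assms(3)]
  show ?thesis
    by (rule mod_hom_restrictI) (use assms(1) f g in \<open>auto simp: M.a_ac smult_r_distr\<close>)
qed

lemma mod_hom_neg:
  assumes "rmodule R N" "f \<in> mod_hom R N M"
  shows "(\<lambda>x \<in> carrier N. (\<ominus> \<one>) \<odot>\<^bsub>M\<^esub> f x) \<in> mod_hom R N M"
proof -
  note f = mod_homD[OF assms(2)]
  have "(\<ominus> \<one>) \<odot>\<^bsub>M\<^esub> (r \<odot>\<^bsub>M\<^esub> x) = r \<odot>\<^bsub>M\<^esub> ((\<ominus> \<one>) \<odot>\<^bsub>M\<^esub> x)" if "r \<in> carrier R" "x \<in> carrier M" for r x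
    using that by (simp flip: smult_assoc add: R.l_minus R.r_minus)
  then show ?thesis
    by (intro mod_hom_restrictI) (use assms(1) f in \<open>auto simp: smult_r_distr\<close>)
qed

text \<open>A quotient module is carried by a set of representatives of the cosets, so that it stays in the
  given type.\<close>

definition coset_rep :: "'x set \<Rightarrow> 'x \<Rightarrow> 'x" where
  "coset_rep U x = (SOME y. y \<in> carrier M \<and> x \<ominus>\<^bsub>M\<^esub> y \<in> U)"

definition quot :: "'x set \<Rightarrow> ('r, 'x) module" where
  "quot U = \<lparr>carrier = coset_rep U ` carrier M, mult = undefined, one = undefined,
     zero = coset_rep U \<zero>\<^bsub>M\<^esub>, add = (\<lambda>x y. coset_rep U (x \<oplus>\<^bsub>M\<^esub> y)),
     smult = (\<lambda>r x. coset_rep U (r \<odot>\<^bsub>M\<^esub> x))\<rparr>"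

lemma coset_rep:
  assumes "submodule U R M" "x \<in> carrier M"
  shows "coset_rep U x \<in> carrier M" "x \<ominus>\<^bsub>M\<^esub> coset_rep U x \<in> U"
    "y \<in> carrier M \<Longrightarrow> coset_rep U x = coset_rep U y \<longleftrightarrow> x \<ominus>\<^bsub>M\<^esub> y \<in> U"
proof -
  note U = submoduleD[OF assms(1)]
  have *: "coset_rep U x \<in> carrier M \<and> x \<ominus>\<^bsub>M\<^esub> coset_rep U x \<in> U" if "x \<in> carrier M" for x
    unfolding coset_rep_def by (rule someI[of _ x]) (use that U in \<open>auto simp: a_minus_def M.r_neg\<close>)
  show "coset_rep U x \<in> carrier M" "x \<ominus>\<^bsub>M\<^esub> coset_rep U x \<in> U" using * assms by auto
  assume y: "y \<in> carrier M"
  have id: "(a \<ominus>\<^bsub>M\<^esub> c) \<ominus>\<^bsub>M\<^esub> (b \<ominus>\<^bsub>M\<^esub> c) = a \<ominus>\<^bsub>M\<^esub> b" "(a \<ominus>\<^bsub>M\<^esub> b) \<oplus>\<^bsub>M\<^esub> (b \<ominus>\<^bsub>M\<^esub> c) = a \<ominus>\<^bsub>M\<^esub> c"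
    if "a \<in> carrier M" "b \<in> carrier M" "c \<in> carrier M" for a b c
  proof -
    have "c \<oplus>\<^bsub>M\<^esub> (\<ominus>\<^bsub>M\<^esub> b \<oplus>\<^bsub>M\<^esub> \<ominus>\<^bsub>M\<^esub> c) = \<ominus>\<^bsub>M\<^esub> b"
      using that M.a_lcomm[of c "\<ominus>\<^bsub>M\<^esub> b" "\<ominus>\<^bsub>M\<^esub> c"] by (simp add: M.r_neg)
    then show "(a \<ominus>\<^bsub>M\<^esub> c) \<ominus>\<^bsub>M\<^esub> (b \<ominus>\<^bsub>M\<^esub> c) = a \<ominus>\<^bsub>M\<^esub> b" "(a \<ominus>\<^bsub>M\<^esub> b) \<oplus>\<^bsub>M\<^esub> (b \<ominus>\<^bsub>M\<^esub> c) = a \<ominus>\<^bsub>M\<^esub> c"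
      using that by (simp_all add: a_minus_def M.minus_add M.a_ac M.r_neg1 M.r_neg2 M.r_neg M.l_neg)
  qed
  show "coset_rep U x = coset_rep U y \<longleftrightarrow> x \<ominus>\<^bsub>M\<^esub> y \<in> U"
  proof
    assume "coset_rep U x = coset_rep U y"
    then show "x \<ominus>\<^bsub>M\<^esub> y \<in> U"
      using *[OF assms(2)] *[OF y] id(1)[of x y "coset_rep U x"] U(6) assms(2) y by metis
  next
    assume xy: "x \<ominus>\<^bsub>M\<^esub> y \<in> U"
    then have yx: "y \<ominus>\<^bsub>M\<^esub> x \<in> U"
      using U(5)[of "x \<ominus>\<^bsub>M\<^esub> y"] assms y by (simp add: a_minus_def M.minus_add M.a_comm)
    have "x \<ominus>\<^bsub>M\<^esub> z \<in> U \<longleftrightarrow> y \<ominus>\<^bsub>M\<^esub> z \<in> U" if "z \<in> carrier M" for z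
      using id(2)[of x y z] id(2)[of y x z] U(3)[OF xy, of "y \<ominus>\<^bsub>M\<^esub> z"] U(3)[OF yx, of "x \<ominus>\<^bsub>M\<^esub> z"]
        assms(2) y that by auto
    \<comment> \<open>Congruent elements have the same choice predicate, and therefore the chosen
      representatives agree.\<close>
    then have "(\<lambda>z. z \<in> carrier M \<and> x \<ominus>\<^bsub>M\<^esub> z \<in> U) = (\<lambda>z. z \<in> carrier M \<and> y \<ominus>\<^bsub>M\<^esub> z \<in> U)" by blast
    then show "coset_rep U x = coset_rep U y" unfolding coset_rep_def by simp
  qed
qed

lemma quot_module:
  assumes "submodule U R M"
  shows "rmodule R (quot U)" "(\<lambda>x \<in> carrier M. coset_rep U x) \<in> mod_hom R M (quot U)"
    "coset_rep U ` carrier M = carrier (quot U)"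
    "x \<in> carrier M \<Longrightarrow> coset_rep U x = \<zero>\<^bsub>quot U\<^esub> \<longleftrightarrow> x \<in> U"
proof -
  note U = submoduleD[OF assms] and q = coset_rep[OF assms]
  let ?q = "coset_rep U"
  have id: "((a \<oplus>\<^bsub>M\<^esub> b) \<ominus>\<^bsub>M\<^esub> (c \<oplus>\<^bsub>M\<^esub> d)) = (a \<ominus>\<^bsub>M\<^esub> c) \<oplus>\<^bsub>M\<^esub> (b \<ominus>\<^bsub>M\<^esub> d)"
    if "a \<in> carrier M" "b \<in> carrier M" "c \<in> carrier M" "d \<in> carrier M" for a b c d
    using that by (simp add: a_minus_def M.minus_add M.a_ac)
  have id': "(r \<odot>\<^bsub>M\<^esub> a) \<ominus>\<^bsub>M\<^esub> (r \<odot>\<^bsub>M\<^esub> b) = r \<odot>\<^bsub>M\<^esub> (a \<ominus>\<^bsub>M\<^esub> b)"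
    if "a \<in> carrier M" "b \<in> carrier M" "r \<in> carrier R" for a b r
  proof -
    have "r \<odot>\<^bsub>M\<^esub> (\<ominus>\<^bsub>M\<^esub> b) \<oplus>\<^bsub>M\<^esub> r \<odot>\<^bsub>M\<^esub> b = \<zero>\<^bsub>M\<^esub>"
      using that by (simp flip: smult_r_distr add: M.l_neg)
    then have "\<ominus>\<^bsub>M\<^esub> (r \<odot>\<^bsub>M\<^esub> b) = r \<odot>\<^bsub>M\<^esub> (\<ominus>\<^bsub>M\<^esub> b)" using that by (intro M.minus_equality) auto
    then show ?thesis using that by (simp add: a_minus_def smult_r_distr)
  qed
  have add: "?q (?q a \<oplus>\<^bsub>M\<^esub> ?q b) = ?q (a \<oplus>\<^bsub>M\<^esub> b)" if "a \<in> carrier M" "b \<in> carrier M" for a b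
    using q(1,2)[OF that(1)] q(1,2)[OF that(2)] that q(3)[of "a \<oplus>\<^bsub>M\<^esub> b" "?q a \<oplus>\<^bsub>M\<^esub> ?q b"] U(3)
    by (simp add: id)
  have sm: "?q (r \<odot>\<^bsub>M\<^esub> ?q a) = ?q (r \<odot>\<^bsub>M\<^esub> a)" if "a \<in> carrier M" "r \<in> carrier R" for a r
    using q(1,2)[OF that(1)] that U(4) q(3)[of "r \<odot>\<^bsub>M\<^esub> a" "r \<odot>\<^bsub>M\<^esub> ?q a"] by (simp add: id')
  have c: "carrier (quot U) = ?q ` carrier M" and z: "\<zero>\<^bsub>quot U\<^esub> = ?q \<zero>\<^bsub>M\<^esub>" by (simp_all add: quot_def)
  have a: "?q a \<oplus>\<^bsub>quot U\<^esub> ?q b = ?q (a \<oplus>\<^bsub>M\<^esub> b)" if "a \<in> carrier M" "b \<in> carrier M" for a b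
    using add[OF that] by (simp add: quot_def)
  have s: "r \<odot>\<^bsub>quot U\<^esub> ?q a = ?q (r \<odot>\<^bsub>M\<^esub> a)" if "a \<in> carrier M" "r \<in> carrier R" for a r
    using sm[OF that] by (simp add: quot_def)
  have "abelian_group (quot U)"
  proof (rule abelian_groupI)
    fix x assume "x \<in> carrier (quot U)"
    then obtain x' where "x' \<in> carrier M" "x = ?q x'" by (auto simp: c)
    then show "\<exists>y \<in> carrier (quot U). y \<oplus>\<^bsub>quot U\<^esub> x = \<zero>\<^bsub>quot U\<^esub>"
      by (intro bexI[of _ "?q (\<ominus>\<^bsub>M\<^esub> x')"]) (auto simp: c a z M.l_neg)
  qed (auto simp: c a z M.a_ac simp del: q(3))
  then show "rmodule R (quot U)"
    by (intro rmodule.intro rmodule_axioms.intro R.ring_axioms)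
      (auto simp: c a s smult_assoc smult_l_distr smult_r_distr simp del: q(3))
  show "(\<lambda>x \<in> carrier M. ?q x) \<in> mod_hom R M (quot U)"
    by (rule mod_hom_restrictI[OF rmodule_axioms]) (auto simp: c a s)
  show "?q ` carrier M = carrier (quot U)" by (simp add: quot_def)
  show "x \<in> carrier M \<Longrightarrow> ?q x = \<zero>\<^bsub>quot U\<^esub> \<longleftrightarrow> x \<in> U"
    using q(3)[of x "\<zero>\<^bsub>M\<^esub>"] M.minus_equality[of "\<zero>\<^bsub>M\<^esub>" "\<zero>\<^bsub>M\<^esub>"] by (simp add: quot_def a_minus_def)
qed

end

section \<open>The category of finitely generated modules and its exact sequences\<close>

lemma mod_add_simps [simp]:
  "Obj (mod_add R) = {M. right_module R M \<and> fin_gen R M}"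
  "Hom (mod_add R) M N = {(M', N', f). M' = M \<and> N' = N \<and> f \<in> mod_hom R M N}"
  "ident (mod_add R) M = (M, M, \<lambda>x \<in> carrier M. x)"
  "cmp (mod_add R) (N', L, g) (M, N, f) = (M, L, compose (carrier M) g f)"
  "zer (mod_add R) M N = (M, N, \<lambda>x \<in> carrier M. \<zero>\<^bsub>N\<^esub>)"
  "pls (mod_add R) (M, N, f) (M', N', g) = (M, N, \<lambda>x \<in> carrier M. f x \<oplus>\<^bsub>N\<^esub> g x)"
  by (simp_all add: mod_add_def)

lemma mod_cat_simps [simp]:
  "Obj (mod_cat R) = Obj (mod_add R)" "Hom (mod_cat R) = Hom (mod_add R)"
  "ident (mod_cat R) = ident (mod_add R)" "cmp (mod_cat R) = cmp (mod_add R)"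
  "zer (mod_cat R) = zer (mod_add R)" "pls (mod_cat R) = pls (mod_add R)"
  "carrier (Ext (mod_cat R) X A) = yoneda_ext R X A" "one (Ext (mod_cat R) X A) = split_class R X A"
  "rlz (mod_cat R) X A \<xi> = \<xi>"
  "carrier (NExt (mod_cat R) X A) = {()}" "one (NExt (mod_cat R) X A) = ()"
  by (simp_all add: mod_cat_def)

lemma preadditive_mod_add:
  assumes "ring R"
  shows "preadditive (mod_add R)"
proof (intro preadditive.intro category.intro preadditive_axioms.intro)
  fix X Y :: "('a, 'c) module"
  assume XY: "X \<in> Obj (mod_add R)" "Y \<in> Obj (mod_add R)"
  interpret X: rmodule R X using XY by (simp add: rmodule_iff)
  interpret Y: rmodule R Y using XY by (simp add: rmodule_iff)
  show "comm_group (hom_group (mod_add R) X Y)"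
  proof (rule comm_groupI)
    fix F assume "F \<in> carrier (hom_group (mod_add R) X Y)"
    then obtain f where f: "F = (X, Y, f)" "f \<in> mod_hom R X Y" by (auto simp: hom_group_def)
    note g = Y.mod_hom_neg[OF X.rmodule_axioms f(2)]
    have "(\<lambda>x \<in> carrier X. (\<ominus>\<^bsub>R\<^esub> \<one>\<^bsub>R\<^esub>) \<odot>\<^bsub>Y\<^esub> f x \<oplus>\<^bsub>Y\<^esub> f x) = (\<lambda>x \<in> carrier X. \<zero>\<^bsub>Y\<^esub>)"
      using mod_homD(1)[OF f(2)] by (auto simp: Y.smult_minus_one Y.M.l_neg intro!: restrict_ext)
    then show "\<exists>G \<in> carrier (hom_group (mod_add R) X Y). G \<otimes>\<^bsub>hom_group (mod_add R) X Y\<^esub> F =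
        \<one>\<^bsub>hom_group (mod_add R) X Y\<^esub>"
      using f g by (intro bexI[of _ "(X, Y, \<lambda>x \<in> carrier X. (\<ominus>\<^bsub>R\<^esub> \<one>\<^bsub>R\<^esub>) \<odot>\<^bsub>Y\<^esub> f x)"])
        (simp_all add: hom_group_def cong: restrict_cong)
  next
    fix F assume "F \<in> carrier (hom_group (mod_add R) X Y)"
    then obtain f where f: "F = (X, Y, f)" "f \<in> mod_hom R X Y" by (auto simp: hom_group_def)
    then show "\<one>\<^bsub>hom_group (mod_add R) X Y\<^esub> \<otimes>\<^bsub>hom_group (mod_add R) X Y\<^esub> F = F"
      using mod_homD(1,4)[OF f(2)] by (auto simp: hom_group_def intro!: extensionalityI[of _ "carrier X"])
  next
    fix F G assume "F \<in> carrier (hom_group (mod_add R) X Y)" "G \<in> carrier (hom_group (mod_add R) X Y)"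
    then obtain f g where f: "F = (X, Y, f)" "f \<in> mod_hom R X Y" "G = (X, Y, g)" "g \<in> mod_hom R X Y"
      by (auto simp: hom_group_def)
    show "F \<otimes>\<^bsub>hom_group (mod_add R) X Y\<^esub> G \<in> carrier (hom_group (mod_add R) X Y)"
      using f Y.mod_hom_add[OF X.rmodule_axioms] by (simp add: hom_group_def)
    show "F \<otimes>\<^bsub>hom_group (mod_add R) X Y\<^esub> G = G \<otimes>\<^bsub>hom_group (mod_add R) X Y\<^esub> F"
      using f mod_homD(1)[OF f(2)] mod_homD(1)[OF f(4)]
      by (auto simp: hom_group_def Y.M.a_comm intro!: restrict_ext)
  next
    fix F G H assume "F \<in> carrier (hom_group (mod_add R) X Y)" "G \<in> carrier (hom_group (mod_add R) X Y)"
      "H \<in> carrier (hom_group (mod_add R) X Y)"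
    then obtain f g h where f: "F = (X, Y, f)" "f \<in> mod_hom R X Y" "G = (X, Y, g)" "g \<in> mod_hom R X Y"
      "H = (X, Y, h)" "h \<in> mod_hom R X Y" by (auto simp: hom_group_def)
    show "F \<otimes>\<^bsub>hom_group (mod_add R) X Y\<^esub> G \<otimes>\<^bsub>hom_group (mod_add R) X Y\<^esub> H =
        F \<otimes>\<^bsub>hom_group (mod_add R) X Y\<^esub> (G \<otimes>\<^bsub>hom_group (mod_add R) X Y\<^esub> H)"
      using f mod_homD(1)[OF f(2)] mod_homD(1)[OF f(4)] mod_homD(1)[OF f(6)]
      by (auto simp: hom_group_def Y.M.a_assoc intro!: restrict_ext)
  qed (use Y.mod_hom_zero[OF X.rmodule_axioms] in \<open>simp add: hom_group_def\<close>)
next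
  fix X Y Z :: "('a, 'c) module" and F G
  assume "X \<in> Obj (mod_add R)" "Y \<in> Obj (mod_add R)" "Z \<in> Obj (mod_add R)"
    and FG: "F \<in> Hom (mod_add R) X Y" "G \<in> Hom (mod_add R) Y Z"
  then show "G \<bullet>\<^bsub>mod_add R\<^esub> F \<in> Hom (mod_add R) X Z"
    using mod_hom_cmp by (fastforce simp: rmodule_iff)
next
  fix X :: "('a, 'c) module"
  assume "X \<in> Obj (mod_add R)"
  then show "ident (mod_add R) X \<in> Hom (mod_add R) X X"
    using rmodule.mod_hom_id by (auto simp flip: rmodule_iff)
next
  fix W X Y Z :: "('a, 'c) module" and F G H
  assume "F \<in> Hom (mod_add R) W X" "G \<in> Hom (mod_add R) X Y" "H \<in> Hom (mod_add R) Y Z"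
  then obtain f g h where f: "F = (W, X, f)" "f \<in> mod_hom R W X" "G = (X, Y, g)" "g \<in> mod_hom R X Y"
    "H = (Y, Z, h)" "h \<in> mod_hom R Y Z" by auto
  show "H \<bullet>\<^bsub>mod_add R\<^esub> G \<bullet>\<^bsub>mod_add R\<^esub> F = H \<bullet>\<^bsub>mod_add R\<^esub> (G \<bullet>\<^bsub>mod_add R\<^esub> F)"
    using f mod_homD(1)[OF f(2)] by (auto simp: compose_def intro!: restrict_ext)
next
  fix X Y :: "('a, 'c) module" and F
  assume "F \<in> Hom (mod_add R) X Y"
  then obtain f where f: "F = (X, Y, f)" "f \<in> mod_hom R X Y" by auto
  show "F \<bullet>\<^bsub>mod_add R\<^esub> ident (mod_add R) X = F" "ident (mod_add R) Y \<bullet>\<^bsub>mod_add R\<^esub> F = F"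
    using f mod_homD(1,4)[OF f(2)]
    by (auto simp: compose_def intro!: extensionalityI[of _ "carrier X"])
next
  fix X Y Z :: "('a, 'c) module" and F G G'
  assume "F \<in> Hom (mod_add R) X Y" "G \<in> Hom (mod_add R) Y Z" "G' \<in> Hom (mod_add R) Y Z"
  then obtain f g g' where f: "F = (X, Y, f)" "f \<in> mod_hom R X Y" "G = (Y, Z, g)" "G' = (Y, Z, g')" by auto
  show "(G \<boxplus>\<^bsub>mod_add R\<^esub> G') \<bullet>\<^bsub>mod_add R\<^esub> F = G \<bullet>\<^bsub>mod_add R\<^esub> F \<boxplus>\<^bsub>mod_add R\<^esub> G' \<bullet>\<^bsub>mod_add R\<^esub> F"
    using f mod_homD(1)[OF f(2)] by (auto simp: compose_def intro!: restrict_ext)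
next
  fix X Y Z :: "('a, 'c) module" and F F' G
  assume "F \<in> Hom (mod_add R) X Y" "F' \<in> Hom (mod_add R) X Y" "G \<in> Hom (mod_add R) Y Z"
  then obtain f f' g where f: "F = (X, Y, f)" "f \<in> mod_hom R X Y" "F' = (X, Y, f')" "f' \<in> mod_hom R X Y"
    "G = (Y, Z, g)" "g \<in> mod_hom R Y Z" by auto
  show "G \<bullet>\<^bsub>mod_add R\<^esub> (F \<boxplus>\<^bsub>mod_add R\<^esub> F') = G \<bullet>\<^bsub>mod_add R\<^esub> F \<boxplus>\<^bsub>mod_add R\<^esub> G \<bullet>\<^bsub>mod_add R\<^esub> F'"
    using f mod_homD(1)[OF f(2)] mod_homD(1)[OF f(4)] mod_homD(2)[OF f(6)]
    by (auto simp: compose_def intro!: restrict_ext)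
qed auto

lemma preadditive_mod_cat:
  assumes "ring R"
  shows "preadditive (mod_cat R)"
  using preadditive_mod_add[OF assms]
  unfolding preadditive_def preadditive_axioms_def category_def hom_group_def mod_cat_simps .

text \<open>\<open>mod_cat\<close> copies the preadditive fields of \<open>mod_add\<close>, so
  notions that involve only these fields agree.\<close>

lemma mod_cat_transfer:
  "is_iso (mod_cat R) = is_iso (mod_add R)" "biproduct (mod_cat R) = biproduct (mod_add R)"
  "is_zero_obj (mod_cat R) = is_zero_obj (mod_add R)" "isomorphic (mod_cat R) = isomorphic (mod_add R)"
  by (intro ext, simp add: is_iso_def biproduct_def is_zero_obj_def isomorphic_def)+

lemma mod_ObjD: "M \<in> Obj (mod_add R) \<Longrightarrow> rmodule R M"
  by (simp add: rmodule_iff)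

lemma mod_ObjI: "\<lbrakk>rmodule R M; fin_gen R M\<rbrakk> \<Longrightarrow> M \<in> Obj (mod_add R)"
  by (simp add: rmodule_iff)

lemma compose_eq_iff:
  assumes "h \<in> extensional (carrier M)"
  shows "compose (carrier M) g f = h \<longleftrightarrow> (\<forall>x \<in> carrier M. g (f x) = h x)"
proof
  assume "\<forall>x \<in> carrier M. g (f x) = h x"
  then show "compose (carrier M) g f = h"
    using assms by (intro extensionalityI[of _ "carrier M"]) (auto simp: compose_def)
qed (auto simp: compose_def)

lemma is_iso_modI:
  assumes "rmodule R M" "rmodule R N" "f \<in> mod_hom R M N" "inj_on f (carrier M)" "f ` carrier M = carrier N"
  shows "is_iso (mod_add R) M N (M, N, f)"
proof -
  interpret f: rmod_hom R M N f by (intro rmod_hom.intro rmod_hom_axioms.intro assms)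
  obtain g where g: "g \<in> mod_hom R N M" "\<And>x. x \<in> carrier M \<Longrightarrow> g (f x) = (\<lambda>x \<in> carrier M. x) x"
    using f.factor_through[OF assms(5,1) f.M.mod_hom_id] inj_onD[OF assms(4)] f.M.M.zero_closed f.zero
    by (metis restrict_apply')
  have "f (g y) = y" if "y \<in> carrier N" for y
    using that g(2) unfolding assms(5)[symmetric] by auto
  then show ?thesis
    unfolding is_iso_def using assms(3) g
    by (auto intro!: bexI[of _ "(N, M, g)"] simp: compose_eq_iff)
qed

lemma is_iso_modD:
  assumes "is_iso (mod_add R) M N F" "rmodule R M" "rmodule R N"
  obtains f g where "F = (M, N, f)" "f \<in> mod_hom R M N" "g \<in> mod_hom R N M"
    "\<And>x. x \<in> carrier M \<Longrightarrow> g (f x) = x" "\<And>x. x \<in> carrier N \<Longrightarrow> f (g x) = x"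
proof -
  from assms(1) obtain f g where "F = (M, N, f)" "f \<in> mod_hom R M N" "g \<in> mod_hom R N M"
    "compose (carrier M) g f = (\<lambda>x \<in> carrier M. x)" "compose (carrier N) f g = (\<lambda>x \<in> carrier N. x)"
    unfolding is_iso_def by auto
  then show thesis using that by (simp add: compose_eq_iff)
qed

text \<open>Short exact sequences in terms of bare functions, whereas \<open>short_exact\<close>
  speaks of morphisms that carry their modules along.\<close>

definition ses :: "('r, 'y) ring_scheme \<Rightarrow> ('r, 'x) module \<Rightarrow> ('x \<Rightarrow> 'x) \<Rightarrow> ('r, 'x) module
    \<Rightarrow> ('x \<Rightarrow> 'x) \<Rightarrow> ('r, 'x) module \<Rightarrow> bool" where
  "ses R A f M g X \<longleftrightarrow> A \<in> Obj (mod_add R) \<and> M \<in> Obj (mod_add R) \<and> X \<in> Obj (mod_add R) \<and>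
     f \<in> mod_hom R A M \<and> g \<in> mod_hom R M X \<and> inj_on f (carrier A) \<and>
     f ` carrier A = {x \<in> carrier M. g x = \<zero>\<^bsub>X\<^esub>} \<and> g ` carrier M = carrier X"

lemma short_exact_iff:
  "(B, F, G) \<in> short_exact R A X \<longleftrightarrow> (\<exists>f g. F = (A, B, f) \<and> G = (B, X, g) \<and> ses R A f B g X)"
  unfolding short_exact_def ses_def a_kernel_def' by auto

text \<open>A conflation is a member of an isomorphism class with an exact representative; exactness
  is carried along the isomorphism of middle terms.\<close>

lemma conflation_modD:
  assumes "conflation (mod_cat R) A F M G X \<xi>"
  obtains f g where "F = (A, M, f)" "G = (M, X, g)" "ses R A f M g X"
proof -
  from assms obtain B F0 G0 where se: "(B, F0, G0) \<in> short_exact R A X" "(M, F, G) \<in> seq_class (mod_add R) A X (B, F0, G0)"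
    and AX: "A \<in> Obj (mod_add R)" "X \<in> Obj (mod_add R)"
    unfolding conflation_def by (auto simp: yoneda_ext_def)
  from se(1) obtain f0 g0 where s0: "F0 = (A, B, f0)" "G0 = (B, X, g0)" "ses R A f0 B g0 X"
    by (auto simp: short_exact_iff)
  from se(2) obtain b where M: "M \<in> Obj (mod_add R)" and b: "is_iso (mod_add R) B M b"
    "b \<bullet>\<^bsub>mod_add R\<^esub> F0 = F" "G \<bullet>\<^bsub>mod_add R\<^esub> b = G0" and FG: "F \<in> Hom (mod_add R) A M" "G \<in> Hom (mod_add R) M X"
    by (auto simp: seq_class_def)
  from FG obtain f g where fg: "F = (A, M, f)" "f \<in> mod_hom R A M" "G = (M, X, g)" "g \<in> mod_hom R M X" by auto
  have B: "B \<in> Obj (mod_add R)" using s0 by (simp add: ses_def)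
  obtain \<beta> \<gamma> where \<beta>: "b = (B, M, \<beta>)" "\<beta> \<in> mod_hom R B M" "\<gamma> \<in> mod_hom R M B"
    "\<And>x. x \<in> carrier B \<Longrightarrow> \<gamma> (\<beta> x) = x" "\<And>x. x \<in> carrier M \<Longrightarrow> \<beta> (\<gamma> x) = x"
    using is_iso_modD[OF b(1) mod_ObjD[OF B] mod_ObjD[OF M]] by metis
  note f0 = mod_homD(1)[of f0 R A B]
  have s: "f0 \<in> mod_hom R A B" "inj_on f0 (carrier A)" "f0 ` carrier A = {x \<in> carrier B. g0 x = \<zero>\<^bsub>X\<^esub>}"
    "g0 ` carrier B = carrier X" using s0 by (auto simp: ses_def)
  have 1: "f x = \<beta> (f0 x)" if "x \<in> carrier A" for x
    using b(2) that unfolding s0 \<beta> fg by (auto simp: compose_def)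
  have 2: "g0 x = g (\<beta> x)" if "x \<in> carrier B" for x
    using b(3) that unfolding s0 \<beta> fg by (auto simp: compose_def)
  have \<gamma>: "\<gamma> x \<in> carrier B" if "x \<in> carrier M" for x using mod_homD(1)[OF \<beta>(3)] that by simp
  have \<beta>c: "\<beta> x \<in> carrier M" if "x \<in> carrier B" for x using mod_homD(1)[OF \<beta>(2)] that by simp
  have "inj_on f (carrier A)"
    using s(2) f0[OF s(1)] 1 \<beta>(4) unfolding inj_on_def by metis
  moreover have "f ` carrier A = {x \<in> carrier M. g x = \<zero>\<^bsub>X\<^esub>}"
  proof -
    have "f ` carrier A = \<beta> ` f0 ` carrier A" using 1 by (auto simp: image_image)
    also have "\<dots> = {x \<in> carrier M. g x = \<zero>\<^bsub>X\<^esub>}"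
      unfolding s(3)
    proof (intro equalityI subsetI)
      fix x assume "x \<in> {x \<in> carrier M. g x = \<zero>\<^bsub>X\<^esub>}"
      then show "x \<in> \<beta> ` {x \<in> carrier B. g0 x = \<zero>\<^bsub>X\<^esub>}"
        using \<gamma>[of x] \<beta>(5)[of x] 2[of "\<gamma> x"] by (intro image_eqI[of _ _ "\<gamma> x"]) auto
    qed (use 2 \<beta>c in auto)
    finally show ?thesis .
  qed
  moreover have "g ` carrier M = carrier X"
  proof
    show "carrier X \<subseteq> g ` carrier M"
      unfolding s(4)[symmetric] using 2 \<beta>c by auto
  qed (use mod_homD(1)[OF fg(4)] in auto)
  ultimately have "ses R A f M g X" unfolding ses_def using fg(2,4) AX M by (intro conjI)
  then show thesis by (rule that[OF fg(1,3)])
qed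

lemma conflation_modI:
  assumes "ring R" "ses R A f M g X"
  shows "\<exists>\<xi>. conflation (mod_cat R) A (A, M, f) M (M, X, g) X \<xi>"
proof -
  interpret preadditive "mod_add R :: (('a, 'c) module, ('a, 'c) mod_mor) preadd" by (rule preadditive_mod_add[OF assms(1)])
  have M: "M \<in> Obj (mod_add R)" using assms by (simp add: ses_def)
  have "is_iso (mod_add R) M M (ident (mod_add R) M)"
    using M is_isoI[of "ident (mod_add R) M" M M "ident (mod_add R) M"] ident_closed by (simp del: mod_add_simps)
  moreover have "ident (mod_add R) M \<bullet>\<^bsub>mod_add R\<^esub> (A, M, f) = (A, M, f)" "(M, X, g) \<bullet>\<^bsub>mod_add R\<^esub> ident (mod_add R) M = (M, X, g)"
    using assms cmp_ident_left[of A M "(A, M, f)"] cmp_ident_right[of M X "(M, X, g)"]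
    by (auto simp: ses_def simp del: mod_add_simps(1,3))
  ultimately have "(M, (A, M, f), (M, X, g)) \<in> seq_class (mod_add R) A X (M, (A, M, f), (M, X, g))"
    unfolding seq_class_def prod.case mem_Collect_eq using assms(2) M
    by (intro conjI exI[of _ "ident (mod_add R) M"]) (simp_all add: ses_def del: mod_add_simps(1,3,4))
  moreover have "(M, (A, M, f), (M, X, g)) \<in> short_exact R A X"
    using assms(2) by (auto simp: short_exact_iff)
  ultimately have "conflation (mod_cat R) A (A, M, f) M (M, X, g) X (seq_class (mod_add R) A X (M, (A, M, f), (M, X, g)))"
    unfolding conflation_def using assms(2) by (auto simp: yoneda_ext_def ses_def simp del: mod_add_simps)
  then show ?thesis by blast
qed

lemma ses_split:
  assumes "ses R A f M g X" "s \<in> mod_hom R X M" "\<And>x. x \<in> carrier X \<Longrightarrow> g (s x) = x"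
  shows "\<exists>p. biproduct (mod_add R) A X M (A, M, f) (X, M, s) p (M, X, g)"
proof -
  have O: "A \<in> Obj (mod_add R)" "M \<in> Obj (mod_add R)" "X \<in> Obj (mod_add R)"
    and h: "f \<in> mod_hom R A M" "g \<in> mod_hom R M X" and inj: "inj_on f (carrier A)"
    and ex: "f ` carrier A = {x \<in> carrier M. g x = \<zero>\<^bsub>X\<^esub>}" using assms(1) by (auto simp: ses_def)
  interpret f: rmod_hom R A M f using O h mod_ObjD by (intro rmod_hom.intro rmod_hom_axioms.intro)
  interpret g: rmod_hom R M X g using O h mod_ObjD by (intro rmod_hom.intro rmod_hom_axioms.intro)
  interpret s: rmod_hom R X M s using O assms(2) mod_ObjD by (intro rmod_hom.intro rmod_hom_axioms.intro)
  \<comment> \<open>The retraction is forced: f (p x) has to be x - s (g x), which lies in the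
    kernel of \<open>g\<close> and hence in the image of \<open>f\<close>.\<close>
  have "x \<ominus>\<^bsub>M\<^esub> s (g x) \<in> f ` carrier A" if "x \<in> carrier M" for x
    unfolding ex using that assms(3) by (simp add: g.diff g.N.diff_eq_zero)
  then have "\<forall>x \<in> carrier M. \<exists>a. a \<in> carrier A \<and> f a = x \<ominus>\<^bsub>M\<^esub> s (g x)" by (metis imageE)
  then obtain p0 where p0: "\<And>x. x \<in> carrier M \<Longrightarrow> p0 x \<in> carrier A \<and> f (p0 x) = x \<ominus>\<^bsub>M\<^esub> s (g x)" by metis
  define p where "p = (\<lambda>x \<in> carrier M. p0 x)"
  have p: "\<And>x. x \<in> carrier M \<Longrightarrow> p x \<in> carrier A" "\<And>x. x \<in> carrier M \<Longrightarrow> f (p x) = x \<ominus>\<^bsub>M\<^esub> s (g x)"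
    using p0 by (auto simp: p_def)
  have ring: "(a \<oplus>\<^bsub>M\<^esub> b) \<ominus>\<^bsub>M\<^esub> (c \<oplus>\<^bsub>M\<^esub> d) = (a \<ominus>\<^bsub>M\<^esub> c) \<oplus>\<^bsub>M\<^esub> (b \<ominus>\<^bsub>M\<^esub> d)"
    if "a \<in> carrier M" "b \<in> carrier M" "c \<in> carrier M" "d \<in> carrier M" for a b c d
    using that by (simp add: a_minus_def f.N.M.minus_add f.N.M.a_ac)
  have smm: "r \<odot>\<^bsub>M\<^esub> (a \<ominus>\<^bsub>M\<^esub> b) = (r \<odot>\<^bsub>M\<^esub> a) \<ominus>\<^bsub>M\<^esub> (r \<odot>\<^bsub>M\<^esub> b)"
    if "a \<in> carrier M" "b \<in> carrier M" "r \<in> carrier R" for a b r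
  proof -
    have "r \<odot>\<^bsub>M\<^esub> (\<ominus>\<^bsub>M\<^esub> b) \<oplus>\<^bsub>M\<^esub> r \<odot>\<^bsub>M\<^esub> b = \<zero>\<^bsub>M\<^esub>"
      using that by (simp flip: f.N.smult_r_distr add: f.N.M.l_neg)
    then have "\<ominus>\<^bsub>M\<^esub> (r \<odot>\<^bsub>M\<^esub> b) = r \<odot>\<^bsub>M\<^esub> (\<ominus>\<^bsub>M\<^esub> b)" using that by (intro f.N.M.minus_equality) auto
    then show ?thesis using that by (simp add: a_minus_def f.N.smult_r_distr)
  qed
  have phom: "p \<in> mod_hom R M A"
  proof (rule mod_homI)
    fix x y assume xy: "x \<in> carrier M" "y \<in> carrier M"
    then have "f (p (x \<oplus>\<^bsub>M\<^esub> y)) = f (p x \<oplus>\<^bsub>A\<^esub> p y)" by (simp add: p f.add g.add s.add ring)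
    then show "p (x \<oplus>\<^bsub>M\<^esub> y) = p x \<oplus>\<^bsub>A\<^esub> p y" by (rule inj_onD[OF inj]) (use xy p(1) in simp_all)
  next
    fix r x assume rx: "r \<in> carrier R" "x \<in> carrier M"
    then have "f (p (r \<odot>\<^bsub>M\<^esub> x)) = f (r \<odot>\<^bsub>A\<^esub> p x)" by (simp add: p f.lin g.lin s.lin smm)
    then show "p (r \<odot>\<^bsub>M\<^esub> x) = r \<odot>\<^bsub>A\<^esub> p x" by (rule inj_onD[OF inj]) (use rx p(1) in simp_all)
  qed (use p in \<open>auto simp: p_def\<close>)
  have gf: "g (f x) = \<zero>\<^bsub>X\<^esub>" if "x \<in> carrier A" for x using ex that by blast
  have pf: "p (f x) = x" if "x \<in> carrier A" for x
  proof (rule inj_onD[OF inj])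
    show "f (p (f x)) = f x"
      using that p(2)[of "f x"] gf[OF that] f.N.M.minus_equality[of "\<zero>\<^bsub>M\<^esub>" "\<zero>\<^bsub>M\<^esub>"] by (simp add: a_minus_def)
  qed (use that p(1) in simp_all)
  have ps: "p (s x) = \<zero>\<^bsub>A\<^esub>" if "x \<in> carrier X" for x
  proof (rule inj_onD[OF inj])
    show "f (p (s x)) = f \<zero>\<^bsub>A\<^esub>" using that p(2)[of "s x"] assms(3) by (simp add: f.N.diff_eq_zero)
  qed (use that p(1) in simp_all)
  have sum: "f (p x) \<oplus>\<^bsub>M\<^esub> s (g x) = x" if "x \<in> carrier M" for x
    using that p(2)[of x] by (simp add: a_minus_def f.N.M.a_assoc f.N.M.l_neg)
  have "biproduct (mod_add R) A X M (A, M, f) (X, M, s) (M, A, p) (M, X, g)"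
    unfolding biproduct_def using O h assms(2) phom
    by (auto simp: compose_def pf ps gf sum assms(3) simp del: mod_add_simps(1) intro!: restrict_ext)
  then show ?thesis by blast
qed

lemma biproduct_ses:
  assumes "biproduct (mod_add R) A X B i1 i2 p1 p2"
  obtains f g where "i1 = (A, B, f)" "p2 = (B, X, g)" "ses R A f B g X"
proof -
  have O: "A \<in> Obj (mod_add R)" "B \<in> Obj (mod_add R)" "X \<in> Obj (mod_add R)"
    using assms unfolding biproduct_def by auto
  from assms obtain f s p g where h: "i1 = (A, B, f)" "i2 = (X, B, s)" "p1 = (B, A, p)" "p2 = (B, X, g)"
    "f \<in> mod_hom R A B" "s \<in> mod_hom R X B" "p \<in> mod_hom R B A" "g \<in> mod_hom R B X"
    unfolding biproduct_def by auto
  interpret f: rmod_hom R A B f using O h mod_ObjD by (intro rmod_hom.intro rmod_hom_axioms.intro)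
  interpret s: rmod_hom R X B s using O h mod_ObjD by (intro rmod_hom.intro rmod_hom_axioms.intro)
  interpret p: rmod_hom R B A p using O h mod_ObjD by (intro rmod_hom.intro rmod_hom_axioms.intro)
  interpret g: rmod_hom R B X g using O h mod_ObjD by (intro rmod_hom.intro rmod_hom_axioms.intro)
  have e: "compose (carrier A) p f = (\<lambda>x \<in> carrier A. x)" "compose (carrier X) g s = (\<lambda>x \<in> carrier X. x)"
    "compose (carrier A) g f = (\<lambda>x \<in> carrier A. \<zero>\<^bsub>X\<^esub>)"
    "(\<lambda>x \<in> carrier B. compose (carrier B) f p x \<oplus>\<^bsub>B\<^esub> compose (carrier B) s g x) = (\<lambda>x \<in> carrier B. x)"
    using assms unfolding biproduct_def h by auto
  have pf: "p (f x) = x" "g (f x) = \<zero>\<^bsub>X\<^esub>" if "x \<in> carrier A" for x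
    using e(1,3) that by (auto simp: compose_eq_iff)
  have gs: "g (s x) = x" if "x \<in> carrier X" for x using e(2) that by (auto simp: compose_eq_iff)
  have sum: "f (p x) \<oplus>\<^bsub>B\<^esub> s (g x) = x" if "x \<in> carrier B" for x
    using fun_cong[OF e(4), of x] that by (simp add: compose_def)
  have "inj_on f (carrier A)" by (rule inj_on_inverseI[of _ p]) (rule pf)
  moreover have "f ` carrier A = {x \<in> carrier B. g x = \<zero>\<^bsub>X\<^esub>}"
  proof (intro equalityI subsetI)
    fix x assume "x \<in> {x \<in> carrier B. g x = \<zero>\<^bsub>X\<^esub>}"
    then show "x \<in> f ` carrier A" using sum[of x] by (intro image_eqI[of _ _ "p x"]) auto
  qed (use pf in auto)
  moreover have "g ` carrier B = carrier X"
  proof (intro equalityI subsetI)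
    fix x assume "x \<in> carrier X"
    then show "x \<in> g ` carrier B" using gs[of x] by (intro image_eqI[of _ _ "s x"]) auto
  qed auto
  ultimately have "ses R A f B g X" unfolding ses_def using O h by auto
  then show thesis using that h by blast
qed

lemma (in preadditive) biproduct_unique:
  assumes "biproduct C X Y Z i1 i2 p1 p2" "biproduct C X Y Z' j1 j2 q1 q2"
  shows "\<exists>b. is_iso C Z Z' b \<and> b \<bullet> i1 = j1 \<and> q2 \<bullet> b = p2"
proof -
  note b = biproductD[OF assms(1)] and c = biproductD[OF assms(2)]
  let ?b = "(j1 \<bullet> p1) \<boxplus> (j2 \<bullet> p2)" and ?c = "(i1 \<bullet> q1) \<boxplus> (i2 \<bullet> q2)"
  have "?c \<bullet> ?b = ident C Z" "?b \<bullet> ?c = ident C Z'"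
    using b c biproduct_pre[OF assms(1)] biproduct_pre[OF assms(2)] by simp_all
  then have "is_iso C Z Z' ?b" using b c by (intro is_isoI[where g="?c"]) auto
  moreover have "?b \<bullet> i1 = j1" "q2 \<bullet> ?b = p2"
    using b c biproduct_pre[OF assms(1)] biproduct_pre[OF assms(2)] by simp_all
  ultimately show ?thesis by blast
qed

text \<open>A reference sequence \<open>B0\<close> is assumed because \<open>yoneda_ext\<close> could be empty if the element type
  were too small for \<open>A \<oplus> X\<close>.\<close>

lemma yoneda_ext_trivial:
  assumes "ring R" "biproduct (mod_add R) A X B0 i1 i2 p1 p2"
    "\<And>B f g. ses R A f B g X \<Longrightarrow> \<exists>s \<in> mod_hom R X B. \<forall>x \<in> carrier X. g (s x) = x"
  shows "yoneda_ext R X A = {split_class R X A}"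
proof -
  interpret preadditive "mod_add R :: (('a, 'c) module, ('a, 'c) mod_mor) preadd" by (rule preadditive_mod_add[OF assms(1)])
  have cls: "seq_class (mod_add R) A X (B, f, g) = split_class R X A" if se: "(B, f, g) \<in> short_exact R A X" for B f g
  proof -
    obtain f0 g0 where fg: "f = (A, B, f0)" "g = (B, X, g0)" "ses R A f0 B g0 X" using se by (auto simp: short_exact_iff)
    then obtain s where "s \<in> mod_hom R X B" "\<forall>x \<in> carrier X. g0 (s x) = x" using assms(3) by blast
    then obtain i p where b: "biproduct (mod_add R) A X B f i p g" using ses_split[OF fg(3)] fg by blast
    note b' = biproductD[OF b]
    show ?thesis
    proof (intro equalityI subsetI)
      \<comment> \<open>Any two biproducts of A and X are related by an isomorphism that respects
        both end maps, so every split sequence falls into this one class.\<close>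
      fix z assume z: "z \<in> split_class R X A"
      then obtain B' f' g' i' p' where z': "z = (B', f', g')" "biproduct (mod_add R) A X B' f' i' p' g'"
        by (auto simp: split_class_def)
      note c = biproductD[OF z'(2)]
      obtain h where "is_iso (mod_add R) B B' h" "h \<bullet>\<^bsub>mod_add R\<^esub> f = f'" "g' \<bullet>\<^bsub>mod_add R\<^esub> h = g"
        using biproduct_unique[OF b z'(2)] by blast
      then show "z \<in> seq_class (mod_add R) A X (B, f, g)"
        unfolding seq_class_def z' prod.case mem_Collect_eq using c
        by (intro conjI exI[of _ h]) (simp_all del: mod_add_simps)
    next
      fix z assume "z \<in> seq_class (mod_add R) A X (B, f, g)"
      then obtain B' f' g' h where z: "z = (B', f', g')" "B' \<in> Obj (mod_add R)" "f' \<in> Hom (mod_add R) A B'" "g' \<in> Hom (mod_add R) B' X"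
        "is_iso (mod_add R) B B' h" "h \<bullet>\<^bsub>mod_add R\<^esub> f = f'" "g' \<bullet>\<^bsub>mod_add R\<^esub> h = g"
        unfolding seq_class_def by (auto simp del: mod_add_simps)
      obtain h' where h: "ar h" "src h = B" "tgt h = B'" "ar h'" "src h' = B'" "tgt h' = B"
        "h' \<bullet>\<^bsub>mod_add R\<^esub> h = ident (mod_add R) B" "h \<bullet>\<^bsub>mod_add R\<^esub> h' = ident (mod_add R) B'"
        using is_isoE[OF z(5) b'(3) z(2)] by metis
      have g': "ar g'" "src g' = B'" using z(2,4) b' by (auto simp del: mod_add_simps)
      have "g \<bullet>\<^bsub>mod_add R\<^esub> h' = g'" unfolding z(7)[symmetric] using h g' by (simp del: mod_add_simps)
      then have "biproduct (mod_add R) A X B' f' (h \<bullet>\<^bsub>mod_add R\<^esub> i) (p \<bullet>\<^bsub>mod_add R\<^esub> h') g'"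
        using biproduct_iso_explicit[OF b h] z(6) by (simp del: mod_add_simps)
      then show "z \<in> split_class R X A" unfolding split_class_def z by blast
    qed
  qed
  obtain f g where "ses R A f B0 g X" using biproduct_ses[OF assms(2)] by metis
  then have "(B0, (A, B0, f), (B0, X, g)) \<in> short_exact R A X" by (auto simp: short_exact_iff)
  then show ?thesis
    unfolding yoneda_ext_def using cls by (auto intro!: image_eqI[of _ _ "(B0, (A, B0, f), (B0, X, g))"])
qed

section \<open>Idempotent algebras and standard modules\<close>

lemma right_ideal_simps [simp]:
  "carrier (right_ideal R a) = (\<lambda>b. a \<otimes>\<^bsub>R\<^esub> b) ` carrier R" "add (right_ideal R a) = add R"
  "zero (right_ideal R a) = zero R" "smult (right_ideal R a) = (\<lambda>b x. x \<otimes>\<^bsub>R\<^esub> b)"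
  by (simp_all add: right_ideal_def)

lemma right_ideal_rmodule:
  fixes R :: "'a ring" (structure)
  assumes "ring R" and a: "a \<in> carrier R"
  shows "rmodule R (right_ideal R a)"
proof -
  interpret ring R by fact
  have "abelian_group (right_ideal R a)"
  proof (rule abelian_groupI)
    show "x \<oplus>\<^bsub>right_ideal R a\<^esub> y \<in> carrier (right_ideal R a)"
      if "x \<in> carrier (right_ideal R a)" "y \<in> carrier (right_ideal R a)" for x y
      using that a by (auto simp flip: r_distr)
    show "\<exists>y \<in> carrier (right_ideal R a). y \<oplus>\<^bsub>right_ideal R a\<^esub> x = \<zero>\<^bsub>right_ideal R a\<^esub>"
      if x: "x \<in> carrier (right_ideal R a)" for x
    proof -
      obtain b where b: "b \<in> carrier R" "x = a \<otimes> b" using x by auto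
      have "a \<otimes> (\<ominus> b) \<oplus> a \<otimes> b = \<zero>" using a b by (simp flip: r_distr add: l_neg)
      then show ?thesis using b by (intro bexI[of _ "a \<otimes> (\<ominus> b)"]) auto
    qed
    show "\<zero>\<^bsub>right_ideal R a\<^esub> \<in> carrier (right_ideal R a)"
      using a by (auto intro!: image_eqI[of _ _ \<zero>])
  qed (use a in \<open>auto simp: a_ac\<close>)
  then show ?thesis
    using a by (intro rmodule.intro rmodule_axioms.intro ring_axioms)
      (auto simp: m_assoc l_distr r_distr)
qed

declare right_ideal_simps(1) [simp del]

lemma rad_submodule:
  assumes "rmodule R M"
  shows "submodule (carrier (rad R M)) R M" "rad R M = M\<lparr>carrier := carrier (rad R M)\<rparr>"
    "x \<in> carrier (rad R M) \<longleftrightarrow> x \<in> carrier M \<and> (\<forall>U. maximal_submodule R U M \<longrightarrow> x \<in> U)"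
proof -
  interpret rmodule R M by fact
  show x: "x \<in> carrier (rad R M) \<longleftrightarrow> x \<in> carrier M \<and> (\<forall>U. maximal_submodule R U M \<longrightarrow> x \<in> U)" for x
    by (auto simp: rad_def)
  have ms: "maximal_submodule R U M \<Longrightarrow> submodule U R M" for U by (simp add: maximal_submodule_def)
  show "submodule (carrier (rad R M)) R M"
  proof (rule submoduleI)
    show "carrier (rad R M) \<subseteq> carrier M" using x by auto
    show "\<zero>\<^bsub>M\<^esub> \<in> carrier (rad R M)" unfolding x using submoduleD(2)[OF ms] by simp
  next
    fix u v assume "u \<in> carrier (rad R M)" "v \<in> carrier (rad R M)"
    then show "u \<oplus>\<^bsub>M\<^esub> v \<in> carrier (rad R M)" unfolding x using submoduleD(3)[OF ms] by simp
  next
    fix r u assume "r \<in> carrier R" "u \<in> carrier (rad R M)"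
    then show "r \<odot>\<^bsub>M\<^esub> u \<in> carrier (rad R M)" unfolding x using submoduleD(4)[OF ms] by simp
  qed
qed (simp add: rad_def)

lemma maximal_submoduleD:
  assumes "maximal_submodule R U M"
  shows "submodule U R M" "U \<noteq> carrier M"
    "\<lbrakk>submodule V R M; U \<subseteq> V; x \<in> V; x \<notin> U\<rbrakk> \<Longrightarrow> V = carrier M"
  using assms unfolding maximal_submodule_def by auto

lemma factor_mapD:
  assumes "factor_map R M N p"
  shows "rmod_hom R M N p" "p ` carrier M = carrier N" "M \<in> Obj (mod_add R)" "N \<in> Obj (mod_add R)"
    "p \<in> mod_hom R M N"
  using assms mod_ObjD unfolding factor_map_def
  by (auto intro!: rmod_hom.intro rmod_hom_axioms.intro simp del: mod_add_simps)

lemma mod_filt_extend: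
  fixes R :: "'a ring"
  assumes "ring R" "ses R A f N g Y" "A \<in> addc (mod_cat R) S" "Y \<in> filt (mod_cat R) S"
  shows "N \<in> filt (mod_cat R) S"
proof -
  obtain l where Y: "Y \<in> filt_len (mod_cat R) S l" using assms(4) by (auto simp: filt_def)
  have N: "N \<in> Obj (mod_cat R)" using assms(2) by (simp add: ses_def)
  obtain \<xi> where c: "conflation (mod_cat R) A (A, N, f) N (N, Y, g) Y \<xi>"
    using conflation_modI[OF assms(1,2)] by blast
  have "N \<in> filt_len (mod_cat R) S (Suc l)"
    unfolding filt_len.simps star_def
    by (intro CollectI conjI N bexI[OF _ assms(3)] bexI[OF _ Y] exI) (rule c)
  then show ?thesis unfolding filt_def by blast
qed

lemma (in rmodule) finsum_smult:
  assumes "finite S" "f \<in> S \<rightarrow> carrier R" "x \<in> carrier M"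
  shows "finsum R f S \<odot>\<^bsub>M\<^esub> x = finsum M (\<lambda>s. f s \<odot>\<^bsub>M\<^esub> x) S"
  using assms
proof (induction S rule: finite_induct)
  case (insert s F)
  have "(\<lambda>s. f s \<odot>\<^bsub>M\<^esub> x) \<in> F \<rightarrow> carrier M" using insert by (auto intro!: smult_closed)
  then show ?case using insert by (simp add: smult_l_distr)
qed simp

text \<open>U + V is a submodule that strictly contains U, so it is the whole module.\<close>

lemma maximal_submodule_sum:
  fixes R :: "'r ring"
  assumes "rmodule R M" and U: "maximal_submodule R U M" and V: "submodule V R M" "x \<in> V" "x \<notin> U" and z: "z \<in> carrier M"
  obtains u v where "u \<in> U" "v \<in> V" "u \<oplus>\<^bsub>M\<^esub> v = z"
proof -
  interpret rmodule R M by fact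
  note S = sum_submodule[OF maximal_submoduleD(1)[OF U] V(1)]
  have "{u \<oplus>\<^bsub>M\<^esub> v |u v. u \<in> U \<and> v \<in> V} = carrier M"
    by (rule maximal_submoduleD(3)[OF U S(1,2) _ V(3)]) (use S(3) V(2) in auto)
  with z have "z \<in> {u \<oplus>\<^bsub>M\<^esub> v |u v. u \<in> U \<and> v \<in> V}" by (simp only:)
  then show thesis by (elim CollectE exE conjE) (rule that, simp_all)
qed

text \<open>The facts about B that the module theory consumes, separated from the category behind B.
  \<open>local\<close> is locality of e(i) R in the form used: proper submodules U, V have no
  elements adding up to e(i). \<open>basic\<close> says that no composite e(i) R -> e(j) R -> e(i) R
  is the identity.\<close>

locale idem_alg = ring R for R :: "'a ring" (structure) +
  fixes t :: nat and e :: "nat \<Rightarrow> 'a"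
  assumes idem_closed: "i \<in> {1..t} \<Longrightarrow> e i \<in> carrier R"
    and idem_mult: "\<lbrakk>i \<in> {1..t}; j \<in> {1..t}\<rbrakk> \<Longrightarrow> e i \<otimes> e j = (if i = j then e i else \<zero>)"
    and idem_sum: "finsum R e {1..t} = \<one>"
    and local: "\<lbrakk>i \<in> {1..t}; submodule U R (right_ideal R (e i)); submodule V R (right_ideal R (e i));
      u \<in> U; v \<in> V; u \<oplus> v = e i\<rbrakk> \<Longrightarrow> e i \<in> U \<or> e i \<in> V"
    and basic: "\<lbrakk>i \<in> {1..t}; j \<in> {1..t}; i \<noteq> j; x \<in> carrier (right_ideal R (e i)); x \<otimes> e j = x; b \<in> carrier R\<rbrakk>
      \<Longrightarrow> x \<otimes> b \<noteq> e i"
    and ri_fin_len: "i \<in> {1..t} \<Longrightarrow> rmodule.fin_len R (right_ideal R (e i))"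
begin

abbreviation ri :: "nat \<Rightarrow> ('a, 'a) module" where "ri i \<equiv> right_ideal R (e i)"

lemma ri_rmodule: "i \<in> {1..t} \<Longrightarrow> rmodule R (ri i)"
  using right_ideal_rmodule[OF ring_axioms] idem_closed by blast

lemma ri_obj: "i \<in> {1..t} \<Longrightarrow> ri i \<in> Obj (mod_add R)"
  using ri_rmodule ri_fin_len rmodule.fin_len_fin_gen mod_ObjI by blast

lemma ri_iff: "i \<in> {1..t} \<Longrightarrow> x \<in> carrier (ri i) \<longleftrightarrow> x \<in> carrier R \<and> e i \<otimes> x = x"
proof
  assume "i \<in> {1..t}" "x \<in> carrier (ri i)"
  then show "x \<in> carrier R \<and> e i \<otimes> x = x"
    using idem_closed[of i] idem_mult[of i i] by (auto simp: right_ideal_simps(1) m_assoc[symmetric])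
next
  assume "x \<in> carrier R \<and> e i \<otimes> x = x"
  then show "x \<in> carrier (ri i)" by (metis imageI right_ideal_simps(1))
qed

lemma idem_in_ri: "i \<in> {1..t} \<Longrightarrow> e i \<in> carrier (ri i)"
  using idem_closed[of i] idem_mult[of i i] by (simp add: ri_iff)

lemma ri_generated:
  assumes "i \<in> {1..t}" "submodule U R (ri i)" "e i \<in> U"
  shows "U = carrier (ri i)"
  using submoduleD(1,4)[OF assms(2)] assms(3) by (auto simp: right_ideal_simps(1))

lemma ri_local:
  assumes "i \<in> {1..t}" "submodule U R (ri i)" "submodule V R (ri i)" "u \<in> U" "v \<in> V" "u \<oplus> v = e i"
  shows "U = carrier (ri i) \<or> V = carrier (ri i)"
  using local[OF assms] ri_generated assms by blast

text \<open>Every x is the sum of its parts x e(j), because the idempotents add up to the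
  identity.\<close>

lemma peirce_decomposition:
  assumes "rmodule R M" "submodule U R M" "x \<in> carrier M" "\<And>j. j \<in> {1..t} \<Longrightarrow> e j \<odot>\<^bsub>M\<^esub> x \<in> U"
  shows "x \<in> U"
proof -
  interpret rmodule R M by fact
  have "x = finsum R e {1..t} \<odot>\<^bsub>M\<^esub> x" using assms idem_sum by simp
  also have "\<dots> = finsum M (\<lambda>j. e j \<odot>\<^bsub>M\<^esub> x) {1..t}"
    using assms idem_closed by (intro finsum_smult) auto
  also have "\<dots> \<in> U" using assms(4) by (intro finsum_submodule[OF assms(2)]) auto
  finally show ?thesis .
qed

lemma ri_hom:
  assumes "i \<in> {1..t}" "rmodule R M" "m \<in> carrier M" "e i \<odot>\<^bsub>M\<^esub> m = m"
  shows "(\<lambda>x \<in> carrier (ri i). x \<odot>\<^bsub>M\<^esub> m) \<in> mod_hom R (ri i) M"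
proof -
  interpret rmodule R M by fact
  have c: "x \<in> carrier R" if "x \<in> carrier (ri i)" for x using that ri_iff assms(1) by blast
  show ?thesis
    by (rule mod_hom_restrictI[OF ri_rmodule[OF assms(1)]])
      (use c assms(3) in \<open>simp_all add: smult_l_distr smult_assoc\<close>)
qed

text \<open>M e(j) = 0; for a module of finite length this says that S(j) is not a composition
  factor.\<close>

definition killed :: "nat \<Rightarrow> ('a, 'a) module \<Rightarrow> bool" where
  "killed j M \<longleftrightarrow> (\<forall>x \<in> carrier M. e j \<odot>\<^bsub>M\<^esub> x = \<zero>\<^bsub>M\<^esub>)"

text \<open>It suffices that x e(j) lies in every maximal submodule U of e(l) R. Otherwise U and the
  submodule generated by x e(j) together produce e(l); locality makes the latter all of e(l) R, so
  e(l) is a multiple of x e(j), contrary to \<open>basic\<close>.\<close>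

lemma top_killed:
  assumes "is_top R (ri l) S" "l \<in> {1..t}" "j \<in> {1..t}" "j \<noteq> l"
  shows "killed j S"
  unfolding killed_def
proof
  fix y assume y: "y \<in> carrier S"
  obtain p where p: "factor_map R (ri l) S p" "a_kernel (ri l) S p = carrier (rad R (ri l))"
    using assms(1) by (auto simp: is_top_def)
  note pD = factor_mapD[OF p(1)]
  interpret p: rmod_hom R "ri l" S p by (rule pD(1))
  obtain x where x: "x \<in> carrier (ri l)" "y = p x" using y pD(2) by blast
  have xR: "x \<in> carrier R" using x ri_iff assms by blast
  note ej = idem_closed[OF assms(3)]
  have z: "x \<otimes> e j \<in> carrier (ri l)" using p.M.smult_closed[OF ej x(1)] by simp
  have zz: "(x \<otimes> e j) \<otimes> e j = x \<otimes> e j" using xR ej idem_mult[OF assms(3,3)] by (simp add: m_assoc)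
  have "x \<otimes> e j \<in> carrier (rad R (ri l))"
    unfolding rad_submodule(3)[OF p.M.rmodule_axioms]
  proof (intro conjI allI impI)
    fix U assume U: "maximal_submodule R U (ri l)"
    then have sU: "submodule U R (ri l)" "U \<noteq> carrier (ri l)" by (auto simp: maximal_submodule_def)
    let ?Z = "(\<lambda>r. r \<odot>\<^bsub>ri l\<^esub> (x \<otimes> e j)) ` carrier R"
    note Z = p.M.cyclic_submodule[OF z]
    show "x \<otimes> e j \<in> U"
    proof (rule ccontr)
      assume nU: "x \<otimes> e j \<notin> U"
      obtain u v where uv: "u \<in> U" "v \<in> ?Z" "u \<oplus>\<^bsub>ri l\<^esub> v = e l"
        by (rule maximal_submodule_sum[OF p.M.rmodule_axioms U Z nU idem_in_ri[OF assms(2)]])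
      have "?Z = carrier (ri l)" using ri_local[OF assms(2) sU(1) Z(1) uv[unfolded right_ideal_simps(2)]] sU(2) by metis
      with idem_in_ri[OF assms(2)] have "e l \<in> ?Z" by (simp only:)
      then obtain b where "b \<in> carrier R" "(x \<otimes> e j) \<otimes> b = e l" by auto
      then show False using basic[OF assms(2,3) _ z zz] assms(4) by metis
    qed
  qed (rule z)
  then have "p (x \<otimes> e j) = \<zero>\<^bsub>S\<^esub>" using p(2) p.kernel_iff by blast
  then show "e j \<odot>\<^bsub>S\<^esub> y = \<zero>\<^bsub>S\<^esub>" using p.lin[OF ej x(1)] x(2) by simp
qed

section \<open>Filtrations by simples detected by idempotents\<close>

lemma simples_obj: "simples R e J \<subseteq> Obj (mod_add R)"
  unfolding simples_def is_top_def using factor_mapD(4) by blast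

text \<open>A morphism through a module killed by e(j) sends x e(j) to zero, and so does a sum of
  such morphisms. Applied to an identity, this carries \<open>killed\<close> over to additive
  closures.\<close>

lemma thr_killed:
  assumes "preadditive.thr (mod_cat R) S Z Z' n F" "S \<subseteq> Obj (mod_add R)" "Z \<in> Obj (mod_add R)"
    "Z' \<in> Obj (mod_add R)" "j \<in> {1..t}" "\<And>N. N \<in> S \<Longrightarrow> killed j N" "x \<in> carrier Z"
  shows "mor_fun F (e j \<odot>\<^bsub>Z\<^esub> x) = \<zero>\<^bsub>Z'\<^esub>"
proof -
  interpret C: preadditive "mod_cat R :: (('a, 'a) module, ('a, 'a) mod_mor, ('a, 'a) mod_ext, unit) neg_extri"
    by (rule preadditive_mod_cat) (rule ring_axioms)
  interpret Z: rmodule R Z using assms mod_ObjD by blast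
  interpret Z': rmodule R Z' using assms mod_ObjD by blast
  have ex: "e j \<odot>\<^bsub>Z\<^esub> x \<in> carrier Z" using idem_closed[OF assms(5)] assms by simp
  have "\<exists>s. F = (Z, Z', s) \<and> s (e j \<odot>\<^bsub>Z\<^esub> x) = \<zero>\<^bsub>Z'\<^esub>"
    using assms(1)
  proof induction
    case thr_zer
    then show ?case using ex by simp
  next
    case (thr_pls n s N a b)
    then obtain a' b' s' where m: "a = (Z, N, a')" "a' \<in> mod_hom R Z N" "b = (N, Z', b')" "b' \<in> mod_hom R N Z'"
      "s = (Z, Z', s')" "s' (e j \<odot>\<^bsub>Z\<^esub> x) = \<zero>\<^bsub>Z'\<^esub>" by auto
    interpret N: rmodule R N using thr_pls assms mod_ObjD by blast
    interpret a: rmod_hom R Z N a' by unfold_locales (rule m)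
    interpret b: rmod_hom R N Z' b' by unfold_locales (rule m)
    have "a' (e j \<odot>\<^bsub>Z\<^esub> x) = \<zero>\<^bsub>N\<^esub>"
      using a.lin[OF idem_closed[OF assms(5)] assms(7)] assms(6)[OF thr_pls(2)] a.closed[OF assms(7)]
      by (simp add: killed_def)
    then show ?case using m ex by (simp add: compose_def)
  qed
  then show ?thesis by auto
qed

text \<open>The factors are killed because e(j) annihilates the tops of the other e(l) R. Across an
  extension, x e(j) is the image of some y in the submodule, and x e(j) = x e(j) e(j) is the image
  of y e(j) = 0.\<close>

lemma filt_simples_killed:
  assumes "M \<in> filt (mod_cat R) (simples R e J)" "J \<subseteq> {1..t}" "j \<in> {1..t} - J"
  shows "killed j M" "M \<in> Obj (mod_add R)"
proof -
  interpret C: preadditive "mod_cat R :: (('a, 'a) module, ('a, 'a) mod_mor, ('a, 'a) mod_ext, unit) neg_extri"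
    by (rule preadditive_mod_cat) (rule ring_axioms)
  note ej = idem_closed[of j]
  have k: "killed j S" if S: "S \<in> simples R e J" for S
  proof -
    obtain l where l: "l \<in> J" "is_top R (ri l) S" using S unfolding simples_def by blast
    show ?thesis by (rule top_killed[OF l(2)]) (use l assms(2,3) in auto)
  qed
  have add: "killed j Z \<and> Z \<in> Obj (mod_add R)" if "Z \<in> addc (mod_cat R) (simples R e J)" for Z
  proof -
    have Z: "Z \<in> Obj (mod_add R)" "\<exists>n. C.thr (simples R e J) Z Z n (ident (mod_cat R) Z)"
      using C.addc_thr[OF that] simples_obj by (auto simp del: mod_add_simps)
    interpret Z: rmodule R Z using Z mod_ObjD by blast
    have "e j \<odot>\<^bsub>Z\<^esub> x = \<zero>\<^bsub>Z\<^esub>" if "x \<in> carrier Z" for x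
      using Z thr_killed[OF _ simples_obj Z(1) Z(1) _ k that] assms(3) ej that by auto
    then show ?thesis using Z by (simp add: killed_def del: mod_add_simps)
  qed
  have "killed j M \<and> M \<in> Obj (mod_add R)" if "M \<in> filt_len (mod_cat R) (simples R e J) l" for l M
    using that
  proof (induction l arbitrary: M)
    case 0
    then show ?case using add by simp
  next
    case (Suc l)
    then obtain X Y F G \<xi> where XY: "X \<in> addc (mod_cat R) (simples R e J)" "Y \<in> filt_len (mod_cat R) (simples R e J) l"
      "conflation (mod_cat R) X F M G Y \<xi>" by (auto simp: star_def)
    obtain f g where "ses R X f M g Y" using conflation_modD[OF XY(3)] by metis
    then have s: "X \<in> Obj (mod_add R)" "M \<in> Obj (mod_add R)" "Y \<in> Obj (mod_add R)" "f \<in> mod_hom R X M"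
      "g \<in> mod_hom R M Y" "f ` carrier X = {x \<in> carrier M. g x = \<zero>\<^bsub>Y\<^esub>}"
      by (auto simp: ses_def simp del: mod_add_simps)
    interpret f: rmod_hom R X M f using s mod_ObjD by (intro rmod_hom.intro rmod_hom_axioms.intro)
    interpret g: rmod_hom R M Y g using s mod_ObjD by (intro rmod_hom.intro rmod_hom_axioms.intro)
    have kX: "killed j X" and kY: "killed j Y" using add XY Suc by blast+
    have "e j \<odot>\<^bsub>M\<^esub> x = \<zero>\<^bsub>M\<^esub>" if x: "x \<in> carrier M" for x
    proof -
      have j: "j \<in> {1..t}" using assms by auto
      have "g (e j \<odot>\<^bsub>M\<^esub> x) = \<zero>\<^bsub>Y\<^esub>"
        using kY x j ej g.lin[of "e j" x] g.closed[OF x] by (simp add: killed_def)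
      then have "e j \<odot>\<^bsub>M\<^esub> x \<in> f ` carrier X" unfolding s(6) using x ej[OF j] by simp
      then obtain y where y: "y \<in> carrier X" "e j \<odot>\<^bsub>M\<^esub> x = f y" by auto
      have "e j \<odot>\<^bsub>M\<^esub> x = e j \<odot>\<^bsub>M\<^esub> (e j \<odot>\<^bsub>M\<^esub> x)"
        using f.N.smult_assoc[of "e j" "e j" x] x ej[OF j] idem_mult[OF j j] by simp
      also have "\<dots> = f (e j \<odot>\<^bsub>X\<^esub> y)" using y ej[OF j] f.lin by simp
      finally show ?thesis using kX y by (simp add: killed_def)
    qed
    then show ?case using s by (simp add: killed_def del: mod_add_simps)
  qed
  then show "killed j M" "M \<in> Obj (mod_add R)" using assms(1) by (auto simp: filt_def simp del: mod_add_simps)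
qed

text \<open>Sending e(j) to y is onto because X is simple. The kernel is then maximal, and by
  locality it is contained in every maximal submodule, so it is the radical.\<close>

lemma simple_is_top:
  assumes "j \<in> {1..t}" "rmodule R X" "X \<in> Obj (mod_add R)" "y \<in> carrier X" "y \<noteq> \<zero>\<^bsub>X\<^esub>" "e j \<odot>\<^bsub>X\<^esub> y = y"
    "\<And>U. submodule U R X \<Longrightarrow> U = {\<zero>\<^bsub>X\<^esub>} \<or> U = carrier X"
  shows "is_top R (ri j) X"
proof -
  define h where "h = (\<lambda>x \<in> carrier (ri j). x \<odot>\<^bsub>X\<^esub> y)"
  have hom: "h \<in> mod_hom R (ri j) X" unfolding h_def by (rule ri_hom[OF assms(1,2,4,6)])
  interpret X: rmodule R X by fact
  interpret j: rmodule R "ri j" by (rule ri_rmodule[OF assms(1)])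
  interpret h: rmod_hom R "ri j" X h by unfold_locales (rule hom)
  have hy: "h (e j) = y" using idem_in_ri[OF assms(1)] assms(6) by (simp add: h_def)
  have onto: "h ` carrier (ri j) = carrier X"
    using assms(7)[OF h.image_submodule[OF j.whole_submodule]] idem_in_ri[OF assms(1)] hy assms(5)
    by (metis imageI singletonD)
  let ?K = "{x \<in> carrier (ri j). h x \<in> {\<zero>\<^bsub>X\<^esub>}}"
  have K: "submodule ?K R (ri j)" by (rule h.vimage_submodule[OF X.zero_submodule])
  have eK: "e j \<notin> ?K" using hy assms(5) by auto
  have max: "maximal_submodule R ?K (ri j)"
    unfolding maximal_submodule_def
  proof (intro conjI allI impI)
    show "?K \<noteq> carrier (ri j)" using eK idem_in_ri[OF assms(1)] by blast
    fix V assume V: "submodule V R (ri j) \<and> ?K \<subseteq> V"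
    note VD = submoduleD[OF conjunct1[OF V]]
    from assms(7)[OF h.image_submodule[OF conjunct1[OF V]]]
    show "V = ?K \<or> V = carrier (ri j)"
    proof
      assume "h ` V = {\<zero>\<^bsub>X\<^esub>}"
      then have "V \<subseteq> ?K" using VD(1) by blast
      then show ?thesis using V by blast
    next
      assume hV: "h ` V = carrier X"
      have "carrier (ri j) \<subseteq> V"
      proof
        fix x assume x: "x \<in> carrier (ri j)"
        then have "h x \<in> h ` V" unfolding hV using h.closed by blast
        then obtain v where v: "v \<in> V" "h v = h x" by auto
        have vc: "v \<in> carrier (ri j)" using VD(1) v by blast
        have "h (x \<ominus>\<^bsub>ri j\<^esub> v) = \<zero>\<^bsub>X\<^esub>" using h.diff_zero[OF x vc] v(2) by simp
        then have "x \<ominus>\<^bsub>ri j\<^esub> v \<in> ?K" using j.M.minus_closed[OF x vc] by simp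
        then have "x \<ominus>\<^bsub>ri j\<^esub> v \<in> V" by (rule subsetD[OF conjunct2[OF V]])
        then have "(x \<ominus>\<^bsub>ri j\<^esub> v) \<oplus>\<^bsub>ri j\<^esub> v \<in> V" by (rule VD(3)[OF _ v(1)])
        moreover have "(x \<ominus>\<^bsub>ri j\<^esub> v) \<oplus>\<^bsub>ri j\<^esub> v = x"
          unfolding a_minus_def using x vc j.M.a_assoc j.M.l_neg by (metis j.M.a_inv_closed j.M.r_zero)
        ultimately show "x \<in> V" by simp
      qed
      then show ?thesis using VD(1) by blast
    qed
  qed (rule K)
  have "a_kernel (ri j) X h = carrier (rad R (ri j))"
  proof (intro equalityI subsetI)
    fix x assume "x \<in> carrier (rad R (ri j))"
    then have "x \<in> ?K" using rad_submodule(3)[OF j.rmodule_axioms] max by blast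
    then show "x \<in> a_kernel (ri j) X h" unfolding h.kernel_iff by simp
  next
    fix x assume "x \<in> a_kernel (ri j) X h"
    then have x: "x \<in> ?K" unfolding h.kernel_iff by simp
    show "x \<in> carrier (rad R (ri j))"
      unfolding rad_submodule(3)[OF j.rmodule_axioms]
    proof (intro conjI allI impI)
      fix U assume U: "maximal_submodule R U (ri j)"
      then have sU: "submodule U R (ri j)" "U \<noteq> carrier (ri j)" by (auto simp: maximal_submodule_def)
      show "x \<in> U"
      proof (rule ccontr)
        assume nU: "x \<notin> U"
        obtain u v where uv: "u \<in> U" "v \<in> ?K" "u \<oplus>\<^bsub>ri j\<^esub> v = e j"
          by (rule maximal_submodule_sum[OF j.rmodule_axioms U K x nU idem_in_ri[OF assms(1)]])
        show False using local[OF assms(1) sU(1) K uv[unfolded right_ideal_simps(2)]] eK ri_generated[OF assms(1) sU(1)] sU(2) by metis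
      qed
    qed (use x in blast)
  qed
  moreover have "factor_map R (ri j) X h"
    unfolding factor_map_def using ri_obj[OF assms(1)] assms(3) hom onto by blast
  ultimately show ?thesis unfolding is_top_def by blast
qed

lemma zero_filt:
  fixes N :: "('a, 'a) module"
  assumes "rmodule R N" "carrier N = {\<zero>\<^bsub>N\<^esub>}"
  shows "N \<in> filt (mod_cat R) S"
proof -
  interpret C: preadditive "mod_cat R :: (('a, 'a) module, ('a, 'a) mod_mor, ('a, 'a) mod_ext, unit) neg_extri"
    by (rule preadditive_mod_cat) (rule ring_axioms)
  interpret N: rmodule R N by fact
  have "N.span {} = carrier N"
    using N.span_submodule[of "{}"] submoduleD(1,2)[OF N.span_submodule(1)[of "{}"]] assms(2) by auto
  then have "fin_gen R N" unfolding N.fin_gen_span by (intro exI[of _ "{}"]) auto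
  moreover have "(\<lambda>x \<in> carrier N. x) = (\<lambda>x \<in> carrier N. \<zero>\<^bsub>N\<^esub>)"
    using assms(2) by (intro restrict_ext) auto
  ultimately have "is_zero_obj (mod_cat R) N"
    using assms(1) by (simp add: is_zero_obj_def rmodule_iff)
  then have "N \<in> filt_len (mod_cat R) S 0" using C.zero_obj_addc by simp
  then show ?thesis unfolding filt_def by blast
qed

text \<open>Converse to \<open>filt_simples_killed\<close>, by Noetherian induction: among the
  factor modules that are not filtered take one, N, with maximal kernel. A minimal nonzero submodule
  of N is simple, hence some S(j), with j in J because N inherits the killing from M. The quotient
  by it is filtered by maximality, and so is N.\<close>

lemma simples_filt:
  assumes "rmodule R M" "rmodule.fin_len R M" "J \<subseteq> {1..t}" "\<And>j. j \<in> {1..t} - J \<Longrightarrow> killed j M"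
  shows "M \<in> filt (mod_cat R) (simples R e J)"
proof -
  interpret M: rmodule R M by fact
  let ?F = "filt (mod_cat R) (simples R e J)"
  let ?Q = "\<lambda>U N q. rmod_hom R M N q \<and> q ` carrier M = carrier N \<and> {x \<in> carrier M. q x = \<zero>\<^bsub>N\<^esub>} = U"
  \<comment> \<open>Factor modules are recorded by their kernels in M, so that the ascending chain
    condition of M applies to them.\<close>
  define \<U> where "\<U> = {U. \<exists>N q. ?Q U N q \<and> N \<notin> ?F}"
  have memI: "U \<in> \<U>" if "?Q U N q" "N \<notin> ?F" for U N q using that unfolding \<U>_def by blast
  have memE: "\<exists>N q. ?Q U N q \<and> N \<notin> ?F" if "U \<in> \<U>" for U using that unfolding \<U>_def by blast
  have sub: "submodule U R M" if U: "U \<in> \<U>" for U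
  proof -
    obtain N q where q: "rmod_hom R M N q" "{x \<in> carrier M. q x = \<zero>\<^bsub>N\<^esub>} = U" using memE[OF U] by blast
    interpret q: rmod_hom R M N q by (rule q)
    have "submodule {x \<in> carrier M. q x \<in> {\<zero>\<^bsub>N\<^esub>}} R M" by (rule q.vimage_submodule[OF q.N.zero_submodule])
    then show ?thesis using q(2) by simp
  qed
  have "\<U> = {}"
  proof (rule ccontr)
    assume "\<U> \<noteq> {}"
    then obtain U where "U \<in> \<U>" by (metis ex_in_conv)
    then have "\<exists>V \<in> \<U>. \<forall>W \<in> \<U>. V \<subseteq> W \<longrightarrow> W = V" by (rule M.fin_len_acc[OF assms(2) _ sub])
    then obtain V where V: "V \<in> \<U>" and Vmax: "\<forall>W \<in> \<U>. V \<subseteq> W \<longrightarrow> W = V" by (elim bexE) (rule that)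
    from memE[OF V] obtain N q where q: "rmod_hom R M N q" "q ` carrier M = carrier N"
      and Vq: "{x \<in> carrier M. q x = \<zero>\<^bsub>N\<^esub>} = V" and NF: "N \<notin> ?F" by blast
    interpret q: rmod_hom R M N q by (rule q)
    have Nfl: "q.N.fin_len" using q.fin_len_image[OF q(2) assms(2)] .
    let ?\<X> = "{X. submodule X R N \<and> X \<noteq> {\<zero>\<^bsub>N\<^esub>}}"
    have "carrier N \<noteq> {\<zero>\<^bsub>N\<^esub>}" using zero_filt[OF q.N.rmodule_axioms] NF by blast
    then have "carrier N \<in> ?\<X>" using q.N.whole_submodule by blast
    then have "\<exists>X \<in> ?\<X>. \<forall>W \<in> ?\<X>. W \<subseteq> X \<longrightarrow> W = X"
      by (rule q.N.fin_len_dcc[OF Nfl]) simp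
    then obtain X where X: "X \<in> ?\<X>" "\<forall>W \<in> ?\<X>. W \<subseteq> X \<longrightarrow> W = X" by (elim bexE) (rule that)
    then have sX: "submodule X R N" and nX: "X \<noteq> {\<zero>\<^bsub>N\<^esub>}" by auto
    note XD = submoduleD[OF sX]
    let ?X = "N\<lparr>carrier := X\<rparr>"
    interpret X: rmodule R ?X by (rule q.N.sub_rmodule[OF sX])
    have XO: "?X \<in> Obj (mod_add R)"
      using X.fin_len_fin_gen q.N.fin_len_sub[OF Nfl sX] mod_ObjI[OF X.rmodule_axioms] by blast
    obtain x where x: "x \<in> X" "x \<noteq> \<zero>\<^bsub>N\<^esub>" using nX XD(2) by blast
    then have xN: "x \<in> carrier N" using XD(1) by blast
    obtain j where j: "j \<in> {1..t}" "e j \<odot>\<^bsub>N\<^esub> x \<noteq> \<zero>\<^bsub>N\<^esub>"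
      using peirce_decomposition[OF q.N.rmodule_axioms q.N.zero_submodule xN] x(2) by blast
    note ej = idem_closed[OF j(1)]
    have "j \<in> J"
    proof (rule ccontr)
      assume "j \<notin> J"
      then have k: "killed j M" using assms(4) j by blast
      obtain m where "m \<in> carrier M" "x = q m" using xN q(2) by blast
      then show False using j(2) k q.lin[OF ej] by (simp add: killed_def flip: q.lin)
    qed
    have simple: "U = {\<zero>\<^bsub>?X\<^esub>} \<or> U = carrier ?X" if "submodule U R ?X" for U
      using that X(2) q.N.sub_submodule[OF sX, of U] by auto
    have "e j \<odot>\<^bsub>?X\<^esub> (e j \<odot>\<^bsub>N\<^esub> x) = e j \<odot>\<^bsub>N\<^esub> x"
      using q.N.smult_assoc[OF ej ej xN] idem_mult[OF j(1) j(1)] by simp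
    then have "is_top R (ri j) ?X"
      using simple_is_top[OF j(1) X.rmodule_axioms XO, of "e j \<odot>\<^bsub>N\<^esub> x"] simple j(2) XD(4)[OF ej x(1)] by simp
    then have "?X \<in> simples R e J" using \<open>j \<in> J\<close> unfolding simples_def by blast
    let ?Y = "q.N.quot X" and ?r = "\<lambda>x \<in> carrier N. q.N.coset_rep X x"
    note Y = q.N.quot_module[OF sX]
    interpret r: rmod_hom R N ?Y ?r by (intro rmod_hom.intro rmod_hom_axioms.intro q.N.rmodule_axioms Y(1,2))
    let ?s = "compose (carrier M) ?r q"
    have s: "?s \<in> mod_hom R M ?Y" by (rule mod_hom_cmp[OF M.rmodule_axioms q.hom r.hom])
    have ronto: "?r ` carrier N = carrier ?Y" using Y(3) by simp
    have sonto: "?s ` carrier M = carrier ?Y"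
    proof -
      have "?s ` carrier M = ?r ` q ` carrier M" by (auto simp: compose_def)
      then show ?thesis using q(2) ronto by simp
    qed
    let ?W = "{x \<in> carrier M. ?s x = \<zero>\<^bsub>?Y\<^esub>}"
    have W: "?W = {y \<in> carrier M. q y \<in> X}"
      using Y(4) by (intro Collect_cong) (auto simp: compose_def)
    have "V \<subseteq> ?W" unfolding W Vq[symmetric] using XD(2) by auto
    moreover have "?W \<noteq> V"
    proof
      assume WV: "?W = V"
      obtain m where "m \<in> carrier M" "x = q m" using xN q(2) by blast
      then show False using WV x unfolding W Vq[symmetric] by blast
    qed
    ultimately have "?W \<notin> \<U>" using Vmax by metis
    moreover have "rmod_hom R M ?Y ?s" by (rule rmod_hom.intro[OF M.rmodule_axioms Y(1) rmod_hom_axioms.intro[OF s]])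
    ultimately have YF: "?Y \<in> ?F" using memI[of ?Y ?s ?W] sonto by auto
    have NO: "N \<in> Obj (mod_add R)" using mod_ObjI[OF q.N.rmodule_axioms q.N.fin_len_fin_gen[OF Nfl]] .
    have YO: "?Y \<in> Obj (mod_add R)"
      using mod_ObjI[OF Y(1) r.fin_gen_image[OF ronto q.N.fin_len_fin_gen[OF Nfl]]] .
    have i: "(\<lambda>x \<in> carrier ?X. x) \<in> mod_hom R ?X N"
      by (rule mod_hom_restrictI[OF X.rmodule_axioms]) (use XD(1) in auto)
    have "ses R ?X (\<lambda>x \<in> carrier ?X. x) N ?r ?Y"
      unfolding ses_def
    proof (intro conjI XO NO YO i Y(2) ronto)
      show "inj_on (\<lambda>x \<in> carrier ?X. x) (carrier ?X)" by (auto simp: inj_on_def)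
      show "(\<lambda>x \<in> carrier ?X. x) ` carrier ?X = {x \<in> carrier N. ?r x = \<zero>\<^bsub>?Y\<^esub>}"
        using Y(4) XD(1) by auto
    qed
    moreover have "?X \<in> addc (mod_cat R) (simples R e J)"
    proof -
      interpret C: preadditive "mod_cat R :: (('a, 'a) module, ('a, 'a) mod_mor, ('a, 'a) mod_ext, unit) neg_extri"
        by (rule preadditive_mod_cat) (rule ring_axioms)
      let ?Z = "N\<lparr>carrier := {\<zero>\<^bsub>N\<^esub>}\<rparr>"
      interpret Z: rmodule R ?Z by (rule q.N.sub_rmodule[OF q.N.zero_submodule])
      have "fin_gen R ?Z" by (rule Z.fin_len_fin_gen[OF q.N.fin_len_sub[OF Nfl q.N.zero_submodule]])
      then have "is_zero_obj (mod_cat R) ?Z"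
        using Z.rmodule_axioms by (simp add: is_zero_obj_def rmodule_iff restrict_def fun_eq_iff)
      then show ?thesis using C.member_addc \<open>?X \<in> simples R e J\<close> XO by (simp del: mod_add_simps)
    qed
    ultimately show False using mod_filt_extend[OF ring_axioms _ _ YF] NF by blast
  qed
  moreover have "?Q {\<zero>\<^bsub>M\<^esub>} M (\<lambda>x \<in> carrier M. x)"
    using M.rmodule_axioms M.mod_hom_id by (auto intro!: rmod_hom.intro rmod_hom_axioms.intro)
  ultimately show ?thesis using memI[of M "\<lambda>x \<in> carrier M. x" "{\<zero>\<^bsub>M\<^esub>}"] by blast
qed

end

section \<open>Recognizing standard and proper standard modules\<close>

context idem_alg
begin

text \<open>For a submodule K of e(i) R: K is generated by its parts K e(j) with j at least
  \<open>j0\<close>, expressed by testing against submodules.\<close>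

definition generated_from :: "nat \<Rightarrow> nat \<Rightarrow> 'a set \<Rightarrow> bool" where
  "generated_from i j0 K \<longleftrightarrow> (\<forall>U. submodule U R (ri i) \<longrightarrow>
     (\<forall>x \<in> K. \<forall>j \<in> {j0..t}. x \<otimes> e j = x \<longrightarrow> x \<in> U) \<longrightarrow> K \<subseteq> U)"

lemma generated_fromD:
  "\<lbrakk>generated_from i j0 K; submodule U R (ri i);
    \<And>x j. \<lbrakk>x \<in> K; j \<in> {j0..t}; x \<otimes> e j = x\<rbrakk> \<Longrightarrow> x \<in> U\<rbrakk> \<Longrightarrow> K \<subseteq> U"
  unfolding generated_from_def by blast

lemma killed_hom:
  assumes "rmod_hom R M N q" "x \<in> carrier M" "e j \<odot>\<^bsub>M\<^esub> x = x" "killed j N" "j \<in> {1..t}"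
  shows "q x = \<zero>\<^bsub>N\<^esub>"
proof -
  interpret rmod_hom R M N q by fact
  show ?thesis using lin[OF idem_closed[OF assms(5)] assms(2)] assms closed[OF assms(2)] by (simp add: killed_def)
qed

text \<open>D is admissible because it is killed by the idempotents above i. Every admissible factor
  kills the parts at e(j) with j > i, and these generate the kernel of \<open>p\<close>, which is
  therefore contained in every admissible kernel.\<close>

lemma standard_moduleI:
  assumes i: "i \<in> {1..t}" and p: "factor_map R (ri i) D p" and k: "\<And>j. j \<in> {Suc i..t} \<Longrightarrow> killed j D"
    and gen: "generated_from i (Suc i) {x \<in> carrier (ri i). p x = \<zero>\<^bsub>D\<^esub>}"
  shows "standard_module R e i D"
proof -
  note pD = factor_mapD[OF p]
  interpret p: rmod_hom R "ri i" D p by (rule pD(1))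
  have fl: "p.N.fin_len" by (rule p.fin_len_image[OF pD(2) ri_fin_len[OF i]])
  have J: "{1..i} \<subseteq> {1..t}" and J': "{1..t} - {1..i} = {Suc i..t}" using i by auto
  have "D \<in> filt (mod_cat R) (simples R e {1..i})"
    by (rule simples_filt[OF p.N.rmodule_axioms fl J]) (use k in auto)
  moreover have "a_kernel (ri i) D p \<subseteq> a_kernel (ri i) N q"
    if N: "N \<in> filt (mod_cat R) (simples R e {1..i})" and q: "factor_map R (ri i) N q" for N q
  proof -
    interpret q: rmod_hom R "ri i" N q by (rule factor_mapD(1)[OF q])
    have "{x \<in> carrier (ri i). p x = \<zero>\<^bsub>D\<^esub>} \<subseteq> {x \<in> carrier (ri i). q x \<in> {\<zero>\<^bsub>N\<^esub>}}"
    proof (rule generated_fromD[OF gen q.vimage_submodule[OF q.N.zero_submodule]])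
      fix x j assume x: "x \<in> {x \<in> carrier (ri i). p x = \<zero>\<^bsub>D\<^esub>}" and j: "j \<in> {Suc i..t}" and xj: "x \<otimes> e j = x"
      have "killed j N" by (rule filt_simples_killed(1)[OF N J]) (use j J' in auto)
      then show "x \<in> {x \<in> carrier (ri i). q x \<in> {\<zero>\<^bsub>N\<^esub>}}"
        using killed_hom[OF q.rmod_hom_axioms, of x j] x j xj i by simp
    qed
    then show ?thesis unfolding a_kernel_def' by auto
  qed
  ultimately show ?thesis unfolding standard_module_def max_factor_def using p by blast
qed

text \<open>The standard module is constructed as the quotient \<Delta> of e(i) R by the submodule T
  generated by the parts at e(j) with j > i. The last hypothesis keeps S(i) out of the radical of D.
  The generation hypothesis makes D maximal: in any competitor N the kernel of \<open>p\<close> is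
  sent into the radical, where S(i) does not occur.\<close>

lemma proper_standard_moduleI:
  assumes i: "i \<in> {1..t}" and p: "factor_map R (ri i) D p" and k: "\<And>j. j \<in> {Suc i..t} \<Longrightarrow> killed j D"
    and nz: "carrier D \<noteq> {\<zero>\<^bsub>D\<^esub>}"
    and gen: "generated_from i i {x \<in> carrier (ri i). p x = \<zero>\<^bsub>D\<^esub>}"
    and hd: "\<And>h U. \<lbrakk>h \<in> carrier D; h \<noteq> \<zero>\<^bsub>D\<^esub>; e i \<odot>\<^bsub>D\<^esub> h = h; submodule U R D; h \<in> U\<rbrakk> \<Longrightarrow> U = carrier D"
  shows "proper_standard_module R e i D"
proof -
  note pD = factor_mapD[OF p]
  interpret p: rmod_hom R "ri i" D p by (rule pD(1))
  let ?K = "{x \<in> carrier (ri i). p x = \<zero>\<^bsub>D\<^esub>}"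
  have sK: "submodule ?K R (ri i)" using p.vimage_submodule[OF p.N.zero_submodule] by simp
  have Kprop: "?K \<noteq> carrier (ri i)"
  proof
    assume *: "?K = carrier (ri i)"
    have "carrier D \<subseteq> {\<zero>\<^bsub>D\<^esub>}" unfolding pD(2)[symmetric] using * by blast
    then show False using nz p.N.M.zero_closed by blast
  qed
  have fl: "p.N.fin_len" by (rule p.fin_len_image[OF pD(2) ri_fin_len[OF i]])
  let ?G = "{x \<in> carrier (ri i). \<exists>j \<in> {Suc i..t}. x \<otimes> e j = x}"
  have G: "?G \<subseteq> carrier (ri i)" by blast
  define T where "T = p.M.span ?G"
  have sT: "submodule T R (ri i)" and GT: "?G \<subseteq> T" unfolding T_def using p.M.span_submodule[OF G] by blast+
  have TK: "T \<subseteq> ?K"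
    unfolding T_def
  proof (rule p.M.span_least[OF sK])
    show "?G \<subseteq> ?K" using killed_hom[OF p.rmod_hom_axioms] k i by auto
  qed
  define \<Delta> where "\<Delta> = p.M.quot T"
  define \<pi> where "\<pi> = (\<lambda>x \<in> carrier (ri i). p.M.coset_rep T x)"
  note Q = p.M.quot_module[OF sT, folded \<Delta>_def \<pi>_def]
  interpret \<pi>: rmod_hom R "ri i" \<Delta> \<pi> by (intro rmod_hom.intro rmod_hom_axioms.intro p.M.rmodule_axioms Q(1,2))
  have \<pi>onto: "\<pi> ` carrier (ri i) = carrier \<Delta>" using Q(3) by (simp add: \<pi>_def)
  have \<pi>ker: "\<pi> x = \<zero>\<^bsub>\<Delta>\<^esub> \<longleftrightarrow> x \<in> T" if "x \<in> carrier (ri i)" for x using Q(4)[OF that] that by (simp add: \<pi>_def)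
  have flD: "\<pi>.N.fin_len" by (rule \<pi>.fin_len_image[OF \<pi>onto ri_fin_len[OF i]])
  have \<Delta>O: "\<Delta> \<in> Obj (mod_add R)" by (rule mod_ObjI[OF \<pi>.N.rmodule_axioms \<pi>.N.fin_len_fin_gen[OF flD]])
  have f\<pi>: "factor_map R (ri i) \<Delta> \<pi>" unfolding factor_map_def using pD(3) \<Delta>O Q(2) \<pi>onto by blast
  have std: "standard_module R e i \<Delta>"
  proof (rule standard_moduleI[OF i f\<pi>])
    fix j assume j: "j \<in> {Suc i..t}"
    then have j': "j \<in> {1..t}" using i by auto
    note ej = idem_closed[OF j']
    show "killed j \<Delta>"
      unfolding killed_def
    proof
      fix y assume "y \<in> carrier \<Delta>"
      then obtain x where x: "x \<in> carrier (ri i)" "y = \<pi> x" unfolding \<pi>onto[symmetric] by blast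
      have xR: "x \<in> carrier R" using x ri_iff[OF i] by blast
      have c: "x \<otimes> e j \<in> carrier (ri i)" using p.M.smult_closed[OF ej x(1)] by simp
      have "(x \<otimes> e j) \<otimes> e j = x \<otimes> e j" using xR ej idem_mult[OF j' j'] by (simp add: m_assoc)
      then have "x \<otimes> e j \<in> T" using GT c j by blast
      then have "\<pi> (x \<otimes> e j) = \<zero>\<^bsub>\<Delta>\<^esub>" using \<pi>ker[OF c] by blast
      then show "e j \<odot>\<^bsub>\<Delta>\<^esub> y = \<zero>\<^bsub>\<Delta>\<^esub>" using \<pi>.lin[OF ej x(1)] x(2) by simp
    qed
  next
    show "generated_from i (Suc i) {x \<in> carrier (ri i). \<pi> x = \<zero>\<^bsub>\<Delta>\<^esub>}"
      unfolding generated_from_def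
    proof (intro allI impI)
      fix U assume U: "submodule U R (ri i)"
        and *: "\<forall>x \<in> {x \<in> carrier (ri i). \<pi> x = \<zero>\<^bsub>\<Delta>\<^esub>}. \<forall>j \<in> {Suc i..t}. x \<otimes> e j = x \<longrightarrow> x \<in> U"
      have "?G \<subseteq> U"
      proof
        fix x assume x: "x \<in> ?G"
        then have "x \<in> T" using GT by blast
        then show "x \<in> U" using * x \<pi>ker by blast
      qed
      then have "T \<subseteq> U" unfolding T_def by (rule p.M.span_least[OF U])
      then show "{x \<in> carrier (ri i). \<pi> x = \<zero>\<^bsub>\<Delta>\<^esub>} \<subseteq> U" using \<pi>ker by blast
    qed
  qed
  have kT: "p x = \<zero>\<^bsub>D\<^esub>" if "x \<in> carrier (ri i)" "\<pi> x = \<zero>\<^bsub>\<Delta>\<^esub>" for x using that \<pi>ker TK by blast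
  have "\<exists>r \<in> mod_hom R \<Delta> D. \<forall>x \<in> carrier (ri i). r (\<pi> x) = p x"
    by (rule \<pi>.factor_through[OF \<pi>onto p.N.rmodule_axioms p.hom kT]) auto
  then obtain r where r: "r \<in> mod_hom R \<Delta> D" "\<And>x. x \<in> carrier (ri i) \<Longrightarrow> r (\<pi> x) = p x" by metis
  have ronto: "r ` carrier \<Delta> = carrier D"
    unfolding \<pi>onto[symmetric] pD(2)[symmetric] image_image using r(2) by (rule image_cong[OF refl])
  have fr: "factor_map R \<Delta> D r" unfolding factor_map_def using \<Delta>O pD(4) r(1) ronto by blast
  have J: "{1..<i} \<subseteq> {1..t}" using i by auto
  have "rad R D \<in> filt (mod_cat R) (simples R e {1..<i})"
  proof -
    note rd = rad_submodule[OF p.N.rmodule_axioms]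
    let ?r = "D\<lparr>carrier := carrier (rad R D)\<rparr>"
    interpret rad: rmodule R ?r by (rule p.N.sub_rmodule[OF rd(1)])
    \<comment> \<open>Without a maximal submodule the radical would be all of D; one exists because
      D is nonzero of finite length.\<close>
    obtain U0 where U0: "maximal_submodule R U0 D"
    proof -
      define \<U> where "\<U> = {U. submodule U R D \<and> U \<noteq> carrier D}"
      have "{\<zero>\<^bsub>D\<^esub>} \<in> \<U>" using nz p.N.zero_submodule by (auto simp: \<U>_def)
      then have "\<exists>V \<in> \<U>. \<forall>W \<in> \<U>. V \<subseteq> W \<longrightarrow> W = V"
        by (rule p.N.fin_len_acc[OF fl]) (simp add: \<U>_def)
      then obtain V where V: "V \<in> \<U>" "\<forall>W \<in> \<U>. V \<subseteq> W \<longrightarrow> W = V" by (elim bexE) (rule that)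
      show thesis
      proof (rule that)
        show "maximal_submodule R V D"
          using V unfolding maximal_submodule_def \<U>_def by auto
      qed
    qed
    have "?r \<in> filt (mod_cat R) (simples R e {1..<i})"
    proof (rule simples_filt[OF rad.rmodule_axioms p.N.fin_len_sub[OF fl rd(1)] J])
      fix j assume j: "j \<in> {1..t} - {1..<i}"
      then have j': "j \<in> {1..t}" by simp
      have "e j \<odot>\<^bsub>D\<^esub> x = \<zero>\<^bsub>D\<^esub>" if x: "x \<in> carrier (rad R D)" for x
      proof (cases "j = i")
        case False
        then have "killed j D" using j k by auto
        then show ?thesis using x rd(3) by (auto simp: killed_def)
      next
        case True
        note ei = idem_closed[OF i]
        have xD: "x \<in> carrier D" using x rd(3) by blast
        have h: "e i \<odot>\<^bsub>D\<^esub> x \<in> carrier D" using ei xD by simp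
        have hh: "e i \<odot>\<^bsub>D\<^esub> (e i \<odot>\<^bsub>D\<^esub> x) = e i \<odot>\<^bsub>D\<^esub> x"
          using p.N.smult_assoc[OF ei ei xD] idem_mult[OF i i] by simp
        \<comment> \<open>A nonzero part at e(i) of a radical element would generate D and yet lie
          in the proper submodule \<open>U0\<close>.\<close>
        have "x \<in> U0" using x rd(3) U0 by blast
        then have "e i \<odot>\<^bsub>D\<^esub> x \<in> U0" by (rule submoduleD(4)[OF maximal_submoduleD(1)[OF U0] ei])
        then show ?thesis
          using hd[OF h _ hh maximal_submoduleD(1)[OF U0]] maximal_submoduleD(2)[OF U0] True by metis
      qed
      then show "killed j ?r" by (simp add: killed_def)
    qed
    then show ?thesis using rd(2) by simp
  qed
  moreover have "a_kernel \<Delta> D r \<subseteq> a_kernel \<Delta> N q"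
    if N: "rad R N \<in> filt (mod_cat R) (simples R e {1..<i})" and q: "factor_map R \<Delta> N q" for N q
  proof -
    note qD = factor_mapD[OF q]
    interpret q: rmod_hom R \<Delta> N q by (rule qD(1))
    let ?s = "compose (carrier (ri i)) q \<pi>"
    have s: "?s \<in> mod_hom R (ri i) N" by (rule mod_hom_cmp[OF p.M.rmodule_axioms \<pi>.hom q.hom])
    interpret s: rmod_hom R "ri i" N ?s by unfold_locales (rule s)
    have sx: "?s x = q (\<pi> x)" if "x \<in> carrier (ri i)" for x using that by (simp add: compose_def)
    have sonto: "?s ` carrier (ri i) = carrier N"
      unfolding qD(2)[symmetric] \<pi>onto[symmetric] image_image using sx by (rule image_cong[OF refl])
    note rd = rad_submodule[OF q.N.rmodule_axioms]
    \<comment> \<open>The kernel \<open>?K\<close> is a proper submodule of the local module e(i) R.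
      If its image were not contained in a maximal V, then \<open>?K\<close> and the preimage of V
      would together produce e(i), so that the preimage is everything and V = N.\<close>
    have rad: "?s x \<in> carrier (rad R N)" if x: "x \<in> ?K" for x
      unfolding rd(3)
    proof (intro conjI allI impI)
      show "?s x \<in> carrier N" using x by simp
      fix V assume V: "maximal_submodule R V N"
      show "?s x \<in> V"
      proof (rule ccontr)
        assume nV: "?s x \<notin> V"
        let ?W = "{x \<in> carrier (ri i). ?s x \<in> V}"
        have sW: "submodule ?W R (ri i)" by (rule s.vimage_submodule[OF maximal_submoduleD(1)[OF V]])
        have ei: "e i \<in> carrier (ri i)" by (rule idem_in_ri[OF i])
        obtain v y where vy: "v \<in> V" "y \<in> ?s ` ?K" "v \<oplus>\<^bsub>N\<^esub> y = ?s (e i)"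
          by (rule maximal_submodule_sum[OF q.N.rmodule_axioms V s.image_submodule[OF sK] imageI[OF x] nV s.closed[OF ei]])
        then obtain z where z: "z \<in> ?K" "y = ?s z" by blast
        then have zc: "z \<in> carrier (ri i)" by blast
        have vN: "v \<in> carrier N" using vy(1) submoduleD(1)[OF maximal_submoduleD(1)[OF V]] by blast
        have "?s (e i \<ominus>\<^bsub>ri i\<^esub> z) = ?s (e i) \<ominus>\<^bsub>N\<^esub> ?s z" by (rule s.diff[OF ei zc])
        also have "\<dots> = v"
          unfolding vy(3)[symmetric] z(2) a_minus_def using vN s.closed[OF zc]
          by (simp add: q.N.M.a_assoc q.N.M.r_neg)
        finally have "e i \<ominus>\<^bsub>ri i\<^esub> z \<in> ?W" using vy(1) p.M.M.minus_closed[OF ei zc] by simp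
        moreover have "(e i \<ominus>\<^bsub>ri i\<^esub> z) \<oplus>\<^bsub>ri i\<^esub> z = e i"
          unfolding a_minus_def using ei zc p.M.M.a_inv_closed[OF zc]
          by (simp only: p.M.M.a_assoc p.M.M.l_neg p.M.M.r_zero)
        ultimately have "?W = carrier (ri i) \<or> ?K = carrier (ri i)"
          using ri_local[OF i sW sK _ z(1)] by simp
        then have W: "?W = carrier (ri i)" using Kprop by blast
        have "carrier N \<subseteq> V" unfolding sonto[symmetric] using W by blast
        then show False using maximal_submoduleD(1,2)[OF V] submoduleD(1) by blast
      qed
    qed
    have "?K \<subseteq> {x \<in> carrier (ri i). ?s x \<in> {\<zero>\<^bsub>N\<^esub>}}"
    proof (rule generated_fromD[OF gen s.vimage_submodule[OF q.N.zero_submodule]])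
      fix x j assume x: "x \<in> ?K" and j: "j \<in> {i..t}" and xj: "x \<otimes> e j = x"
      then have xc: "x \<in> carrier (ri i)" and j': "j \<in> {1..t}" using i by auto
      have "?s x = \<zero>\<^bsub>N\<^esub>"
      \<comment> \<open>Parts above i vanish already in \<Delta>; the part at i vanishes because the
        radical of N is killed by e(i).\<close>
      proof (cases "j = i")
        case False
        then have "j \<in> {Suc i..t}" using j by auto
        then have "x \<in> T" using GT xc xj by blast
        then show ?thesis using sx[OF xc] \<pi>ker[OF xc] by simp
      next
        case True
        have "killed i (rad R N)" by (rule filt_simples_killed(1)[OF N J]) (use i in auto)
        then have "e i \<odot>\<^bsub>N\<^esub> ?s x = \<zero>\<^bsub>N\<^esub>" using rad[OF x] by (simp add: killed_def rad_def)
        then show ?thesis using s.lin[OF idem_closed[OF i] xc] xj True by simp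
      qed
      then show "x \<in> {x \<in> carrier (ri i). ?s x \<in> {\<zero>\<^bsub>N\<^esub>}}" using xc by simp
    qed
    then have K: "q (\<pi> x) = \<zero>\<^bsub>N\<^esub>" if "x \<in> carrier (ri i)" "p x = \<zero>\<^bsub>D\<^esub>" for x using that sx by auto
    show ?thesis
    proof
      fix y assume "y \<in> a_kernel \<Delta> D r"
      then have y: "y \<in> carrier \<Delta>" "r y = \<zero>\<^bsub>D\<^esub>" unfolding a_kernel_def' by auto
      then obtain x where "x \<in> carrier (ri i)" "y = \<pi> x" unfolding \<pi>onto[symmetric] by blast
      then show "y \<in> a_kernel \<Delta> N q" unfolding a_kernel_def' using K r(2) y by auto
    qed
  qed
  ultimately have "max_factor R \<Delta> {N. rad R N \<in> filt (mod_cat R) (simples R e {1..<i})} D"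
    unfolding max_factor_def using fr by blast
  then show ?thesis unfolding proper_standard_module_def using std by blast
qed

end

section \<open>The functor from a mixed stratifying system to modules\<close>

lemma k_spaceD:
  assumes "k_space sm G"
  shows "comm_group G" "\<And>a x. x \<in> carrier G \<Longrightarrow> sm a x \<in> carrier G" "\<And>x. x \<in> carrier G \<Longrightarrow> sm 1 x = x"
    "\<And>a b x. x \<in> carrier G \<Longrightarrow> sm (a * b) x = sm a (sm b x)"
    "\<And>a b x. x \<in> carrier G \<Longrightarrow> sm (a + b) x = sm a x \<otimes>\<^bsub>G\<^esub> sm b x"
    "\<And>a x y. \<lbrakk>x \<in> carrier G; y \<in> carrier G\<rbrakk> \<Longrightarrow> sm a (x \<otimes>\<^bsub>G\<^esub> y) = sm a x \<otimes>\<^bsub>G\<^esub> sm a y"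
  using assms unfolding k_space_def by blast+

definition k_subspace :: "('k::field \<Rightarrow> 'm \<Rightarrow> 'm) \<Rightarrow> ('m, 'z) monoid_scheme \<Rightarrow> 'm set \<Rightarrow> bool" where
  "k_subspace sm G U \<longleftrightarrow> U \<subseteq> carrier G \<and> \<one>\<^bsub>G\<^esub> \<in> U \<and> (\<forall>x \<in> U. \<forall>y \<in> U. x \<otimes>\<^bsub>G\<^esub> y \<in> U) \<and> (\<forall>a. \<forall>x \<in> U. sm a x \<in> U)"

text \<open>A stand-in for the dimension of subspaces of W: only strict monotonicity is recorded,
  which is what \<open>fin_len\<close> asks for.\<close>

definition has_measure :: "('k::field \<Rightarrow> 'm \<Rightarrow> 'm) \<Rightarrow> ('m, 'z) monoid_scheme \<Rightarrow> 'm set \<Rightarrow> bool" where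
  "has_measure sm G W \<longleftrightarrow> (\<exists>\<mu> :: 'm set \<Rightarrow> nat. \<forall>U V. k_subspace sm G U \<and> k_subspace sm G V \<and> U \<subset> V \<and> V \<subseteq> W \<longrightarrow> \<mu> U < \<mu> V)"

text \<open>The measure gains one on subspaces that leave W. If U is contained in V, has the same
  trace on W and leaves W, then U = V: subtracting a multiple of an element of U outside W brings
  any element of V into W.\<close>

lemma has_measure_insert:
  assumes G: "k_space sm G" and W: "k_subspace sm G W" and m: "has_measure sm G W" and s: "s \<in> carrier G"
  defines "W' \<equiv> {w \<otimes>\<^bsub>G\<^esub> sm c s | w c. w \<in> W}"
  shows "k_subspace sm G W'" "has_measure sm G W'"
proof -
  note k = k_spaceD[OF G]
  interpret comm_group G by (rule k(1))
  have Wc: "w \<in> carrier G" if "w \<in> W" for w using that W by (auto simp: k_subspace_def)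
  have Wa: "x \<otimes>\<^bsub>G\<^esub> y \<in> W" if "x \<in> W" "y \<in> W" for x y using that W by (auto simp: k_subspace_def)
  have Ws: "sm a x \<in> W" if "x \<in> W" for a x using that W by (auto simp: k_subspace_def)
  have zero: "sm 0 x = \<one>\<^bsub>G\<^esub>" if "x \<in> carrier G" for x
    using k(5)[OF that, of 0 0] k(2)[OF that, of 0] by (simp add: r_cancel_one)
  show "k_subspace sm G W'"
    unfolding k_subspace_def
  proof (intro conjI ballI allI)
    show "W' \<subseteq> carrier G" unfolding W'_def using Wc s k(2) by auto
    show "\<one>\<^bsub>G\<^esub> \<in> W'"
      unfolding W'_def using W zero[OF s] by (intro CollectI exI[of _ "\<one>\<^bsub>G\<^esub>"] exI[of _ 0]) (auto simp: k_subspace_def)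
  next
    fix x y assume "x \<in> W'" "y \<in> W'"
    then obtain w c w' c' where x: "x = w \<otimes>\<^bsub>G\<^esub> sm c s" "y = w' \<otimes>\<^bsub>G\<^esub> sm c' s" "w \<in> W" "w' \<in> W"
      unfolding W'_def by blast
    then have "x \<otimes>\<^bsub>G\<^esub> y = (w \<otimes>\<^bsub>G\<^esub> w') \<otimes>\<^bsub>G\<^esub> sm (c + c') s" using Wc s k(2,5) by (simp add: m_ac)
    then show "x \<otimes>\<^bsub>G\<^esub> y \<in> W'" unfolding W'_def using x Wa by blast
  next
    fix a x assume "x \<in> W'"
    then obtain w c where x: "x = w \<otimes>\<^bsub>G\<^esub> sm c s" "w \<in> W" unfolding W'_def by blast
    then have "sm a x = sm a w \<otimes>\<^bsub>G\<^esub> sm (a * c) s" using Wc s k(2,4,6) by simp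
    then show "sm a x \<in> W'" unfolding W'_def using x Ws by blast
  qed
  obtain \<mu> :: "'b set \<Rightarrow> nat" where
    \<mu>: "\<And>U V. \<lbrakk>k_subspace sm G U; k_subspace sm G V; U \<subset> V; V \<subseteq> W\<rbrakk> \<Longrightarrow> \<mu> U < \<mu> V"
    using m unfolding has_measure_def by blast
  have int: "k_subspace sm G (U \<inter> W)" if "k_subspace sm G U" for U
    using that W unfolding k_subspace_def by blast
  define \<nu> where "\<nu> U = \<mu> (U \<inter> W) + (if U \<subseteq> W then 0 else 1)" for U
  have "\<nu> U < \<nu> V" if U: "k_subspace sm G U" and V: "k_subspace sm G V" and UV: "U \<subset> V" and VW: "V \<subseteq> W'" for U V
  proof (cases "U \<inter> W = V \<inter> W")
    case False
    then have "\<mu> (U \<inter> W) < \<mu> (V \<inter> W)" using UV by (intro \<mu> int U V) auto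
    then show ?thesis unfolding \<nu>_def using UV by auto
  next
    case True
    have "U \<subseteq> W"
    proof (rule ccontr)
      assume "\<not> U \<subseteq> W"
      then obtain u where u: "u \<in> U" "u \<notin> W" by blast
      then obtain w1 c1 where u': "u = w1 \<otimes>\<^bsub>G\<^esub> sm c1 s" "w1 \<in> W" using UV VW unfolding W'_def by blast
      have "c1 \<noteq> 0" using u u' zero[OF s] Wc by auto
      have uc: "u \<in> carrier G" using u U by (auto simp: k_subspace_def)
      have "V \<subseteq> U"
      proof
        fix v assume v: "v \<in> V"
        then obtain w c where v': "v = w \<otimes>\<^bsub>G\<^esub> sm c s" "w \<in> W" using VW unfolding W'_def by blast
        have vc: "v \<in> carrier G" using v V by (auto simp: k_subspace_def)
        \<comment> \<open>This coefficient cancels the component along \<open>s\<close>;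
          \<open>c1\<close> is nonzero because \<open>u\<close> lies outside W.\<close>
        define a where "a = - (c / c1)"
        define x where "x = v \<otimes>\<^bsub>G\<^esub> sm a u"
        have ac: "a * c1 = - c" using \<open>c1 \<noteq> 0\<close> by (simp add: a_def)
        have "x = (w \<otimes>\<^bsub>G\<^esub> sm a w1) \<otimes>\<^bsub>G\<^esub> (sm c s \<otimes>\<^bsub>G\<^esub> sm (a * c1) s)"
          unfolding x_def v' u' using Wc v' u' s k(2,4,6) by (simp add: m_ac)
        also have "sm c s \<otimes>\<^bsub>G\<^esub> sm (a * c1) s = \<one>\<^bsub>G\<^esub>"
          unfolding ac using k(5)[OF s, of c "- c"] zero[OF s] by simp
        finally have "x \<in> W" using Wc Wa Ws v' u' by simp
        moreover have "x \<in> V" unfolding x_def using v u UV V by (auto simp: k_subspace_def)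
        ultimately have xU: "x \<in> U" using True by blast
        have "x \<otimes>\<^bsub>G\<^esub> sm (- a) u = v \<otimes>\<^bsub>G\<^esub> (sm a u \<otimes>\<^bsub>G\<^esub> sm (- a) u)"
          unfolding x_def using uc vc k(2) by (simp add: m_assoc)
        also have "sm a u \<otimes>\<^bsub>G\<^esub> sm (- a) u = \<one>\<^bsub>G\<^esub>"
          using k(5)[OF uc, of a "- a", symmetric] zero[OF uc] by simp
        also have "v \<otimes>\<^bsub>G\<^esub> \<one>\<^bsub>G\<^esub> = v" using vc by simp
        finally have "v = x \<otimes>\<^bsub>G\<^esub> sm (- a) u" ..
        moreover have "x \<otimes>\<^bsub>G\<^esub> sm (- a) u \<in> U" using U xU u unfolding k_subspace_def by blast
        ultimately show "v \<in> U" by simp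
      qed
      then show False using UV by blast
    qed
    moreover have "\<not> V \<subseteq> W" using True UV \<open>U \<subseteq> W\<close> by blast
    ultimately show ?thesis unfolding \<nu>_def using True by simp
  qed
  then show "has_measure sm G W'" unfolding has_measure_def by blast
qed

text \<open>The generators are adjoined one at a time to the zero subspace, so no basis has to be
  chosen and linear dependence among them is harmless.\<close>

lemma fin_dim_measure:
  assumes G: "k_space sm G" "fin_dim sm G"
  shows "has_measure sm G (carrier G)"
proof -
  note k = k_spaceD[OF G(1)]
  interpret comm_group G by (rule k(1))
  have one: "sm a \<one>\<^bsub>G\<^esub> = \<one>\<^bsub>G\<^esub>" for a
    using k(6)[of "\<one>\<^bsub>G\<^esub>" "\<one>\<^bsub>G\<^esub>" a] k(2)[of "\<one>\<^bsub>G\<^esub>" a] by (simp add: r_cancel_one)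
  obtain S where S: "finite S" "S \<subseteq> carrier G" "\<forall>x \<in> carrier G. \<exists>c. x = finprod G (\<lambda>s. sm (c s) s) S"
    using G(2) unfolding fin_dim_def by blast
  have "\<exists>W. k_subspace sm G W \<and> has_measure sm G W \<and> (\<forall>c. finprod G (\<lambda>s. sm (c s) s) S \<in> W)"
    using S(1,2)
  proof (induction S rule: finite_induct)
    case empty
    have "k_subspace sm G {\<one>\<^bsub>G\<^esub>}" using one by (simp add: k_subspace_def)
    moreover have "has_measure sm G {\<one>\<^bsub>G\<^esub>}" unfolding has_measure_def k_subspace_def by auto
    ultimately show ?case by auto
  next
    case (insert s S)
    then obtain W where W: "k_subspace sm G W" "has_measure sm G W" "\<forall>c. finprod G (\<lambda>s. sm (c s) s) S \<in> W" by auto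
    have s: "s \<in> carrier G" using insert by auto
    note W' = has_measure_insert[OF G(1) W(1,2) s]
    have "finprod G (\<lambda>s. sm (c s) s) (insert s S) \<in> {w \<otimes>\<^bsub>G\<^esub> sm c s | w c. w \<in> W}" for c
    proof -
      have f: "(\<lambda>s. sm (c s) s) \<in> S \<rightarrow> carrier G" using insert k(2) by auto
      have "finprod G (\<lambda>s. sm (c s) s) (insert s S) = finprod G (\<lambda>s. sm (c s) s) S \<otimes>\<^bsub>G\<^esub> sm (c s) s"
        using finprod_insert[OF insert(1,2) f k(2)[OF s]] m_comm[OF k(2)[OF s] finprod_closed[OF f]] by simp
      then show ?thesis using W(3) by blast
    qed
    then show ?case using W' by blast
  qed
  then obtain W where W: "k_subspace sm G W" "has_measure sm G W" "\<forall>c. finprod G (\<lambda>s. sm (c s) s) S \<in> W" by blast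
  have "carrier G \<subseteq> W"
  proof
    fix x assume "x \<in> carrier G"
    then obtain c where "x = finprod G (\<lambda>s. sm (c s) s) S" using S(3) by blast
    then show "x \<in> W" using W(3) by simp
  qed
  then have "carrier G = W" using W(1) unfolding k_subspace_def by blast
  then show ?thesis using W(2) by simp
qed

section \<open>The represented functor on morphisms through Q\<close>

lemma psi_obj_simps [simp]:
  "carrier (psi_obj C Q X) = Hom C Q X" "zero (psi_obj C Q X) = zer C Q X" "add (psi_obj C Q X) = pls C"
  "smult (psi_obj C Q X) = (\<lambda>b f. cmp C f b)"
  by (simp_all add: psi_obj_def)

context preadditive
begin

lemma psi_rmodule:
  assumes "Q \<in> Obj C" "X \<in> Obj C"
  shows "rmodule (End_ring C Q) (psi_obj C Q X)"
proof -
  have "abelian_group (psi_obj C Q X)"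
  proof (rule abelian_groupI)
    show "\<exists>y \<in> carrier (psi_obj C Q X). y \<oplus>\<^bsub>psi_obj C Q X\<^esub> x = \<zero>\<^bsub>psi_obj C Q X\<^esub>"
      if "x \<in> carrier (psi_obj C Q X)" for x
      using that assms by (intro bexI[of _ "mn x"]) auto
  qed (use assms in \<open>auto simp: pls_ac\<close>)
  then show ?thesis
    using assms by (intro rmodule.intro rmodule_axioms.intro ring_End) auto
qed

definition psi :: "'o \<Rightarrow> 'o \<Rightarrow> 'm \<Rightarrow> 'm \<Rightarrow> 'm" where
  "psi Q X h = (\<lambda>f \<in> Hom C Q X. h \<bullet> f)"

lemma psi_hom:
  assumes "Q \<in> Obj C" "ar h" "src h = X" "tgt h = Y"
  shows "psi Q X h \<in> mod_hom (End_ring C Q) (psi_obj C Q X) (psi_obj C Q Y)"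
proof -
  have O: "X \<in> Obj C" "Y \<in> Obj C" using assms src_obj tgt_obj by blast+
  have "(\<lambda>f \<in> carrier (psi_obj C Q X). h \<bullet> f) \<in> mod_hom (End_ring C Q) (psi_obj C Q X) (psi_obj C Q Y)"
    by (rule mod_hom_restrictI[OF psi_rmodule]) (use assms O in auto)
  then show ?thesis by (simp add: psi_def)
qed

lemma psi_app [simp]: "\<lbrakk>Q \<in> Obj C; X \<in> Obj C; ar f; src f = Q; tgt f = X\<rbrakk> \<Longrightarrow> psi Q X h f = h \<bullet> f"
  by (simp add: psi_def)

lemma psi_mor_eq: "psi_mor C Q X Y h = (psi_obj C Q X, psi_obj C Q Y, psi Q X h)"
  by (simp add: psi_mor_def psi_def)

context
  fixes Q S X Y n s
  assumes thr: "thr {Q} X Y n s" and O: "Q \<in> Obj C" "X \<in> Obj C" "Y \<in> Obj C"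
begin

text \<open>\<open>h\<close> kills each summand b a of \<open>s\<close> because it kills b. With
  \<open>s\<close> the identity of an object of add Q this is faithfulness there.\<close>

lemma thr_faithful:
  assumes "ar h" "src h = Y" "tgt h = Z" "\<And>b. \<lbrakk>ar b; src b = Q; tgt b = Y\<rbrakk> \<Longrightarrow> h \<bullet> b = zer C Q Z"
  shows "h \<bullet> s = zer C X Z"
  using thr
proof induction
  case thr_zer
  then show ?case using assms(1-3) O by simp
next
  case (thr_pls n s W a b)
  have Z: "Z \<in> Obj C" using assms by (metis tgt_obj)
  note s = thr_arr[OF thr_pls(1) _ O(2,3)]
  have ab: "ar a" "src a = X" "tgt a = Q" "ar b" "src b = Q" "tgt b = Y" using thr_pls O by auto
  have "h \<bullet> (b \<bullet> a) = zer C X Z"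
    using pre_simp[OF assms(4)[OF ab(4-6)], of a] ab assms(1-3) O Z by simp
  then show ?case using thr_pls(5) s ab assms(1-3) O Z by simp
qed

text \<open>On a summand b a, linearity over End Q turns \<phi> into composition with \<phi>(b) a.
  The sum of these morphisms represents \<phi> after \<open>s\<close>; with \<open>s\<close> an
  identity this is fullness on add Q.\<close>

lemma thr_full:
  assumes "\<phi> \<in> mod_hom (End_ring C Q) (psi_obj C Q Y) (psi_obj C Q Z)" "Z \<in> Obj C"
  shows "\<exists>h. ar h \<and> src h = X \<and> tgt h = Z \<and> (\<forall>f. ar f \<and> src f = Q \<and> tgt f = X \<longrightarrow> \<phi> (s \<bullet> f) = h \<bullet> f)"
  using thr
proof induction
  case thr_zer
  interpret \<phi>: rmod_hom "End_ring C Q" "psi_obj C Q Y" "psi_obj C Q Z" \<phi>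
    by (intro rmod_hom.intro rmod_hom_axioms.intro psi_rmodule O assms)
  show ?case using \<phi>.zero O assms(2) by (intro exI[of _ "zer C X Z"]) auto
next
  case (thr_pls n s W a b)
  interpret \<phi>: rmod_hom "End_ring C Q" "psi_obj C Q Y" "psi_obj C Q Z" \<phi>
    by (intro rmod_hom.intro rmod_hom_axioms.intro psi_rmodule O assms)
  note s = thr_arr[OF thr_pls(1) _ O(2,3)]
  have ab: "ar a" "src a = X" "tgt a = Q" "ar b" "src b = Q" "tgt b = Y" using thr_pls O by auto
  obtain h where h: "ar h" "src h = X" "tgt h = Z"
    "\<And>f. ar f \<and> src f = Q \<and> tgt f = X \<Longrightarrow> \<phi> (s \<bullet> f) = h \<bullet> f" using thr_pls(5) by blast
  have \<phi>b: "ar (\<phi> b)" "src (\<phi> b) = Q" "tgt (\<phi> b) = Z" using \<phi>.closed[of b] ab O assms(2) by auto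
  have "\<phi> ((s \<boxplus> (b \<bullet> a)) \<bullet> f) = (h \<boxplus> (\<phi> b \<bullet> a)) \<bullet> f" if f: "ar f" "src f = Q" "tgt f = X" for f
  proof -
    have "\<phi> ((s \<boxplus> (b \<bullet> a)) \<bullet> f) = \<phi> ((s \<bullet> f) \<boxplus> (b \<bullet> (a \<bullet> f)))" using s ab f O by simp
    also have "\<dots> = \<phi> (s \<bullet> f) \<boxplus> \<phi> (b \<bullet> (a \<bullet> f))"
      using \<phi>.add[of "s \<bullet> f" "b \<bullet> (a \<bullet> f)"] s ab f O by simp
    also have "\<phi> (b \<bullet> (a \<bullet> f)) = \<phi> b \<bullet> (a \<bullet> f)"
      using \<phi>.lin[of "a \<bullet> f" b] ab f O by simp
    finally show ?thesis using h f \<phi>b ab by simp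
  qed
  then show ?case using h \<phi>b ab by (intro exI[of _ "h \<boxplus> (\<phi> b \<bullet> a)"]) auto
qed

text \<open>For a summand b a choose m with g(m) = \<phi>(b) and send f to the action of a f on m.
  With \<open>s\<close> the identity of an object of add Q this is projectivity of its
  image.\<close>

lemma thr_projective:
  assumes "rmod_hom (End_ring C Q) M N g" "g ` carrier M = carrier N"
    "\<phi> \<in> mod_hom (End_ring C Q) (psi_obj C Q Y) N"
  shows "\<exists>\<psi> \<in> mod_hom (End_ring C Q) (psi_obj C Q X) M.
    \<forall>f. ar f \<and> src f = Q \<and> tgt f = X \<longrightarrow> g (\<psi> f) = \<phi> (s \<bullet> f)"
  using thr
proof induction
  case thr_zer
  interpret g: rmod_hom "End_ring C Q" M N g by fact
  interpret \<phi>: rmod_hom "End_ring C Q" "psi_obj C Q Y" N \<phi>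
    by (intro rmod_hom.intro rmod_hom_axioms.intro psi_rmodule O assms g.N.rmodule_axioms)
  show ?case using \<phi>.zero O
    by (intro bexI[OF _ g.M.mod_hom_zero[OF psi_rmodule]]) auto
next
  case (thr_pls n s W a b)
  interpret g: rmod_hom "End_ring C Q" M N g by fact
  interpret \<phi>: rmod_hom "End_ring C Q" "psi_obj C Q Y" N \<phi>
    by (intro rmod_hom.intro rmod_hom_axioms.intro psi_rmodule O assms g.N.rmodule_axioms)
  note s = thr_arr[OF thr_pls(1) _ O(2,3)]
  have ab: "ar a" "src a = X" "tgt a = Q" "ar b" "src b = Q" "tgt b = Y" using thr_pls O by auto
  obtain \<psi> where \<psi>: "\<psi> \<in> mod_hom (End_ring C Q) (psi_obj C Q X) M"
    "\<And>f. ar f \<and> src f = Q \<and> tgt f = X \<Longrightarrow> g (\<psi> f) = \<phi> (s \<bullet> f)" using thr_pls(5) by blast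
  have "\<phi> b \<in> carrier N" using \<phi>.closed[of b] ab O by simp
  then obtain m where m: "m \<in> carrier M" "g m = \<phi> b" unfolding assms(2)[symmetric] by auto
  let ?m = "\<lambda>f \<in> carrier (psi_obj C Q X). (a \<bullet> f) \<odot>\<^bsub>M\<^esub> m"
  have mh: "?m \<in> mod_hom (End_ring C Q) (psi_obj C Q X) M"
  proof (rule mod_hom_restrictI[OF psi_rmodule])
    fix r f assume rf: "r \<in> carrier (End_ring C Q)" "f \<in> carrier (psi_obj C Q X)"
    have "((a \<bullet> f) \<bullet> r) \<odot>\<^bsub>M\<^esub> m = r \<odot>\<^bsub>M\<^esub> ((a \<bullet> f) \<odot>\<^bsub>M\<^esub> m)"
      using g.M.smult_assoc[of "a \<bullet> f" r m] ab O m(1) rf by simp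
    then show "(a \<bullet> (r \<odot>\<^bsub>psi_obj C Q X\<^esub> f)) \<odot>\<^bsub>M\<^esub> m = r \<odot>\<^bsub>M\<^esub> ((a \<bullet> f) \<odot>\<^bsub>M\<^esub> m)"
      using ab O rf by simp
  next
    fix f f' assume f: "f \<in> carrier (psi_obj C Q X)" "f' \<in> carrier (psi_obj C Q X)"
    then show "(a \<bullet> (f \<oplus>\<^bsub>psi_obj C Q X\<^esub> f')) \<odot>\<^bsub>M\<^esub> m = (a \<bullet> f) \<odot>\<^bsub>M\<^esub> m \<oplus>\<^bsub>M\<^esub> (a \<bullet> f') \<odot>\<^bsub>M\<^esub> m"
      using g.M.smult_l_distr[of "a \<bullet> f" "a \<bullet> f'" m] ab O m(1) by simp
  next
    fix f assume "f \<in> carrier (psi_obj C Q X)"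
    then show "(a \<bullet> f) \<odot>\<^bsub>M\<^esub> m \<in> carrier M" using ab O m(1) by simp
  qed (use O in auto)
  have "g (\<psi> f \<oplus>\<^bsub>M\<^esub> (a \<bullet> f) \<odot>\<^bsub>M\<^esub> m) = \<phi> ((s \<boxplus> (b \<bullet> a)) \<bullet> f)" if f: "ar f" "src f = Q" "tgt f = X" for f
  proof -
    have af: "a \<bullet> f \<in> carrier (End_ring C Q)" using ab f O by simp
    have pf: "\<psi> f \<in> carrier M" using mod_homD(1)[OF \<psi>(1), of f] f O by simp
    have "g (\<psi> f \<oplus>\<^bsub>M\<^esub> (a \<bullet> f) \<odot>\<^bsub>M\<^esub> m) = \<phi> (s \<bullet> f) \<oplus>\<^bsub>N\<^esub> (a \<bullet> f) \<odot>\<^bsub>N\<^esub> \<phi> b"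
      using g.add[OF pf g.M.smult_closed[OF af m(1)]] g.lin[OF af m(1)] \<psi>(2) f m(2) by simp
    also have "\<dots> = \<phi> ((s \<bullet> f) \<boxplus> (b \<bullet> (a \<bullet> f)))"
      using \<phi>.add[of "s \<bullet> f" "b \<bullet> (a \<bullet> f)"] \<phi>.lin[OF af, of b] s ab f O by simp
    finally show ?thesis using s ab f O by simp
  qed
  then show ?case using O
    by (intro bexI[OF _ g.M.mod_hom_add[OF psi_rmodule[OF O(1,2)] \<psi>(1) mh]]) simp
qed

end

end

section \<open>Vanishing results for a mixed stratifying system\<close>

locale mss = extriangulated_negative C for C :: "('o, 'm, 'e, 'n) neg_extri" (structure) +
  fixes sm :: "'k::field \<Rightarrow> 'm \<Rightarrow> 'm" and t :: nat and \<Theta> P :: "nat \<Rightarrow> 'o" and PP :: 'o and \<iota> \<pi> :: "nat \<Rightarrow> 'm"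
  assumes klin: "k_linear_category C sm"
    and homfin: "hom_finite C sm"
    and ks: "krull_schmidt C"
    and sys: "mixed_stratifying_system C t \<Theta> P"
    and ds: "direct_sum C {1..t} P PP \<iota> \<pi>"
begin

abbreviation B :: "'m ring" where "B \<equiv> End_ring C PP"
abbreviation \<Psi> :: "'o \<Rightarrow> ('m, 'm) module" where "\<Psi> \<equiv> psi_obj C PP"
abbreviation F :: "nat set \<Rightarrow> 'o set" where "F J \<equiv> fl (\<Theta> ` J)"

lemma PP_obj [simp]: "PP \<in> Obj C" using ds by (simp add: direct_sum_def)

lemma \<Theta>_obj [simp]: "i \<in> {1..t} \<Longrightarrow> \<Theta> i \<in> Obj C"
  using sys by (simp add: mixed_stratifying_system_def)

lemma P_indec: "i \<in> {1..t} \<Longrightarrow> indecomposable C (P i)"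
  using sys by (simp add: mixed_stratifying_system_def)

lemma P_obj [simp]: "i \<in> {1..t} \<Longrightarrow> P i \<in> Obj C"
  using P_indec by (simp add: indecomposable_def)

lemma P_loc: "i \<in> {1..t} \<Longrightarrow> loc (P i)"
  using indecomposable_loc[OF P_indec ks] .

lemma brick_or_stone: "i \<in> {1..t} \<Longrightarrow> brick C (\<Theta> i) \<or> stone C (\<Theta> i)"
  using sys unfolding mixed_stratifying_system_def by blast

text \<open>The endomorphism ring of a brick is a division ring, and a stone is indecomposable,
  hence local in a Krull-Schmidt category. Both kinds enter the filtration arguments through
  locality.\<close>

lemma \<Theta>_loc: "i \<in> {1..t} \<Longrightarrow> loc (\<Theta> i)"
  using brick_or_stone brick_loc indecomposable_loc[OF _ ks] unfolding stone_def by blast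

lemma \<Theta>_hom_zero: "\<lbrakk>i \<in> {1..t}; j \<in> {1..t}; j < i; ar f; src f = \<Theta> i; tgt f = \<Theta> j\<rbrakk> \<Longrightarrow> f = zer C (\<Theta> i) (\<Theta> j)"
  using sys unfolding mixed_stratifying_system_def by (metis (no_types, lifting) \<Theta>_obj hom_iff singletonD)

lemma filt_F: "J \<subseteq> {1..t} \<Longrightarrow> filt C (\<Theta> ` J) = F J"
  by (rule filt_fl) (use \<Theta>_loc in auto)

lemma F_mono: "\<lbrakk>X \<in> F J; J \<subseteq> J'\<rbrakk> \<Longrightarrow> X \<in> F J'"
  using fl_mono by (metis image_mono)

lemma P_conflation:
  assumes "i \<in> {1..t}"
  obtains K f g d where "K \<in> F {i..t}" "conflation C K f (P i) g (\<Theta> i) d"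
proof -
  have "{i..t} \<subseteq> {1..t}" using assms by auto
  then show thesis
    using sys assms that filt_F[of "{i..t}"] unfolding mixed_stratifying_system_def by metis
qed

lemma P_F: "i \<in> {1..t} \<Longrightarrow> P i \<in> F {i..t}"
proof -
  assume i: "i \<in> {1..t}"
  obtain K f g d where K: "K \<in> F {i..t}" "conflation C K f (P i) g (\<Theta> i) d" using P_conflation[OF i] by metis
  have "\<Theta> i \<in> F {i..t}" by (rule fl_member) (use i in auto)
  then show ?thesis by (rule fl_closed[OF K])
qed

lemma P_thr: "\<exists>n. thr (P ` {1..t}) PP PP n (ident C PP)"
  by (rule direct_sum_thr[OF ds]) auto

text \<open>Each P(i) is an extension of \<Theta>(i) by K(i), and P is a finite direct sum of the
  P(i).\<close>

lemma PP_F: "PP \<in> F {1..t}"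
proof -
  have "PP \<in> sums (P ` {1..t})" proof -
    obtain n where "thr (P ` {1..t}) PP PP n (ident C PP)" using P_thr by blast
    then show ?thesis by (rule ident_thr_sums) (use P_loc in auto)
  qed
  moreover have "P ` {1..t} \<subseteq> F {1..t}"
  proof
    fix X assume "X \<in> P ` {1..t}"
    then obtain i where i: "i \<in> {1..t}" "X = P i" by blast
    show "X \<in> F {1..t}" unfolding i(2) by (rule F_mono[OF P_F[OF i(1)]]) (use i(1) in auto)
  qed
  ultimately show ?thesis by (rule sums_fl)
qed

lemma PP_ext:
  assumes "X \<in> F {1..t}"
  shows "carrier (Ext C PP X) = {\<one>\<^bsub>Ext C PP X\<^esub>}"
proof -
  have "carrier (Ext C (P i) X) = {\<one>\<^bsub>Ext C (P i) X\<^esub>}" if "i \<in> {1..t}" for i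
    using sys that assms filt_F[of "{1..t}"] unfolding mixed_stratifying_system_def by blast
  moreover obtain n where n: "thr (P ` {1..t}) PP PP n (ident C PP)" using P_thr by blast
  ultimately show ?thesis by (intro bif_thr_ident[OF ET1 n _ PP_obj fl_obj[OF assms]]) (auto simp del: One_nat_def)
qed

lemma thr_ob_ext:
  assumes "X \<in> F {1..t}" "thr_ob PP Q"
  shows "carrier (Ext C Q X) = {\<one>\<^bsub>Ext C Q X\<^esub>}"
  using assms(2) bif_thr_ident[OF ET1, of "{PP}" Q _ X] PP_ext[OF assms(1)] fl_obj[OF assms(1)]
  unfolding thr_ob_def by (metis PP_obj empty_subsetI insert_subset singletonD)

lemma next_F: "\<lbrakk>X \<in> F {1..t}; Y \<in> F {1..t}\<rbrakk> \<Longrightarrow> carrier (NExt C X Y) = {\<one>\<^bsub>NExt C X Y\<^esub>}"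
proof (rule next_trivial_fl[where S="\<Theta> ` {1..t}"])
  have *: "\<forall>i \<in> {1..t}. \<forall>j \<in> {1..t}. carrier (NExt C (\<Theta> i) (\<Theta> j)) = {\<one>\<^bsub>NExt C (\<Theta> i) (\<Theta> j)\<^esub>}"
    using sys unfolding mixed_stratifying_system_def by (elim conjE)
  show "carrier (NExt C T U) = {\<one>\<^bsub>NExt C T U\<^esub>}" if TU: "T \<in> \<Theta> ` {1..t}" "U \<in> \<Theta> ` {1..t}" for T U
  proof -
    obtain i j where "i \<in> {1..t}" "T = \<Theta> i" "j \<in> {1..t}" "U = \<Theta> j" using TU by blast
    then show ?thesis using * by blast
  qed
qed

lemma \<iota>\<pi>:
  assumes "i \<in> {1..t}"
  shows "ar (\<iota> i)" "src (\<iota> i) = P i" "tgt (\<iota> i) = PP" "ar (\<pi> i)" "src (\<pi> i) = PP" "tgt (\<pi> i) = P i"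
    "\<pi> i \<bullet> \<iota> i = ident C (P i)"
  using ds assms unfolding direct_sum_def by auto

lemma P_thr_ob: "i \<in> {1..t} \<Longrightarrow> thr_ob PP (P i)"
  using thr_ob_retract[of "\<iota> i" "P i" PP "\<pi> i"] \<iota>\<pi> by simp

lemma F_presented:
  assumes "X \<in> F {1..t}"
  shows "presented (\<Theta> ` {1..t}) PP X"
proof (rule presented_fl[OF assms])
  show "presented (\<Theta> ` {1..t}) PP T" if "T \<in> \<Theta> ` {1..t}" for T
  proof -
    obtain i where i: "i \<in> {1..t}" "T = \<Theta> i" using \<open>T \<in> \<Theta> ` {1..t}\<close> by blast
    obtain K f g d where K: "K \<in> F {i..t}" "conflation C K f (P i) g (\<Theta> i) d" using P_conflation[OF i(1)] by metis
    have "K \<in> F {1..t}" by (rule F_mono[OF K(1)]) (use i in auto)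
    then show ?thesis using K P_thr_ob[OF i(1)] i(2) unfolding presented_def by blast
  qed
  show "carrier (Ext C Q T) = {\<one>\<^bsub>Ext C Q T\<^esub>}" if "thr_ob PP Q" "T \<in> \<Theta> ` {1..t}" for Q T
    using that thr_ob_ext fl_member[of T "\<Theta> ` {1..t}"] by auto
qed auto

section \<open>Exactness, faithfulness and fullness on F(\<Theta>)\<close>

lemma psi_exact:
  assumes c: "conflation C A f M g X d" and F: "A \<in> F {1..t}" "X \<in> F {1..t}"
  shows "\<And>u. \<lbrakk>ar u; src u = PP; tgt u = A; f \<bullet> u = zer C PP M\<rbrakk> \<Longrightarrow> u = zer C PP A"
    "\<And>v. \<lbrakk>ar v; src v = PP; tgt v = M; g \<bullet> v = zer C PP X\<rbrakk> \<Longrightarrow> \<exists>u. ar u \<and> src u = PP \<and> tgt u = A \<and> v = f \<bullet> u"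
    "\<And>w. \<lbrakk>ar w; src w = PP; tgt w = X\<rbrakk> \<Longrightarrow> \<exists>v. ar v \<and> src v = PP \<and> tgt v = M \<and> g \<bullet> v = w"
proof -
  note cD = conflD[OF c]
  \<comment> \<open>Injectivity rests on E^-1(P, X) = 0 and surjectivity on E(P, A) = 0; exactness
    in the middle is the weak kernel property.\<close>
  show "u = zer C PP A" if "ar u" "src u = PP" "tgt u = A" "f \<bullet> u = zer C PP M" for u
    by (rule inflation_monic[OF c next_F[OF PP_F F(2)] that])
  show "\<exists>u. ar u \<and> src u = PP \<and> tgt u = A \<and> v = f \<bullet> u" if "ar v" "src v = PP" "tgt v = M" "g \<bullet> v = zer C PP X" for v
    using weak_kernel[OF c that] by metis
  show "\<exists>v. ar v \<and> src v = PP \<and> tgt v = M \<and> g \<bullet> v = w" if w: "ar w" "src w = PP" "tgt w = X" for w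
  proof -
    have "pull C A w d \<in> carrier (Ext C PP A)" using ext_pull_closed[of A w d PP] cD w by simp
    then have "pull C A w d = \<one>\<^bsub>Ext C PP A\<^esub>" using PP_ext[OF F(1)] by blast
    then show ?thesis using lift_deflation[OF c w] by metis
  qed
qed

text \<open>Composition with a presentation Q -> X moves the question to Q in add P, where
  \<open>thr_faithful\<close> applies. The deflation is cancelled by \<open>deflation_epic\<close>,
  which is where E^-1(K, Y) = 0 enters.\<close>

lemma psi_faithful_zero:
  assumes X: "X \<in> F {1..t}" and Y: "Y \<in> F {1..t}" and h: "ar h" "src h = X" "tgt h = Y"
    and z: "\<And>u. \<lbrakk>ar u; src u = PP; tgt u = X\<rbrakk> \<Longrightarrow> h \<bullet> u = zer C PP Y"
  shows "h = zer C X Y"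
proof -
  obtain K f Q g d where K: "conflation C K f Q g X d" "K \<in> F {1..t}" "thr_ob PP Q"
    using F_presented[OF X] by (auto simp: presented_def)
  note c = conflD[OF K(1)]
  have YO: "Y \<in> Obj C" using fl_obj[OF Y] .
  obtain n where n: "thr {PP} Q Q n (ident C Q)" using K(3) by (auto simp: thr_ob_def)
  have "(h \<bullet> g) \<bullet> ident C Q = zer C Q Y"
    by (rule thr_faithful[OF n]) (use c h z in auto)
  then have "h \<bullet> g = zer C Q Y" using c h by simp
  then show ?thesis by (rule deflation_epic[OF K(1) next_F[OF K(2) Y] h])
qed

lemma psi_faithful:
  assumes "X \<in> F {1..t}" "Y \<in> F {1..t}" "ar h" "src h = X" "tgt h = Y" "ar h'" "src h' = X" "tgt h' = Y"
    "\<And>u. \<lbrakk>ar u; src u = PP; tgt u = X\<rbrakk> \<Longrightarrow> h \<bullet> u = h' \<bullet> u"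
  shows "h = h'"
proof (rule diff_eq_zer)
  show "h \<boxplus> mn h' = zer C (src h') (tgt h')"
    unfolding assms(7,8)
    by (rule psi_faithful_zero[OF assms(1,2)]) (use assms in auto)
qed (use assms in auto)

text \<open>Over Q the composite of \<phi> with the presentation is represented by some
  \<open>h\<close>. Faithfulness on K gives h f = 0, so \<open>h\<close> descends to X along the
  weak cokernel; surjectivity of the presentation on elements identifies the result with
  \<phi>.\<close>

lemma psi_full:
  assumes X: "X \<in> F {1..t}" and Y: "Y \<in> F {1..t}" and \<phi>: "\<phi> \<in> mod_hom B (\<Psi> X) (\<Psi> Y)"
  obtains h where "ar h" "src h = X" "tgt h = Y" "\<And>u. \<lbrakk>ar u; src u = PP; tgt u = X\<rbrakk> \<Longrightarrow> \<phi> u = h \<bullet> u"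
proof -
  obtain K f Q g d where K: "conflation C K f Q g X d" "K \<in> F {1..t}" "thr_ob PP Q"
    using F_presented[OF X] by (auto simp: presented_def)
  note c = conflD[OF K(1)]
  have YO: "Y \<in> Obj C" and XO: "X \<in> Obj C" using fl_obj X Y by blast+
  obtain n where n: "thr {PP} Q Q n (ident C Q)" using K(3) by (auto simp: thr_ob_def)
  interpret \<phi>: rmod_hom B "\<Psi> X" "\<Psi> Y" \<phi>
    by (intro rmod_hom.intro rmod_hom_axioms.intro psi_rmodule PP_obj XO YO \<phi>)
  have c\<phi>: "compose (carrier (\<Psi> Q)) \<phi> (psi PP Q g) \<in> mod_hom B (\<Psi> Q) (\<Psi> Y)"
    by (rule mod_hom_cmp[OF psi_rmodule psi_hom \<phi>]) (use c in auto)
  obtain h where h: "ar h" "src h = Q" "tgt h = Y"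
    "\<And>u. ar u \<and> src u = PP \<and> tgt u = Q \<Longrightarrow> compose (carrier (\<Psi> Q)) \<phi> (psi PP Q g) (ident C Q \<bullet> u) = h \<bullet> u"
    using thr_full[OF n PP_obj c(3,3) c\<phi> YO] by blast
  have h4: "\<phi> (g \<bullet> u) = h \<bullet> u" if "ar u" "src u = PP" "tgt u = Q" for u
    using h(4)[of u] that c by (simp add: compose_def)
  have "h \<bullet> f = zer C K Y"
  proof (rule psi_faithful_zero[OF K(2) Y])
    fix u assume u: "ar u" "src u = PP" "tgt u = K"
    have "(h \<bullet> f) \<bullet> u = \<phi> (g \<bullet> (f \<bullet> u))" using h4[of "f \<bullet> u"] u c h by simp
    also have "g \<bullet> (f \<bullet> u) = zer C PP X" using pre_simp[OF c(11), of u] u c by simp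
    finally show "(h \<bullet> f) \<bullet> u = zer C PP Y" using \<phi>.zero by simp
  qed (use c h in auto)
  then obtain h' where h': "ar h'" "src h' = X" "tgt h' = Y" "h = h' \<bullet> g"
    using weak_cokernel[OF K(1) h(1-3)] by metis
  show thesis
  proof (rule that[OF h'(1-3)])
    fix u assume u: "ar u" "src u = PP" "tgt u = X"
    obtain v where v: "ar v" "src v = PP" "tgt v = Q" "g \<bullet> v = u" using psi_exact(3)[OF K(1,2) X u] by blast
    show "\<phi> u = h' \<bullet> u" using h4[OF v(1-3)] v h' c by simp
  qed
qed

end

section \<open>Isomorphisms, biproducts and finite length under the functor\<close>

lemma is_iso_mod_inverseI:
  assumes "f \<in> mod_hom R M N" "g \<in> mod_hom R N M" "\<And>x. x \<in> carrier M \<Longrightarrow> g (f x) = x"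
    "\<And>x. x \<in> carrier N \<Longrightarrow> f (g x) = x"
  shows "is_iso (mod_add R) M N (M, N, f)"
  unfolding is_iso_def using assms by (auto intro!: bexI[of _ "(N, M, g)"] simp: compose_eq_iff)

lemma isomorphic_modE:
  assumes "isomorphic (mod_add R) M N" "rmodule R M" "rmodule R N"
  obtains f g where "f \<in> mod_hom R M N" "g \<in> mod_hom R N M" "\<And>x. x \<in> carrier M \<Longrightarrow> g (f x) = x"
    "\<And>x. x \<in> carrier N \<Longrightarrow> f (g x) = x"
  using assms(1) is_iso_modD[OF _ assms(2,3)] unfolding isomorphic_def by metis

context preadditive
begin

lemma psi_cmp:
  assumes "Q \<in> Obj C" "ar h" "src h = X" "tgt h = Y" "ar k" "src k = Y"
  shows "compose (Hom C Q X) (psi Q Y k) (psi Q X h) = psi Q X (k \<bullet> h)"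
proof -
  have "X \<in> Obj C" "Y \<in> Obj C" using assms src_obj tgt_obj by blast+
  then show ?thesis using assms by (auto simp: compose_def psi_def intro!: restrict_ext)
qed

lemma psi_ident: "\<lbrakk>Q \<in> Obj C; X \<in> Obj C\<rbrakk> \<Longrightarrow> psi Q X (ident C X) = (\<lambda>f \<in> Hom C Q X. f)"
  by (auto simp: psi_def intro!: restrict_ext)

lemma psi_zer: "\<lbrakk>Q \<in> Obj C; X \<in> Obj C; Y \<in> Obj C\<rbrakk> \<Longrightarrow> psi Q X (zer C X Y) = (\<lambda>f \<in> Hom C Q X. zer C Q Y)"
  by (auto simp: psi_def intro!: restrict_ext)

lemma psi_pls:
  assumes "Q \<in> Obj C" "ar h" "src h = X" "ar k" "src k = X" "tgt k = tgt h"
  shows "(\<lambda>f \<in> Hom C Q X. psi Q X h f \<boxplus> psi Q X k f) = psi Q X (h \<boxplus> k)"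
proof -
  have "X \<in> Obj C" using assms src_obj by blast
  then show ?thesis using assms by (auto simp: psi_def intro!: restrict_ext)
qed

lemma psi_biproduct:
  assumes b: "biproduct C X Y Z i1 i2 p1 p2" and Q: "Q \<in> Obj C"
    and O: "psi_obj C Q X \<in> Obj (mod_add (End_ring C Q))" "psi_obj C Q Y \<in> Obj (mod_add (End_ring C Q))"
      "psi_obj C Q Z \<in> Obj (mod_add (End_ring C Q))"
  shows "biproduct (mod_add (End_ring C Q)) (psi_obj C Q X) (psi_obj C Q Y) (psi_obj C Q Z)
    (psi_mor C Q X Z i1) (psi_mor C Q Y Z i2) (psi_mor C Q Z X p1) (psi_mor C Q Z Y p2)"
proof -
  note b' = biproductD[OF b]
  show ?thesis
    unfolding biproduct_def psi_mor_eq
    using O psi_hom[OF Q b'(4-6)] psi_hom[OF Q b'(7-9)] psi_hom[OF Q b'(10-12)] psi_hom[OF Q b'(13-15)]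
      psi_cmp[OF Q b'(4-6) b'(10,11)] psi_cmp[OF Q b'(7-9) b'(13,14)] psi_cmp[OF Q b'(7-9) b'(10,11)]
      psi_cmp[OF Q b'(4-6) b'(13,14)] psi_cmp[OF Q b'(10-12) b'(4,5)] psi_cmp[OF Q b'(13-15) b'(7,8)]
      psi_ident[OF Q b'(1)] psi_ident[OF Q b'(2)] psi_ident[OF Q b'(3)] psi_zer[OF Q b'(1,2)] psi_zer[OF Q b'(2,1)]
      psi_pls[OF Q, of "i1 \<bullet> p1" Z "i2 \<bullet> p2"] b'
    by (simp del: mod_add_simps(1) hom_iff)
qed

lemma psi_isomorphic:
  assumes "isomorphic C X Y" "Q \<in> Obj C" "X \<in> Obj C" "Y \<in> Obj C"
  shows "isomorphic (mod_add (End_ring C Q)) (psi_obj C Q X) (psi_obj C Q Y)"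
proof -
  obtain f where f: "is_iso C X Y f" using assms by (auto simp: isomorphic_def)
  obtain g where g: "ar f" "src f = X" "tgt f = Y" "ar g" "src g = Y" "tgt g = X" "g \<bullet> f = ident C X" "f \<bullet> g = ident C Y"
    using is_isoE[OF f assms(3,4)] by metis
  have "is_iso (mod_add (End_ring C Q)) (psi_obj C Q X) (psi_obj C Q Y) (psi_obj C Q X, psi_obj C Q Y, psi Q X f)"
  proof (rule is_iso_mod_inverseI[OF psi_hom[OF assms(2) g(1-3)] psi_hom[OF assms(2) g(4-6)]])
    fix x assume "x \<in> carrier (psi_obj C Q X)"
    then show "psi Q Y g (psi Q X f x) = x" using g assms pre_simp[OF g(7), of x] by simp
  next
    fix x assume "x \<in> carrier (psi_obj C Q Y)"
    then show "psi Q X f (psi Q Y g x) = x" using g assms pre_simp[OF g(8), of x] by simp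
  qed
  then show ?thesis unfolding isomorphic_def by blast
qed

end

context mss
begin

lemma ring_B: "ring B"
  by (rule ring_End[OF PP_obj])

text \<open>Scalars act through the multiples of the identity of P, so every B-submodule is a
  k-subspace and inherits the measure that stands for dimension.\<close>

lemma psi_fin_len:
  assumes X: "X \<in> Obj C"
  shows "rmodule.fin_len B (\<Psi> X)"
proof -
  interpret k: k_linear_category C sm by (rule klin)
  interpret M: rmodule B "\<Psi> X" by (rule psi_rmodule[OF PP_obj X])
  have G: "k_space sm (hom_group C PP X)" by (rule k.hom_k_space[OF PP_obj X])
  have G': "k_space sm (hom_group C PP PP)" by (rule k.hom_k_space[OF PP_obj PP_obj])
  have "fin_dim sm (hom_group C PP X)" using homfin X by (simp add: hom_finite_def)
  from fin_dim_measure[OF G this] obtain \<mu> :: "'m set \<Rightarrow> nat" where \<mu>: "\<forall>U V. k_subspace sm (hom_group C PP X) U \<and>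
      k_subspace sm (hom_group C PP X) V \<and> U \<subset> V \<and> V \<subseteq> Hom C PP X \<longrightarrow> \<mu> U < \<mu> V"
    unfolding has_measure_def carrier_hom_group by (elim exE) (rule that)
  have sub: "k_subspace sm (hom_group C PP X) U" if U: "submodule U B (\<Psi> X)" for U
  proof -
    note UD = submoduleD[OF U]
    have "sm a x \<in> U" if x: "x \<in> U" for a x
    proof -
      have xh: "x \<in> Hom C PP X" using UD(1) x by auto
      have c: "sm a (ident C PP) \<in> carrier B" using k_spaceD(2)[OF G', of "ident C PP" a] by simp
      have "x \<bullet> sm a (ident C PP) = sm a (x \<bullet> ident C PP)"
        by (rule k.sm_cmp_right[of PP PP X]) (use xh X in auto)
      also have "\<dots> = sm a x" using xh X by simp
      finally show ?thesis using UD(4)[OF c x] by simp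
    qed
    then show ?thesis using UD(1-3) unfolding k_subspace_def by simp
  qed
  have "\<mu> U < \<mu> V" if "submodule U B (\<Psi> X)" "submodule V B (\<Psi> X)" "U \<subset> V" for U V
    using \<mu> sub[OF that(1)] sub[OF that(2)] that(3) submoduleD(1)[OF that(2)] by simp
  then show ?thesis unfolding M.fin_len_def by blast
qed

lemma psi_mod_obj: "X \<in> Obj C \<Longrightarrow> \<Psi> X \<in> Obj (mod_add B)"
  using mod_ObjI[OF psi_rmodule[OF PP_obj] rmodule.fin_len_fin_gen[OF psi_rmodule[OF PP_obj] psi_fin_len]] .

lemma psi_zero_obj:
  assumes "is_zero_obj C Z"
  shows "is_zero_obj (mod_add B) (\<Psi> Z)"
proof -
  have Z: "Z \<in> Obj C" "ident C Z = zer C Z Z" using assms by (auto simp: is_zero_obj_def)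
  show ?thesis
    using psi_mod_obj[OF Z(1)] psi_ident[OF PP_obj Z(1)] psi_zer[OF PP_obj Z(1,1)] Z(2)
    unfolding is_zero_obj_def by (simp del: mod_add_simps(1))
qed

lemma psi_ses:
  assumes c: "conflation C A f M g X d" and F: "A \<in> F {1..t}" "X \<in> F {1..t}"
  shows "ses B (\<Psi> A) (psi PP A f) (\<Psi> M) (psi PP M g) (\<Psi> X)"
proof -
  note cD = conflD[OF c] and ex = psi_exact[OF c F]
  interpret f: rmod_hom B "\<Psi> A" "\<Psi> M" "psi PP A f"
    by (intro rmod_hom.intro rmod_hom_axioms.intro psi_rmodule PP_obj cD psi_hom)
  show ?thesis
    unfolding ses_def
  proof (intro conjI psi_mod_obj cD psi_hom PP_obj)
    show "inj_on (psi PP A f) (carrier (\<Psi> A))"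
    proof (rule f.inj_onI_kernel)
      fix u assume "u \<in> carrier (\<Psi> A)" "psi PP A f u = \<zero>\<^bsub>\<Psi> M\<^esub>"
      then show "u = \<zero>\<^bsub>\<Psi> A\<^esub>" using ex(1)[of u] cD by simp
    qed
    show "psi PP A f ` carrier (\<Psi> A) = {x \<in> carrier (\<Psi> M). psi PP M g x = \<zero>\<^bsub>\<Psi> X\<^esub>}"
    proof (intro equalityI subsetI)
      fix v assume "v \<in> psi PP A f ` carrier (\<Psi> A)"
      then obtain u where u: "ar u" "src u = PP" "tgt u = A" "v = f \<bullet> u" using cD by auto
      then show "v \<in> {x \<in> carrier (\<Psi> M). psi PP M g x = \<zero>\<^bsub>\<Psi> X\<^esub>}"
        using pre_simp[OF cD(11), of u] cD by simp
    next
      fix v assume "v \<in> {x \<in> carrier (\<Psi> M). psi PP M g x = \<zero>\<^bsub>\<Psi> X\<^esub>}"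
      then have "\<exists>u. ar u \<and> src u = PP \<and> tgt u = A \<and> v = f \<bullet> u" using cD by (intro ex(2)) auto
      then obtain u where u: "ar u" "src u = PP" "tgt u = A" "v = f \<bullet> u" by blast
      then show "v \<in> psi PP A f ` carrier (\<Psi> A)" using cD by (intro image_eqI[of _ _ u]) auto
    qed
    show "psi PP M g ` carrier (\<Psi> M) = carrier (\<Psi> X)"
    proof (intro equalityI subsetI)
      fix w assume "w \<in> carrier (\<Psi> X)"
      then have "\<exists>v. ar v \<and> src v = PP \<and> tgt v = M \<and> g \<bullet> v = w" using cD by (intro ex(3)) auto
      then obtain v where v: "ar v" "src v = PP" "tgt v = M" "g \<bullet> v = w" by blast
      then show "w \<in> psi PP M g ` carrier (\<Psi> M)" using cD by (intro image_eqI[of _ _ v]) auto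
    next
      fix w assume "w \<in> psi PP M g ` carrier (\<Psi> M)"
      then show "w \<in> carrier (\<Psi> X)" using cD by auto
    qed
  qed
qed

section \<open>Filtered modules and the lifting of extensions\<close>

abbreviation \<Psi>\<Theta> :: "nat set \<Rightarrow> ('m, 'm) module set" where "\<Psi>\<Theta> J \<equiv> (\<lambda>i. \<Psi> (\<Theta> i)) ` J"

lemma psi_filt:
  assumes "X \<in> F J" "J \<subseteq> {1..t}"
  shows "\<Psi> X \<in> filt (mod_cat B) (\<Psi>\<Theta> J)"
  using assms(1)
proof induction
  interpret D: preadditive "mod_cat B :: (('m, 'm) module, ('m, 'm) mod_mor, ('m, 'm) mod_ext, unit) neg_extri"
    by (rule preadditive_mod_cat[OF ring_B])
  obtain O' where O': "is_zero_obj C O'" using zero_obj_exists by blast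
  {
    case (fl_zero Z)
    have "\<Psi> Z \<in> filt_len (mod_cat B) (\<Psi>\<Theta> J) 0"
      using D.zero_obj_addc[of "\<Psi> Z"] psi_zero_obj[OF fl_zero] by (simp add: mod_cat_transfer(3) del: mod_add_simps)
    then show ?case unfolding filt_def by blast
  next
    case (fl_ext T Y f X g d)
    obtain i where i: "i \<in> J" "T = \<Theta> i" using fl_ext by blast
    have "T \<in> F {1..t}" using i assms(2) by (intro fl_member) auto
    moreover have "Y \<in> F {1..t}" by (rule F_mono[OF fl_ext(2) assms(2)])
    ultimately have s: "ses B (\<Psi> T) (psi PP T f) (\<Psi> X) (psi PP X g) (\<Psi> Y)" by (rule psi_ses[OF fl_ext(3)])
    have "\<Psi> T \<in> addc (mod_cat B) (\<Psi>\<Theta> J)"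
      by (rule D.member_addc[of "\<Psi> O'"])
        (use psi_zero_obj[OF O'] i conflD(1)[OF fl_ext(3)] psi_mod_obj in \<open>auto simp: mod_cat_transfer(3) simp del: mod_add_simps\<close>)
    then show ?case by (rule mod_filt_extend[OF ring_B s _ fl_ext(4)])
  }
qed

text \<open>The isomorphism \<theta> has to respect both end maps, since a splitting of the lifted
  conflation must become a splitting of M. It is obtained by factoring a homomorphism out of
  \<Psi>(X \<oplus> Q), which covers \<Psi> E.\<close>

lemma psi_extension:
  assumes X: "X \<in> F {1..t}" and Y: "Y \<in> F {1..t}" and s: "ses B (\<Psi> X) f M g (\<Psi> Y)"
  obtains E x y d \<theta> where "conflation C X x E y Y d" "\<theta> \<in> mod_hom B (\<Psi> E) M" "inj_on \<theta> (carrier (\<Psi> E))"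
    "\<theta> ` carrier (\<Psi> E) = carrier M" "\<And>u. \<lbrakk>ar u; src u = PP; tgt u = X\<rbrakk> \<Longrightarrow> \<theta> (x \<bullet> u) = f u"
    "\<And>w. \<lbrakk>ar w; src w = PP; tgt w = E\<rbrakk> \<Longrightarrow> g (\<theta> w) = y \<bullet> w"
proof -
  obtain K k Q q d where K: "conflation C K k Q q Y d" "K \<in> F {1..t}" "thr_ob PP Q"
    using F_presented[OF Y] by (auto simp: presented_def)
  note c = conflD[OF K(1)]
  have XO: "X \<in> Obj C" and YO: "Y \<in> Obj C" using fl_obj X Y by blast+
  have M: "M \<in> Obj (mod_add B)" and f: "f \<in> mod_hom B (\<Psi> X) M" and g: "g \<in> mod_hom B M (\<Psi> Y)"
    and finj: "inj_on f (carrier (\<Psi> X))" and fim: "f ` carrier (\<Psi> X) = {x \<in> carrier M. g x = \<zero>\<^bsub>\<Psi> Y\<^esub>}"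
    and gon: "g ` carrier M = carrier (\<Psi> Y)" using s by (auto simp: ses_def simp del: mod_add_simps)
  interpret M: rmodule B M by (rule mod_ObjD[OF M])
  interpret f: rmod_hom B "\<Psi> X" M f
    by (intro rmod_hom.intro rmod_hom_axioms.intro psi_rmodule PP_obj XO M.rmodule_axioms f)
  interpret g: rmod_hom B M "\<Psi> Y" g
    by (intro rmod_hom.intro rmod_hom_axioms.intro psi_rmodule PP_obj YO M.rmodule_axioms g)
  obtain n where n: "thr {PP} Q Q n (ident C Q)" using K(3) by (auto simp: thr_ob_def)
  \<comment> \<open>\<Psi> Q is projective, so \<Psi>(q) lifts along the surjection
    \<open>g\<close>.\<close>
  obtain \<phi> where \<phi>: "\<phi> \<in> mod_hom B (\<Psi> Q) M" and \<phi>2: "\<And>u. ar u \<and> src u = PP \<and> tgt u = Q \<Longrightarrow> g (\<phi> u) = psi PP Q q (ident C Q \<bullet> u)"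
    using thr_projective[OF n PP_obj c(3,3) g.rmod_hom_axioms gon psi_hom[OF PP_obj c(8-10)]] by blast
  have g\<phi>: "g (\<phi> u) = q \<bullet> u" if "ar u" "src u = PP" "tgt u = Q" for u
    using \<phi>2[of u] that c by simp
  interpret \<phi>: rmod_hom B "\<Psi> Q" M \<phi>
    by (intro rmod_hom.intro rmod_hom_axioms.intro psi_rmodule PP_obj c M.rmodule_axioms \<phi>)
  have "\<exists>a \<in> mod_hom B (\<Psi> K) (\<Psi> X). \<forall>u \<in> carrier (\<Psi> K). f (a u) = \<phi> (k \<bullet> u)"
  proof -
    \<comment> \<open>On \<Psi> K the lift lands in the kernel of \<open>g\<close>, which is the
      image of \<open>f\<close>, and is read back through the injection \<open>f\<close>.\<close>
    let ?a = "\<lambda>u \<in> carrier (\<Psi> K). inv_into (carrier (\<Psi> X)) f (\<phi> (k \<bullet> u))"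
    have im: "\<phi> (k \<bullet> u) \<in> f ` carrier (\<Psi> X)" if u: "u \<in> carrier (\<Psi> K)" for u
    proof -
      have u': "ar u" "src u = PP" "tgt u = K" using u c by auto
      have "q \<bullet> (k \<bullet> u) = zer C PP Y" using pre_simp[OF c(11), of u] u' c by simp
      then show ?thesis unfolding fim using g\<phi>[of "k \<bullet> u"] u' c \<phi>.closed[of "k \<bullet> u"] by simp
    qed
    have fa: "f (?a u) = \<phi> (k \<bullet> u)" if "u \<in> carrier (\<Psi> K)" for u
      using f_inv_into_f[OF im[OF that]] that by simp
    have ac: "?a u \<in> carrier (\<Psi> X)" if "u \<in> carrier (\<Psi> K)" for u
      using inv_into_into[OF im[OF that]] that by simp
    interpret K: rmodule B "\<Psi> K" by (rule psi_rmodule[OF PP_obj c(1)])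
    have "?a \<in> mod_hom B (\<Psi> K) (\<Psi> X)"
    proof (rule mod_homI)
      fix u v assume uv: "u \<in> carrier (\<Psi> K)" "v \<in> carrier (\<Psi> K)"
      have "f (?a (u \<oplus>\<^bsub>\<Psi> K\<^esub> v)) = \<phi> ((k \<bullet> u) \<boxplus> (k \<bullet> v))"
        using fa[OF K.M.a_closed[OF uv]] uv c by simp
      also have "\<dots> = f (?a u) \<oplus>\<^bsub>M\<^esub> f (?a v)"
        unfolding fa[OF uv(1)] fa[OF uv(2)] using \<phi>.add[of "k \<bullet> u" "k \<bullet> v"] uv c by simp
      also have "\<dots> = f (?a u \<oplus>\<^bsub>\<Psi> X\<^esub> ?a v)" by (rule f.add[symmetric]) (rule ac[OF uv(1)], rule ac[OF uv(2)])
      finally show "?a (u \<oplus>\<^bsub>\<Psi> K\<^esub> v) = ?a u \<oplus>\<^bsub>\<Psi> X\<^esub> ?a v"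
        by (rule inj_onD[OF finj _ ac[OF K.M.a_closed[OF uv]] f.M.M.a_closed[OF ac[OF uv(1)] ac[OF uv(2)]]])
    next
      fix r u assume ru: "r \<in> carrier B" "u \<in> carrier (\<Psi> K)"
      have "f (?a (r \<odot>\<^bsub>\<Psi> K\<^esub> u)) = \<phi> ((k \<bullet> u) \<bullet> r)"
        using fa[OF K.smult_closed[OF ru]] ru c by simp
      also have "\<dots> = r \<odot>\<^bsub>M\<^esub> f (?a u)"
        unfolding fa[OF ru(2)] using \<phi>.lin[of r "k \<bullet> u"] ru c by simp
      also have "\<dots> = f (r \<odot>\<^bsub>\<Psi> X\<^esub> ?a u)" by (rule f.lin[symmetric]) (rule ru(1), rule ac[OF ru(2)])
      finally show "?a (r \<odot>\<^bsub>\<Psi> K\<^esub> u) = r \<odot>\<^bsub>\<Psi> X\<^esub> ?a u"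
        by (rule inj_onD[OF finj _ ac[OF K.smult_closed[OF ru]] f.M.smult_closed[OF ru(1) ac[OF ru(2)]]])
    qed (rule ac, auto)
    then show ?thesis using fa by blast
  qed
  then obtain a0 where a0: "a0 \<in> mod_hom B (\<Psi> K) (\<Psi> X)" "\<And>u. u \<in> carrier (\<Psi> K) \<Longrightarrow> f (a0 u) = \<phi> (k \<bullet> u)" by blast
  obtain a where a: "ar a" "src a = K" "tgt a = X" "\<And>u. \<lbrakk>ar u; src u = PP; tgt u = K\<rbrakk> \<Longrightarrow> a0 u = a \<bullet> u"
    using psi_full[OF K(2) X a0(1)] by metis
  have fa: "f (a \<bullet> u) = \<phi> (k \<bullet> u)" if "ar u" "src u = PP" "tgt u = K" for u
    using a0(2)[of u] a(4)[OF that] that c by simp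
  \<comment> \<open>The pushout itself is taken in C, by pushing the class of the presentation along
    the morphism \<open>a\<close> that represents the homomorphism \<open>a0\<close>.\<close>
  have ad: "push C Y a d \<in> carrier (Ext C Y X)" using ext_push_closed[OF YO a(1), of d X] c a by simp
  obtain E x y where E: "conflation C X x E y Y (push C Y a d)" using confl_exists[OF XO YO ad] by metis
  note e = conflD[OF E]
  have "\<exists>b \<in> Hom C Q E. b \<bullet> k = x \<bullet> a \<and> y \<bullet> b = ident C Y \<bullet> q"
    by (rule ET2_realization[OF K(1) E]) (use a c e ext_pull_ident[OF YO XO ad] in simp_all)
  then obtain b where b0: "b \<in> Hom C Q E" "b \<bullet> k = x \<bullet> a" "y \<bullet> b = ident C Y \<bullet> q" by blast
  have b: "ar b" "src b = Q" "tgt b = E" "b \<bullet> k = x \<bullet> a" "y \<bullet> b = q"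
    using b0(1) c(3) e(3) by (auto simp: b0(2,3) c)
  obtain W i1 i2 p1 p2 where W: "biproduct C X Q W i1 i2 p1 p2" using biproduct_exists[OF XO c(3)] by blast
  note w = biproductD[OF W]
  \<comment> \<open>X \<oplus> Q maps to E by \<open>x\<close> on X and \<open>b\<close> on Q. Under
    \<Psi> this is onto, and its kernel consists of the pairs (- a l, k l) with l in \<Psi>
    K.\<close>
  let ?r = "psi PP W ((x \<bullet> p1) \<boxplus> (b \<bullet> p2))"
  interpret r: rmod_hom B "\<Psi> W" "\<Psi> E" ?r
    by (intro rmod_hom.intro rmod_hom_axioms.intro psi_rmodule psi_hom PP_obj) (use w b e in auto)
  have rv: "?r v = (x \<bullet> (p1 \<bullet> v)) \<boxplus> (b \<bullet> (p2 \<bullet> v))" if "ar v" "src v = PP" "tgt v = W" for v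
    using that w b e by simp
  let ?h = "\<lambda>v \<in> carrier (\<Psi> W). f (p1 \<bullet> v) \<oplus>\<^bsub>M\<^esub> \<phi> (p2 \<bullet> v)"
  have h: "?h \<in> mod_hom B (\<Psi> W) M"
  proof -
    have "(\<lambda>v \<in> carrier (\<Psi> W). compose (carrier (\<Psi> W)) f (psi PP W p1) v \<oplus>\<^bsub>M\<^esub> compose (carrier (\<Psi> W)) \<phi> (psi PP W p2) v)
      \<in> mod_hom B (\<Psi> W) M"
      by (intro M.mod_hom_add mod_hom_cmp[OF _ _ f] mod_hom_cmp[OF _ _ \<phi>] r.M.rmodule_axioms psi_hom PP_obj w)
    also have "(\<lambda>v \<in> carrier (\<Psi> W). compose (carrier (\<Psi> W)) f (psi PP W p1) v \<oplus>\<^bsub>M\<^esub> compose (carrier (\<Psi> W)) \<phi> (psi PP W p2) v) = ?h"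
      using w by (intro restrict_ext) (simp add: compose_def)
    finally show ?thesis .
  qed
  have r_onto: "?r ` carrier (\<Psi> W) = carrier (\<Psi> E)"
  proof (intro equalityI subsetI)
    fix z assume "z \<in> carrier (\<Psi> E)"
    then have z: "ar z" "src z = PP" "tgt z = E" using e by auto
    obtain v where v: "ar v" "src v = PP" "tgt v = Q" "q \<bullet> v = y \<bullet> z"
      using psi_exact(3)[OF K(1,2) Y, of "y \<bullet> z"] z e by auto
    have "y \<bullet> (z \<boxplus> mn (b \<bullet> v)) = zer C PP Y"
      using pre_simp[OF b(5), of v] z v b e c by simp
    then obtain u where u: "ar u" "src u = PP" "tgt u = X" "z \<boxplus> mn (b \<bullet> v) = x \<bullet> u"
      using psi_exact(2)[OF E X Y, of "z \<boxplus> mn (b \<bullet> v)"] z v b by auto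
    have "?r ((i1 \<bullet> u) \<boxplus> (i2 \<bullet> v)) = (x \<bullet> u) \<boxplus> (b \<bullet> v)"
      using rv[of "(i1 \<bullet> u) \<boxplus> (i2 \<bullet> v)"] biproduct_pre[OF W u(1)] biproduct_pre[OF W v(1)] u v w XO c(3) e b by simp
    also have "\<dots> = z" unfolding u(4)[symmetric] using z v b by (simp add: pls_assoc)
    finally have "?r ((i1 \<bullet> u) \<boxplus> (i2 \<bullet> v)) = z" .
    moreover have "(i1 \<bullet> u) \<boxplus> (i2 \<bullet> v) \<in> carrier (\<Psi> W)" using u v w by simp
    ultimately show "z \<in> ?r ` carrier (\<Psi> W)" by (metis imageI)
  next
    fix z assume "z \<in> ?r ` carrier (\<Psi> W)"
    then show "z \<in> carrier (\<Psi> E)" using r.closed by blast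
  qed
  \<comment> \<open>On such a pair the two contributions cancel, because f (a l) = \<phi> (k
    l).\<close>
  have ker: "?h v = \<zero>\<^bsub>M\<^esub>" if v: "v \<in> carrier (\<Psi> W)" and z: "?r v = \<zero>\<^bsub>\<Psi> E\<^esub>" for v
  proof -
    have v': "ar v" "src v = PP" "tgt v = W" using v w by auto
    let ?u = "p1 \<bullet> v" and ?v = "p2 \<bullet> v"
    have uv: "ar ?u" "src ?u = PP" "tgt ?u = X" "ar ?v" "src ?v = PP" "tgt ?v = Q" using v' w by auto
    have s: "(x \<bullet> ?u) \<boxplus> (b \<bullet> ?v) = zer C PP E" using rv[OF v'] z by simp
    have "y \<bullet> ((x \<bullet> ?u) \<boxplus> (b \<bullet> ?v)) = q \<bullet> ?v"
      using pre_simp[OF e(11) _ _ uv(1)] pre_simp[OF b(5) _ _ uv(4)] uv e b c by simp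
    then have "q \<bullet> ?v = zer C PP Y" unfolding s using e by simp
    then obtain l where l: "ar l" "src l = PP" "tgt l = K" "?v = k \<bullet> l" using psi_exact(2)[OF K(1,2) Y uv(4-6)] by blast
    have "x \<bullet> (?u \<boxplus> (a \<bullet> l)) = zer C PP E"
      using s pre_simp[OF b(4), of l] l a b c e uv by simp
    then have "?u \<boxplus> (a \<bullet> l) = zer C PP X"
      using psi_exact(1)[OF E X Y, of "?u \<boxplus> (a \<bullet> l)"] uv l a by simp
    then have "f (?u \<boxplus> (a \<bullet> l)) = \<zero>\<^bsub>M\<^esub>" using f.zero by simp
    then have "f ?u \<oplus>\<^bsub>M\<^esub> f (a \<bullet> l) = \<zero>\<^bsub>M\<^esub>" using f.add[of ?u "a \<bullet> l"] uv l a XO by simp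
    then show ?thesis using fa[OF l(1-3)] l(4) v by simp
  qed
  have "\<exists>\<theta> \<in> mod_hom B (\<Psi> E) M. \<forall>v \<in> carrier (\<Psi> W). \<theta> (?r v) = ?h v"
    by (rule r.factor_through[OF r_onto M.rmodule_axioms h ker]) auto
  then obtain \<theta> where \<theta>: "\<theta> \<in> mod_hom B (\<Psi> E) M" "\<And>v. v \<in> carrier (\<Psi> W) \<Longrightarrow> \<theta> (?r v) = ?h v" by blast
  interpret \<theta>: rmod_hom B "\<Psi> E" M \<theta>
    by (intro rmod_hom.intro rmod_hom_axioms.intro psi_rmodule PP_obj e M.rmodule_axioms \<theta>)
  have \<theta>x: "\<theta> (x \<bullet> u) = f u" if u: "ar u" "src u = PP" "tgt u = X" for u
  proof -
    have iu: "i1 \<bullet> u \<in> carrier (\<Psi> W)" using u w by simp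
    have "?r (i1 \<bullet> u) = x \<bullet> u" using rv[of "i1 \<bullet> u"] u w b e biproduct_pre[OF W u(1)] by simp
    moreover have "?h (i1 \<bullet> u) = f u"
      using iu biproduct_pre[OF W u(1)] u XO \<phi>.zero f.closed[of u] by simp
    ultimately show ?thesis using \<theta>(2)[OF iu] by simp
  qed
  have g\<theta>: "g (\<theta> z) = y \<bullet> z" if z: "ar z" "src z = PP" "tgt z = E" for z
  proof -
    have "z \<in> carrier (\<Psi> E)" using z e by simp
    then obtain v where v: "v \<in> carrier (\<Psi> W)" "z = ?r v" unfolding r_onto[symmetric] by blast
    have v': "ar v" "src v = PP" "tgt v = W" using v w by auto
    let ?u = "p1 \<bullet> v" and ?v = "p2 \<bullet> v"
    have uv: "ar ?u" "src ?u = PP" "tgt ?u = X" "ar ?v" "src ?v = PP" "tgt ?v = Q" using v' w by auto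
    have uM: "f ?u \<in> carrier M" and vM: "\<phi> ?v \<in> carrier M" using f.closed[of ?u] \<phi>.closed[of ?v] uv XO c by auto
    have "g (f ?u) = \<zero>\<^bsub>\<Psi> Y\<^esub>" using fim uv XO by auto
    then have "g (\<theta> z) = zer C PP Y \<boxplus> (q \<bullet> ?v)"
      unfolding v(2) \<theta>(2)[OF v(1)] using v(1) g.add[OF uM vM] g\<phi>[OF uv(4-6)] by simp
    also have "\<dots> = y \<bullet> z"
      unfolding v(2) rv[OF v'] using pre_simp[OF e(11) _ _ uv(1)] pre_simp[OF b(5) _ _ uv(4)] uv e b c by simp
    finally show ?thesis .
  qed
  show thesis
  proof (rule that[OF E \<theta>(1) _ _ \<theta>x g\<theta>])
    show "inj_on \<theta> (carrier (\<Psi> E))"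
    proof (rule \<theta>.inj_onI_kernel)
      fix z assume z: "z \<in> carrier (\<Psi> E)" "\<theta> z = \<zero>\<^bsub>M\<^esub>"
      then have z': "ar z" "src z = PP" "tgt z = E" using e by auto
      have "y \<bullet> z = zer C PP Y" using g\<theta>[OF z'] z(2) g.zero by simp
      then obtain u where u: "ar u" "src u = PP" "tgt u = X" "z = x \<bullet> u" using psi_exact(2)[OF E X Y z'] by blast
      have "f u = f (zer C PP X)" using \<theta>x[OF u(1-3)] u(4) z(2) f.zero by simp
      then have "u = zer C PP X" using inj_onD[OF finj, of u "zer C PP X"] u XO by simp
      then show "z = \<zero>\<^bsub>\<Psi> E\<^esub>" using u e by simp
    qed
    show "\<theta> ` carrier (\<Psi> E) = carrier M"
    proof (intro equalityI subsetI)
      fix m assume m: "m \<in> carrier M"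
      have gm: "g m \<in> carrier (\<Psi> Y)" using g.closed[OF m] .
      then obtain z where z: "ar z" "src z = PP" "tgt z = E" "y \<bullet> z = g m"
        using psi_exact(3)[OF E X Y, of "g m"] YO by auto
      have zE: "z \<in> carrier (\<Psi> E)" using z e by simp
      have "m \<ominus>\<^bsub>M\<^esub> \<theta> z \<in> f ` carrier (\<Psi> X)"
        unfolding fim using m zE g.diff_zero[OF m \<theta>.closed[OF zE]] g\<theta>[OF z(1-3)] z(4) by simp
      then obtain u where u: "u \<in> carrier (\<Psi> X)" "m \<ominus>\<^bsub>M\<^esub> \<theta> z = f u" by blast
      then have u': "ar u" "src u = PP" "tgt u = X" using XO by auto
      have xu: "x \<bullet> u \<in> carrier (\<Psi> E)" using u' e by simp
      have "\<theta> ((x \<bullet> u) \<oplus>\<^bsub>\<Psi> E\<^esub> z) = (m \<ominus>\<^bsub>M\<^esub> \<theta> z) \<oplus>\<^bsub>M\<^esub> \<theta> z"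
        unfolding \<theta>.add[OF xu zE] \<theta>x[OF u'] u(2) ..
      also have "\<dots> = m"
        unfolding a_minus_def using m \<theta>.closed[OF zE] by (simp add: M.M.a_assoc M.M.l_neg)
      finally have "m = \<theta> ((x \<bullet> u) \<oplus>\<^bsub>\<Psi> E\<^esub> z)" ..
      then show "m \<in> \<theta> ` carrier (\<Psi> E)" by (rule image_eqI[OF _ r.N.M.a_closed[OF xu zE]])
    next
      fix m assume "m \<in> \<theta> ` carrier (\<Psi> E)"
      then show "m \<in> carrier M" using \<theta>.closed by blast
    qed
  qed
qed

end

section \<open>Full subcategories and a criterion for equivalences\<close>

context preadditive
begin

lemma full_sub_simps [simp]:
  "Obj (full_sub C S) = S" "Hom (full_sub C S) = Hom C" "ident (full_sub C S) = ident C"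
  "cmp (full_sub C S) = cmp C" "zer (full_sub C S) = zer C" "pls (full_sub C S) = pls C"
  by (simp_all add: full_sub_def)

lemma preadditive_full_sub:
  assumes "S \<subseteq> Obj C"
  shows "preadditive (full_sub C S)"
proof -
  have o: "X \<in> Obj C" if "X \<in> S" for X using that assms by auto
  have g: "hom_group (full_sub C S) X Y = hom_group C X Y" for X Y by (simp add: hom_group_def)
  show ?thesis
  proof (intro preadditive.intro category.intro preadditive_axioms.intro; simp only: full_sub_simps g)
    fix X Y X' Y' f assume "X \<in> S" "Y \<in> S" "X' \<in> S" "Y' \<in> S" "f \<in> Hom C X Y" "f \<in> Hom C X' Y'"
    then show "X = X' \<and> Y = Y'" using o by simp
  qed (use o hom_grp in simp_all)
qed

lemma is_iso_full_sub: "is_iso (full_sub C S) = is_iso C"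
  by (intro ext) (simp add: is_iso_def)

lemma biproduct_iso_left:
  assumes b: "biproduct C X Y Z i1 i2 p1 p2" and f: "ar f" "src f = X" "tgt f = X'" "ar g" "src g = X'" "tgt g = X"
    "g \<bullet> f = ident C X" "f \<bullet> g = ident C X'"
  shows "biproduct C X' Y Z (i1 \<bullet> g) i2 (f \<bullet> p1) p2"
proof -
  note b' = biproductD[OF b]
  have X': "X' \<in> Obj C" using f tgt_obj by blast
  have "i1 \<bullet> (g \<bullet> (f \<bullet> p1)) = i1 \<bullet> p1" using pre_simp[OF f(7), of p1] f b' by simp
  then show ?thesis
    using b' f biproduct_pre[OF b, of g] X' unfolding biproduct_def by simp
qed

end

text \<open>The quasi-inverse is built by choice: objects come from density, morphisms from fullness
  after conjugation with the chosen isomorphisms \<epsilon>. Identities in C are checked after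
  applying the functor, by faithfulness.\<close>

lemma equivalenceI:
  assumes C: "preadditive C" and D: "preadditive D" and func: "is_functor C D Fo Fm"
    and full: "\<And>X Y g. \<lbrakk>X \<in> Obj C; Y \<in> Obj C; g \<in> Hom D (Fo X) (Fo Y)\<rbrakk> \<Longrightarrow> \<exists>f \<in> Hom C X Y. Fm X Y f = g"
    and faithful: "\<And>X Y f f'. \<lbrakk>X \<in> Obj C; Y \<in> Obj C; f \<in> Hom C X Y; f' \<in> Hom C X Y; Fm X Y f = Fm X Y f'\<rbrakk> \<Longrightarrow> f = f'"
    and dense: "\<And>Y. Y \<in> Obj D \<Longrightarrow> \<exists>X \<in> Obj C. isomorphic D (Fo X) Y"
  shows "is_equivalence C D Fo Fm"
proof -
  interpret C: preadditive C by (rule C)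
  interpret D: preadditive D by (rule D)
  have Fo: "Fo X \<in> Obj D" if "X \<in> Obj C" for X using func that by (simp add: is_functor_def)
  have Fm: "D.ar (Fm X Y f)" "D.src (Fm X Y f) = Fo X" "D.tgt (Fm X Y f) = Fo Y"
    if "X \<in> Obj C" "Y \<in> Obj C" "C.ar f" "C.src f = X" "C.tgt f = Y" for X Y f
    using func that Fo unfolding is_functor_def by (metis C.hom_iff D.hom_iff)+
  have Fid: "Fm X X (ident C X) = ident D (Fo X)" if "X \<in> Obj C" for X
    using func that unfolding is_functor_def by blast
  have Fcmp: "Fm X Z (g \<bullet>\<^bsub>C\<^esub> f) = Fm Y Z g \<bullet>\<^bsub>D\<^esub> Fm X Y f"
    if "C.ar f" "C.src f = X" "C.tgt f = Y" "C.ar g" "C.src g = Y" "C.tgt g = Z" for X Y Z f g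
  proof -
    have O: "X \<in> Obj C" "Y \<in> Obj C" "Z \<in> Obj C" using that C.src_obj C.tgt_obj by blast+
    have *: "\<forall>X \<in> Obj C. \<forall>Y \<in> Obj C. \<forall>Z \<in> Obj C. \<forall>f \<in> Hom C X Y. \<forall>g \<in> Hom C Y Z.
        Fm X Z (g \<bullet>\<^bsub>C\<^esub> f) = Fm Y Z g \<bullet>\<^bsub>D\<^esub> Fm X Y f"
      using func unfolding is_functor_def by (elim conjE)
    show ?thesis by (rule *[rule_format]) (use O that in auto)
  qed
  have "\<forall>Y. \<exists>X e e'. Y \<in> Obj D \<longrightarrow> X \<in> Obj C \<and> D.ar e \<and> D.src e = Fo X \<and> D.tgt e = Y \<and> D.ar e' \<and> D.src e' = Y \<and>
      D.tgt e' = Fo X \<and> e' \<bullet>\<^bsub>D\<^esub> e = ident D (Fo X) \<and> e \<bullet>\<^bsub>D\<^esub> e' = ident D Y"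
  proof
    fix Y
    show "\<exists>X e e'. Y \<in> Obj D \<longrightarrow> X \<in> Obj C \<and> D.ar e \<and> D.src e = Fo X \<and> D.tgt e = Y \<and> D.ar e' \<and> D.src e' = Y \<and>
      D.tgt e' = Fo X \<and> e' \<bullet>\<^bsub>D\<^esub> e = ident D (Fo X) \<and> e \<bullet>\<^bsub>D\<^esub> e' = ident D Y"
    proof (cases "Y \<in> Obj D")
      case True
      obtain X e where X: "X \<in> Obj C" "is_iso D (Fo X) Y e" using dense[OF True] by (auto simp: isomorphic_def)
      then show ?thesis using D.is_isoE[OF X(2) Fo[OF X(1)] True] by metis
    qed auto
  qed
  then obtain Go \<epsilon> \<epsilon>' where "\<forall>Y. Y \<in> Obj D \<longrightarrow> Go Y \<in> Obj C \<and> D.ar (\<epsilon> Y) \<and> D.src (\<epsilon> Y) = Fo (Go Y) \<and> D.tgt (\<epsilon> Y) = Y \<and> D.ar (\<epsilon>' Y) \<and>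
      D.src (\<epsilon>' Y) = Y \<and> D.tgt (\<epsilon>' Y) = Fo (Go Y) \<and> \<epsilon>' Y \<bullet>\<^bsub>D\<^esub> \<epsilon> Y = ident D (Fo (Go Y)) \<and> \<epsilon> Y \<bullet>\<^bsub>D\<^esub> \<epsilon>' Y = ident D Y"
    by (elim choice[THEN exE]) (rule that)
  then have G: "Go Y \<in> Obj C" and e: "D.ar (\<epsilon> Y)" "D.src (\<epsilon> Y) = Fo (Go Y)" "D.tgt (\<epsilon> Y) = Y" "D.ar (\<epsilon>' Y)"
      "D.src (\<epsilon>' Y) = Y" "D.tgt (\<epsilon>' Y) = Fo (Go Y)" "\<epsilon>' Y \<bullet>\<^bsub>D\<^esub> \<epsilon> Y = ident D (Fo (Go Y))" "\<epsilon> Y \<bullet>\<^bsub>D\<^esub> \<epsilon>' Y = ident D Y"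
    if "Y \<in> Obj D" for Y using that by blast+
  have ep: "\<epsilon> Y \<bullet>\<^bsub>D\<^esub> (\<epsilon>' Y \<bullet>\<^bsub>D\<^esub> h) = h" if "Y \<in> Obj D" "D.ar h" "D.tgt h = Y" for Y h
    using D.pre_simp[OF e(8)[OF that(1)], of h] e[OF that(1)] that by simp
  have e'p: "\<epsilon>' Y \<bullet>\<^bsub>D\<^esub> (\<epsilon> Y \<bullet>\<^bsub>D\<^esub> h) = h" if "Y \<in> Obj D" "D.ar h" "D.tgt h = Fo (Go Y)" for Y h
    using D.pre_simp[OF e(7)[OF that(1)], of h] e[OF that(1)] that by simp
  define L where "L X Y g = (SOME f. f \<in> Hom C X Y \<and> Fm X Y f = g)" for X Y g
  have L0: "L X Y g \<in> Hom C X Y \<and> Fm X Y (L X Y g) = g"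
    if O: "X \<in> Obj C" "Y \<in> Obj C" and g: "D.ar g" "D.src g = Fo X" "D.tgt g = Fo Y" for X Y g
  proof -
    have "g \<in> Hom D (Fo X) (Fo Y)" using O g Fo by simp
    then have "\<exists>f. f \<in> Hom C X Y \<and> Fm X Y f = g" using full[OF O] by blast
    then show ?thesis unfolding L_def by (rule someI_ex)
  qed
  have L: "C.ar (L X Y g)" "C.src (L X Y g) = X" "C.tgt (L X Y g) = Y" "Fm X Y (L X Y g) = g"
    if "X \<in> Obj C" "Y \<in> Obj C" "D.ar g" "D.src g = Fo X" "D.tgt g = Fo Y" for X Y g
    using L0[OF that] that by auto
  have eqI: "f = f'" if "C.ar f" "C.src f = X" "C.tgt f = Y" "C.ar f'" "C.src f' = X" "C.tgt f' = Y"
    "Fm X Y f = Fm X Y f'" for X Y f f'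
  proof -
    have "X \<in> Obj C" "Y \<in> Obj C" using that C.src_obj C.tgt_obj by blast+
    then show ?thesis using that by (intro faithful[of X Y]) auto
  qed
  define Gm where "Gm Y Y' g = L (Go Y) (Go Y') (\<epsilon>' Y' \<bullet>\<^bsub>D\<^esub> (g \<bullet>\<^bsub>D\<^esub> \<epsilon> Y))" for Y Y' g
  have Gm: "C.ar (Gm Y Y' g)" "C.src (Gm Y Y' g) = Go Y" "C.tgt (Gm Y Y' g) = Go Y'"
    "Fm (Go Y) (Go Y') (Gm Y Y' g) = \<epsilon>' Y' \<bullet>\<^bsub>D\<^esub> (g \<bullet>\<^bsub>D\<^esub> \<epsilon> Y)"
    if "Y \<in> Obj D" "Y' \<in> Obj D" "D.ar g" "D.src g = Y" "D.tgt g = Y'" for Y Y' g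
    unfolding Gm_def by (rule L; use that e G in simp)+
  define \<eta> where "\<eta> X = L X (Go (Fo X)) (\<epsilon>' (Fo X))" for X
  have \<eta>: "C.ar (\<eta> X)" "C.src (\<eta> X) = X" "C.tgt (\<eta> X) = Go (Fo X)" "Fm X (Go (Fo X)) (\<eta> X) = \<epsilon>' (Fo X)"
    if "X \<in> Obj C" for X unfolding \<eta>_def by (rule L; use that e[OF Fo] G[OF Fo] in simp)+
  define \<eta>' where "\<eta>' X = L (Go (Fo X)) X (\<epsilon> (Fo X))" for X
  have \<eta>': "C.ar (\<eta>' X)" "C.src (\<eta>' X) = Go (Fo X)" "C.tgt (\<eta>' X) = X" "Fm (Go (Fo X)) X (\<eta>' X) = \<epsilon> (Fo X)"
    if "X \<in> Obj C" for X unfolding \<eta>'_def by (rule L; use that e[OF Fo] G[OF Fo] in simp)+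
  have "is_functor D C Go Gm"
    unfolding is_functor_def
  proof (intro conjI ballI)
    fix Y assume Y: "Y \<in> Obj D"
    show "Go Y \<in> Obj C" by (rule G[OF Y])
    show "Gm Y Y (ident D Y) = ident C (Go Y)"
      by (rule eqI[of _ "Go Y" "Go Y"]) (use Gm[OF Y Y] G[OF Y] Fid e[OF Y] Y in simp_all)
  next
    fix Y Y' g assume Y: "Y \<in> Obj D" "Y' \<in> Obj D" and g: "g \<in> Hom D Y Y'"
    then show "Gm Y Y' g \<in> Hom C (Go Y) (Go Y')" using Gm[OF Y] G by simp
  next
    fix X Y Z f g assume O: "X \<in> Obj D" "Y \<in> Obj D" "Z \<in> Obj D" and f: "f \<in> Hom D X Y" and g: "g \<in> Hom D Y Z"
    have fg: "D.ar f" "D.src f = X" "D.tgt f = Y" "D.ar g" "D.src g = Y" "D.tgt g = Z" using f g O by auto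
    note 1 = Gm[OF O(1,2) fg(1-3)] and 2 = Gm[OF O(2,3) fg(4-6)]
    have 3: "D.ar (g \<bullet>\<^bsub>D\<^esub> f)" "D.src (g \<bullet>\<^bsub>D\<^esub> f) = X" "D.tgt (g \<bullet>\<^bsub>D\<^esub> f) = Z" using fg by auto
    note 4 = Gm[OF O(1,3) 3]
    show "Gm X Z (g \<bullet>\<^bsub>D\<^esub> f) = Gm Y Z g \<bullet>\<^bsub>C\<^esub> Gm X Y f"
    proof (rule eqI[OF 4(1-3)])
      show "Fm (Go X) (Go Z) (Gm X Z (g \<bullet>\<^bsub>D\<^esub> f)) = Fm (Go X) (Go Z) (Gm Y Z g \<bullet>\<^bsub>C\<^esub> Gm X Y f)"
        unfolding 4(4) Fcmp[OF 1(1-3) 2(1-3)] 1(4) 2(4)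
        using fg e[OF O(1)] e[OF O(2)] e[OF O(3)] ep[OF O(2), of "f \<bullet>\<^bsub>D\<^esub> \<epsilon> X"] by simp
    qed (use 1 2 in auto)
  qed
  moreover have "natural_iso C C (\<lambda>X. X) (\<lambda>X Y f. f) (\<lambda>X. Go (Fo X)) (\<lambda>X Y f. Gm (Fo X) (Fo Y) (Fm X Y f)) \<eta>"
    unfolding natural_iso_def
  proof (intro conjI ballI)
    fix X assume X: "X \<in> Obj C"
    note 1 = \<eta>[OF X] and 2 = \<eta>'[OF X] and 3 = e[OF Fo[OF X]] and 4 = G[OF Fo[OF X]]
    have "\<eta>' X \<bullet>\<^bsub>C\<^esub> \<eta> X = ident C X"
      by (rule eqI[of _ X X]) (use 1 2 3 X Fcmp[OF 1(1-3) 2(1-3)] Fid[OF X] in simp_all)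
    moreover have "\<eta> X \<bullet>\<^bsub>C\<^esub> \<eta>' X = ident C (Go (Fo X))"
      by (rule eqI[of _ "Go (Fo X)" "Go (Fo X)"]) (use 1 2 3 4 X Fcmp[OF 2(1-3) 1(1-3)] Fid[OF 4] in simp_all)
    ultimately show "is_iso C X (Go (Fo X)) (\<eta> X)"
      using 1 2 4 X by (intro C.is_isoI[where g="\<eta>' X"]) auto
  next
    fix X Y f assume O: "X \<in> Obj C" "Y \<in> Obj C" and "f \<in> Hom C X Y"
    then have f: "C.ar f" "C.src f = X" "C.tgt f = Y" by auto
    note Ff = Fm[OF O f] and 1 = \<eta>[OF O(1)] and 2 = \<eta>[OF O(2)]
    note g = Gm[OF Fo[OF O(1)] Fo[OF O(2)] Ff]
    show "Gm (Fo X) (Fo Y) (Fm X Y f) \<bullet>\<^bsub>C\<^esub> \<eta> X = \<eta> Y \<bullet>\<^bsub>C\<^esub> f"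
    proof (rule eqI[of _ X "Go (Fo Y)"])
      show "Fm X (Go (Fo Y)) (Gm (Fo X) (Fo Y) (Fm X Y f) \<bullet>\<^bsub>C\<^esub> \<eta> X) = Fm X (Go (Fo Y)) (\<eta> Y \<bullet>\<^bsub>C\<^esub> f)"
        unfolding Fcmp[OF 1(1-3) g(1-3)] Fcmp[OF f 2(1-3)] g(4) 1(4) 2(4)
        using Ff e[OF Fo[OF O(1)]] e[OF Fo[OF O(2)]] by simp
    qed (use g 1 2 f in simp_all)
  qed
  moreover have "natural_iso D D (\<lambda>X. Fo (Go X)) (\<lambda>X Y f. Fm (Go X) (Go Y) (Gm X Y f)) (\<lambda>X. X) (\<lambda>X Y f. f) \<epsilon>"
    unfolding natural_iso_def
  proof (intro conjI ballI)
    fix Y assume Y: "Y \<in> Obj D"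
    show "is_iso D (Fo (Go Y)) Y (\<epsilon> Y)"
      using e[OF Y] Y Fo[OF G[OF Y]] by (intro D.is_isoI[where g="\<epsilon>' Y"]) auto
  next
    fix X Y f assume O: "X \<in> Obj D" "Y \<in> Obj D" and "f \<in> Hom D X Y"
    then have f: "D.ar f" "D.src f = X" "D.tgt f = Y" by auto
    show "f \<bullet>\<^bsub>D\<^esub> \<epsilon> X = \<epsilon> Y \<bullet>\<^bsub>D\<^esub> Fm (Go X) (Go Y) (Gm X Y f)"
      unfolding Gm(4)[OF O f] using f e[OF O(1)] e[OF O(2)] ep[OF O(2), of "f \<bullet>\<^bsub>D\<^esub> \<epsilon> X"] by simp
  qed
  ultimately show ?thesis unfolding is_equivalence_def using func by blast
qed

section \<open>Indecomposables, bricks and trivial extensions under the functor\<close>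

context mss
begin

text \<open>If \<Psi> X were zero, the identity and the zero morphism of X would agree on all
  morphisms from P, and faithfulness would identify them.\<close>

lemma psi_zero_iff:
  assumes "X \<in> F {1..t}" "ident C X \<noteq> zer C X X"
  shows "ident (mod_add B) (\<Psi> X) \<noteq> zer (mod_add B) (\<Psi> X) (\<Psi> X)"
proof
  assume *: "ident (mod_add B) (\<Psi> X) = zer (mod_add B) (\<Psi> X) (\<Psi> X)"
  have XO: "X \<in> Obj C" by (rule fl_obj[OF assms(1)])
  have "ident C X = zer C X X"
  proof (rule psi_faithful[OF assms(1,1)])
    fix u assume u: "ar u" "src u = PP" "tgt u = X"
    then have "u = zer C PP X" using fun_cong[of _ _ u] * XO by (auto dest!: fun_cong[of _ _ u])
    then show "ident C X \<bullet> u = zer C X X \<bullet> u" using u XO by simp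
  qed (use XO in auto)
  then show False using assms(2) by simp
qed

text \<open>An idempotent of \<Psi> X is represented by an idempotent of X, by fullness and
  faithfulness, and a local object has only 0 and 1.\<close>

lemma psi_indecomposable:
  assumes X: "X \<in> F {1..t}" "loc X"
  shows "indecomposable (mod_cat B) (\<Psi> X)"
proof -
  interpret D: preadditive "mod_cat B :: (('m, 'm) module, ('m, 'm) mod_mor, ('m, 'm) mod_ext, unit) neg_extri"
    by (rule preadditive_mod_cat[OF ring_B])
  have XO: "X \<in> Obj C" by (rule fl_obj[OF X(1)])
  show ?thesis
  proof (rule D.trivial_idempotents_indecomposable)
    show "\<Psi> X \<in> Obj (mod_cat B)" using psi_mod_obj[OF XO] by (simp del: mod_add_simps)
    show "ident (mod_cat B) (\<Psi> X) \<noteq> zer (mod_cat B) (\<Psi> X) (\<Psi> X)"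
      using psi_zero_iff[OF X(1)] X(2) by (simp add: loc_def del: mod_add_simps)
    fix E assume "E \<in> Hom (mod_cat B) (\<Psi> X) (\<Psi> X)" and EE: "E \<bullet>\<^bsub>mod_cat B\<^esub> E = E"
    then obtain \<phi> where \<phi>: "E = (\<Psi> X, \<Psi> X, \<phi>)" "\<phi> \<in> mod_hom B (\<Psi> X) (\<Psi> X)" by auto
    obtain h where h: "ar h" "src h = X" "tgt h = X" "\<And>u. \<lbrakk>ar u; src u = PP; tgt u = X\<rbrakk> \<Longrightarrow> \<phi> u = h \<bullet> u"
      using psi_full[OF X(1,1) \<phi>(2)] by metis
    have "\<phi> = psi PP X h"
      by (rule mod_hom_eqI[OF \<phi>(2) psi_hom[OF PP_obj h(1-3)]]) (use h XO in simp)
    then have E: "E = (\<Psi> X, \<Psi> X, psi PP X h)" using \<phi> by simp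
    have c: "compose (carrier (\<Psi> X)) \<phi> \<phi> = \<phi>" using EE \<phi>(1) by simp
    have "h \<bullet> h = h"
    proof (rule psi_faithful[OF X(1,1)])
      fix u assume u: "ar u" "src u = PP" "tgt u = X"
      have "\<phi> (\<phi> u) = \<phi> u" using fun_cong[OF c, of u] u XO by (simp add: compose_def)
      then show "(h \<bullet> h) \<bullet> u = h \<bullet> u" using h u by simp
    qed (use h in auto)
    then have "h = ident C X \<or> h = zer C X X" using loc_idempotent[OF X(2)] h XO by simp
    then show "E = ident (mod_cat B) (\<Psi> X) \<or> E = zer (mod_cat B) (\<Psi> X) (\<Psi> X)"
      unfolding E using psi_ident[OF PP_obj XO] psi_zer[OF PP_obj XO XO] by auto
  qed
qed

text \<open>A nonzero endomorphism of \<Psi> X is represented by a nonzero endomorphism of X, whose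
  inverse is carried over.\<close>

lemma psi_brick:
  assumes X: "X \<in> F {1..t}" "brick C X"
  shows "brick (mod_cat B) (\<Psi> X)"
proof -
  interpret D: preadditive "mod_cat B :: (('m, 'm) module, ('m, 'm) mod_mor, ('m, 'm) mod_ext, unit) neg_extri"
    by (rule preadditive_mod_cat[OF ring_B])
  have XO: "X \<in> Obj C" by (rule fl_obj[OF X(1)])
  have O: "\<Psi> X \<in> Obj (mod_cat B)" using psi_mod_obj[OF XO] by (simp del: mod_add_simps)
  have nz: "ident (mod_cat B) (\<Psi> X) \<noteq> zer (mod_cat B) (\<Psi> X) (\<Psi> X)"
    using psi_zero_iff[OF X(1)] brick_loc[OF X(2)] by (simp add: loc_def del: mod_add_simps)
  have U: "Units (End_ring C X) = Hom C X X - {zer C X X}"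
    using X(2) unfolding brick_def division_ring_def by simp
  have "is_iso (mod_cat B) (\<Psi> X) (\<Psi> X) E"
    if "E \<in> Hom (mod_cat B) (\<Psi> X) (\<Psi> X)" "E \<noteq> zer (mod_cat B) (\<Psi> X) (\<Psi> X)" for E
  proof -
    obtain \<phi> where \<phi>: "E = (\<Psi> X, \<Psi> X, \<phi>)" "\<phi> \<in> mod_hom B (\<Psi> X) (\<Psi> X)" using \<open>E \<in> _\<close> by auto
    obtain h where h: "ar h" "src h = X" "tgt h = X" "\<And>u. \<lbrakk>ar u; src u = PP; tgt u = X\<rbrakk> \<Longrightarrow> \<phi> u = h \<bullet> u"
      using psi_full[OF X(1,1) \<phi>(2)] by metis
    have e: "\<phi> = psi PP X h"
      by (rule mod_hom_eqI[OF \<phi>(2) psi_hom[OF PP_obj h(1-3)]]) (use h XO in simp)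
    have "h \<noteq> zer C X X" using that(2) psi_zer[OF PP_obj XO XO] \<phi>(1) e by auto
    then have "is_iso C X X h" using U h(1-3) XO by (simp flip: Units_End)
    then obtain k where k: "ar k" "src k = X" "tgt k = X" "k \<bullet> h = ident C X" "h \<bullet> k = ident C X"
      using is_isoE[OF _ XO XO] by metis
    have "is_iso (mod_add B) (\<Psi> X) (\<Psi> X) (\<Psi> X, \<Psi> X, psi PP X h)"
    proof (rule is_iso_mod_inverseI[OF psi_hom[OF PP_obj h(1-3)] psi_hom[OF PP_obj k(1-3)]])
      fix x assume "x \<in> carrier (\<Psi> X)"
      then show "psi PP X k (psi PP X h x) = x" "psi PP X h (psi PP X k x) = x"
        using h(1-3) k XO pre_simp[OF k(4), of x] pre_simp[OF k(5), of x] by simp_all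
    qed
    then show ?thesis using \<phi>(1) e mod_cat_transfer(1) by metis
  qed
  moreover have "\<not> is_iso (mod_cat B) (\<Psi> X) (\<Psi> X) (zer (mod_cat B) (\<Psi> X) (\<Psi> X))"
  proof
    assume i: "is_iso (mod_cat B) (\<Psi> X) (\<Psi> X) (zer (mod_cat B) (\<Psi> X) (\<Psi> X))"
    obtain g where "D.ar g" "D.src g = \<Psi> X" "D.tgt g = \<Psi> X"
      "zer (mod_cat B) (\<Psi> X) (\<Psi> X) \<bullet>\<^bsub>mod_cat B\<^esub> g = ident (mod_cat B) (\<Psi> X)" using D.is_isoE[OF i O O] by metis
    then show False using nz O by (simp del: mod_cat_simps)
  qed
  moreover have "is_iso (mod_cat B) (\<Psi> X) (\<Psi> X) E \<Longrightarrow> E \<in> Hom (mod_cat B) (\<Psi> X) (\<Psi> X)" for E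
    unfolding is_iso_def by blast
  ultimately have "Units (End_ring (mod_cat B) (\<Psi> X)) = carrier (End_ring (mod_cat B) (\<Psi> X)) - {zero (End_ring (mod_cat B) (\<Psi> X))}"
    unfolding D.End_ring_simps using D.Units_End[OF O] by blast
  then show ?thesis unfolding brick_def division_ring_def using O D.ring_End[OF O] by blast
qed

text \<open>An extension of \<Psi> Y by \<Psi> X lifts to a conflation; this splits, and its section
  is carried back. An isomorphic copy N of \<Psi> X is allowed because a filtered module is known
  only up to isomorphism to come from F(\<Theta>).\<close>

lemma psi_yoneda_trivial:
  assumes X: "X \<in> F {1..t}" and Y: "Y \<in> F {1..t}" and ext: "carrier (Ext C Y X) = {\<one>\<^bsub>Ext C Y X\<^esub>}"
    and N: "isomorphic (mod_add B) (\<Psi> X) N" "N \<in> Obj (mod_add B)"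
  shows "yoneda_ext B (\<Psi> Y) N = {split_class B (\<Psi> Y) N}"
proof -
  interpret D: preadditive "mod_add B :: (('m, 'm) module, ('m, 'm) mod_mor) preadd"
    by (rule preadditive_mod_add[OF ring_B])
  have XO: "X \<in> Obj C" and YO: "Y \<in> Obj C" using fl_obj X Y by blast+
  obtain f g where fg: "f \<in> mod_hom B (\<Psi> X) N" "g \<in> mod_hom B N (\<Psi> X)" "\<And>x. x \<in> carrier (\<Psi> X) \<Longrightarrow> g (f x) = x"
    "\<And>x. x \<in> carrier N \<Longrightarrow> f (g x) = x"
    using isomorphic_modE[OF N(1) psi_rmodule[OF PP_obj XO] mod_ObjD[OF N(2)]] by metis
  obtain Z i1 i2 p1 p2 where b: "biproduct C X Y Z i1 i2 p1 p2" using biproduct_exists[OF XO YO] by blast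
  note bp = psi_biproduct[OF b PP_obj psi_mod_obj[OF XO] psi_mod_obj[OF YO] psi_mod_obj[OF biproductD(3)[OF b]]]
  \<comment> \<open>\<open>yoneda_ext_trivial\<close> asks for a reference sequence; the biproduct
    is formed in C and transported to N.\<close>
  have bi: "\<exists>Z i1 i2 p1 p2. biproduct (mod_add B) N (\<Psi> Y) Z i1 i2 p1 p2"
  proof -
    have i: "is_iso (mod_add B) (\<Psi> X) N (\<Psi> X, N, f)" by (rule is_iso_mod_inverseI[OF fg])
    obtain G where "D.ar (\<Psi> X, N, f)" "D.src (\<Psi> X, N, f) = \<Psi> X" "D.tgt (\<Psi> X, N, f) = N" "D.ar G" "D.src G = N"
      "D.tgt G = \<Psi> X" "G \<bullet>\<^bsub>mod_add B\<^esub> (\<Psi> X, N, f) = ident (mod_add B) (\<Psi> X)"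
      "(\<Psi> X, N, f) \<bullet>\<^bsub>mod_add B\<^esub> G = ident (mod_add B) N"
      using D.is_isoE[OF i psi_mod_obj[OF XO] N(2)] by metis
    from D.biproduct_iso_left[OF bp this] show ?thesis by blast
  qed
  then obtain Z' j1 j2 q1 q2 where bi: "biproduct (mod_add B) N (\<Psi> Y) Z' j1 j2 q1 q2" by blast
  show ?thesis
  proof (rule yoneda_ext_trivial[OF ring_B bi])
    fix M a c assume s: "ses B N a M c (\<Psi> Y)"
    let ?a = "compose (carrier (\<Psi> X)) a f"
    have a: "a \<in> mod_hom B N M" "inj_on a (carrier N)" "a ` carrier N = {x \<in> carrier M. c x = \<zero>\<^bsub>\<Psi> Y\<^esub>}"
      using s by (auto simp: ses_def)
    have fon: "f ` carrier (\<Psi> X) = carrier N"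
    proof (intro equalityI subsetI)
      fix x assume "x \<in> carrier N"
      then show "x \<in> f ` carrier (\<Psi> X)" using fg(4)[of x] mod_homD(1)[OF fg(2), of x] by (metis imageI)
    next
      fix x assume "x \<in> f ` carrier (\<Psi> X)"
      then show "x \<in> carrier N" using mod_homD(1)[OF fg(1)] by blast
    qed
    have "inj_on ?a (carrier (\<Psi> X))"
    proof (rule inj_onI)
      fix x y assume xy: "x \<in> carrier (\<Psi> X)" "y \<in> carrier (\<Psi> X)" "?a x = ?a y"
      then have "a (f x) = a (f y)" by (simp only: compose_eq)
      then have "f x = f y" using inj_onD[OF a(2)] mod_homD(1)[OF fg(1)] xy by metis
      then show "x = y" using fg(3) xy by metis
    qed
    moreover have "?a ` carrier (\<Psi> X) = {x \<in> carrier M. c x = \<zero>\<^bsub>\<Psi> Y\<^esub>}"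
      unfolding a(3)[symmetric] fon[symmetric] image_image by (rule image_cong) (simp_all only: compose_eq)
    moreover have "?a \<in> mod_hom B (\<Psi> X) M" by (rule mod_hom_cmp[OF psi_rmodule[OF PP_obj XO] fg(1) a(1)])
    ultimately have s': "ses B (\<Psi> X) ?a M c (\<Psi> Y)"
      using s psi_mod_obj[OF XO] by (simp add: ses_def del: mod_add_simps)
    obtain E x y d \<theta> where E: "conflation C X x E y Y d" "\<theta> \<in> mod_hom B (\<Psi> E) M"
      "\<And>w. \<lbrakk>ar w; src w = PP; tgt w = E\<rbrakk> \<Longrightarrow> c (\<theta> w) = y \<bullet> w"
      by (rule psi_extension[OF X Y s']) (rule that)
    note e = conflD[OF E(1)]
    have "d = \<one>\<^bsub>Ext C Y X\<^esub>" using ext e by blast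
    then obtain i p where "biproduct C X Y E x i p y" using split_biproduct E(1) by metis
    then have i: "ar i" "src i = Y" "tgt i = E" "y \<bullet> i = ident C Y" by (auto dest: biproductD)
    let ?s = "compose (carrier (\<Psi> Y)) \<theta> (psi PP Y i)"
    have "?s \<in> mod_hom B (\<Psi> Y) M"
      by (rule mod_hom_cmp[OF psi_rmodule[OF PP_obj YO] psi_hom[OF PP_obj i(1-3)] E(2)])
    moreover have "c (?s u) = u" if u: "u \<in> carrier (\<Psi> Y)" for u
    proof -
      have u': "ar u" "src u = PP" "tgt u = Y" using u YO by auto
      have "c (?s u) = y \<bullet> (i \<bullet> u)" using E(3)[of "i \<bullet> u"] u u' i YO by (simp add: compose_def)
      then show ?thesis using pre_simp[OF i(4), of u] u' i e by simp
    qed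
    ultimately show "\<exists>s \<in> mod_hom B (\<Psi> Y) M. \<forall>u \<in> carrier (\<Psi> Y). c (s u) = u" by blast
  qed
qed

end

section \<open>The equivalence and the image system\<close>

context mss
begin

text \<open>The direct sum that collects the intermediate modules is formed in C, so that no
  biproduct of modules has to be found; its inclusions and projections combine the summands into one
  factorization.\<close>

lemma thr_mod_factor:
  assumes "preadditive.thr (mod_cat B) (\<Psi>\<Theta> {1..t}) Z Z' n G" "Z \<in> Obj (mod_add B)" "Z' \<in> Obj (mod_add B)"
  shows "\<exists>M \<in> sums (\<Theta> ` {1..t}). \<exists>a \<in> mod_hom B Z (\<Psi> M). \<exists>b \<in> mod_hom B (\<Psi> M) Z'.
    \<exists>s. G = (Z, Z', s) \<and> (\<forall>x \<in> carrier Z. s x = b (a x))"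
proof -
  interpret D: preadditive "mod_cat B :: (('m, 'm) module, ('m, 'm) mod_mor, ('m, 'm) mod_ext, unit) neg_extri"
    by (rule preadditive_mod_cat[OF ring_B])
  interpret Z: rmodule B Z by (rule mod_ObjD[OF assms(2)])
  interpret Z': rmodule B Z' by (rule mod_ObjD[OF assms(3)])
  show ?thesis
    using assms(1)
  proof induction
    case thr_zer
    obtain O' where O': "is_zero_obj C O'" using zero_obj_exists by blast
    then have OO: "O' \<in> Obj C" by (simp add: is_zero_obj_def)
    interpret O: rmodule B "\<Psi> O'" by (rule psi_rmodule[OF PP_obj OO])
    have "\<exists>s. zer (mod_cat B) Z Z' = (Z, Z', s) \<and>
        (\<forall>x \<in> carrier Z. s x = (\<lambda>x \<in> carrier (\<Psi> O'). \<zero>\<^bsub>Z'\<^esub>) ((\<lambda>x \<in> carrier Z. \<zero>\<^bsub>\<Psi> O'\<^esub>) x))"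
      using OO by auto
    then show ?case
      using sums_zero[OF O'] O.mod_hom_zero[OF Z.rmodule_axioms] Z'.mod_hom_zero[OF O.rmodule_axioms] by blast
  next
    case (thr_pls n r N \<alpha> \<beta>)
    then obtain M a b s where M: "M \<in> sums (\<Theta> ` {1..t})" and a: "a \<in> mod_hom B Z (\<Psi> M)" and b: "b \<in> mod_hom B (\<Psi> M) Z'"
      and s: "r = (Z, Z', s)" "\<And>x. x \<in> carrier Z \<Longrightarrow> s x = b (a x)" by blast
    obtain j where j: "j \<in> {1..t}" "N = \<Psi> (\<Theta> j)" using thr_pls(2) by blast
    obtain a' b' where a': "\<alpha> = (Z, \<Psi> (\<Theta> j), a')" "a' \<in> mod_hom B Z (\<Psi> (\<Theta> j))"
      and b': "\<beta> = (\<Psi> (\<Theta> j), Z', b')" "b' \<in> mod_hom B (\<Psi> (\<Theta> j)) Z'"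
      using thr_pls(3,4) j(2) by auto
    have MO: "M \<in> Obj C" by (rule sums_obj[OF M])
    obtain W i1 i2 p1 p2 where W: "biproduct C (\<Theta> j) M W i1 i2 p1 p2"
      using biproduct_exists[OF \<Theta>_obj[OF j(1)] MO] by blast
    note w = biproductD[OF W]
    interpret W: rmodule B "\<Psi> W" by (rule psi_rmodule[OF PP_obj w(3)])
    let ?a = "\<lambda>x \<in> carrier Z. compose (carrier Z) (psi PP (\<Theta> j) i1) a' x \<oplus>\<^bsub>\<Psi> W\<^esub> compose (carrier Z) (psi PP M i2) a x"
    let ?b = "\<lambda>u \<in> carrier (\<Psi> W). compose (carrier (\<Psi> W)) b' (psi PP W p1) u \<oplus>\<^bsub>Z'\<^esub> compose (carrier (\<Psi> W)) b (psi PP W p2) u"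
    have ha: "?a \<in> mod_hom B Z (\<Psi> W)"
      by (intro W.mod_hom_add mod_hom_cmp[OF _ a'(2)] mod_hom_cmp[OF _ a] Z.rmodule_axioms psi_hom PP_obj w)
    have hb: "?b \<in> mod_hom B (\<Psi> W) Z'"
      by (intro Z'.mod_hom_add mod_hom_cmp[OF _ _ b'(2)] mod_hom_cmp[OF _ _ b] W.rmodule_axioms psi_hom PP_obj w)
    have "s x \<oplus>\<^bsub>Z'\<^esub> b' (a' x) = ?b (?a x)" if x: "x \<in> carrier Z" for x
    proof -
      have 1: "ar (a' x)" "src (a' x) = PP" "tgt (a' x) = \<Theta> j" using mod_homD(1)[OF a'(2) x] w by auto
      have 2: "ar (a x)" "src (a x) = PP" "tgt (a x) = M" using mod_homD(1)[OF a x] MO by auto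
      have ax: "?a x = (i1 \<bullet> a' x) \<boxplus> (i2 \<bullet> a x)" using x 1 2 w by (simp add: compose_def)
      have p: "p1 \<bullet> ((i1 \<bullet> a' x) \<boxplus> (i2 \<bullet> a x)) = a' x" "p2 \<bullet> ((i1 \<bullet> a' x) \<boxplus> (i2 \<bullet> a x)) = a x"
        using 1 2 w biproduct_pre[OF W 1(1)] biproduct_pre[OF W 2(1)] by simp_all
      have c: "(i1 \<bullet> a' x) \<boxplus> (i2 \<bullet> a x) \<in> carrier (\<Psi> W)" using 1 2 w by simp
      have m: "b' (a' x) \<in> carrier Z'" "b (a x) \<in> carrier Z'"
        using mod_homD(1)[OF b'(2), of "a' x"] mod_homD(1)[OF b, of "a x"] 1 2 w by auto
      have "?b (?a x) = b' (a' x) \<oplus>\<^bsub>Z'\<^esub> b (a x)"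
        unfolding ax using c p 1 2 w by (simp add: compose_def)
      then show ?thesis using s(2)[OF x] m by (simp add: Z'.M.a_comm)
    qed
    then have "\<exists>q. r \<boxplus>\<^bsub>mod_cat B\<^esub> \<beta> \<bullet>\<^bsub>mod_cat B\<^esub> \<alpha> = (Z, Z', q) \<and> (\<forall>x \<in> carrier Z. q x = ?b (?a x))"
      unfolding s(1) a'(1) b'(1) by (simp add: compose_def del: psi_obj_simps)
    moreover have "W \<in> sums (\<Theta> ` {1..t})" using sums_add[OF _ M W] j(1) by blast
    ultimately show ?case using ha hb by blast
  qed
qed

lemma sums_F: "X \<in> sums (\<Theta> ` {1..t}) \<Longrightarrow> X \<in> F {1..t}"
  by (rule sums_fl) (auto intro: fl_member)

text \<open>Z is a retract of some \<Psi> M by homomorphisms \<open>a\<close> and \<open>b\<close>.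
  The idempotent a b lifts to an idempotent of M, which splits in C through a finite direct sum X of
  the \<Theta>(j), and \<Psi> X is isomorphic to Z.\<close>

lemma addc_mod_image:
  assumes "Z \<in> addc (mod_cat B) (\<Psi>\<Theta> {1..t})"
  shows "\<exists>X \<in> F {1..t}. isomorphic (mod_add B) (\<Psi> X) Z"
proof -
  interpret D: preadditive "mod_cat B :: (('m, 'm) module, ('m, 'm) mod_mor, ('m, 'm) mod_ext, unit) neg_extri"
    by (rule preadditive_mod_cat[OF ring_B])
  have S: "\<Psi>\<Theta> {1..t} \<subseteq> Obj (mod_cat B)" using psi_mod_obj \<Theta>_obj by (auto simp del: mod_add_simps)
  have ZO: "Z \<in> Obj (mod_add B)" using D.addc_thr(1)[OF assms S] by simp
  obtain n where n: "D.thr (\<Psi>\<Theta> {1..t}) Z Z n (ident (mod_cat B) Z)" using D.addc_thr(2)[OF assms S] by blast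
  obtain M a b s where M: "M \<in> sums (\<Theta> ` {1..t})" and a: "a \<in> mod_hom B Z (\<Psi> M)" and b: "b \<in> mod_hom B (\<Psi> M) Z"
    and s: "ident (mod_cat B) Z = (Z, Z, s)" "\<forall>x \<in> carrier Z. s x = b (a x)"
    using thr_mod_factor[OF n ZO ZO] by blast
  have ba: "b (a x) = x" if "x \<in> carrier Z" for x using s that by auto
  have MF: "M \<in> F {1..t}" by (rule sums_F[OF M])
  have MO: "M \<in> Obj C" by (rule sums_obj[OF M])
  interpret M: rmodule B "\<Psi> M" by (rule psi_rmodule[OF PP_obj MO])
  obtain e where e: "ar e" "src e = M" "tgt e = M" "\<And>u. \<lbrakk>ar u; src u = PP; tgt u = M\<rbrakk> \<Longrightarrow> compose (carrier (\<Psi> M)) a b u = e \<bullet> u"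
    using psi_full[OF MF MF mod_hom_cmp[OF M.rmodule_axioms b a]] by metis
  have eu: "e \<bullet> u = a (b u)" if "ar u" "src u = PP" "tgt u = M" for u
    using e(4)[OF that] that MO by (simp add: compose_def)
  have "e \<bullet> e = e"
  proof (rule psi_faithful[OF MF MF])
    fix u assume u: "ar u" "src u = PP" "tgt u = M"
    have bu: "b u \<in> carrier Z" using mod_homD(1)[OF b, of u] u MO by simp
    have "(e \<bullet> e) \<bullet> u = e \<bullet> (e \<bullet> u)" using u e by simp
    also have "\<dots> = a (b (e \<bullet> u))" using u e by (intro eu) auto
    also have "\<dots> = e \<bullet> u" unfolding eu[OF u] ba[OF bu] ..
    finally show "(e \<bullet> e) \<bullet> u = e \<bullet> u" .
  qed (use e in auto)
  moreover have "\<exists>n. thr (\<Theta> ` {1..t}) M M n e"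
  proof -
    have SO: "\<Theta> ` {1..t} \<subseteq> Obj C" using \<Theta>_obj by blast
    obtain n where "thr (\<Theta> ` {1..t}) M M n (ident C M)" using sums_thr[OF M SO] by blast
    from thr_cmp[OF this SO MO MO MO MO, of "ident C M" e] show ?thesis using e MO by auto
  qed
  ultimately have "splits (\<Theta> ` {1..t}) e" using idempotent_splits[of "\<Theta> ` {1..t}" M _ e] \<Theta>_loc MO by blast
  then obtain X i p where X: "X \<in> sums (\<Theta> ` {1..t})" and i: "ar i" "src i = X" "tgt i = M" and p: "ar p" "src p = M" "tgt p = X"
    and pi: "p \<bullet> i = ident C X" "i \<bullet> p = e" unfolding splits_def using e by auto
  have XO: "X \<in> Obj C" by (rule sums_obj[OF X])
  have "is_iso (mod_add B) (\<Psi> X) Z (\<Psi> X, Z, compose (carrier (\<Psi> X)) b (psi PP X i))"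
  proof (rule is_iso_mod_inverseI)
    show "compose (carrier (\<Psi> X)) b (psi PP X i) \<in> mod_hom B (\<Psi> X) Z"
      by (rule mod_hom_cmp[OF psi_rmodule[OF PP_obj XO] psi_hom[OF PP_obj i] b])
    show "compose (carrier Z) (psi PP M p) a \<in> mod_hom B Z (\<Psi> X)"
      by (rule mod_hom_cmp[OF mod_ObjD[OF ZO] a psi_hom[OF PP_obj p]])
  next
    fix u assume "u \<in> carrier (\<Psi> X)"
    then have u: "ar u" "src u = PP" "tgt u = X" using XO by auto
    have iu: "ar (i \<bullet> u)" "src (i \<bullet> u) = PP" "tgt (i \<bullet> u) = M" using u i by auto
    have bu: "b (i \<bullet> u) \<in> carrier Z" using mod_homD(1)[OF b, of "i \<bullet> u"] iu MO by simp
    have "a (b (i \<bullet> u)) = i \<bullet> u"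
      unfolding eu[OF iu, symmetric] pi(2)[symmetric] using pre_simp[OF pi(1), of u] u i p by simp
    moreover have "compose (carrier (\<Psi> X)) b (psi PP X i) u = b (i \<bullet> u)" using u XO by (simp add: compose_def)
    moreover have "a (b (i \<bullet> u)) \<in> carrier (\<Psi> M)" by (rule mod_homD(1)[OF a bu])
    ultimately show "compose (carrier Z) (psi PP M p) a (compose (carrier (\<Psi> X)) b (psi PP X i) u) = u"
      using bu iu MO pre_simp[OF pi(1), of u] u i p by (simp add: compose_def)
  next
    fix x assume x: "x \<in> carrier Z"
    have ax: "ar (a x)" "src (a x) = PP" "tgt (a x) = M" using mod_homD(1)[OF a x] MO by auto
    have pa: "p \<bullet> a x \<in> carrier (\<Psi> X)" using ax p XO by simp
    have "i \<bullet> (p \<bullet> a x) = e \<bullet> a x" using pre_simp[OF pi(2), of "a x"] ax i p by simp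
    also have "\<dots> = a x" unfolding eu[OF ax] ba[OF x] ..
    finally have "i \<bullet> (p \<bullet> a x) = a x" .
    then show "compose (carrier (\<Psi> X)) b (psi PP X i) (compose (carrier Z) (psi PP M p) a x) = x"
      using x pa ax p XO MO ba[OF x] by (simp add: compose_def)
  qed
  then show ?thesis using sums_F[OF X] unfolding isomorphic_def by blast
qed

text \<open>Induction on the filtration length: both ends of the defining sequence are replaced by
  isomorphic modules \<Psi> X and \<Psi> X', and the resulting extension is lifted by
  \<open>psi_extension\<close>.\<close>

lemma filt_mod_image:
  assumes "N \<in> filt (mod_cat B) (\<Psi>\<Theta> {1..t})"
  shows "N \<in> Obj (mod_add B)" "\<exists>X \<in> F {1..t}. isomorphic (mod_add B) (\<Psi> X) N"
proof -
  interpret D: preadditive "mod_cat B :: (('m, 'm) module, ('m, 'm) mod_mor, ('m, 'm) mod_ext, unit) neg_extri"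
    by (rule preadditive_mod_cat[OF ring_B])
  have S: "\<Psi>\<Theta> {1..t} \<subseteq> Obj (mod_cat B)" using psi_mod_obj \<Theta>_obj by (auto simp del: mod_add_simps)
  have "N \<in> Obj (mod_add B) \<and> (\<exists>X \<in> F {1..t}. isomorphic (mod_add B) (\<Psi> X) N)"
    if "N \<in> filt_len (mod_cat B) (\<Psi>\<Theta> {1..t}) l" for N l
    using that
  proof (induction l arbitrary: N)
    case 0
    then show ?case using addc_mod_image D.addc_thr(1)[OF _ S] by (simp del: mod_add_simps)
  next
    case (Suc l)
    then obtain Z Y G H \<xi> where ZY: "Z \<in> addc (mod_cat B) (\<Psi>\<Theta> {1..t})" "Y \<in> filt_len (mod_cat B) (\<Psi>\<Theta> {1..t}) l"
      "conflation (mod_cat B) Z G N H Y \<xi>" by (auto simp: star_def simp del: mod_add_simps)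
    obtain g h where s: "ses B Z g N h Y" using conflation_modD[OF ZY(3)] by metis
    have O: "Z \<in> Obj (mod_add B)" "N \<in> Obj (mod_add B)" "Y \<in> Obj (mod_add B)" and gh: "g \<in> mod_hom B Z N" "h \<in> mod_hom B N Y"
      and gi: "inj_on g (carrier Z)" and gk: "g ` carrier Z = {x \<in> carrier N. h x = \<zero>\<^bsub>Y\<^esub>}" and hs: "h ` carrier N = carrier Y"
      using s by (auto simp: ses_def simp del: mod_add_simps)
    obtain X where X: "X \<in> F {1..t}" "isomorphic (mod_add B) (\<Psi> X) Z" using addc_mod_image[OF ZY(1)] by blast
    obtain X' where X': "X' \<in> F {1..t}" "isomorphic (mod_add B) (\<Psi> X') Y" using Suc.IH[OF ZY(2)] by blast
    have XO: "X \<in> Obj C" and XO': "X' \<in> Obj C" using fl_obj X X' by blast+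
    obtain a a' where a: "a \<in> mod_hom B (\<Psi> X) Z" "a' \<in> mod_hom B Z (\<Psi> X)" "\<And>x. x \<in> carrier (\<Psi> X) \<Longrightarrow> a' (a x) = x"
      "\<And>x. x \<in> carrier Z \<Longrightarrow> a (a' x) = x"
      using isomorphic_modE[OF X(2) psi_rmodule[OF PP_obj XO] mod_ObjD[OF O(1)]] by metis
    obtain b b' where b: "b \<in> mod_hom B (\<Psi> X') Y" "b' \<in> mod_hom B Y (\<Psi> X')" "\<And>x. x \<in> carrier (\<Psi> X') \<Longrightarrow> b' (b x) = x"
      "\<And>x. x \<in> carrier Y \<Longrightarrow> b (b' x) = x"
      using isomorphic_modE[OF X'(2) psi_rmodule[OF PP_obj XO'] mod_ObjD[OF O(3)]] by metis
    interpret b': rmod_hom B Y "\<Psi> X'" b'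
      by (intro rmod_hom.intro rmod_hom_axioms.intro mod_ObjD[OF O(3)] psi_rmodule PP_obj XO' b)
    interpret b: rmod_hom B "\<Psi> X'" Y b
      by (intro rmod_hom.intro rmod_hom_axioms.intro mod_ObjD[OF O(3)] psi_rmodule PP_obj XO' b)
    let ?g = "compose (carrier (\<Psi> X)) g a" and ?h = "compose (carrier N) b' h"
    have ac: "a x \<in> carrier Z" if "x \<in> carrier (\<Psi> X)" for x using mod_homD(1)[OF a(1) that] .
    have ac': "a' x \<in> carrier (\<Psi> X)" if "x \<in> carrier Z" for x using mod_homD(1)[OF a(2) that] .
    have hc: "h x \<in> carrier Y" if "x \<in> carrier N" for x using mod_homD(1)[OF gh(2) that] .
    have bz: "b' y = \<zero>\<^bsub>\<Psi> X'\<^esub> \<longleftrightarrow> y = \<zero>\<^bsub>Y\<^esub>" if "y \<in> carrier Y" for y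
      using b(4)[OF that] b.zero b'.zero by metis
    have "inj_on ?g (carrier (\<Psi> X))"
    proof (rule inj_onI)
      fix x y assume xy: "x \<in> carrier (\<Psi> X)" "y \<in> carrier (\<Psi> X)" "?g x = ?g y"
      then have "g (a x) = g (a y)" by (simp only: compose_eq)
      then show "x = y" using inj_onD[OF gi] ac a(3) xy by metis
    qed
    moreover have "?g ` carrier (\<Psi> X) = {x \<in> carrier N. ?h x = \<zero>\<^bsub>\<Psi> X'\<^esub>}"
    proof -
      have "?g ` carrier (\<Psi> X) = g ` a ` carrier (\<Psi> X)"
        unfolding image_image by (rule image_cong) (simp_all only: compose_eq)
      also have "a ` carrier (\<Psi> X) = carrier Z"
      proof (intro equalityI subsetI)
        fix x assume "x \<in> carrier Z"
        then show "x \<in> a ` carrier (\<Psi> X)" using a(4) ac' by (metis imageI)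
      qed (use ac in blast)
      also have "g ` carrier Z = {x \<in> carrier N. ?h x = \<zero>\<^bsub>\<Psi> X'\<^esub>}"
        unfolding gk by (rule Collect_cong) (use bz hc in \<open>auto simp: compose_def\<close>)
      finally show ?thesis .
    qed
    moreover have "?h ` carrier N = carrier (\<Psi> X')"
    proof -
      have "?h ` carrier N = b' ` h ` carrier N"
        unfolding image_image by (rule image_cong) (simp_all only: compose_eq)
      also have "\<dots> = carrier (\<Psi> X')"
        unfolding hs
      proof (intro equalityI subsetI)
        fix x assume "x \<in> carrier (\<Psi> X')"
        then show "x \<in> b' ` carrier Y" using b(3) b.closed by (metis imageI)
      next
        fix x assume "x \<in> b' ` carrier Y"
        then show "x \<in> carrier (\<Psi> X')" using b'.closed by blast
      qed
      finally show ?thesis .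
    qed
    moreover have "?g \<in> mod_hom B (\<Psi> X) N" by (rule mod_hom_cmp[OF psi_rmodule[OF PP_obj XO] a(1) gh(1)])
    moreover have "?h \<in> mod_hom B N (\<Psi> X')" by (rule mod_hom_cmp[OF mod_ObjD[OF O(2)] gh(2) b(2)])
    ultimately have s': "ses B (\<Psi> X) ?g N ?h (\<Psi> X')"
      using O(2) psi_mod_obj XO XO' unfolding ses_def by (simp del: mod_add_simps)
    obtain E x y d \<theta> where E: "conflation C X x E y X' d" and \<theta>: "\<theta> \<in> mod_hom B (\<Psi> E) N" "inj_on \<theta> (carrier (\<Psi> E))"
      "\<theta> ` carrier (\<Psi> E) = carrier N"
      by (rule psi_extension[OF X(1) X'(1) s']) (rule that)
    have "isomorphic (mod_add B) (\<Psi> E) N"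
      unfolding isomorphic_def
      using is_iso_modI[OF psi_rmodule[OF PP_obj conflD(3)[OF E]] mod_ObjD[OF O(2)] \<theta>] by blast
    moreover have "E \<in> F {1..t}" by (rule fl_closed[OF X(1) E X'(1)])
    ultimately show ?case using O(2) by blast
  qed
  then show "N \<in> Obj (mod_add B)" "\<exists>X \<in> F {1..t}. isomorphic (mod_add B) (\<Psi> X) N"
    using assms unfolding filt_def by blast+
qed

lemma psi_equivalence:
  "is_equivalence (full_sub C (filt C (\<Theta> ` {1..t})))
    (full_sub (mod_cat B) (filt (mod_cat B) (\<Psi>\<Theta> {1..t}))) \<Psi> (psi_mor C PP)"
proof -
  interpret D: preadditive "mod_cat B :: (('m, 'm) module, ('m, 'm) mod_mor, ('m, 'm) mod_ext, unit) neg_extri"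
    by (rule preadditive_mod_cat[OF ring_B])
  have fF: "filt C (\<Theta> ` {1..t}) = F {1..t}" by (rule filt_F) simp
  have O: "X \<in> Obj C" if "X \<in> F {1..t}" for X using fl_obj[OF that] .
  show ?thesis
    unfolding fF
  proof (rule equivalenceI)
    show "preadditive (full_sub C (F {1..t}))" using O by (intro preadditive_full_sub) blast
    show "preadditive (full_sub (mod_cat B) (filt (mod_cat B) (\<Psi>\<Theta> {1..t})))"
      using filt_mod_image(1) by (intro D.preadditive_full_sub) (auto simp del: mod_add_simps)
    show "is_functor (full_sub C (F {1..t})) (full_sub (mod_cat B) (filt (mod_cat B) (\<Psi>\<Theta> {1..t}))) \<Psi> (psi_mor C PP)"
      unfolding is_functor_def full_sub_simps D.full_sub_simps psi_mor_eq
    proof (intro conjI ballI)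
      fix X assume "X \<in> F {1..t}"
      then show "\<Psi> X \<in> filt (mod_cat B) (\<Psi>\<Theta> {1..t})" by (rule psi_filt) simp
    next
      fix X Y f assume "X \<in> F {1..t}" "Y \<in> F {1..t}" "f \<in> Hom C X Y"
      then show "(\<Psi> X, \<Psi> Y, psi PP X f) \<in> Hom (mod_cat B) (\<Psi> X) (\<Psi> Y)"
        using psi_hom[OF PP_obj, of f X Y] O by simp
    next
      fix X assume "X \<in> F {1..t}"
      then show "(\<Psi> X, \<Psi> X, psi PP X (ident C X)) = ident (mod_cat B) (\<Psi> X)"
        using psi_ident[OF PP_obj O] by simp
    next
      fix X Y Z f g assume "X \<in> F {1..t}" "Y \<in> F {1..t}" "Z \<in> F {1..t}" "f \<in> Hom C X Y" "g \<in> Hom C Y Z"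
      then show "(\<Psi> X, \<Psi> Z, psi PP X (g \<bullet> f)) = (\<Psi> Y, \<Psi> Z, psi PP Y g) \<bullet>\<^bsub>mod_cat B\<^esub> (\<Psi> X, \<Psi> Y, psi PP X f)"
        using psi_cmp[OF PP_obj, of f X Y g] O by simp
    qed
  next
    fix X Y g assume XY: "X \<in> Obj (full_sub C (F {1..t}))" "Y \<in> Obj (full_sub C (F {1..t}))"
      and "g \<in> Hom (full_sub (mod_cat B) (filt (mod_cat B) (\<Psi>\<Theta> {1..t}))) (\<Psi> X) (\<Psi> Y)"
    then obtain \<phi> where \<phi>: "g = (\<Psi> X, \<Psi> Y, \<phi>)" "\<phi> \<in> mod_hom B (\<Psi> X) (\<Psi> Y)" by auto
    have F: "X \<in> F {1..t}" "Y \<in> F {1..t}" using XY by simp_all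
    obtain h where h: "ar h" "src h = X" "tgt h = Y" "\<And>u. \<lbrakk>ar u; src u = PP; tgt u = X\<rbrakk> \<Longrightarrow> \<phi> u = h \<bullet> u"
      using psi_full[OF F \<phi>(2)] by metis
    have "\<phi> = psi PP X h"
      by (rule mod_hom_eqI[OF \<phi>(2) psi_hom[OF PP_obj h(1-3)]]) (use h O[OF F(1)] in simp)
    then show "\<exists>f \<in> Hom (full_sub C (F {1..t})) X Y. psi_mor C PP X Y f = g"
      using \<phi>(1) h(1-3) O F by (intro bexI[of _ h]) (auto simp: psi_mor_eq)
  next
    fix X Y f f' assume XY: "X \<in> Obj (full_sub C (F {1..t}))" "Y \<in> Obj (full_sub C (F {1..t}))"
      and ff: "f \<in> Hom (full_sub C (F {1..t})) X Y" "f' \<in> Hom (full_sub C (F {1..t})) X Y"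
      and eq: "psi_mor C PP X Y f = psi_mor C PP X Y f'"
    have F: "X \<in> F {1..t}" "Y \<in> F {1..t}" using XY by simp_all
    have f: "ar f" "src f = X" "tgt f = Y" "ar f'" "src f' = X" "tgt f' = Y" using ff O[OF F(1)] O[OF F(2)] by simp_all
    have e: "psi PP X f = psi PP X f'" using eq by (simp add: psi_mor_eq)
    show "f = f'"
    proof (rule psi_faithful[OF F f])
      fix u assume u: "ar u" "src u = PP" "tgt u = X"
      show "f \<bullet> u = f' \<bullet> u" using fun_cong[OF e, of u] u O[OF F(1)] by simp
    qed
  next
    fix N assume "N \<in> Obj (full_sub (mod_cat B) (filt (mod_cat B) (\<Psi>\<Theta> {1..t})))"
    then have N: "N \<in> filt (mod_cat B) (\<Psi>\<Theta> {1..t})" by simp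
    obtain X where "X \<in> F {1..t}" "isomorphic (mod_add B) (\<Psi> X) N" using filt_mod_image(2)[OF N] by blast
    then show "\<exists>X \<in> Obj (full_sub C (F {1..t})). isomorphic (full_sub (mod_cat B) (filt (mod_cat B) (\<Psi>\<Theta> {1..t}))) (\<Psi> X) N"
      by (auto simp: isomorphic_def D.is_iso_full_sub mod_cat_transfer(1) simp del: mod_add_simps)
  qed
qed

lemma psi_stratifying:
  "mixed_stratifying_system (mod_cat B) t (\<lambda>i. \<Psi> (\<Theta> i)) (\<lambda>i. \<Psi> (P i))"
proof -
  have \<Theta>F: "\<Theta> i \<in> F {1..t}" if "i \<in> {1..t}" for i using that by (intro fl_member) auto
  have PF: "P i \<in> F {1..t}" if "i \<in> {1..t}" for i by (rule F_mono[OF P_F[OF that]]) (use that in auto)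
  show ?thesis
    unfolding mixed_stratifying_system_def
  proof (intro conjI ballI)
    fix i assume i: "i \<in> {1..t}"
    show "\<Psi> (\<Theta> i) \<in> Obj (mod_cat B)" using psi_mod_obj[OF \<Theta>_obj[OF i]] by (simp del: mod_add_simps)
    show "indecomposable (mod_cat B) (\<Psi> (P i))" by (rule psi_indecomposable[OF PF[OF i] P_loc[OF i]])
    show "brick (mod_cat B) (\<Psi> (\<Theta> i)) \<or> stone (mod_cat B) (\<Psi> (\<Theta> i))"
      using brick_or_stone[OF i]
    proof
      assume "brick C (\<Theta> i)"
      then show ?thesis using psi_brick[OF \<Theta>F[OF i]] by blast
    next
      assume "stone C (\<Theta> i)"
      then have e: "carrier (Ext C (\<Theta> i) (\<Theta> i)) = {\<one>\<^bsub>Ext C (\<Theta> i) (\<Theta> i)\<^esub>}" by (simp add: stone_def)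
      have "isomorphic C (\<Theta> i) (\<Theta> i)"
        unfolding isomorphic_def using is_isoI[of "ident C (\<Theta> i)" "\<Theta> i" "\<Theta> i" "ident C (\<Theta> i)"] \<Theta>_obj[OF i] by auto
      then have r: "isomorphic (mod_add B) (\<Psi> (\<Theta> i)) (\<Psi> (\<Theta> i))"
        by (rule psi_isomorphic[OF _ PP_obj \<Theta>_obj[OF i] \<Theta>_obj[OF i]])
      have "stone (mod_cat B) (\<Psi> (\<Theta> i))"
        unfolding stone_def
        using psi_indecomposable[OF \<Theta>F[OF i] \<Theta>_loc[OF i]]
          psi_yoneda_trivial[OF \<Theta>F[OF i] \<Theta>F[OF i] e r psi_mod_obj[OF \<Theta>_obj[OF i]]] by simp
      then show ?thesis by blast
    qed
  next
    fix i j assume i: "i \<in> {1..t}" and j: "j \<in> {1..t}"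
    show "j < i \<longrightarrow> Hom (mod_cat B) (\<Psi> (\<Theta> i)) (\<Psi> (\<Theta> j)) = {zer (mod_cat B) (\<Psi> (\<Theta> i)) (\<Psi> (\<Theta> j))}"
    proof
      assume ij: "j < i"
      interpret j: rmodule B "\<Psi> (\<Theta> j)" by (rule psi_rmodule[OF PP_obj \<Theta>_obj[OF j]])
      have z: "(\<lambda>x \<in> carrier (\<Psi> (\<Theta> i)). \<zero>\<^bsub>\<Psi> (\<Theta> j)\<^esub>) \<in> mod_hom B (\<Psi> (\<Theta> i)) (\<Psi> (\<Theta> j))"
        by (rule j.mod_hom_zero[OF psi_rmodule[OF PP_obj \<Theta>_obj[OF i]]])
      have *: "\<phi> = (\<lambda>x \<in> carrier (\<Psi> (\<Theta> i)). \<zero>\<^bsub>\<Psi> (\<Theta> j)\<^esub>)" if \<phi>: "\<phi> \<in> mod_hom B (\<Psi> (\<Theta> i)) (\<Psi> (\<Theta> j))" for \<phi>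
      proof (rule mod_hom_eqI[OF \<phi> z])
        fix u assume u: "u \<in> carrier (\<Psi> (\<Theta> i))"
        obtain h where h: "ar h" "src h = \<Theta> i" "tgt h = \<Theta> j" "\<And>u. \<lbrakk>ar u; src u = PP; tgt u = \<Theta> i\<rbrakk> \<Longrightarrow> \<phi> u = h \<bullet> u"
          using psi_full[OF \<Theta>F[OF i] \<Theta>F[OF j] \<phi>] by metis
        have "h = zer C (\<Theta> i) (\<Theta> j)" by (rule \<Theta>_hom_zero[OF i j ij h(1-3)])
        then show "\<phi> u = (\<lambda>x \<in> carrier (\<Psi> (\<Theta> i)). \<zero>\<^bsub>\<Psi> (\<Theta> j)\<^esub>) u"
          using h(4) u \<Theta>_obj[OF i] \<Theta>_obj[OF j] by simp
      qed
      show "Hom (mod_cat B) (\<Psi> (\<Theta> i)) (\<Psi> (\<Theta> j)) = {zer (mod_cat B) (\<Psi> (\<Theta> i)) (\<Psi> (\<Theta> j))}"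
      proof (intro equalityI subsetI)
        fix G assume "G \<in> Hom (mod_cat B) (\<Psi> (\<Theta> i)) (\<Psi> (\<Theta> j))"
        then obtain \<phi> where \<phi>: "G = (\<Psi> (\<Theta> i), \<Psi> (\<Theta> j), \<phi>)" "\<phi> \<in> mod_hom B (\<Psi> (\<Theta> i)) (\<Psi> (\<Theta> j))" by auto
        show "G \<in> {zer (mod_cat B) (\<Psi> (\<Theta> i)) (\<Psi> (\<Theta> j))}" unfolding \<phi>(1) *[OF \<phi>(2)] by simp
      qed (use z in simp)
    qed
  next
    fix i assume i: "i \<in> {1..t}"
    obtain K f g d where K: "K \<in> F {i..t}" "conflation C K f (P i) g (\<Theta> i) d" using P_conflation[OF i] by metis
    have KF: "K \<in> F {1..t}" by (rule F_mono[OF K(1)]) (use i in auto)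
    have "\<Psi> K \<in> filt (mod_cat B) (\<Psi>\<Theta> {i..t})" by (rule psi_filt[OF K(1)]) (use i in auto)
    then show "\<exists>K \<in> filt (mod_cat B) (\<Psi>\<Theta> {i..t}). \<exists>f g \<delta>. conflation (mod_cat B) K f (\<Psi> (P i)) g (\<Psi> (\<Theta> i)) \<delta>"
      using conflation_modI[OF ring_B psi_ses[OF K(2) KF \<Theta>F[OF i]]] by blast
  next
    fix i N assume i: "i \<in> {1..t}" and N: "N \<in> filt (mod_cat B) (\<Psi>\<Theta> {1..t})"
    obtain X where X: "X \<in> F {1..t}" "isomorphic (mod_add B) (\<Psi> X) N" using filt_mod_image(2)[OF N] by blast
    show "carrier (Ext (mod_cat B) (\<Psi> (P i)) N) = {\<one>\<^bsub>Ext (mod_cat B) (\<Psi> (P i)) N\<^esub>}"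
      using psi_yoneda_trivial[OF X(1) PF[OF i] thr_ob_ext[OF X(1) P_thr_ob[OF i]] X(2) filt_mod_image(1)[OF N]] by simp
  qed simp
qed

end

section \<open>The endomorphism algebra is mixed stratified\<close>

context idem_alg
begin

text \<open>Mutually inverse isomorphisms, evaluated at e(i) and e(j), would write e(i) as an
  element of e(i) R e(j) times another element, which \<open>basic\<close> excludes.\<close>

lemma ri_not_isomorphic:
  assumes ij: "i \<in> {1..t}" "j \<in> {1..t}" "i \<noteq> j"
  shows "\<not> isomorphic (mod_add R) (ri i) (ri j)"
proof
  assume iso: "isomorphic (mod_add R) (ri i) (ri j)"
  obtain f g where fg: "f \<in> mod_hom R (ri i) (ri j)" "g \<in> mod_hom R (ri j) (ri i)" "\<And>x. x \<in> carrier (ri i) \<Longrightarrow> g (f x) = x"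
    using isomorphic_modE[OF iso ri_rmodule[OF ij(1)] ri_rmodule[OF ij(2)]] by metis
  note f = mod_homD[OF fg(1)] and g = mod_homD[OF fg(2)]
  note ei = idem_in_ri[OF ij(1)] and ej = idem_in_ri[OF ij(2)]
  have b: "f (e i) \<in> carrier R" "e j \<otimes> f (e i) = f (e i)" using f(1)[OF ei] ri_iff[OF ij(2)] by blast+
  have "g (e j) \<otimes> e j = g (e j)" using g(3)[OF idem_closed[OF ij(2)] ej] idem_mult[OF ij(2,2)] by simp
  moreover have "g (e j) \<otimes> f (e i) = e i" using g(3)[OF b(1) ej] b(2) fg(3)[OF ei] by simp
  ultimately show False using basic[OF ij g(1)[OF ej] _ b(1)] by blast
qed

end

section \<open>The idempotents of B and the indecomposables P(i)\<close>

context mss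
begin

abbreviation e :: "nat \<Rightarrow> 'm" where "e i \<equiv> \<iota> i \<bullet> \<pi> i"

lemma e_arr: "i \<in> {1..t} \<Longrightarrow> ar (e i)" "i \<in> {1..t} \<Longrightarrow> src (e i) = PP" "i \<in> {1..t} \<Longrightarrow> tgt (e i) = PP"
  using \<iota>\<pi> by simp_all

lemma e_pre:
  assumes "i \<in> {1..t}" "ar x" "tgt x = P i"
  shows "\<pi> i \<bullet> (\<iota> i \<bullet> x) = x"
  using pre_simp[OF \<iota>\<pi>(7)[OF assms(1)], of x] \<iota>\<pi>[OF assms(1)] assms by simp

text \<open>All factors \<Theta>(j) have j > i, so a morphism to \<Theta>(i) vanishes on the bottom
  factor and descends to the rest of the filtration.\<close>

lemma hom_F_zero:
  assumes "X \<in> F J" "J \<subseteq> {1..t}" "i \<in> {1..t}" "\<And>j. j \<in> J \<Longrightarrow> i < j" "ar h" "src h = X" "tgt h = \<Theta> i"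
  shows "h = zer C X (\<Theta> i)"
  using assms(1,5-7)
proof (induction arbitrary: h)
  case (fl_zero Z)
  then have Z: "Z \<in> Obj C" by (simp add: is_zero_obj_def)
  show ?case using zero_objD(3)[OF fl_zero(1) \<Theta>_obj[OF assms(3)]] fl_zero Z assms(3) by simp
next
  case (fl_ext T Y f X g d)
  note c = conflD[OF fl_ext(3)]
  obtain j where j: "j \<in> J" "T = \<Theta> j" using fl_ext by blast
  have "h \<bullet> f = zer C T (\<Theta> i)"
    unfolding j(2) by (rule \<Theta>_hom_zero[of j i]) (use j assms c fl_ext in auto)
  then obtain h' where h': "ar h'" "src h' = Y" "tgt h' = \<Theta> i" "h = h' \<bullet> g"
    using weak_cokernel[OF fl_ext(3) fl_ext(5-7)] by metis
  have "h' = zer C Y (\<Theta> i)" by (rule fl_ext(4)[OF h'(1-3)])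
  then show ?case using h' c assms(3) by simp
qed

lemma P_hom_zero:
  assumes "i \<in> {1..t}" "j \<in> {1..t}" "i < j" "ar h" "src h = P j" "tgt h = \<Theta> i"
  shows "h = zer C (P j) (\<Theta> i)"
  by (rule hom_F_zero[OF P_F[OF assms(2)] _ assms(1) _ assms(4-6)]) (use assms in auto)

text \<open>If \<open>g\<close> were zero, the identity of \<Theta>(i) would have zero composite
  with it and hence vanish, since the deflation is epic on these objects; but a local object is
  nonzero.\<close>

lemma P_deflation_nonzero:
  assumes "i \<in> {1..t}" "K \<in> F {1..t}" "conflation C K f (P i) g (\<Theta> i) d"
  shows "g \<noteq> zer C (P i) (\<Theta> i)"
proof
  assume g: "g = zer C (P i) (\<Theta> i)"
  note c = conflD[OF assms(3)]
  have \<Theta>F: "\<Theta> i \<in> F {1..t}" using assms by (intro fl_member) auto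
  have "ident C (\<Theta> i) = zer C (\<Theta> i) (\<Theta> i)"
    by (rule deflation_epic[OF assms(3) next_F[OF assms(2) \<Theta>F]]) (use g c in auto)
  then show False using \<Theta>_loc[OF assms(1)] by (simp add: loc_def)
qed

text \<open>For i < j there is no nonzero morphism from P(j) to \<Theta>(i), whereas the deflation
  from P(i) to \<Theta>(i) is nonzero.\<close>

lemma P_not_isomorphic:
  assumes "i \<in> {1..t}" "j \<in> {1..t}" "i \<noteq> j"
  shows "\<not> isomorphic C (P i) (P j)"
proof -
  have *: False if ij: "i \<in> {1..t}" "j \<in> {1..t}" "i < j" and iso: "isomorphic C (P j) (P i)" for i j
  proof -
    obtain K f g d where K: "K \<in> F {i..t}" "conflation C K f (P i) g (\<Theta> i) d" using P_conflation[OF ij(1)] by metis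
    have KF: "K \<in> F {1..t}" by (rule F_mono[OF K(1)]) (use ij in auto)
    note c = conflD[OF K(2)]
    obtain h where "is_iso C (P j) (P i) h" using iso by (auto simp: isomorphic_def)
    then obtain k where h: "ar h" "src h = P j" "tgt h = P i" "ar k" "src k = P i" "tgt k = P j" "h \<bullet> k = ident C (P i)"
      using is_isoE[OF _ P_obj[OF ij(2)] P_obj[OF ij(1)]] by metis
    have "g \<bullet> h = zer C (P j) (\<Theta> i)" by (rule P_hom_zero[OF ij]) (use h c in auto)
    then have "g \<bullet> (h \<bullet> k) = zer C (P i) (\<Theta> i)" using pre_simp[of g h _ k] h c by simp
    then have "g = zer C (P i) (\<Theta> i)" using h c by simp
    then show False using P_deflation_nonzero[OF ij(1) KF K(2)] by blast
  qed
  show ?thesis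
    using *[of i j] *[of j i] assms isomorphic_sym[OF _ P_obj[OF assms(1)] P_obj[OF assms(2)]] by (metis linorder_neqE_nat)
qed

text \<open>The right ideal shares its operations with the regular module \<Psi> P, so that it can
  be treated as a submodule and inherits finite length.\<close>

lemma right_ideal_eq: "right_ideal B a = (\<Psi> PP)\<lparr>carrier := (\<lambda>b. a \<bullet> b) ` Hom C PP PP\<rparr>"
  by (simp add: right_ideal_def psi_obj_def)

lemma right_ideal_one: "right_ideal B \<one>\<^bsub>B\<^esub> = \<Psi> PP"
proof -
  have "(\<lambda>b. ident C PP \<bullet> b) ` Hom C PP PP = Hom C PP PP"
    by (auto simp: image_iff)
  then show ?thesis unfolding right_ideal_eq by simp
qed

text \<open>With w inverse to \<pi> u \<iota>, the element b = \<iota> w \<pi> does it. Consequently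
  a submodule of e(i) B that contains such a u contains e(i).\<close>

lemma e_iso:
  assumes i: "i \<in> {1..t}" and u: "ar u" "src u = PP" "tgt u = PP" "e i \<bullet> u = u"
    and iso: "is_iso C (P i) (P i) (\<pi> i \<bullet> (u \<bullet> \<iota> i))"
  shows "\<exists>b \<in> Hom C PP PP. u \<bullet> b = e i"
proof -
  note ip = \<iota>\<pi>[OF i]
  obtain w where w: "ar w" "src w = P i" "tgt w = P i" "(\<pi> i \<bullet> (u \<bullet> \<iota> i)) \<bullet> w = ident C (P i)"
    using is_isoE[OF iso P_obj[OF i] P_obj[OF i]] by metis
  have "u \<bullet> (\<iota> i \<bullet> (w \<bullet> \<pi> i)) = e i \<bullet> (u \<bullet> (\<iota> i \<bullet> (w \<bullet> \<pi> i)))"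
    using pre_simp[OF u(4), of "\<iota> i \<bullet> (w \<bullet> \<pi> i)"] u ip w by simp
  also have "\<dots> = \<iota> i \<bullet> (((\<pi> i \<bullet> (u \<bullet> \<iota> i)) \<bullet> w) \<bullet> \<pi> i)" using u(1-3) ip w(1-3) by simp
  also have "\<dots> = e i" unfolding w(4) using ip by simp
  finally show ?thesis using u ip w by (intro bexI[of _ "\<iota> i \<bullet> (w \<bullet> \<pi> i)"]) auto
qed

sublocale idem_alg B t e
proof (intro idem_alg.intro idem_alg_axioms.intro ring_B)
  fix i assume i: "i \<in> {1..t}"
  show ei: "e i \<in> carrier B" using e_arr[OF i] by simp
  fix j assume j: "j \<in> {1..t}"
  have pi: "\<pi> i \<bullet> \<iota> j = (if j = i then ident C (P j) else zer C (P j) (P i))"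
    using ds i j unfolding direct_sum_def by blast
  show "e i \<otimes>\<^bsub>B\<^esub> e j = (if i = j then e i else \<zero>\<^bsub>B\<^esub>)"
    using pre_simp[OF pi, of "\<pi> j"] \<iota>\<pi>[OF i] \<iota>\<pi>[OF j] P_obj[OF i] P_obj[OF j] by simp
next
  have "add_monoid B = hom_group C PP PP" by (simp add: End_ring_def hom_group_def)
  then have "finsum B e {1..t} = finprod (hom_group C PP PP) e {1..t}" by (simp only: finsum_def)
  also have "\<dots> = ident C PP" using ds unfolding direct_sum_def by blast
  finally show "finsum B e {1..t} = \<one>\<^bsub>B\<^esub>" by simp
next
  fix i U V u v assume i: "i \<in> {1..t}" and U: "submodule U B (right_ideal B (e i))" and V: "submodule V B (right_ideal B (e i))"
    and u: "u \<in> U" and v: "v \<in> V" and uv: "u \<oplus>\<^bsub>B\<^esub> v = e i"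
  note ip = \<iota>\<pi>[OF i]
  have mem: "ar x \<and> src x = PP \<and> tgt x = PP \<and> e i \<bullet> x = x" if "x \<in> carrier (right_ideal B (e i))" for x
    using that ip pre_simp[OF ip(7)] by (auto simp: right_ideal_simps)
  have u': "ar u" "src u = PP" "tgt u = PP" "e i \<bullet> u = u" and v': "ar v" "src v = PP" "tgt v = PP" "e i \<bullet> v = v"
    using mem submoduleD(1)[OF U] submoduleD(1)[OF V] u v by blast+
  \<comment> \<open>Locality of P(i) is applied in the corner e(i) B e(i), identified with the
    endomorphism ring of P(i).\<close>
  have "(\<pi> i \<bullet> (u \<bullet> \<iota> i)) \<boxplus> (\<pi> i \<bullet> (v \<bullet> \<iota> i)) = \<pi> i \<bullet> ((u \<boxplus> v) \<bullet> \<iota> i)"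
    using u' v' ip by simp
  also have "\<dots> = ident C (P i)" using uv ip by simp
  finally have "is_iso C (P i) (P i) (\<pi> i \<bullet> (u \<bullet> \<iota> i)) \<or> is_iso C (P i) (P i) (\<pi> i \<bullet> (v \<bullet> \<iota> i))"
    using u' v' ip by (intro locD[OF P_loc[OF i]]) auto
  then show "e i \<in> U \<or> e i \<in> V"
  proof
    assume "is_iso C (P i) (P i) (\<pi> i \<bullet> (u \<bullet> \<iota> i))"
    then obtain b where b: "b \<in> carrier B" "u \<bullet> b = e i" using e_iso[OF i u'] by auto
    show ?thesis using submoduleD(4)[OF U b(1) u] b(2) by (simp add: right_ideal_simps)
  next
    assume "is_iso C (P i) (P i) (\<pi> i \<bullet> (v \<bullet> \<iota> i))"
    then obtain b where b: "b \<in> carrier B" "v \<bullet> b = e i" using e_iso[OF i v'] by auto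
    show ?thesis using submoduleD(4)[OF V b(1) v] b(2) by (simp add: right_ideal_simps)
  qed
next
  fix i j x b assume i: "i \<in> {1..t}" and j: "j \<in> {1..t}" and ij: "i \<noteq> j" and x: "x \<in> carrier (right_ideal B (e i))"
    and xj: "x \<otimes>\<^bsub>B\<^esub> e j = x" and b: "b \<in> carrier B"
  show "x \<otimes>\<^bsub>B\<^esub> b \<noteq> e i"
  proof
    assume xb: "x \<otimes>\<^bsub>B\<^esub> b = e i"
    note ip = \<iota>\<pi>[OF i] and jp = \<iota>\<pi>[OF j]
    have x': "ar x" "src x = PP" "tgt x = PP" and b': "ar b" "src b = PP" "tgt b = PP" using x b ip by (auto simp: right_ideal_simps)
    \<comment> \<open>The equation x b = e(i) becomes a factorization of the identity of P(i)
      through P(j). The idempotent \<alpha> \<beta> of the local object P(j) is 1 or 0, so either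
      P(i) and P(j) are isomorphic or the identity of P(i) is zero.\<close>
    define \<alpha> \<beta> where "\<alpha> = \<pi> j \<bullet> (b \<bullet> \<iota> i)" and "\<beta> = \<pi> i \<bullet> (x \<bullet> \<iota> j)"
    have \<alpha>: "ar \<alpha>" "src \<alpha> = P i" "tgt \<alpha> = P j" and \<beta>: "ar \<beta>" "src \<beta> = P j" "tgt \<beta> = P i"
      unfolding \<alpha>_def \<beta>_def using x' b' ip jp by auto
    have "\<beta> \<bullet> \<alpha> = \<pi> i \<bullet> ((x \<bullet> e j) \<bullet> (b \<bullet> \<iota> i))" unfolding \<alpha>_def \<beta>_def using x' b' ip(1-6) jp(1-6) by simp
    also have "\<dots> = \<pi> i \<bullet> ((x \<bullet> b) \<bullet> \<iota> i)" using xj x' b' ip jp by simp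
    also have "\<dots> = ident C (P i)" using xb ip by simp
    finally have \<beta>\<alpha>: "\<beta> \<bullet> \<alpha> = ident C (P i)" .
    have "(\<alpha> \<bullet> \<beta>) \<bullet> (\<alpha> \<bullet> \<beta>) = \<alpha> \<bullet> \<beta>" using \<alpha> \<beta> pre_simp[OF \<beta>\<alpha>, of \<beta>] by simp
    then have "\<alpha> \<bullet> \<beta> = ident C (P j) \<or> \<alpha> \<bullet> \<beta> = zer C (P j) (P j)"
      using \<alpha> \<beta> P_obj[OF j] by (intro loc_idempotent[OF P_loc[OF j]]) auto
    then show False
    proof
      assume "\<alpha> \<bullet> \<beta> = ident C (P j)"
      then have "is_iso C (P i) (P j) \<alpha>" using \<alpha> \<beta> \<beta>\<alpha> P_obj[OF i] P_obj[OF j] by (intro is_isoI[of \<alpha> _ _ \<beta>]) auto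
      then show False using P_not_isomorphic[OF i j ij] unfolding isomorphic_def by blast
    next
      assume z: "\<alpha> \<bullet> \<beta> = zer C (P j) (P j)"
      have "\<beta> \<bullet> ((\<alpha> \<bullet> \<beta>) \<bullet> \<alpha>) = ident C (P i)" using \<alpha> \<beta> \<beta>\<alpha> pre_simp[OF \<beta>\<alpha>, of "\<beta> \<bullet> \<alpha>"] P_obj[OF i] by simp
      then have "ident C (P i) = zer C (P i) (P i)" unfolding z using \<alpha> \<beta> P_obj[OF i] P_obj[OF j] by simp
      then show False using P_loc[OF i] by (simp add: loc_def)
    qed
  qed
next
  fix i assume i: "i \<in> {1..t}"
  interpret Q: rmodule B "\<Psi> PP" by (rule psi_rmodule[OF PP_obj PP_obj])
  interpret f: rmod_hom B "\<Psi> PP" "\<Psi> PP" "psi PP PP (e i)"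
    by (intro rmod_hom.intro rmod_hom_axioms.intro Q.rmodule_axioms psi_hom PP_obj e_arr[OF i])
  have "psi PP PP (e i) ` carrier (\<Psi> PP) = (\<lambda>b. e i \<bullet> b) ` Hom C PP PP"
    by (rule image_cong) simp_all
  then have "submodule ((\<lambda>b. e i \<bullet> b) ` Hom C PP PP) B (\<Psi> PP)"
    using f.image_submodule[OF Q.whole_submodule] by simp
  then show "rmodule.fin_len B (right_ideal B (e i))"
    unfolding right_ideal_eq by (rule Q.fin_len_sub[OF psi_fin_len[OF PP_obj]])
qed

lemma ri_mem_iff:
  assumes "i \<in> {1..t}"
  shows "x \<in> carrier (ri i) \<longleftrightarrow> ar x \<and> src x = PP \<and> tgt x = PP \<and> e i \<bullet> x = x"
  unfolding ri_iff[OF assms] by simp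

text \<open>\<Psi> X is generated by its parts at e(j) with j at least \<open>j0\<close>. Testing
  against submodules lets the property pass along conflations by taking images and
  preimages.\<close>

definition psi_generated :: "nat \<Rightarrow> 'o \<Rightarrow> bool" where
  "psi_generated j0 X \<longleftrightarrow> (\<forall>V. submodule V B (\<Psi> X) \<longrightarrow>
     (\<forall>u \<in> carrier (\<Psi> X). \<forall>j \<in> {j0..t}. u \<bullet> e j = u \<longrightarrow> u \<in> V) \<longrightarrow> V = carrier (\<Psi> X))"

lemma psi_generatedD:
  "\<lbrakk>psi_generated j0 X; submodule V B (\<Psi> X);
    \<And>u j. \<lbrakk>u \<in> carrier (\<Psi> X); j \<in> {j0..t}; u \<bullet> e j = u\<rbrakk> \<Longrightarrow> u \<in> V\<rbrakk> \<Longrightarrow> V = carrier (\<Psi> X)"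
  unfolding psi_generated_def by blast

text \<open>\<Psi> \<Theta>(k) is the image of \<Psi> P(k), hence generated by the single element g
  \<pi>(k), which sits at e(k).\<close>

lemma psi_generated_\<Theta>:
  assumes "k \<in> {1..t}" "j0 \<le> k"
  shows "psi_generated j0 (\<Theta> k)"
  unfolding psi_generated_def
proof (intro allI impI)
  fix V assume V: "submodule V B (\<Psi> (\<Theta> k))"
    and gen: "\<forall>u \<in> carrier (\<Psi> (\<Theta> k)). \<forall>j \<in> {j0..t}. u \<bullet> e j = u \<longrightarrow> u \<in> V"
  obtain K f g d where K: "K \<in> F {k..t}" "conflation C K f (P k) g (\<Theta> k) d" using P_conflation[OF assms(1)] by metis
  have KF: "K \<in> F {1..t}" by (rule F_mono[OF K(1)]) (use assms in auto)
  have \<Theta>F: "\<Theta> k \<in> F {1..t}" using assms by (intro fl_member) auto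
  note c = conflD[OF K(2)] and ip = \<iota>\<pi>[OF assms(1)]
  have "(g \<bullet> \<pi> k) \<bullet> e k = g \<bullet> \<pi> k" using c ip e_pre[OF assms(1), of "\<pi> k"] by simp
  moreover have "g \<bullet> \<pi> k \<in> carrier (\<Psi> (\<Theta> k))" using c ip by simp
  moreover have "k \<in> {j0..t}" using assms by simp
  ultimately have m: "g \<bullet> \<pi> k \<in> V" using gen by blast
  have "carrier (\<Psi> (\<Theta> k)) \<subseteq> V"
  proof
    fix w assume "w \<in> carrier (\<Psi> (\<Theta> k))"
    then have w: "ar w" "src w = PP" "tgt w = \<Theta> k" using c by auto
    obtain v where v: "ar v" "src v = PP" "tgt v = P k" "g \<bullet> v = w" using psi_exact(3)[OF K(2) KF \<Theta>F w] by blast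
    have "w = (g \<bullet> \<pi> k) \<bullet> (\<iota> k \<bullet> v)" using v c ip e_pre[OF assms(1) v(1,3)] by simp
    moreover have "\<iota> k \<bullet> v \<in> carrier B" using v ip by simp
    ultimately show "w \<in> V" using submoduleD(4)[OF V _ m, of "\<iota> k \<bullet> v"] by simp
  qed
  then show "V = carrier (\<Psi> (\<Theta> k))" using submoduleD(1)[OF V] by blast
qed

text \<open>If V contains all the relevant parts of \<Psi> M, then its image is all of \<Psi> Y and
  its preimage is all of \<Psi> A, by the two generation hypotheses; exactness then gives V = \<Psi>
  M.\<close>

lemma psi_generated_ext:
  assumes c: "conflation C A f M g Y d" and FA: "A \<in> F {1..t}" "Y \<in> F {1..t}"
    and gen: "psi_generated j0 A" "psi_generated j0 Y" and j0: "1 \<le> j0"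
  shows "psi_generated j0 M"
  unfolding psi_generated_def
proof (intro allI impI)
  fix V assume V: "submodule V B (\<Psi> M)"
    and gV: "\<forall>u \<in> carrier (\<Psi> M). \<forall>j \<in> {j0..t}. u \<bullet> e j = u \<longrightarrow> u \<in> V"
  note cD = conflD[OF c] and ex = psi_exact[OF c FA]
  interpret f: rmod_hom B "\<Psi> A" "\<Psi> M" "psi PP A f"
    by (intro rmod_hom.intro rmod_hom_axioms.intro psi_rmodule PP_obj cD psi_hom)
  interpret g: rmod_hom B "\<Psi> M" "\<Psi> Y" "psi PP M g"
    by (intro rmod_hom.intro rmod_hom_axioms.intro psi_rmodule PP_obj cD psi_hom)
  have gV': "psi PP M g ` V = carrier (\<Psi> Y)"
  proof (rule psi_generatedD[OF gen(2) g.image_submodule[OF V]])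
    fix u j assume "u \<in> carrier (\<Psi> Y)" and j: "j \<in> {j0..t}" and uj: "u \<bullet> e j = u"
    then have u: "ar u" "src u = PP" "tgt u = Y" using cD by auto
    have j': "j \<in> {1..t}" using j j0 by auto
    note ej = e_arr[OF j']
    obtain v where v: "ar v" "src v = PP" "tgt v = M" "g \<bullet> v = u" using ex(3)[OF u] by blast
    \<comment> \<open>Multiplying a lift of \<open>u\<close> by e(j) keeps it a lift, because u e(j)
      = u, and turns it into a part at e(j).\<close>
    have vc: "v \<bullet> e j \<in> carrier (\<Psi> M)" using v ej cD by simp
    have "(v \<bullet> e j) \<bullet> e j = v \<bullet> (e j \<bullet> e j)" by (rule assoc) (use v ej in simp_all)
    then have "(v \<bullet> e j) \<bullet> e j = v \<bullet> e j" using idem_mult[OF j' j'] by simp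
    then have "v \<bullet> e j \<in> V" using gV vc j by blast
    moreover have "psi PP M g (v \<bullet> e j) = u"
    proof -
      have "psi PP M g (v \<bullet> e j) = g \<bullet> (v \<bullet> e j)" using v ej cD by simp
      also have "\<dots> = u \<bullet> e j" by (rule pre_simp[OF v(4)]) (use v ej cD in simp_all)
      finally show ?thesis using uj by simp
    qed
    ultimately show "u \<in> psi PP M g ` V" by (metis imageI)
  qed
  have fV: "{u \<in> carrier (\<Psi> A). psi PP A f u \<in> V} = carrier (\<Psi> A)"
  proof (rule psi_generatedD[OF gen(1) f.vimage_submodule[OF V]])
    fix u j assume u: "u \<in> carrier (\<Psi> A)" and j: "j \<in> {j0..t}" and uj: "u \<bullet> e j = u"
    have u': "ar u" "src u = PP" "tgt u = A" using u cD by auto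
    have j': "j \<in> {1..t}" using j j0 by auto
    have "(f \<bullet> u) \<bullet> e j = f \<bullet> (u \<bullet> e j)" by (rule assoc) (use u' e_arr[OF j'] cD in simp_all)
    then have "(f \<bullet> u) \<bullet> e j = f \<bullet> u" using uj by simp
    moreover have "f \<bullet> u \<in> carrier (\<Psi> M)" using u' cD by simp
    ultimately have "f \<bullet> u \<in> V" using gV j by blast
    then show "u \<in> {u \<in> carrier (\<Psi> A). psi PP A f u \<in> V}" using u u' cD by simp
  qed
  have "carrier (\<Psi> M) \<subseteq> V"
  proof
    fix x assume x: "x \<in> carrier (\<Psi> M)"
    then have x': "ar x" "src x = PP" "tgt x = M" using cD by auto
    have "psi PP M g x \<in> psi PP M g ` V" unfolding gV' by (rule g.closed[OF x])
    then obtain v where v: "v \<in> V" "psi PP M g x = psi PP M g v" by blast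
    have vM: "v \<in> carrier (\<Psi> M)" using v submoduleD(1)[OF V] by blast
    then have v': "ar v" "src v = PP" "tgt v = M" using cD by auto
    have "g \<bullet> x = g \<bullet> v" using v(2) x' v' cD by simp
    then have "g \<bullet> (x \<boxplus> mn v) = zer C PP Y" using x' v' cD by simp
    then obtain u where u: "ar u" "src u = PP" "tgt u = A" "x \<boxplus> mn v = f \<bullet> u"
      using ex(2)[of "x \<boxplus> mn v"] x' v' by auto
    have "u \<in> carrier (\<Psi> A)" using u cD by simp
    then have "u \<in> {u \<in> carrier (\<Psi> A). psi PP A f u \<in> V}" unfolding fV .
    then have "f \<bullet> u \<in> V" using u cD by simp
    then have "(f \<bullet> u) \<boxplus> v \<in> V" using submoduleD(3)[OF V _ v(1)] by simp
    moreover have "(f \<bullet> u) \<boxplus> v = x" unfolding u(4)[symmetric] using x' v' by (simp add: pls_assoc)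
    ultimately show "x \<in> V" by simp
  qed
  then show "V = carrier (\<Psi> M)" using submoduleD(1)[OF V] by blast
qed

lemma psi_generated_zero:
  assumes "is_zero_obj C Z"
  shows "psi_generated j0 Z"
  unfolding psi_generated_def
proof (intro allI impI)
  fix V assume V: "submodule V B (\<Psi> Z)"
  have Z: "Z \<in> Obj C" using assms by (simp add: is_zero_obj_def)
  have "carrier (\<Psi> Z) \<subseteq> {zer C PP Z}" using zero_objD(2)[OF assms PP_obj] by auto
  then show "V = carrier (\<Psi> Z)" using submoduleD(1,2)[OF V] by auto
qed

lemma psi_generated_F:
  assumes "X \<in> F {i..t}" "i \<in> {1..t}"
  shows "psi_generated i X"
  using assms(1)
proof induction
  case (fl_zero Z)
  then show ?case by (rule psi_generated_zero)
next
  case (fl_ext T Y f X g d)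
  obtain k where k: "k \<in> {i..t}" "T = \<Theta> k" using fl_ext by blast
  have k': "k \<in> {1..t}" using k assms(2) by auto
  show ?case
  proof (rule psi_generated_ext[OF fl_ext(3)])
    show "T \<in> F {1..t}" using k k' by (intro fl_member) auto
    show "Y \<in> F {1..t}" by (rule F_mono[OF fl_ext(2)]) (use assms(2) in auto)
    show "psi_generated i T" unfolding k(2) by (rule psi_generated_\<Theta>[OF k']) (use k in simp)
  qed (use fl_ext(4) assms(2) in auto)
qed

section \<open>Standard and proper standard modules at a fixed index\<close>

context
  fixes i K f g d
  assumes i: "i \<in> {1..t}" and K: "K \<in> F {i..t}" and conf: "conflation C K f (P i) g (\<Theta> i) d"
begin

lemma K_F: "K \<in> F {1..t}"
  by (rule F_mono[OF K]) (use i in auto)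

lemma \<Theta>i_F: "\<Theta> i \<in> F {1..t}"
  using i by (intro fl_member) auto

text \<open>The module e(i) B is \<Psi> P(i) by means of \<iota>(i) and \<pi>(i); under this
  identification the map is \<Psi>(g).\<close>

definition top_map :: "'m \<Rightarrow> 'm" where
  "top_map = (\<lambda>x \<in> carrier (ri i). g \<bullet> (\<pi> i \<bullet> x))"

lemma top_map_factor: "factor_map B (ri i) (\<Psi> (\<Theta> i)) top_map"
  unfolding factor_map_def
proof (intro conjI)
  note c = conflD[OF conf] and ip = \<iota>\<pi>[OF i] and mem = ri_mem_iff[OF i]
  show "ri i \<in> Obj (mod_add B)" by (rule ri_obj[OF i])
  show "\<Psi> (\<Theta> i) \<in> Obj (mod_add B)" by (rule psi_mod_obj[OF \<Theta>_obj[OF i]])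
  show "top_map \<in> mod_hom B (ri i) (\<Psi> (\<Theta> i))"
    unfolding top_map_def
    by (rule mod_hom_restrictI[OF ri_rmodule[OF i]]) (use c ip mem in auto)
  show "top_map ` carrier (ri i) = carrier (\<Psi> (\<Theta> i))"
  proof (intro equalityI subsetI)
    fix w assume "w \<in> carrier (\<Psi> (\<Theta> i))"
    then have w: "ar w" "src w = PP" "tgt w = \<Theta> i" using c by auto
    obtain v where v: "ar v" "src v = PP" "tgt v = P i" "g \<bullet> v = w" using psi_exact(3)[OF conf K_F \<Theta>i_F w] by blast
    have m: "\<iota> i \<bullet> v \<in> carrier (ri i)" unfolding mem using v ip e_pre[OF i v(1,3)] by simp
    have tv: "top_map (\<iota> i \<bullet> v) = w" unfolding top_map_def using m e_pre[OF i v(1,3)] v(4) by simp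
    show "w \<in> top_map ` carrier (ri i)" unfolding tv[symmetric] by (rule imageI[OF m])
  next
    fix w assume "w \<in> top_map ` carrier (ri i)"
    then obtain x where x: "x \<in> carrier (ri i)" "w = top_map x" by (elim imageE) (rule that)
    then have "ar x" "src x = PP" "tgt x = PP" unfolding mem by blast+
    then show "w \<in> carrier (\<Psi> (\<Theta> i))" unfolding x(2) top_map_def using x(1) c ip by simp
  qed
qed

text \<open>By exactness the kernel is the image of \<Psi> K under composition with \<iota>(i) f,
  and generation by parts passes to images.\<close>

lemma top_map_kernel:
  assumes gen: "psi_generated j0 K" and j0: "1 \<le> j0"
  shows "generated_from i j0 {x \<in> carrier (ri i). top_map x = \<zero>\<^bsub>\<Psi> (\<Theta> i)\<^esub>}"
  unfolding generated_from_def
proof (intro allI impI)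
  note c = conflD[OF conf] and ip = \<iota>\<pi>[OF i] and mem = ri_mem_iff[OF i]
  fix U assume U: "submodule U B (ri i)"
    and gU: "\<forall>x \<in> {x \<in> carrier (ri i). top_map x = \<zero>\<^bsub>\<Psi> (\<Theta> i)\<^esub>}. \<forall>j \<in> {j0..t}. x \<otimes>\<^bsub>B\<^esub> e j = x \<longrightarrow> x \<in> U"
  let ?h = "\<lambda>u \<in> carrier (\<Psi> K). \<iota> i \<bullet> (f \<bullet> u)"
  have fu: "ar (f \<bullet> u)" "tgt (f \<bullet> u) = P i" if "u \<in> carrier (\<Psi> K)" for u using that c by auto
  have "?h \<in> mod_hom B (\<Psi> K) (ri i)"
    by (rule mod_hom_restrictI[OF psi_rmodule[OF PP_obj c(1)]]) (use c ip e_pre[OF i] in \<open>auto simp: mem\<close>)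
  then interpret h: rmod_hom B "\<Psi> K" "ri i" ?h
    by (intro rmod_hom.intro rmod_hom_axioms.intro psi_rmodule PP_obj c ri_rmodule[OF i])
  have top: "?h u \<in> {x \<in> carrier (ri i). top_map x = \<zero>\<^bsub>\<Psi> (\<Theta> i)\<^esub>}" if u: "u \<in> carrier (\<Psi> K)" for u
  proof -
    have u': "ar u" "src u = PP" "tgt u = K" using u c by auto
    have "g \<bullet> (f \<bullet> u) = zer C PP (\<Theta> i)" using pre_simp[OF c(11), of u] u' c by simp
    then have "top_map (?h u) = \<zero>\<^bsub>\<Psi> (\<Theta> i)\<^esub>"
      unfolding top_map_def using h.closed[OF u] u e_pre[OF i fu[OF u]] by simp
    then show ?thesis using h.closed[OF u] by blast
  qed
  have V: "{u \<in> carrier (\<Psi> K). ?h u \<in> U} = carrier (\<Psi> K)"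
  proof (rule psi_generatedD[OF gen h.vimage_submodule[OF U]])
    fix u j assume u: "u \<in> carrier (\<Psi> K)" and j: "j \<in> {j0..t}" and uj: "u \<bullet> e j = u"
    have j': "j \<in> {1..t}" using j j0 by auto
    have "e j \<odot>\<^bsub>ri i\<^esub> ?h u = ?h u" using h.lin[OF idem_closed[OF j'] u] uj by simp
    then have "?h u \<otimes>\<^bsub>B\<^esub> e j = ?h u" by simp
    then have "?h u \<in> U" using gU top[OF u] j by blast
    then show "u \<in> {u \<in> carrier (\<Psi> K). ?h u \<in> U}" using u by blast
  qed
  show "{x \<in> carrier (ri i). top_map x = \<zero>\<^bsub>\<Psi> (\<Theta> i)\<^esub>} \<subseteq> U"
  proof
    fix x assume x: "x \<in> {x \<in> carrier (ri i). top_map x = \<zero>\<^bsub>\<Psi> (\<Theta> i)\<^esub>}"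
    then have x': "ar x" "src x = PP" "tgt x = PP" "e i \<bullet> x = x" and gx: "g \<bullet> (\<pi> i \<bullet> x) = zer C PP (\<Theta> i)"
      using mem by (auto simp: top_map_def)
    obtain u where u: "ar u" "src u = PP" "tgt u = K" "\<pi> i \<bullet> x = f \<bullet> u"
      using psi_exact(2)[OF conf K_F \<Theta>i_F _ _ _ gx] x' ip by auto
    have uK: "u \<in> carrier (\<Psi> K)" using u c by simp
    have "x = \<iota> i \<bullet> (\<pi> i \<bullet> x)" using x' ip by simp
    then have "x = ?h u" using u(4) uK by simp
    moreover have "?h u \<in> U" using V uK by blast
    ultimately show "x \<in> U" by simp
  qed
qed

text \<open>A part at e(j) factors through a morphism from P(j) to \<Theta>(i), which is zero for j
  > i.\<close>

lemma \<Psi>\<Theta>_killed: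
  assumes "j \<in> {Suc i..t}"
  shows "killed j (\<Psi> (\<Theta> i))"
  unfolding killed_def
proof
  have j: "j \<in> {1..t}" using assms i by auto
  note jp = \<iota>\<pi>[OF j]
  fix h assume "h \<in> carrier (\<Psi> (\<Theta> i))"
  then have h: "ar h" "src h = PP" "tgt h = \<Theta> i" using \<Theta>_obj[OF i] by auto
  have "h \<bullet> \<iota> j = zer C (P j) (\<Theta> i)" by (rule P_hom_zero[OF i j]) (use assms h jp in auto)
  then show "e j \<odot>\<^bsub>\<Psi> (\<Theta> i)\<^esub> h = \<zero>\<^bsub>\<Psi> (\<Theta> i)\<^esub>"
    using pre_simp[of h "\<iota> j" _ "\<pi> j"] h jp \<Theta>_obj[OF i] by simp
qed

lemma g\<pi>_nonzero: "g \<bullet> \<pi> i \<noteq> zer C PP (\<Theta> i)"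
proof
  note c = conflD[OF conf] and ip = \<iota>\<pi>[OF i]
  assume "g \<bullet> \<pi> i = zer C PP (\<Theta> i)"
  then have "g \<bullet> (\<pi> i \<bullet> \<iota> i) = zer C (P i) (\<Theta> i)" using pre_simp[of g "\<pi> i" _ "\<iota> i"] c ip by simp
  then have "g = zer C (P i) (\<Theta> i)" using c ip by simp
  then show False using P_deflation_nonzero[OF i K_F conf] by blast
qed

lemma \<Psi>\<Theta>_nonzero: "carrier (\<Psi> (\<Theta> i)) \<noteq> {\<zero>\<^bsub>\<Psi> (\<Theta> i)\<^esub>}"
proof -
  note c = conflD[OF conf] and ip = \<iota>\<pi>[OF i]
  have "g \<bullet> \<pi> i \<in> carrier (\<Psi> (\<Theta> i))" using c ip by simp
  then show ?thesis using g\<pi>_nonzero by auto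
qed

lemma brick_proper_standard:
  assumes br: "brick C (\<Theta> i)"
  shows "proper_standard_module B e i (\<Psi> (\<Theta> i))"
proof (rule proper_standard_moduleI[OF i top_map_factor \<Psi>\<Theta>_killed \<Psi>\<Theta>_nonzero top_map_kernel])
  show "psi_generated i K" by (rule psi_generated_F[OF K i])
  \<comment> \<open>Induction on the filtration of X. If \<open>h\<close> vanishes on the bottom
    factor \<Theta>(k), it descends to the quotient. Otherwise the restriction to \<Theta>(k) is
    nonzero, which forces k = i, and it is invertible because \<Theta>(i) is a brick.\<close>
  have surj: "\<exists>v. ar v \<and> src v = PP \<and> tgt v = X \<and> h \<bullet> v = w"
    if X: "X \<in> F {i..t}" and h: "ar h" "src h = X" "tgt h = \<Theta> i" "h \<noteq> zer C X (\<Theta> i)"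
      and w: "ar w" "src w = PP" "tgt w = \<Theta> i" for X h w
    using X h
  proof (induction arbitrary: h)
    case (fl_zero Z)
    then show ?case using zero_objD(3)[OF fl_zero(1) \<Theta>_obj[OF i], of h] zero_objD(1)[OF fl_zero(1) PP_obj] \<Theta>_obj[OF i] by simp
  next
    case (fl_ext T Y f X g d)
    note c = conflD[OF fl_ext(3)]
    obtain k where k: "k \<in> {i..t}" "T = \<Theta> k" using fl_ext by blast
    have k': "k \<in> {1..t}" using k i by auto
    have TF: "T \<in> F {1..t}" using k k' by (intro fl_member) auto
    have YF: "Y \<in> F {1..t}" by (rule F_mono[OF fl_ext(2)]) (use i in auto)
    show ?case
    proof (cases "h \<bullet> f = zer C T (\<Theta> i)")
      case True
      then obtain h' where h': "ar h'" "src h' = Y" "tgt h' = \<Theta> i" "h = h' \<bullet> g"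
        using weak_cokernel[OF fl_ext(3) fl_ext(5-7)] by metis
      have "h' \<noteq> zer C Y (\<Theta> i)"
      proof
        assume "h' = zer C Y (\<Theta> i)"
        then have "h = zer C Y (\<Theta> i) \<bullet> g" by (simp only: h'(4))
        also have "\<dots> = zer C X (\<Theta> i)" using c \<Theta>_obj[OF i] by simp
        finally show False using fl_ext(8) by contradiction
      qed
      then obtain v where v: "ar v" "src v = PP" "tgt v = Y" "h' \<bullet> v = w" using fl_ext(4)[OF h'(1-3)] by blast
      obtain v' where v': "ar v'" "src v' = PP" "tgt v' = X" "g \<bullet> v' = v"
        using psi_exact(3)[OF fl_ext(3) TF YF v(1-3)] by blast
      have "h \<bullet> v' = w" using h' v' v c by simp
      then show ?thesis using v' by blast
    next
      case False
      have hf: "ar (h \<bullet> f)" "src (h \<bullet> f) = \<Theta> k" "tgt (h \<bullet> f) = \<Theta> i" using fl_ext(5-7) c k by auto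
      have "k = i"
      proof (rule ccontr)
        assume "k \<noteq> i"
        then have "h \<bullet> f = zer C (\<Theta> k) (\<Theta> i)" using k by (intro \<Theta>_hom_zero[OF k' i _ hf]) auto
        then show False using False k by simp
      qed
      then have T: "T = \<Theta> i" using k by simp
      have "is_iso C (\<Theta> i) (\<Theta> i) (h \<bullet> f)"
        using br hf False T \<open>k = i\<close> \<Theta>_obj[OF i] unfolding brick_def division_ring_def by (simp flip: Units_End)
      then obtain q where q: "ar q" "src q = \<Theta> i" "tgt q = \<Theta> i" "(h \<bullet> f) \<bullet> q = ident C (\<Theta> i)"
        using is_isoE[OF _ \<Theta>_obj[OF i] \<Theta>_obj[OF i]] by metis
      have "h \<bullet> (f \<bullet> (q \<bullet> w)) = ((h \<bullet> f) \<bullet> q) \<bullet> w" using q(1-3) w c T fl_ext(5-7) by simp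
      also have "\<dots> = w" using q w by simp
      finally show ?thesis using q w c T by (intro exI[of _ "f \<bullet> (q \<bullet> w)"]) auto
    qed
  qed
  fix h U assume h: "h \<in> carrier (\<Psi> (\<Theta> i))" "h \<noteq> \<zero>\<^bsub>\<Psi> (\<Theta> i)\<^esub>" "e i \<odot>\<^bsub>\<Psi> (\<Theta> i)\<^esub> h = h"
    and U: "submodule U B (\<Psi> (\<Theta> i))" and hU: "h \<in> U"
  note ip = \<iota>\<pi>[OF i]
  have h': "ar h" "src h = PP" "tgt h = \<Theta> i" "h \<bullet> (\<iota> i \<bullet> \<pi> i) = h" using h \<Theta>_obj[OF i] by auto
  have hi: "ar (h \<bullet> \<iota> i)" "src (h \<bullet> \<iota> i) = P i" "tgt (h \<bullet> \<iota> i) = \<Theta> i" using h' ip by auto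
  \<comment> \<open>A nonzero element at e(i) is a nonzero morphism from P(i) to \<Theta>(i); being
    surjective on elements, it makes \<open>h\<close> a generator of \<Psi> \<Theta>(i).\<close>
  have nz: "h \<bullet> \<iota> i \<noteq> zer C (P i) (\<Theta> i)"
  proof
    assume "h \<bullet> \<iota> i = zer C (P i) (\<Theta> i)"
    then have "h \<bullet> (\<iota> i \<bullet> \<pi> i) = zer C PP (\<Theta> i)" using pre_simp[of h "\<iota> i" _ "\<pi> i"] h' ip \<Theta>_obj[OF i] by simp
    then show False using h' h(2) by simp
  qed
  have "carrier (\<Psi> (\<Theta> i)) \<subseteq> U"
  proof
    fix w assume "w \<in> carrier (\<Psi> (\<Theta> i))"
    then have w: "ar w" "src w = PP" "tgt w = \<Theta> i" using \<Theta>_obj[OF i] by auto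
    obtain v where v: "ar v" "src v = PP" "tgt v = P i" "(h \<bullet> \<iota> i) \<bullet> v = w"
      using surj[OF P_F[OF i] hi nz w] by blast
    have "w = h \<bullet> (\<iota> i \<bullet> v)" using v h' ip by simp
    moreover have "\<iota> i \<bullet> v \<in> carrier B" using v ip by simp
    ultimately show "w \<in> U" using submoduleD(4)[OF U _ hU, of "\<iota> i \<bullet> v"] by simp
  qed
  then show "U = carrier (\<Psi> (\<Theta> i))" using submoduleD(1)[OF U] by blast
qed (use i in auto)

lemma stone_standard:
  assumes st: "stone C (\<Theta> i)"
  shows "standard_module B e i (\<Psi> (\<Theta> i))"
proof (rule standard_moduleI[OF i top_map_factor \<Psi>\<Theta>_killed top_map_kernel])
  have ii: "carrier (Ext C (\<Theta> i) (\<Theta> i)) = {\<one>\<^bsub>Ext C (\<Theta> i) (\<Theta> i)\<^esub>}" using st by (simp add: stone_def)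
  \<comment> \<open>For k > i a class over \<Theta>(k) becomes trivial on P(k), so it is pushed out
    along a morphism from L to \<Theta>(i); this is zero because all factors of L have index at
    least k. The case k = i is the stone condition.\<close>
  have ext\<Theta>: "carrier (Ext C (\<Theta> k) (\<Theta> i)) = {\<one>\<^bsub>Ext C (\<Theta> k) (\<Theta> i)\<^esub>}" if k: "k \<in> {i..t}" for k
  proof (cases "k = i")
    case True
    then show ?thesis using ii by simp
  next
    case False
    have k': "k \<in> {1..t}" using k i by auto
    obtain L a b c where L: "L \<in> F {k..t}" "conflation C L a (P k) b (\<Theta> k) c" using P_conflation[OF k'] by metis
    note cD = conflD[OF L(2)]
    have "x = \<one>\<^bsub>Ext C (\<Theta> k) (\<Theta> i)\<^esub>" if x: "x \<in> carrier (Ext C (\<Theta> k) (\<Theta> i))" for x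
    proof -
      have "pull C (\<Theta> i) b x \<in> carrier (Ext C (P k) (\<Theta> i))"
        using ext_pull_closed[OF \<Theta>_obj[OF i] cD(8)] x cD by simp
      then have "pull C (\<Theta> i) b x = \<one>\<^bsub>Ext C (P k) (\<Theta> i)\<^esub>"
        using thr_ob_ext[OF \<Theta>i_F P_thr_ob[OF k']] by blast
      then obtain h where h: "ar h" "src h = L" "tgt h = \<Theta> i" "x = push C (\<Theta> k) h c"
        using pull_trivial_push[OF L(2) x \<Theta>_obj[OF i]] by metis
      have "h = zer C L (\<Theta> i)" by (rule hom_F_zero[OF L(1) _ i _ h(1-3)]) (use k False i in auto)
      then show ?thesis using h(4) ext_push_zer[OF cD(2,1) \<Theta>_obj[OF i] cD(4)] by simp
    qed
    then show ?thesis using ext_one[OF \<Theta>_obj[OF k'] \<Theta>_obj[OF i]] by blast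
  qed
  \<comment> \<open>When the quotient Y is generated by higher parts, a bottom factor \<Theta>(i)
    splits off because E(Y, \<Theta>(i)) = 0, and the projection onto it is the required surjection.
    A surjection found on Y is composed with X -> Y.\<close>
  have dich: "psi_generated (Suc i) X \<or>
      (\<exists>h. ar h \<and> src h = X \<and> tgt h = \<Theta> i \<and> (\<forall>w. ar w \<and> src w = PP \<and> tgt w = \<Theta> i \<longrightarrow> (\<exists>v. ar v \<and> src v = PP \<and> tgt v = X \<and> h \<bullet> v = w)))"
    if X: "X \<in> F {i..t}" for X
    using X
  proof induction
    case (fl_zero Z)
    then show ?case using psi_generated_zero by blast
  next
    case (fl_ext T Y f X g d)
    note c = conflD[OF fl_ext(3)]
    obtain k where k: "k \<in> {i..t}" "T = \<Theta> k" using fl_ext by blast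
    have k': "k \<in> {1..t}" using k i by auto
    have TF: "T \<in> F {1..t}" using k k' by (intro fl_member) auto
    have YF: "Y \<in> F {1..t}" by (rule F_mono[OF fl_ext(2)]) (use i in auto)
    from fl_ext(4) show ?case
    proof
      assume "\<exists>h. ar h \<and> src h = Y \<and> tgt h = \<Theta> i \<and> (\<forall>w. ar w \<and> src w = PP \<and> tgt w = \<Theta> i \<longrightarrow> (\<exists>v. ar v \<and> src v = PP \<and> tgt v = Y \<and> h \<bullet> v = w))"
      then obtain h where h: "ar h" "src h = Y" "tgt h = \<Theta> i"
        "\<And>w. ar w \<and> src w = PP \<and> tgt w = \<Theta> i \<Longrightarrow> \<exists>v. ar v \<and> src v = PP \<and> tgt v = Y \<and> h \<bullet> v = w" by blast
      have "\<exists>v. ar v \<and> src v = PP \<and> tgt v = X \<and> (h \<bullet> g) \<bullet> v = w" if w: "ar w \<and> src w = PP \<and> tgt w = \<Theta> i" for w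
      proof -
        obtain v where v: "ar v" "src v = PP" "tgt v = Y" "h \<bullet> v = w" using h(4)[OF w] by blast
        obtain v' where v': "ar v'" "src v' = PP" "tgt v' = X" "g \<bullet> v' = v" using psi_exact(3)[OF fl_ext(3) TF YF v(1-3)] by blast
        have "(h \<bullet> g) \<bullet> v' = w" using h(1-3) c v v' by simp
        then show ?thesis using v' by blast
      qed
      then show ?thesis using h(1-3) c by (intro disjI2 exI[of _ "h \<bullet> g"]) simp
    next
      assume gY: "psi_generated (Suc i) Y"
      show ?thesis
      proof (cases "k = i")
        case False
        have "psi_generated (Suc i) T" unfolding k(2) by (rule psi_generated_\<Theta>[OF k']) (use k False in auto)
        then show ?thesis using psi_generated_ext[OF fl_ext(3) TF YF _ gY] by simp
      next
        case True
        then have T: "T = \<Theta> i" using k by simp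
        have "carrier (Ext C Y (\<Theta> i)) = {\<one>\<^bsub>Ext C Y (\<Theta> i)\<^esub>}"
          by (rule ext_trivial_fl[OF fl_ext(2) \<Theta>_obj[OF i]]) (use ext\<Theta> in blast)
        then have "d = \<one>\<^bsub>Ext C Y T\<^esub>" using c(4) T by blast
        then obtain q p where "biproduct C T Y X f q p g" using split_biproduct fl_ext(3) by metis
        then have p: "ar p" "src p = X" "tgt p = \<Theta> i" "p \<bullet> f = ident C (\<Theta> i)" using T by (auto dest: biproductD)
        have "\<exists>v. ar v \<and> src v = PP \<and> tgt v = X \<and> p \<bullet> v = w" if w: "ar w \<and> src w = PP \<and> tgt w = \<Theta> i" for w
        proof -
          have "p \<bullet> (f \<bullet> w) = w" using pre_simp[OF p(4), of w] p w c T by simp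
          then show ?thesis using w c T by (intro exI[of _ "f \<bullet> w"]) simp
        qed
        then show ?thesis using p by blast
      qed
    qed
  qed
  show "psi_generated (Suc i) K"
  proof (rule ccontr)
    assume "\<not> psi_generated (Suc i) K"
    then obtain h where h: "ar h" "src h = K" "tgt h = \<Theta> i"
      "\<And>w. ar w \<and> src w = PP \<and> tgt w = \<Theta> i \<Longrightarrow> \<exists>v. ar v \<and> src v = PP \<and> tgt v = K \<and> h \<bullet> v = w"
      using dich[OF K] by blast
    note c = conflD[OF conf] and ip = \<iota>\<pi>[OF i]
    \<comment> \<open>The obstruction to extending \<open>h\<close> over P(i) lies in E(\<Theta>(i),
      \<Theta>(i)), which is trivial for a stone.\<close>
    have "push C (\<Theta> i) h d \<in> carrier (Ext C (\<Theta> i) (\<Theta> i))" using ext_push_closed[OF c(2) h(1)] h c by simp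
    then have "push C (\<Theta> i) h d = \<one>\<^bsub>Ext C (\<Theta> i) (\<Theta> i)\<^esub>" using ii by blast
    then obtain q where q: "ar q" "src q = P i" "tgt q = \<Theta> i" "q \<bullet> f = h" using extend_inflation[OF conf h(1-3)] by metis
    have nz: "q \<bullet> \<pi> i \<noteq> zer C PP (\<Theta> i)"
    proof
      assume "q \<bullet> \<pi> i = zer C PP (\<Theta> i)"
      then have "q \<bullet> (\<pi> i \<bullet> \<iota> i) = zer C (P i) (\<Theta> i)" using pre_simp[of q "\<pi> i" _ "\<iota> i"] q ip c by simp
      then have "q = zer C (P i) (\<Theta> i)" using q ip by simp
      then have h0: "h = zer C K (\<Theta> i)" using q(4) c by simp
      have "ar (g \<bullet> \<pi> i) \<and> src (g \<bullet> \<pi> i) = PP \<and> tgt (g \<bullet> \<pi> i) = \<Theta> i" using c ip by simp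
      then obtain v where "ar v" "src v = PP" "tgt v = K" "h \<bullet> v = g \<bullet> \<pi> i" using h(4) by blast
      then show False using h0 g\<pi>_nonzero c by simp
    qed
    have hom: "rmod_hom B (ri i) (\<Psi> (\<Theta> i)) (\<lambda>x \<in> carrier (ri i). r \<bullet> (\<pi> i \<bullet> x))"
      if r: "ar r" "src r = P i" "tgt r = \<Theta> i" for r
    proof (intro rmod_hom.intro rmod_hom_axioms.intro psi_rmodule PP_obj ri_rmodule i \<Theta>_obj)
      show "(\<lambda>x \<in> carrier (ri i). r \<bullet> (\<pi> i \<bullet> x)) \<in> mod_hom B (ri i) (\<Psi> (\<Theta> i))"
        by (rule mod_hom_restrictI[OF ri_rmodule[OF i]]) (use r ip c ri_mem_iff[OF i] in auto)
    qed
    let ?U = "\<lambda>r. {x \<in> carrier (ri i). (\<lambda>x \<in> carrier (ri i). r \<bullet> (\<pi> i \<bullet> x)) x \<in> {\<zero>\<^bsub>\<Psi> (\<Theta> i)\<^esub>}}"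
    have sub: "submodule (?U r) B (ri i)" if r: "ar r" "src r = P i" "tgt r = \<Theta> i" for r
      by (rule rmod_hom.vimage_submodule[OF hom[OF r] rmodule.zero_submodule[OF psi_rmodule[OF PP_obj \<Theta>_obj[OF i]]]])
    have Uiff: "x \<in> ?U r \<longleftrightarrow> x \<in> carrier (ri i) \<and> r \<bullet> (\<pi> i \<bullet> x) = zer C PP (\<Theta> i)" for x r by auto
    have "ar (q \<bullet> \<pi> i) \<and> src (q \<bullet> \<pi> i) = PP \<and> tgt (q \<bullet> \<pi> i) = \<Theta> i" using q ip by simp
    then obtain u where u: "ar u" "src u = PP" "tgt u = K" "h \<bullet> u = q \<bullet> \<pi> i" using h(4) by blast
    \<comment> \<open>Since h u = q \<pi>(i) and q f = h, this element lies in the kernel attached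
      to \<open>g\<close>, and e(i) minus it in the kernel attached to \<open>q\<close>. They add up
      to e(i), although both kernels are proper because neither g \<pi>(i) nor q \<pi>(i) is
      zero.\<close>
    let ?x = "\<iota> i \<bullet> (f \<bullet> u)"
    have x: "ar ?x" "src ?x = PP" "tgt ?x = PP" using u c ip by auto
    have px: "\<pi> i \<bullet> ?x = f \<bullet> u" using e_pre[OF i, of "f \<bullet> u"] u c by simp
    have ex: "e i \<bullet> ?x = ?x" using px x ip by simp
    have gfu: "g \<bullet> (f \<bullet> u) = zer C PP (\<Theta> i)" using pre_simp[OF c(11), of u] u c by simp
    have x1: "?x \<in> ?U g" unfolding Uiff unfolding ri_mem_iff[OF i] px using x ex gfu by blast
    have pe: "\<pi> i \<bullet> e i = \<pi> i" using e_pre[OF i, of "\<pi> i"] ip by simp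
    have ee: "e i \<bullet> e i = e i" using pe ip by simp
    have x2: "e i \<boxplus> mn ?x \<in> ?U q"
      unfolding Uiff unfolding ri_mem_iff[OF i]
    proof (intro conjI)
      have qfu: "q \<bullet> (f \<bullet> u) = q \<bullet> \<pi> i" using pre_simp[OF q(4), of u] q u c by simp
      show "q \<bullet> (\<pi> i \<bullet> (e i \<boxplus> mn ?x)) = zer C PP (\<Theta> i)"
      proof -
        have "\<pi> i \<bullet> (e i \<boxplus> mn ?x) = (\<pi> i \<bullet> e i) \<boxplus> mn (\<pi> i \<bullet> ?x)" using x e_arr[OF i] ip(4-6) by (simp del: cmp_arr assoc add: cmp_arr)
        also have "\<dots> = \<pi> i \<boxplus> mn (f \<bullet> u)" unfolding pe px ..
        finally show ?thesis using qfu q ip u c by simp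
      qed
      have "e i \<bullet> (e i \<boxplus> mn ?x) = (e i \<bullet> e i) \<boxplus> mn (e i \<bullet> ?x)"
        using x e_arr[OF i] by (simp del: assoc)
      then show "e i \<bullet> (e i \<boxplus> mn ?x) = e i \<boxplus> mn ?x" unfolding ee ex .
    qed (use x e_arr[OF i] in simp_all)
    have "?x \<boxplus> (e i \<boxplus> mn ?x) = e i" using x e_arr[OF i] pls_lcomm[of ?x "e i" "mn ?x"] by simp
    then have "e i \<in> ?U g \<or> e i \<in> ?U q"
      using local[OF i sub[OF c(8-10)] sub[OF q(1-3)] x1 x2] by simp
    then have "g \<bullet> (\<pi> i \<bullet> e i) = zer C PP (\<Theta> i) \<or> q \<bullet> (\<pi> i \<bullet> e i) = zer C PP (\<Theta> i)" unfolding Uiff by blast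
    then show False unfolding pe using nz g\<pi>_nonzero by blast
  qed
qed simp_all

end

text \<open>A decomposition e(i) = f + g into orthogonal idempotents places f in the corner e(i) B
  e(i), that is, in the endomorphism ring of P(i), whose only idempotents are 0 and 1.\<close>

lemma e_primitive:
  assumes i: "i \<in> {1..t}"
  shows "primitive_idempotent B (e i)"
  unfolding primitive_idempotent_def
proof (intro conjI ballI impI)
  note ip = \<iota>\<pi>[OF i]
  show "e i \<in> carrier B" by (rule idem_closed[OF i])
  show ee: "e i \<otimes>\<^bsub>B\<^esub> e i = e i" using idem_mult[OF i i] by simp
  show "e i \<noteq> \<zero>\<^bsub>B\<^esub>"
  proof
    assume "e i = \<zero>\<^bsub>B\<^esub>"
    then have "\<pi> i \<bullet> (e i \<bullet> \<iota> i) = zer C (P i) (P i)" using ip P_obj[OF i] by simp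
    moreover have "\<pi> i \<bullet> (e i \<bullet> \<iota> i) = ident C (P i)" using ip P_obj[OF i] by simp
    ultimately show False using P_loc[OF i] by (simp add: loc_def)
  qed
  fix f g assume "f \<in> carrier B" "g \<in> carrier B"
    and fg: "f \<otimes>\<^bsub>B\<^esub> f = f \<and> g \<otimes>\<^bsub>B\<^esub> g = g \<and> f \<otimes>\<^bsub>B\<^esub> g = \<zero>\<^bsub>B\<^esub> \<and> g \<otimes>\<^bsub>B\<^esub> f = \<zero>\<^bsub>B\<^esub> \<and> e i = f \<oplus>\<^bsub>B\<^esub> g"
  then have f: "ar f" "src f = PP" "tgt f = PP" and g: "ar g" "src g = PP" "tgt g = PP" by auto
  have ff: "f \<bullet> f = f" "f \<bullet> g = zer C PP PP" "g \<bullet> f = zer C PP PP" and efg: "e i = f \<boxplus> g" using fg by auto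
  have ef: "e i \<bullet> f = f" "f \<bullet> e i = f" unfolding efg using f g ff by simp_all
  let ?a = "\<pi> i \<bullet> (f \<bullet> \<iota> i)"
  have a: "ar ?a" "src ?a = P i" "tgt ?a = P i" using f ip by auto
  have "?a \<bullet> ?a = \<pi> i \<bullet> ((f \<bullet> e i) \<bullet> (f \<bullet> \<iota> i))" using f ip(1-6) by simp
  also have "\<dots> = ?a" unfolding ef(2) using pre_simp[OF ff(1), of "\<iota> i"] f ip by simp
  finally have "?a = ident C (P i) \<or> ?a = zer C (P i) (P i)"
    using a P_obj[OF i] by (intro loc_idempotent[OF P_loc[OF i]]) auto
  moreover have fa: "f = \<iota> i \<bullet> (?a \<bullet> \<pi> i)"
  proof -
    have "\<iota> i \<bullet> (?a \<bullet> \<pi> i) = e i \<bullet> (f \<bullet> e i)" using f ip(1-6) by simp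
    then show ?thesis unfolding ef ..
  qed
  ultimately show "f = \<zero>\<^bsub>B\<^esub> \<or> g = \<zero>\<^bsub>B\<^esub>"
  proof (elim disjE)
    assume a0: "?a = zer C (P i) (P i)"
    have "f = zer C PP PP" by (subst fa, subst a0) (use ip P_obj[OF i] in simp)
    then show ?thesis by simp
  next
    assume a1: "?a = ident C (P i)"
    have "f = e i" by (subst fa, subst a1) (use ip P_obj[OF i] in simp)
    then have "f = f \<boxplus> g" using efg by simp
    then have "g = zer C PP PP" using pls_eq_self[of g f] f g by metis
    then show ?thesis by simp
  qed
qed

lemma B_stratified: "mixed_stratified_algebra sm B t e (\<lambda>i. \<Psi> (\<Theta> i))"
  unfolding mixed_stratified_algebra_def
proof (intro conjI ballI)
  interpret k: k_linear_category C sm by (rule klin)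
  have am: "add_monoid B = hom_group C PP PP" by (simp add: End_ring_def hom_group_def)
  show "fd_algebra sm B"
    unfolding fd_algebra_def am
  proof (intro conjI ballI allI)
    show "ring B" by (rule ring_B)
    show "k_space sm (hom_group C PP PP)" by (rule k.hom_k_space[OF PP_obj PP_obj])
    show "fin_dim sm (hom_group C PP PP)" using homfin by (simp add: hom_finite_def)
    fix r a b assume ab: "a \<in> carrier B" "b \<in> carrier B"
    show "sm r a \<otimes>\<^bsub>B\<^esub> b = sm r (a \<otimes>\<^bsub>B\<^esub> b)" using k.sm_cmp_left[of PP PP PP b a r] ab by simp
    show "a \<otimes>\<^bsub>B\<^esub> sm r b = sm r (a \<otimes>\<^bsub>B\<^esub> b)" using k.sm_cmp_right[of PP PP PP b a r] ab by simp
  qed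
  show "complete_idempotents B t e"
    unfolding complete_idempotents_def
    using e_primitive idem_mult idem_sum by auto
  show "basic_algebra B t e"
    unfolding basic_algebra_def using ri_not_isomorphic by blast
  show "right_ideal B \<one>\<^bsub>B\<^esub> \<in> filt (mod_cat B) (\<Psi>\<Theta> {1..t})"
    unfolding right_ideal_one by (rule psi_filt[OF PP_F]) simp
  fix i assume i: "i \<in> {1..t}"
  obtain K f g d where K: "K \<in> F {i..t}" "conflation C K f (P i) g (\<Theta> i) d" using P_conflation[OF i] by metis
  show "standard_module B e i (\<Psi> (\<Theta> i)) \<or> proper_standard_module B e i (\<Psi> (\<Theta> i))"
    using brick_or_stone[OF i] brick_proper_standard[OF i K] stone_standard[OF i K] by blast
qed

end

theorem theorem4p7:
  fixes C :: "('o, 'm, 'e, 'n) neg_extri"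
    and sm :: "'k::field \<Rightarrow> 'm \<Rightarrow> 'm"
    and t :: nat
    and \<Theta> P :: "nat \<Rightarrow> 'o"
    and PP :: 'o
    and \<iota> \<pi> :: "nat \<Rightarrow> 'm"
  assumes "extriangulated_negative C"
    and "k_linear_category C sm"
    and "hom_finite C sm"
    and "krull_schmidt C"
    and "mixed_stratifying_system C t \<Theta> P"
    and "direct_sum C {1..t} P PP \<iota> \<pi>"
  shows "let B = End_ring C PP; \<Psi> = psi_obj C PP in
      mixed_stratifying_system (mod_cat B) t (\<lambda>i. \<Psi> (\<Theta> i)) (\<lambda>i. \<Psi> (P i)) \<and>
      is_equivalence
        (full_sub C (filt C (\<Theta> ` {1..t})))
        (full_sub (mod_cat B) (filt (mod_cat B) ((\<lambda>i. \<Psi> (\<Theta> i)) ` {1..t})))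
        \<Psi> (psi_mor C PP) \<and>
      mixed_stratified_algebra sm B t (\<lambda>i. \<iota> i \<bullet>\<^bsub>C\<^esub> \<pi> i) (\<lambda>i. \<Psi> (\<Theta> i))"
proof -
  interpret mss C sm t \<Theta> P PP \<iota> \<pi>
    using assms by (intro mss.intro mss_axioms.intro)
  show ?thesis unfolding Let_def using psi_stratifying psi_equivalence B_stratified by blast
qed

end
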